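(* Let $D=\mathrm{diag}\{d_1,\dots,d_p\}<0$ and let $H\in\mathcal H(D)$, with generating matrix function $k$. Then the corresponding canonical system $\frac{d}{dx}w(x,z)=izJH(x)w(x,z)$, $x\ge0$, has a unique Weyl function $\varphi$, and it admits the representation $$\varphi(z)=-zD\int_0^\infty e^{izx}s(x)\,dx\qquad(z\in\mathbb C_+),$$ where $s(x)=\frac12I_p+|D|^{-1}\int_0^xk(t)\,dt$.
   Context: Notation: $J=\begin{bmatrix}0&I_p\\ I_p&0\end{bmatrix}$; $|D|=\mathrm{diag}\{|d_1|,\dots,|d_p|\}$; $\mathbb C_+$ is the open upper half-plane; $L^2_p(0,l)$ is the space of $\mathbb C^p$-valued square-summable functions. Class $\mathcal H(D)$ (for $D<0$): let $k(x)=\{k_{ij}(x)\}_{i,j=1}^p$ be a $p\times p$ matrix function with $k\in L^2_{p\times p}(0,l)$ for all $0<l<\infty$, $k(-x)=k(x)^*$, and such that for all $0<l<\infty$ the operators $$S_l=I+\int_0^l\{k_{ij}(d_jt-d_ix)\}_{i,j=1}^p\,\cdot\,dt$$ in $L^2_p(0,l)$ are positive, bounded and boundedly invertible. Then $S_l^{-1}=E_l^*E_l$ with $E_l=I+\int_0^xE(x,t)\,\cdot\,dt$ bounded in $L_p^2(0,l)$, where $E(x,t)$ is a Hilbert–Schmidt kernel (not depending on $l$). Put $$s(x)=\tfrac12I_p+|D|^{-1}\int_0^xk(t)dt,\quad \Pi(x)=\Big[D\{s_{ij}(|d_i|x)\}_{i,j=1}^p\quad I_p\Big],\quad \beta(x)=(E_l\Pi)(x)\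 (x<l),\quad H(x)=\beta(x)^*\beta(x)$$ (with $E_l$ applied columnwise). The class $\mathcal H(D)$ consists of all Hamiltonians $H(x)$, $0<x<\infty$, obtained in this way from such $k$; $k$ is said to generate $H$. Weyl function: let $w$ be the fundamental solution of the canonical system normalized by $w(0,z)=I_{2p}$. A Weyl function is a $p\times p$ holomorphic matrix function $\varphi$ in $\mathbb C_+$ satisfying $$\int_0^\infty[\,I_p\ \ i\varphi(z)^*\,]\,w(x,z)^*H(x)w(x,z)\begin{bmatrix}I_p\\ -i\varphi(z)\end{bmatrix}dx<\infty,\qquad z\in\mathbb C_+.$$ *)

theory Defs
  imports "HOL-Analysis.Analysis" "HOL-Library.Nonpos_Ints"
begin

section \<open>Complex matrices\<close>

text \<open>
  The dimension \<open>p\<close> is \<open>CARD('p)\<close>, and \<open>2p\<close> is realised by the index type \<open>'p + 'p\<close>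
  (\<open>Inl\<close> = first block, \<open>Inr\<close> = second block). In the library, \<open>'a^'n^'m\<close> has \<open>'m\<close> rows
  and \<open>'n\<close> columns. A scalar multiple \<open>c A\<close> of a matrix is written \<open>mat c ** A\<close>.
\<close>

definition ctranspose :: "complex^'n^'m \<Rightarrow> complex^'m^'n" where
  "ctranspose A = (\<chi> i j. cnj (A $ j $ i))"

definition diag_mat :: "real^'n \<Rightarrow> complex^'n^'n" where
  "diag_mat d = (\<chi> i j. if i = j then complex_of_real (d $ i) else 0)"

definition hblock :: "'a^'m^'k \<Rightarrow> 'a^'n^'k \<Rightarrow> 'a^('m + 'n)^'k" where
  "hblock A B = (\<chi> i j. case j of Inl a \<Rightarrow> A $ i $ a | Inr b \<Rightarrow> B $ i $ b)"

definition vblock :: "'a^'k^'m \<Rightarrow> 'a^'k^'n \<Rightarrow> 'a^'k^('m + 'n)" where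
  "vblock A B = (\<chi> i. case i of Inl a \<Rightarrow> A $ a | Inr b \<Rightarrow> B $ b)"

definition Jmat :: "complex^('p::finite + 'p)^('p + 'p)" where
  "Jmat = vblock (hblock (mat 0) (mat 1)) (hblock (mat 1) (mat 0))"

definition abs_diag :: "real^'n \<Rightarrow> complex^'n^'n" where
  "abs_diag d = diag_mat (\<chi> i. \<bar>d $ i\<bar>)"


section \<open>Operators on \<open>L\<^sup>2\<close>\<close>

definition sq_integrable_on ::
    "('a::euclidean_space \<Rightarrow> 'b::euclidean_space) \<Rightarrow> 'a set \<Rightarrow> bool" where
  "sq_integrable_on f A \<longleftrightarrow>
     f \<in> borel_measurable (lebesgue_on A) \<and> integrable (lebesgue_on A) (\<lambda>x. (norm (f x))\<^sup>2)"

text \<open>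
  Elements of \<open>L\<^sup>2\<^sub>p(0,l)\<close> are represented by functions on \<open>\<real>\<close> of which only the almost
  everywhere class on \<open>(0,l)\<close> matters; operators are maps between such functions. A bounded
  operator below automatically respects almost everywhere equality.
\<close>

type_synonym 'p vfun = "real \<Rightarrow> complex^'p"

definition L2 :: "real \<Rightarrow> ('p::finite) vfun set" where
  "L2 l = {f. sq_integrable_on f {0<..<l}}"

definition ae_eq :: "real \<Rightarrow> ('p::finite) vfun \<Rightarrow> 'p vfun \<Rightarrow> bool" where
  "ae_eq l f g \<longleftrightarrow> (AE x in lebesgue_on {0<..<l}. f x = g x)"

definition L2_inner :: "real \<Rightarrow> ('p::finite) vfun \<Rightarrow> 'p vfun \<Rightarrow> complex" where
  "L2_inner l f g = (LINT x|lebesgue_on {0<..<l}. (\<Sum>i\<in>UNIV. f x $ i * cnj (g x $ i)))"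

definition L2_norm :: "real \<Rightarrow> ('p::finite) vfun \<Rightarrow> real" where
  "L2_norm l f = sqrt (LINT x|lebesgue_on {0<..<l}. (norm (f x))\<^sup>2)"

definition bounded_op :: "real \<Rightarrow> (('p::finite) vfun \<Rightarrow> 'p vfun) \<Rightarrow> bool" where
  "bounded_op l T \<longleftrightarrow>
     (\<forall>f\<in>L2 l. T f \<in> L2 l) \<and>
     (\<forall>f\<in>L2 l. \<forall>g\<in>L2 l. ae_eq l (T (\<lambda>x. f x + g x)) (\<lambda>x. T f x + T g x)) \<and>
     (\<forall>c. \<forall>f\<in>L2 l. ae_eq l (T (\<lambda>x. c *s f x)) (\<lambda>x. c *s T f x)) \<and>
     (\<exists>C. \<forall>f\<in>L2 l. L2_norm l (T f) \<le> C * L2_norm l f)"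

definition positive_op :: "real \<Rightarrow> (('p::finite) vfun \<Rightarrow> 'p vfun) \<Rightarrow> bool" where
  "positive_op l T \<longleftrightarrow> (\<forall>f\<in>L2 l. L2_inner l (T f) f \<in> \<real>\<^sub>\<ge>\<^sub>0)"

definition bounded_inverse ::
    "real \<Rightarrow> (('p::finite) vfun \<Rightarrow> 'p vfun) \<Rightarrow> ('p vfun \<Rightarrow> 'p vfun) \<Rightarrow> bool" where
  "bounded_inverse l T R \<longleftrightarrow>
     bounded_op l R \<and> (\<forall>f\<in>L2 l. ae_eq l (R (T f)) f \<and> ae_eq l (T (R f)) f)"

definition adjoint_op ::
    "real \<Rightarrow> (('p::finite) vfun \<Rightarrow> 'p vfun) \<Rightarrow> ('p vfun \<Rightarrow> 'p vfun) \<Rightarrow> bool" where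
  "adjoint_op l T T' \<longleftrightarrow>
     bounded_op l T' \<and> (\<forall>f\<in>L2 l. \<forall>g\<in>L2 l. L2_inner l (T f) g = L2_inner l f (T' g))"


section \<open>The class of Hamiltonians\<close>

definition S_op ::
    "real^'p \<Rightarrow> (real \<Rightarrow> complex^'p^'p) \<Rightarrow> real \<Rightarrow> ('p::finite) vfun \<Rightarrow> 'p vfun" where
  "S_op d k l f x =
     f x + (LINT t:{0<..<l}|lebesgue. (\<chi> i j. k (d $ j * t - d $ i * x) $ i $ j) *v f t)"

definition admissible_kernel ::
    "real^'p \<Rightarrow> (real \<Rightarrow> complex^'p^('p::finite)) \<Rightarrow> bool" where
  "admissible_kernel d k \<longleftrightarrow>
     (\<forall>l>0. sq_integrable_on k {0<..<l}) \<and>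
     (\<forall>x. k (- x) = ctranspose (k x)) \<and>
     (\<forall>l>0. positive_op l (S_op d k l) \<and> bounded_op l (S_op d k l) \<and>
            (\<exists>R. bounded_inverse l (S_op d k l) R))"

text \<open>
  The operators \<open>E\<^sub>l\<close> for different \<open>l\<close> are given by one and the same formula, so \<open>l\<close> is not
  an argument; only the values of the kernel \<open>E\<close> at \<open>0 < t < x\<close> are relevant.
\<close>

definition E_op ::
    "(real \<Rightarrow> real \<Rightarrow> complex^'p^'p) \<Rightarrow> ('p::finite) vfun \<Rightarrow> 'p vfun" where
  "E_op E f x = f x + (LINT t:{0<..<x}|lebesgue. E x t *v f t)"

text \<open>\<open>S\<^sub>l\<^sup>-\<^sup>1 = E\<^sub>l\<^sup>* E\<^sub>l\<close> for all \<open>l\<close>, with a Hilbert-Schmidt kernel \<open>E\<close> not depending on \<open>l\<close>.\<close>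

definition factorizing_kernel ::
    "real^'p \<Rightarrow> (real \<Rightarrow> complex^'p^'p) \<Rightarrow> (real \<Rightarrow> real \<Rightarrow> complex^'p^('p::finite)) \<Rightarrow> bool" where
  "factorizing_kernel d k E \<longleftrightarrow>
     (\<forall>l>0. sq_integrable_on (\<lambda>(x, t). E x t) {(x, t). 0 < t \<and> t < x \<and> x < l} \<and>
            bounded_op l (E_op E) \<and>
            (\<exists>Estar. adjoint_op l (E_op E) Estar \<and>
                     bounded_inverse l (S_op d k l) (\<lambda>f. Estar (E_op E f))))"

definition s_fun ::
    "real^'p \<Rightarrow> (real \<Rightarrow> complex^'p^'p) \<Rightarrow> real \<Rightarrow> complex^'p^('p::finite)" where
  "s_fun d k x = mat (1/2) + matrix_inv (abs_diag d) ** (LINT t:{0..x}|lebesgue. k t)"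

definition Pi_fun ::
    "real^'p \<Rightarrow> (real \<Rightarrow> complex^'p^'p) \<Rightarrow> real \<Rightarrow> complex^('p + 'p)^('p::finite)" where
  "Pi_fun d k x =
     hblock (diag_mat d ** (\<chi> i j. s_fun d k (\<bar>d $ i\<bar> * x) $ i $ j)) (mat 1)"

definition beta_fun ::
    "real^'p \<Rightarrow> (real \<Rightarrow> complex^'p^'p) \<Rightarrow> (real \<Rightarrow> real \<Rightarrow> complex^'p^'p)
       \<Rightarrow> real \<Rightarrow> complex^('p + 'p)^('p::finite)" where
  "beta_fun d k E x = (\<chi> i j. E_op E (\<lambda>t. column j (Pi_fun d k t)) x $ i)"

text \<open>
  \<open>E\<close>, and hence \<open>\<beta>\<close>, is determined by \<open>k\<close> only up to null sets, so \<open>H = \<beta>\<^sup>* \<beta>\<close> is required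
  almost everywhere.
\<close>

definition generates ::
    "real^'p \<Rightarrow> (real \<Rightarrow> complex^'p^'p) \<Rightarrow> (real \<Rightarrow> complex^('p + 'p)^('p::finite + 'p)) \<Rightarrow> bool"
  where
  "generates d k H \<longleftrightarrow>
     admissible_kernel d k \<and>
     (\<exists>E. factorizing_kernel d k E \<and>
          (AE x in lebesgue_on {0<..}. H x = ctranspose (beta_fun d k E x) ** beta_fun d k E x))"

definition Hamiltonian_class ::
    "real^'p \<Rightarrow> (real \<Rightarrow> complex^('p + 'p)^('p::finite + 'p)) set" where
  "Hamiltonian_class d = {H. \<exists>k. generates d k H}"


section \<open>Weyl functions\<close>

text \<open>
  As \<open>H\<close> is merely locally integrable, a solution of \<open>w' = i z J H w\<close>, \<open>w(0,z) = I\<close>, is an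
  absolutely continuous function satisfying the equation almost everywhere, that is, a solution
  of the corresponding integral equation.
\<close>

definition fundamental_solution ::
    "(real \<Rightarrow> complex^('p + 'p)^('p + 'p)) \<Rightarrow>
     (real \<Rightarrow> complex \<Rightarrow> complex^('p + 'p)^('p::finite + 'p)) \<Rightarrow> bool" where
  "fundamental_solution H w \<longleftrightarrow>
     (\<forall>z. \<forall>x\<ge>0.
        set_integrable lebesgue {0..x} (\<lambda>t. mat (\<i> * z) ** Jmat ** H t ** w t z) \<and>
        w x z = mat 1 + (LINT t:{0..x}|lebesgue. mat (\<i> * z) ** Jmat ** H t ** w t z))"

text \<open>
  The integral of the (nonnegative) matrix function being finite means that this function is
  integrable on the half-line. The fundamental solution is unique on \<open>x \<ge> 0\<close>, so the existential
  quantifier merely names it.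
\<close>

definition Weyl_function ::
    "(real \<Rightarrow> complex^('p + 'p)^('p + 'p)) \<Rightarrow> (complex \<Rightarrow> complex^'p^('p::finite)) \<Rightarrow> bool"
  where
  "Weyl_function H \<phi> \<longleftrightarrow>
     (\<forall>i j. (\<lambda>z. \<phi> z $ i $ j) holomorphic_on {z. 0 < Im z}) \<and>
     (\<exists>w. fundamental_solution H w \<and>
        (\<forall>z. 0 < Im z \<longrightarrow>
           set_integrable lebesgue {0<..}
             (\<lambda>x. hblock (mat 1) (mat \<i> ** ctranspose (\<phi> z))
                    ** ctranspose (w x z) ** H x ** w x z
                    ** vblock (mat 1) (mat (- \<i>) ** \<phi> z))))"

end

(*
  Write A for the operator (A f)_i = i d_i \<integral>\<^sub>0\<^sup>x f_i. The operators S = S_l satisfy A S - S A* = i Pi J Pi*, and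
  S\<^sup>-\<^sup>1 = T*T with T = E_l. Since T is triangular, this gives T A f = i beta J \<integral>\<^sub>0\<^sup>x beta* (T f), so that
  the solution w of the canonical system satisfies beta w = T (I - zA)\<^sup>-\<^sup>1 Pi and the Weyl integrals are the
  limits of the squared L2 norms of T (I - zA)\<^sup>-\<^sup>1 Pi [I; -i phi] on (0, l).

  The forms of the operators S_l extend to one translation invariant nonnegative form q on compactly supported
  functions on the whole line. Invariance makes q(f, f) at most a constant times the squared norm of f
  for f supported in any unit interval, which yields three things: s grows slowly enough for its
  Laplace transform to exist; (I - zA)\<^sup>-\<^sup>1 Pi [I; -i phi] is, for the stated phi, the limit on each (0, l) of the
  image under q of exponentials on the negative half-line, and nonnegativity of q bounds its image under T
  uniformly in l; and T maps no nonzero exponential solution (I - zA)\<^sup>-\<^sup>1 xi to a function square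
  integrable on the half-line, which is the uniqueness of the Weyl function.
*)
theory Submission imports Defs "HOL-Complex_Analysis.Cauchy_Integral_Formula" "HOL-Real_Asymp.Real_Asymp"
begin

section \<open>Square integrable vector functions\<close>

text \<open>The constant in the bound over unit intervals is the norm of S_2 alone; nothing is known
  about how the norms of S_l depend on l, so long-range estimates must go through Cauchy-Schwarz for
  the form. The identity S^-1 = T*T makes T bounded below but does not make it onto, while
  conjugating A by T requires surjectivity. This is extracted from T - I being a Hilbert-Schmidt
  Volterra operator. The exponentials come from the factor exp(i z x) in the formula: \<delta>_j
  exp(-i z \<delta>_j t) in component j decays as t tends to minus infinity, and on x > 0 the kernel
  sends it to a Laplace integral of k shifted by \<delta>_i x, where \<delta>_i = -d_i. That
  function satisfies a Volterra equation for A, and reading off its free term is what singles out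
  phi. As k is only locally square integrable, nothing is differentiated: every identity is used in
  integrated form, and the product rule for primitives replaces differentiation of products.\<close>

definition hprod :: "complex^'p::finite \<Rightarrow> complex^'p \<Rightarrow> complex" where
  "hprod u v = (\<Sum>i\<in>UNIV. u $ i * cnj (v $ i))"

lemma norm_vec_sq: "(norm u)\<^sup>2 = (\<Sum>i\<in>UNIV. (norm (u $ i))\<^sup>2)" for u :: "complex^'p::finite"
  by (simp add: norm_vec_def L2_set_def sum_nonneg)

lemma hprod_self: "hprod u u = of_real ((norm u)\<^sup>2)"
  unfolding hprod_def norm_vec_sq of_real_sum by (intro sum.cong refl complex_norm_square[symmetric])

lemma norm_hprod_le: "norm (hprod u v) \<le> norm u * norm v"
proof -
  have "norm (hprod u v) \<le> (\<Sum>i\<in>UNIV. norm (u $ i) * norm (v $ i))"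
    unfolding hprod_def by (rule order_trans[OF norm_sum]) (simp add: norm_mult)
  also have "\<dots> \<le> norm u * norm v"
    unfolding norm_vec_def using L2_set_mult_ineq[of "\<lambda>i. norm (u $ i)" "\<lambda>i. norm (v $ i)" UNIV] by simp
  finally show ?thesis .
qed

lemma hprod_cnj: "cnj (hprod u v) = hprod v u"
  by (simp add: hprod_def mult.commute)

lemma hprod_add_left: "hprod (u + v) w = hprod u w + hprod v w"
  and hprod_add_right: "hprod w (u + v) = hprod w u + hprod w v"
  and hprod_diff_left: "hprod (u - v) w = hprod u w - hprod v w"
  and hprod_diff_right: "hprod w (u - v) = hprod w u - hprod w v"
  and hprod_smult_left: "hprod (c *s u) w = c * hprod u w"
  and hprod_smult_right: "hprod w (c *s u) = cnj c * hprod w u"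
  and hprod_zero_left [simp]: "hprod 0 w = 0"
  and hprod_zero_right [simp]: "hprod w 0 = 0"
  by (simp_all add: hprod_def algebra_simps sum.distrib sum_subtractf sum_distrib_left)

lemma norm_smult: "norm (c *s u) = norm c * norm u" for u :: "complex^'p::finite"
proof -
  have "(norm (c *s u))\<^sup>2 = (norm c * norm u)\<^sup>2"
    by (simp add: norm_vec_sq norm_mult power_mult_distrib sum_distrib_left)
  then show ?thesis by (simp add: power2_eq_iff_nonneg)
qed

lemma borel_measurable_vec_nth [measurable (raw)]:
  "f \<in> borel_measurable M \<Longrightarrow> (\<lambda>x. f x $ i) \<in> borel_measurable M" for f :: "_ \<Rightarrow> complex^'p::finite"
  using borel_measurable_continuous_on[where f="\<lambda>v. v $ i", OF linear_continuous_on[OF bounded_linear_vec_nth]] .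

lemma borel_measurable_vecI:
  fixes f :: "'a \<Rightarrow> complex^'p::finite"
  assumes "\<And>i. (\<lambda>x. f x $ i) \<in> borel_measurable M"
  shows "f \<in> borel_measurable M"
proof -
  have "(\<lambda>x. f x \<bullet> b) \<in> borel_measurable M" if "b \<in> Basis" for b
  proof -
    from that obtain i u where b: "b = axis i u" "u \<in> Basis" by (auto simp: Basis_vec_def)
    have "(\<lambda>x. f x $ i \<bullet> u) \<in> borel_measurable M" using assms by measurable
    then show ?thesis using b by (simp add: inner_axis)
  qed
  then show ?thesis using borel_measurable_euclidean_space[of f M] by blast
qed

lemma borel_measurable_smult [measurable (raw)]:
  assumes "c \<in> borel_measurable M" "f \<in> borel_measurable M"
  shows "(\<lambda>x. c x *s (f x :: complex^'p::finite)) \<in> borel_measurable M"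
  using assms by (intro borel_measurable_vecI) simp

lemma borel_measurable_hprod [measurable (raw)]:
  assumes "f \<in> borel_measurable M" "g \<in> borel_measurable M"
  shows "(\<lambda>x. hprod (f x) (g x)) \<in> borel_measurable M"
  unfolding hprod_def
proof (intro borel_measurable_sum borel_measurable_times)
  fix i
  show "(\<lambda>x. f x $ i) \<in> borel_measurable M" using assms by measurable
  have "(\<lambda>x. g x $ i) \<in> borel_measurable M" using assms by measurable
  then show "(\<lambda>x. cnj (g x $ i)) \<in> borel_measurable M"
    by (rule borel_measurable_continuous_on[where f=cnj, OF linear_continuous_on[OF bounded_linear_cnj]])
qed

lemma integrable_vecI:
  fixes f :: "'a \<Rightarrow> complex^'p::finite"
  assumes "\<And>i. integrable M (\<lambda>x. f x $ i)"
  shows "integrable M f"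
proof (rule Bochner_Integration.integrable_bound)
  show "integrable M (\<lambda>x. \<Sum>i\<in>UNIV. norm (f x $ i))" using assms by auto
  show "f \<in> borel_measurable M" using assms by (intro borel_measurable_vecI) auto
  show "AE x in M. norm (f x) \<le> norm (\<Sum>i\<in>UNIV. norm (f x $ i))"
  proof (rule AE_I2)
    fix x
    have "norm (f x) \<le> (\<Sum>i\<in>UNIV. norm (f x $ i))"
      unfolding norm_vec_def by (rule L2_set_le_sum) simp
    then show "norm (f x) \<le> norm (\<Sum>i\<in>UNIV. norm (f x $ i))" by (simp add: sum_nonneg)
  qed
qed

lemma integral_vec_nth:
  fixes f :: "'a \<Rightarrow> complex^'p::finite"
  assumes "integrable M f"
  shows "(LINT x|M. f x) $ i = (LINT x|M. f x $ i)"
  using integral_bounded_linear[OF bounded_linear_vec_nth assms] by simp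

lemma integrable_vec_nth:
  fixes f :: "'a \<Rightarrow> complex^'p::finite"
  shows "integrable M f \<Longrightarrow> integrable M (\<lambda>x. f x $ i)"
  using integrable_bounded_linear[OF bounded_linear_vec_nth] by blast


text \<open>Symmetry is part of the conclusion because positivity of an operator is given only as
  nonnegativity of its quadratic form; over the complex scalars the tests c = 1 and c = \<i> already
  force it. Used for the inner product of L^2 and for the form \<open>q\<close>.\<close>

lemma psd_form_Cauchy_Schwarz:
  fixes a b b' d :: complex
  assumes psd: "\<And>c. a + cnj c * b + c * b' + c * cnj c * d \<in> \<real>\<^sub>\<ge>\<^sub>0" and d: "d \<in> \<real>\<^sub>\<ge>\<^sub>0"
  shows "b' = cnj b" "(cmod b)\<^sup>2 \<le> Re a * Re d"
proof -
  have d': "Im d = 0" "Re d \<ge> 0" using d by (auto simp: complex_nonneg_Reals_iff)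
  have a': "Im a = 0" "Re a \<ge> 0" using psd[of 0] by (auto simp: complex_nonneg_Reals_iff)
  have "Im (b + b') = 0" "Re b' = Re b"
    using psd[of 1] psd[of \<i>] d' a' by (auto simp: complex_nonneg_Reals_iff)
  then show b': "b' = cnj b" by (simp add: complex_eq_iff)
  \<comment> \<open>Restricting to c = t b with t real leaves a real quadratic in t. Its value at t
    = -1 / Re d gives the bound; if Re d = 0 it is linear in t and bounded below, hence
    constant.\<close>
  have key: "Re a + 2 * (t * (cmod b)\<^sup>2) + t\<^sup>2 * (cmod b)\<^sup>2 * Re d \<ge> 0" for t :: real
  proof -
    have "Re (a + cnj (t * b) * b + t * b * b' + t * b * cnj (t * b) * d) \<ge> 0"
      using psd[of "t * b"] by (auto simp: complex_nonneg_Reals_iff)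
    then show ?thesis
      unfolding b' by (simp add: d' cmod_power2) (simp add: algebra_simps power2_eq_square)
  qed
  show "(cmod b)\<^sup>2 \<le> Re a * Re d"
  proof (cases "Re d = 0")
    case True
    have "(cmod b)\<^sup>2 = 0"
    proof (rule ccontr)
      assume "(cmod b)\<^sup>2 \<noteq> 0"
      then have "Re a + 2 * (- (Re a + 1) / (cmod b)\<^sup>2 * (cmod b)\<^sup>2) \<ge> 0"
        using key[of "- (Re a + 1) / (cmod b)\<^sup>2"] True by simp
      then show False using a' \<open>(cmod b)\<^sup>2 \<noteq> 0\<close> by simp
    qed
    then show ?thesis using True by simp
  next
    case False
    then have pos: "Re d > 0" using d' by simp
    have "Re a + 2 * (- (1 / Re d) * (cmod b)\<^sup>2) + (- (1 / Re d))\<^sup>2 * (cmod b)\<^sup>2 * Re d \<ge> 0"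
      by (rule key)
    then have "Re a - (cmod b)\<^sup>2 / Re d \<ge> 0"
      using pos by (simp add: field_simps power2_eq_square)
    then show ?thesis using pos by (simp add: field_simps)
  qed
qed

section \<open>L^2 on a finite interval: linear structure, inner product and norm\<close>

abbreviation Il :: "real \<Rightarrow> real measure" where "Il l \<equiv> lebesgue_on {0<..<l}"

lemma finite_measure_Il: "finite_measure (Il l)"
  by (rule finite_measure_lebesgue_on) simp

lemma L2_iff: "f \<in> L2 l \<longleftrightarrow> f \<in> borel_measurable (Il l) \<and> integrable (Il l) (\<lambda>x. (norm (f x))\<^sup>2)"
  by (simp add: L2_def sq_integrable_on_def)

lemma L2_measurable: "f \<in> L2 l \<Longrightarrow> f \<in> borel_measurable (Il l)"
  and L2_integrable_sq: "f \<in> L2 l \<Longrightarrow> integrable (Il l) (\<lambda>x. (norm (f x))\<^sup>2)"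
  by (simp_all add: L2_iff)

lemma L2_bound:
  assumes "g \<in> borel_measurable (Il l)" "integrable (Il l) h" "AE x in Il l. (norm (g x))\<^sup>2 \<le> h x"
  shows "g \<in> L2 l"
  unfolding L2_iff
proof
  show "integrable (Il l) (\<lambda>x. (norm (g x))\<^sup>2)"
  proof (rule Bochner_Integration.integrable_bound[OF assms(2)])
    show "(\<lambda>x. (norm (g x))\<^sup>2) \<in> borel_measurable (Il l)" using assms(1) by measurable
    show "AE x in Il l. norm ((norm (g x))\<^sup>2) \<le> norm (h x)"
      using assms(3) by (rule eventually_mono) auto
  qed
qed (rule assms)

lemma L2_zero [simp]: "(\<lambda>x. 0) \<in> L2 l"
  by (simp add: L2_iff)

lemma L2_add:
  assumes "f \<in> L2 l" "g \<in> L2 l" shows "(\<lambda>x. f x + g x) \<in> L2 l"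
proof (rule L2_bound)
  show "(\<lambda>x. f x + g x) \<in> borel_measurable (Il l)"
    using assms[THEN L2_measurable] by measurable
  show "integrable (Il l) (\<lambda>x. 2 * (norm (f x))\<^sup>2 + 2 * (norm (g x))\<^sup>2)"
    using assms[THEN L2_integrable_sq] by simp
  have "(norm (f x + g x))\<^sup>2 \<le> 2 * (norm (f x))\<^sup>2 + 2 * (norm (g x))\<^sup>2" for x
  proof -
    have "(norm (f x + g x))\<^sup>2 \<le> (norm (f x) + norm (g x))\<^sup>2"
      by (intro power_mono norm_triangle_ineq) simp
    also have "\<dots> \<le> 2 * (norm (f x))\<^sup>2 + 2 * (norm (g x))\<^sup>2"
      using zero_le_power2[of "norm (f x) - norm (g x)"] by (simp add: power2_diff power2_sum)
    finally show ?thesis .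
  qed
  then show "AE x in Il l. (norm (f x + g x))\<^sup>2 \<le> 2 * (norm (f x))\<^sup>2 + 2 * (norm (g x))\<^sup>2"
    by simp
qed

lemma L2_smult:
  assumes "f \<in> L2 l" shows "(\<lambda>x. c *s f x) \<in> L2 l"
  using assms by (auto simp: L2_iff norm_smult power_mult_distrib)

lemma L2_diff:
  assumes "f \<in> L2 l" "g \<in> L2 l" shows "(\<lambda>x. f x - g x) \<in> L2 l"
proof -
  have "(\<lambda>x. f x + (-1) *s g x) \<in> L2 l" using assms by (intro L2_add L2_smult)
  moreover have "f x + (-1) *s g x = f x - g x" for x by (simp add: vec_eq_iff)
  ultimately show ?thesis by simp
qed

lemma L2_sum:
  assumes "finite I" "\<And>i. i \<in> I \<Longrightarrow> f i \<in> L2 l" shows "(\<lambda>x. \<Sum>i\<in>I. f i x) \<in> L2 l"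
  using assms by (induction I) (auto intro: L2_add)

lemma L2_const: "(\<lambda>x. c) \<in> L2 l"
  unfolding L2_iff by (intro conjI borel_measurable_const finite_measure.integrable_const finite_measure_Il)

lemma L2_cong: "f \<in> L2 l \<Longrightarrow> (\<And>x. 0 < x \<Longrightarrow> x < l \<Longrightarrow> f x = g x) \<Longrightarrow> g \<in> L2 l"
proof -
  assume f: "f \<in> L2 l" and eq: "\<And>x. 0 < x \<Longrightarrow> x < l \<Longrightarrow> f x = g x"
  have "g \<in> borel_measurable (Il l) \<longleftrightarrow> f \<in> borel_measurable (Il l)"
    by (rule measurable_cong) (simp add: eq)
  moreover have "integrable (Il l) (\<lambda>x. (norm (g x))\<^sup>2) \<longleftrightarrow> integrable (Il l) (\<lambda>x. (norm (f x))\<^sup>2)"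
    by (rule Bochner_Integration.integrable_cong) (simp_all add: eq)
  ultimately show "g \<in> L2 l" using f by (simp add: L2_iff)
qed

lemma integrable_hprod:
  assumes "f \<in> L2 l" "g \<in> L2 l" shows "integrable (Il l) (\<lambda>x. hprod (f x) (g x))"
proof (rule Bochner_Integration.integrable_bound)
  show "integrable (Il l) (\<lambda>x. (norm (f x))\<^sup>2 + (norm (g x))\<^sup>2)"
    using assms[THEN L2_integrable_sq] by simp
  show "(\<lambda>x. hprod (f x) (g x)) \<in> borel_measurable (Il l)"
    using assms[THEN L2_measurable] by measurable
  have "norm (hprod (f x) (g x)) \<le> norm ((norm (f x))\<^sup>2 + (norm (g x))\<^sup>2)" for x
  proof -
    have "norm (hprod (f x) (g x)) \<le> norm (f x) * norm (g x)" by (rule norm_hprod_le)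
    also have "\<dots> \<le> (norm (f x))\<^sup>2 + (norm (g x))\<^sup>2"
      using sum_squares_bound[of "norm (f x)" "norm (g x)"]
        mult_nonneg_nonneg[OF norm_ge_zero[of "f x"] norm_ge_zero[of "g x"]] by linarith
    finally show ?thesis by simp
  qed
  then show "AE x in Il l. norm (hprod (f x) (g x)) \<le> norm ((norm (f x))\<^sup>2 + (norm (g x))\<^sup>2)"
    by simp
qed

lemma L2_integrable:
  assumes "f \<in> L2 l" shows "integrable (Il l) f"
proof (rule Bochner_Integration.integrable_bound)
  show "integrable (Il l) (\<lambda>x. (norm (f x))\<^sup>2 + 1)"
    by (intro Bochner_Integration.integrable_add L2_integrable_sq assms
        finite_measure.integrable_const finite_measure_Il)
  show "f \<in> borel_measurable (Il l)" using assms by (rule L2_measurable)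
  have "norm (f x) \<le> norm ((norm (f x))\<^sup>2 + 1)" for x
  proof -
    have "norm (f x) \<le> (norm (f x))\<^sup>2 + 1"
      using sum_squares_bound[of "norm (f x)" 1] norm_ge_zero[of "f x"]
      unfolding mult_1_right power_one by linarith
    then show ?thesis by simp
  qed
  then show "AE x in Il l. norm (f x) \<le> norm ((norm (f x))\<^sup>2 + 1)" by simp
qed

lemma L2_inner_eq: "L2_inner l f g = (LINT x|Il l. hprod (f x) (g x))"
  by (simp add: L2_inner_def hprod_def)

context
  fixes l :: real
begin

lemma ip_add_left: "\<lbrakk>f \<in> L2 l; g \<in> L2 l; h \<in> L2 l\<rbrakk> \<Longrightarrow>
    L2_inner l (\<lambda>x. f x + g x) h = L2_inner l f h + L2_inner l g h"
  and ip_diff_left: "\<lbrakk>f \<in> L2 l; g \<in> L2 l; h \<in> L2 l\<rbrakk> \<Longrightarrow>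
    L2_inner l (\<lambda>x. f x - g x) h = L2_inner l f h - L2_inner l g h"
  and ip_add_right: "\<lbrakk>f \<in> L2 l; g \<in> L2 l; h \<in> L2 l\<rbrakk> \<Longrightarrow>
    L2_inner l h (\<lambda>x. f x + g x) = L2_inner l h f + L2_inner l h g"
  and ip_diff_right: "\<lbrakk>f \<in> L2 l; g \<in> L2 l; h \<in> L2 l\<rbrakk> \<Longrightarrow>
    L2_inner l h (\<lambda>x. f x - g x) = L2_inner l h f - L2_inner l h g"
  by (simp_all add: L2_inner_eq hprod_add_left hprod_add_right hprod_diff_left hprod_diff_right integrable_hprod)

lemma ip_smult_left: "L2_inner l (\<lambda>x. c *s f x) h = c * L2_inner l f h"
  and ip_smult_right: "L2_inner l h (\<lambda>x. c *s f x) = cnj c * L2_inner l h f"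
  by (simp_all add: L2_inner_eq hprod_smult_left hprod_smult_right)

lemma ip_cnj: "cnj (L2_inner l f g) = L2_inner l g f"
  unfolding L2_inner_eq by (subst Bochner_Integration.integral_cnj[symmetric]) (simp add: hprod_cnj)

lemma ip_zero [simp]: "L2_inner l (\<lambda>x. 0) g = 0" "L2_inner l g (\<lambda>x. 0) = 0"
  by (simp_all add: L2_inner_eq)

lemma ip_sum_left: "finite I \<Longrightarrow> (\<And>i. i \<in> I \<Longrightarrow> f i \<in> L2 l) \<Longrightarrow> h \<in> L2 l \<Longrightarrow>
    L2_inner l (\<lambda>x. \<Sum>i\<in>I. f i x) h = (\<Sum>i\<in>I. L2_inner l (f i) h)"
  by (induction I rule: finite_induct) (simp_all add: ip_add_left L2_sum)

lemma ip_self: "L2_inner l f f = of_real ((L2_norm l f)\<^sup>2)"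
  by (simp add: L2_inner_eq hprod_self L2_norm_def del: of_real_power)

lemma L2_norm_nonneg [simp]: "0 \<le> L2_norm l f"
  by (simp add: L2_norm_def)

lemma L2_norm_sq: "(L2_norm l f)\<^sup>2 = (LINT x|Il l. (norm (f x))\<^sup>2)"
  by (simp add: L2_norm_def)

lemma L2_norm_smult: "L2_norm l (\<lambda>x. c *s f x) = cmod c * L2_norm l f"
  by (simp add: L2_norm_def norm_smult power_mult_distrib real_sqrt_mult)

lemma ip_Cauchy_Schwarz:
  assumes "f \<in> L2 l" "g \<in> L2 l"
  shows "cmod (L2_inner l f g) \<le> L2_norm l f * L2_norm l g"
proof -
  have "(cmod (L2_inner l f g))\<^sup>2 \<le> Re (L2_inner l f f) * Re (L2_inner l g g)"
  proof (rule psd_form_Cauchy_Schwarz(2))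
    fix c :: complex
    have cg: "(\<lambda>x. c *s g x) \<in> L2 l" using assms by (intro L2_smult)
    have "L2_inner l f f + cnj c * L2_inner l f g + c * L2_inner l g f + c * cnj c * L2_inner l g g
        = L2_inner l (\<lambda>x. f x + c *s g x) (\<lambda>x. f x + c *s g x)"
      using assms cg
      by (simp add: ip_add_left ip_add_right L2_add ip_smult_left ip_smult_right algebra_simps)
    also have "\<dots> \<in> \<real>\<^sub>\<ge>\<^sub>0" by (simp add: ip_self)
    finally show "L2_inner l f f + cnj c * L2_inner l f g + c * L2_inner l g f + c * cnj c * L2_inner l g g \<in> \<real>\<^sub>\<ge>\<^sub>0" .
  qed (simp add: ip_self)
  also have "\<dots> = (L2_norm l f * L2_norm l g)\<^sup>2" by (simp add: ip_self power_mult_distrib)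
  finally show ?thesis by (rule power2_le_imp_le) simp
qed

lemma L2_norm_triangle:
  assumes "f \<in> L2 l" "g \<in> L2 l"
  shows "L2_norm l (\<lambda>x. f x + g x) \<le> L2_norm l f + L2_norm l g"
proof -
  have "complex_of_real ((L2_norm l (\<lambda>x. f x + g x))\<^sup>2)
      = L2_inner l f f + L2_inner l f g + cnj (L2_inner l f g) + L2_inner l g g"
    unfolding ip_self[symmetric] ip_cnj using assms by (simp add: ip_add_left ip_add_right L2_add)
  from arg_cong[OF this, of Re]
  have "(L2_norm l (\<lambda>x. f x + g x))\<^sup>2 = (L2_norm l f)\<^sup>2 + 2 * Re (L2_inner l f g) + (L2_norm l g)\<^sup>2"
    by (simp add: ip_self del: of_real_power)
  also have "\<dots> \<le> (L2_norm l f + L2_norm l g)\<^sup>2"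
    using ip_Cauchy_Schwarz[OF assms] complex_Re_le_cmod[of "L2_inner l f g"]
    by (simp add: power2_sum)
  finally show ?thesis by (rule power2_le_imp_le) simp
qed

lemma L2_norm_zero_iff:
  assumes "f \<in> L2 l" shows "L2_norm l f = 0 \<longleftrightarrow> ae_eq l f (\<lambda>x. 0)"
proof -
  have "L2_norm l f = 0 \<longleftrightarrow> (AE x in Il l. (norm (f x))\<^sup>2 = 0)"
    unfolding L2_norm_def using integral_nonneg_eq_0_iff_AE[OF L2_integrable_sq[OF assms]] by simp
  then show ?thesis by (simp add: ae_eq_def)
qed

lemma ae_eq_refl [simp]: "ae_eq l f f"
  by (simp add: ae_eq_def)

lemma ae_eq_sym: "ae_eq l f g \<Longrightarrow> ae_eq l g f"
  by (auto simp: ae_eq_def elim: eventually_mono)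

lemma ae_eq_trans [trans]: "ae_eq l f g \<Longrightarrow> ae_eq l g h \<Longrightarrow> ae_eq l f h"
  unfolding ae_eq_def by (erule eventually_elim2) auto

lemma ae_eq_add: "ae_eq l f f' \<Longrightarrow> ae_eq l g g' \<Longrightarrow> ae_eq l (\<lambda>x. f x + g x) (\<lambda>x. f' x + g' x)"
  and ae_eq_diff: "ae_eq l f f' \<Longrightarrow> ae_eq l g g' \<Longrightarrow> ae_eq l (\<lambda>x. f x - g x) (\<lambda>x. f' x - g' x)"
  unfolding ae_eq_def by (erule eventually_elim2, auto)+

lemma ae_eq_smult: "ae_eq l f f' \<Longrightarrow> ae_eq l (\<lambda>x. c *s f x) (\<lambda>x. c *s f' x)"
  unfolding ae_eq_def by (erule eventually_mono) auto

lemma ip_cong: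
  assumes "f \<in> L2 l" "f' \<in> L2 l" "g \<in> L2 l" "g' \<in> L2 l" "ae_eq l f f'" "ae_eq l g g'"
  shows "L2_inner l f g = L2_inner l f' g'"
  unfolding L2_inner_eq
proof (rule integral_cong_AE)
  show "AE x in Il l. hprod (f x) (g x) = hprod (f' x) (g' x)"
    using assms(5,6) unfolding ae_eq_def by eventually_elim simp
qed (use assms in \<open>auto intro!: borel_measurable_hprod L2_measurable\<close>)

lemma L2_norm_cong:
  assumes "f \<in> L2 l" "f' \<in> L2 l" "ae_eq l f f'"
  shows "L2_norm l f = L2_norm l f'"
proof -
  have "complex_of_real ((L2_norm l f)\<^sup>2) = complex_of_real ((L2_norm l f')\<^sup>2)"
    unfolding ip_self[symmetric] by (rule ip_cong) (use assms in auto)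
  then have "(L2_norm l f)\<^sup>2 = (L2_norm l f')\<^sup>2" by (simp only: of_real_eq_iff)
  then show ?thesis by (rule power2_eq_imp_eq) auto
qed

end

section \<open>Primitives and convolutions of locally integrable functions\<close>

definition loc_int :: "(real \<Rightarrow> complex) \<Rightarrow> bool" where
  "loc_int \<kappa> \<longleftrightarrow> (\<forall>a b. integrable (lebesgue_on {a<..<b}) \<kappa>)"

text \<open>At least one of the two intervals is empty or a point, so this is the signed primitive
  that vanishes at 0.\<close>

definition prim :: "(real \<Rightarrow> complex) \<Rightarrow> real \<Rightarrow> complex" where
  "prim \<kappa> x = integral {0..x} \<kappa> - integral {x..0} \<kappa>"

section \<open>Integrals over open intervals and affine substitutions\<close>

lemma lebesgue_on_integrable_iff:
  fixes f :: "'a::euclidean_space \<Rightarrow> 'b::euclidean_space"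
  assumes "S \<in> sets lebesgue"
  shows "integrable (lebesgue_on S) f \<longleftrightarrow> integrable lebesgue (\<lambda>x. indicator S x *\<^sub>R f x)"
  using assms by (intro integrable_restrict_space) simp

lemma lebesgue_on_integral_eq:
  fixes f :: "'a::euclidean_space \<Rightarrow> 'b::euclidean_space"
  assumes "S \<in> sets lebesgue"
  shows "integral\<^sup>L (lebesgue_on S) f = (LINT x|lebesgue. indicator S x *\<^sub>R f x)"
  using assms by (intro integral_restrict_space) simp

lemma AE_Il_iff: "(AE x in lebesgue_on {a<..<b}. P x) \<longleftrightarrow> (AE x in lebesgue. a < x \<longrightarrow> x < b \<longrightarrow> P x)" for a b :: real
  by (simp add: AE_restrict_space_iff imp_conjL)

lemma AE_Il_mono: "AE x in Il l. P x \<Longrightarrow> b \<le> l \<Longrightarrow> AE x in Il b. P x"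
  unfolding AE_Il_iff by (erule eventually_mono) auto

text \<open>The endpoints are a null set. This links the Bochner integral on open intervals, in
  which L^2 is phrased, with absolute integrability on closed ones, where the fundamental theorem
  and interval additivity are stated.\<close>

lemma Ioo_integrable_iff:
  fixes f :: "real \<Rightarrow> 'b::euclidean_space"
  shows "integrable (lebesgue_on {a<..<b}) f \<longleftrightarrow> f absolutely_integrable_on {a..b}"
proof -
  have "integrable (lebesgue_on {a<..<b}) f \<longleftrightarrow> f absolutely_integrable_on {a<..<b}"
    by (simp add: lebesgue_on_integrable_iff set_integrable_def)
  also have "\<dots> \<longleftrightarrow> f absolutely_integrable_on {a..b}"
  proof (rule absolutely_integrable_spike_set_eq)
    show "negligible {x \<in> {a<..<b} - {a..b}. f x \<noteq> 0}"
      by (rule negligible_subset[OF negligible_empty]) auto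
    show "negligible {x \<in> {a..b} - {a<..<b}. f x \<noteq> 0}"
      by (rule negligible_subset[of "{a, b}"]) auto
  qed
  finally show ?thesis .
qed

lemma Ioo_integral:
  fixes f :: "real \<Rightarrow> 'b::euclidean_space"
  assumes "integrable (lebesgue_on {a<..<b}) f"
  shows "(LINT t|lebesgue_on {a<..<b}. f t) = integral {a..b} f"
  using lebesgue_integral_eq_integral[OF assms] by (simp add: integral_open_interval_real)

lemma loc_int_measurable:
  assumes "loc_int \<kappa>" shows "\<kappa> \<in> borel_measurable lebesgue"
proof -
  have "(\<lambda>x. if x \<in> {- real n<..<real n} then \<kappa> x else 0) \<in> borel_measurable lebesgue" for n
    using assms unfolding loc_int_def by (intro borel_measurable_if_I borel_measurable_integrable) auto
  moreover have "(\<lambda>n. if x \<in> {- real n<..<real n} then \<kappa> x else 0) \<longlonglongrightarrow> \<kappa> x" for x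
  proof (rule tendsto_eventually)
    obtain N :: nat where "\<bar>x\<bar> < real N" using reals_Archimedean2 by blast
    then show "\<forall>\<^sub>F n in sequentially. (if x \<in> {- real n<..<real n} then \<kappa> x else 0) = \<kappa> x"
      by (intro eventually_sequentiallyI[of N]) auto
  qed
  ultimately show ?thesis by (rule borel_measurable_LIMSEQ_metric)
qed

lemma loc_int_integrable_on: "loc_int \<kappa> \<Longrightarrow> \<kappa> integrable_on {a..b}"
  unfolding loc_int_def Ioo_integrable_iff by (metis set_lebesgue_integral_eq_integral(1))

lemma prim_shift:
  assumes "loc_int \<kappa>" "c \<le> x" "c \<le> 0"
  shows "prim \<kappa> x = integral {c..x} \<kappa> - integral {c..0} \<kappa>"
proof (cases "0 \<le> x")
  case True
  have "integral {c..0} \<kappa> + integral {0..x} \<kappa> = integral {c..x} \<kappa>"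
    using assms True by (intro Henstock_Kurzweil_Integration.integral_combine loc_int_integrable_on) auto
  moreover have "integral {x..0} \<kappa> = 0"
    using True by (cases "x = 0") auto
  ultimately show ?thesis by (simp add: prim_def algebra_simps)
next
  case False
  have "integral {c..x} \<kappa> + integral {x..0} \<kappa> = integral {c..0} \<kappa>"
    using assms False by (intro Henstock_Kurzweil_Integration.integral_combine loc_int_integrable_on) auto
  then show ?thesis using False by (simp add: prim_def algebra_simps)
qed

lemma prim_diff:
  assumes "loc_int \<kappa>" "a \<le> b"
  shows "(LINT t|lebesgue_on {a<..<b}. \<kappa> t) = prim \<kappa> b - prim \<kappa> a"
proof -
  define c where "c = min a 0"
  have "(LINT t|lebesgue_on {a<..<b}. \<kappa> t) = integral {a..b} \<kappa>"
    using assms by (intro Ioo_integral) (auto simp: loc_int_def)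
  moreover have "integral {c..a} \<kappa> + integral {a..b} \<kappa> = integral {c..b} \<kappa>"
    using assms by (intro Henstock_Kurzweil_Integration.integral_combine loc_int_integrable_on) (auto simp: c_def)
  ultimately show ?thesis
    using assms by (simp add: prim_shift[of _ c] c_def algebra_simps)
qed

lemma prim_0 [simp]: "prim \<kappa> 0 = 0"
  by (simp add: prim_def)

lemma prim_nonneg: "loc_int \<kappa> \<Longrightarrow> 0 \<le> x \<Longrightarrow> prim \<kappa> x = (LINT t|Il x. \<kappa> t)"
  by (simp add: prim_diff)

lemma prim_continuous:
  assumes "loc_int \<kappa>" shows "continuous_on UNIV (prim \<kappa>)"
proof -
  have "isCont (prim \<kappa>) x" for x
  proof -
    define M where "M = \<bar>x\<bar> + 1"
    have "continuous_on {-M..M} (\<lambda>x. integral {-M..x} \<kappa> - integral {-M..0} \<kappa>)"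
      by (intro continuous_intros indefinite_integral_continuous_1 loc_int_integrable_on assms)
    then have "continuous_on {-M..M} (prim \<kappa>)"
      by (rule continuous_on_eq) (subst prim_shift[OF assms, of "-M"]; auto simp: M_def)
    then show ?thesis
      by (rule continuous_on_interior) (auto simp: M_def)
  qed
  then show ?thesis by (simp add: continuous_on_eq_continuous_at)
qed

text \<open>The minimum and maximum absorb the sign of c. An inequality is claimed because for a
  \<ge> b the left side is 0 while the interval on the right may be nonempty.\<close>

lemma integrable_affine:
  assumes "loc_int \<kappa>" "c \<noteq> 0"
  shows "integrable (lebesgue_on {a<..<b}) (\<lambda>x. \<kappa> (e + c * x))"
    and "\<bar>c\<bar> * (LINT x|lebesgue_on {a<..<b}. norm (\<kappa> (e + c * x))) \<le> 
      (LINT x|lebesgue_on {min (e + c * a) (e + c * b)<..<max (e + c * a) (e + c * b)}. norm (\<kappa> x))"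
proof -
  define u v where "u = min (e + c * a) (e + c * b)" and "v = max (e + c * a) (e + c * b)"
  have *: "e + c * x \<in> {u<..<v} \<longleftrightarrow> x \<in> {a<..<b}" if "a < b" for x
  proof (cases "c > 0")
    case True
    then have "u = e + c * a" "v = e + c * b" using that by (auto simp: u_def v_def)
    then show ?thesis using True by simp
  next
    case False
    then have "c < 0" using assms by simp
    then have "u = e + c * b" "v = e + c * a" using that by (auto simp: u_def v_def)
    then show ?thesis using \<open>c < 0\<close> by auto
  qed
  have int: "integrable lebesgue (\<lambda>x. indicator {u<..<v} x *\<^sub>R \<kappa> x)"
    using assms unfolding loc_int_def by (subst lebesgue_on_integrable_iff[symmetric]) auto
  from lebesgue_integrable_real_affine[OF this assms(2), of e]
  have "integrable lebesgue (\<lambda>x. indicator {u<..<v} (e + c * x) *\<^sub>R \<kappa> (e + c * x))" .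
  then have 1: "integrable lebesgue (\<lambda>x. indicator {a<..<b} x *\<^sub>R \<kappa> (e + c * x))"
  proof (cases "a < b")
    case True
    then show ?thesis
      using \<open>integrable lebesgue (\<lambda>x. indicator {u<..<v} (e + c * x) *\<^sub>R \<kappa> (e + c * x))\<close>
      by (simp add: indicator_def * del: greaterThanLessThan_iff)
  qed simp
  then show "integrable (lebesgue_on {a<..<b}) (\<lambda>x. \<kappa> (e + c * x))"
    by (subst lebesgue_on_integrable_iff) auto
  show "\<bar>c\<bar> * (LINT x|lebesgue_on {a<..<b}. norm (\<kappa> (e + c * x))) \<le> 
      (LINT x|lebesgue_on {u<..<v}. norm (\<kappa> x))"
  proof (cases "a < b")
    case True
    have "(LINT x|lebesgue_on {u<..<v}. norm (\<kappa> x)) = (LINT x|lebesgue. indicator {u<..<v} x *\<^sub>R norm (\<kappa> x))"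
      by (rule lebesgue_on_integral_eq) simp
    also have "\<dots> = \<bar>c\<bar> *\<^sub>R (LINT x|lebesgue. indicator {u<..<v} (e + c * x) *\<^sub>R norm (\<kappa> (e + c * x)))"
      by (rule lebesgue_integral_real_affine[OF assms(2)])
    also have "\<dots> = \<bar>c\<bar> * (LINT x|lebesgue_on {a<..<b}. norm (\<kappa> (e + c * x)))"
      using True by (subst lebesgue_on_integral_eq) (auto simp: indicator_def * simp del: greaterThanLessThan_iff)
    finally show ?thesis by simp
  qed simp
qed

lemma integral_affine:
  assumes "loc_int \<kappa>" "c > 0" "0 \<le> y"
  shows "(LINT x|Il y. \<kappa> (e + c * x)) = (prim \<kappa> (e + c * y) - prim \<kappa> e) / c"
proof -
  have *: "e + c * x \<in> {e<..<e + c * y} \<longleftrightarrow> x \<in> {0<..<y}" for x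
    using assms by (auto simp: zero_less_mult_iff)
  have "prim \<kappa> (e + c * y) - prim \<kappa> e = (LINT x|lebesgue_on {e<..<e + c * y}. \<kappa> x)"
    using assms by (intro prim_diff[symmetric]) auto
  also have "\<dots> = (LINT x|lebesgue. indicator {e<..<e + c * y} x *\<^sub>R \<kappa> x)"
    by (rule lebesgue_on_integral_eq) simp
  also have "\<dots> = \<bar>c\<bar> *\<^sub>R (LINT x|lebesgue. indicator {e<..<e + c * y} (e + c * x) *\<^sub>R \<kappa> (e + c * x))"
    using assms by (intro lebesgue_integral_real_affine) auto
  also have "\<dots> = c * (LINT x|Il y. \<kappa> (e + c * x))"
    using assms by (subst lebesgue_on_integral_eq)
      (auto simp: indicator_def * scaleR_conv_of_real simp del: greaterThanLessThan_iff)
  finally show ?thesis using assms by simp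
qed

lemma AE_affine:
  assumes "AE x in lebesgue. P x" "c \<noteq> 0" shows "AE x in lebesgue. P (e + c * x :: real)"
proof -
  have m: "(\<lambda>x. e + c * x) \<in> lebesgue \<rightarrow>\<^sub>M lebesgue"
    using lebesgue_affine_measurable[where c= "\<lambda>x::real. c"] assms by simp
  obtain N where N: "{x. \<not> P x} \<subseteq> N" "N \<in> null_sets lebesgue"
    using assms(1) by (auto elim!: AE_E simp: null_sets_def)
  have "negligible ((\<lambda>x. (x - e) / c) ` N)"
  proof (rule negligible_differentiable_image_negligible)
    show "negligible N" using N by (simp add: negligible_iff_null_sets)
    show "(\<lambda>x. (x - e) / c) differentiable_on N"
      unfolding differentiable_on_def using assms by (auto intro!: derivative_intros)
  qed simp
  then have "(\<lambda>x. (x - e) / c) ` N \<in> null_sets lebesgue" by (simp add: negligible_iff_null_sets)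
  then show ?thesis
  proof (rule AE_I')
    show "{x \<in> space lebesgue. \<not> P (e + c * x)} \<subseteq> (\<lambda>x. (x - e) / c) ` N"
    proof
      fix x assume "x \<in> {x \<in> space lebesgue. \<not> P (e + c * x)}"
      then have "e + c * x \<in> N" using N by auto
      then show "x \<in> (\<lambda>x. (x - e) / c) ` N"
        using assms by (intro image_eqI[of _ _ "e + c * x"]) auto
    qed
  qed
qed

text \<open>Joint measurability of (x, t) \<mapsto> \<kappa> (a x + b t), which Fubini requires, is
  immediate only for Borel \<kappa>. The change on a null set is invisible to all integrals
  involved, since affine maps pull null sets back to null sets.\<close>

lemma loc_int_borel_version:
  assumes "loc_int \<kappa>"
  obtains \<kappa>0 where "\<kappa>0 \<in> borel_measurable borel" "AE x in lebesgue. \<kappa> x = \<kappa>0 x" "loc_int \<kappa>0"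
proof -
  note m = loc_int_measurable[OF assms]
  have "(\<lambda>x. Re (\<kappa> x)) \<in> borel_measurable lebesgue" "(\<lambda>x. Im (\<kappa> x)) \<in> borel_measurable lebesgue"
    using m by measurable
  then obtain r i where r: "r \<in> borel_measurable lborel" "AE x in lborel. Re (\<kappa> x) = r x"
    and i: "i \<in> borel_measurable lborel" "AE x in lborel. Im (\<kappa> x) = i x"
    using completion_ex_borel_measurable_real[of "\<lambda>x. Re (\<kappa> x)" lborel]
      completion_ex_borel_measurable_real[of "\<lambda>x. Im (\<kappa> x)" lborel] by auto
  let ?k = "\<lambda>x. Complex (r x) (i x)"
  have 1: "?k \<in> borel_measurable borel"
    using r i by (simp add: complex_is_Real_iff borel_measurable_complex_iff)
  have "AE x in lborel. \<kappa> x = ?k x"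
    using r(2) i(2) by eventually_elim (simp add: complex_eq_iff)
  then have 2: "AE x in lebesgue. \<kappa> x = ?k x" by (rule AE_completion)
  have "loc_int ?k"
    unfolding loc_int_def
  proof (intro allI)
    fix a b
    show "integrable (lebesgue_on {a<..<b}) ?k"
    proof (rule integrable_cong_AE_imp)
      show "integrable (lebesgue_on {a<..<b}) \<kappa>" using assms by (simp add: loc_int_def)
      show "?k \<in> borel_measurable (lebesgue_on {a<..<b})"
        using 1 by (intro measurable_restrict_space1 measurable_completion) simp
      show "AE x in lebesgue_on {a<..<b}. \<kappa> x = ?k x"
        unfolding AE_Il_iff using 2 by (rule eventually_mono) auto
    qed
  qed
  with 1 2 that show thesis by blast
qed

section \<open>Fubini on rectangles and integration by parts\<close>

lemma pair_Il: "pair_sigma_finite (Il l) (Il m)"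
  unfolding pair_sigma_finite_def
  using finite_measure.axioms(1)[OF finite_measure_Il] by blast

lemma measurable_id_Il [measurable]: "(\<lambda>x. x) \<in> borel_measurable (Il l)"
  using id_borel_measurable_lebesgue_on by (simp add: id_def)

lemma integrable_Il_prod:
  fixes a b :: "real \<Rightarrow> complex"
  assumes a: "integrable (Il l) a" and b: "integrable (Il m) b"
    and N: "(\<lambda>(x, y). N x y) \<in> borel_measurable (Il l \<Otimes>\<^sub>M Il m)" and C: "\<And>x y. 0 < x \<Longrightarrow> x < l \<Longrightarrow> 0 < y \<Longrightarrow> y < m \<Longrightarrow> norm (N x y) \<le> C"
  shows "integrable (Il l \<Otimes>\<^sub>M Il m) (\<lambda>(x, y). N x y * (a x * b y))"
proof -
  interpret pair_sigma_finite "Il l" "Il m" by (rule pair_Il)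
  have [measurable]: "a \<in> borel_measurable (Il l)" "b \<in> borel_measurable (Il m)" using a b by auto
  have ab: "integrable (Il l \<Otimes>\<^sub>M Il m) (\<lambda>p. a (fst p) * b (snd p))"
  proof (rule Fubini_integrable)
    show "integrable (Il l) (\<lambda>x. LINT y|Il m. norm (a (fst (x, y)) * b (snd (x, y))))"
      using a by (simp add: norm_mult)
    show "AE x in Il l. integrable (Il m) (\<lambda>y. a (fst (x, y)) * b (snd (x, y)))"
      using b by simp
  qed measurable
  show ?thesis
  proof (rule Bochner_Integration.integrable_bound)
    show "integrable (Il l \<Otimes>\<^sub>M Il m) (\<lambda>p. C * norm (a (fst p) * b (snd p)))"
      using ab by (intro integrable_mult_right integrable_norm)
    show "(\<lambda>(x, y). N x y * (a x * b y)) \<in> borel_measurable (Il l \<Otimes>\<^sub>M Il m)"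
      using N by (simp add: case_prod_beta) measurable
    show "AE p in Il l \<Otimes>\<^sub>M Il m. norm (case p of (x, y) \<Rightarrow> N x y * (a x * b y)) \<le> norm (C * norm (a (fst p) * b (snd p)))"
    proof (rule AE_I2)
      fix p assume "p \<in> space (Il l \<Otimes>\<^sub>M Il m)"
      then obtain x y where p: "p = (x, y)" "0 < x" "x < l" "0 < y" "y < m"
        by (auto simp: space_pair_measure)
      from C[OF p(2-)] have "norm (N x y) \<le> \<bar>C\<bar>" by simp
      then show "norm (case p of (x, y) \<Rightarrow> N x y * (a x * b y)) \<le> norm (C * norm (a (fst p) * b (snd p)))"
        by (simp add: p norm_mult mult_right_mono abs_mult)
    qed
  qed
qed

lemma Fubini_Il_bounded:
  fixes a b :: "real \<Rightarrow> complex"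
  assumes a: "integrable (Il l) a" and b: "integrable (Il m) b"
    and N: "(\<lambda>(x, y). N x y) \<in> borel_measurable (Il l \<Otimes>\<^sub>M Il m)" and C: "\<And>x y. 0 < x \<Longrightarrow> x < l \<Longrightarrow> 0 < y \<Longrightarrow> y < m \<Longrightarrow> norm (N x y) \<le> C"
  shows "(LINT x|Il l. a x * (LINT y|Il m. N x y * b y)) = (LINT y|Il m. b y * (LINT x|Il l. N x y * a x))"
    and "integrable (Il l) (\<lambda>x. a x * (LINT y|Il m. N x y * b y))"
    and "integrable (Il m) (\<lambda>y. b y * (LINT x|Il l. N x y * a x))"
proof -
  interpret pair_sigma_finite "Il l" "Il m" by (rule pair_Il)
  note int = integrable_Il_prod[OF assms]
  have 1: "(LINT y|Il m. N x y * (a x * b y)) = a x * (LINT y|Il m. N x y * b y)" for x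
    by (subst Bochner_Integration.integral_mult_right_zero[symmetric]) (simp add: mult_ac)
  have 2: "(LINT x|Il l. N x y * (a x * b y)) = b y * (LINT x|Il l. N x y * a x)" for y
    by (subst Bochner_Integration.integral_mult_right_zero[symmetric]) (simp add: mult_ac)
  show "(LINT x|Il l. a x * (LINT y|Il m. N x y * b y)) = (LINT y|Il m. b y * (LINT x|Il l. N x y * a x))"
    using Fubini_integral[of "\<lambda>x y. N x y * (a x * b y)"] int by (simp add: 1 2)
  show "integrable (Il l) (\<lambda>x. a x * (LINT y|Il m. N x y * b y))"
    using integrable_fst[of "\<lambda>x y. N x y * (a x * b y)"] int by (simp add: 1)
  show "integrable (Il m) (\<lambda>y. b y * (LINT x|Il l. N x y * a x))"
    using integrable_snd[of "\<lambda>x y. N x y * (a x * b y)"] int by (simp add: 2)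
qed

lemma Il_sub_integral:
  fixes f :: "real \<Rightarrow> 'b::euclidean_space"
  assumes "t \<le> l"
  shows "(LINT s|Il t. f s) = (LINT s|Il l. (if s < t then f s else 0))"
proof -
  have "(LINT s|Il t. f s) = (LINT s|lebesgue. indicator {0<..<t} s *\<^sub>R f s)"
    by (rule lebesgue_on_integral_eq) simp
  also have "\<dots> = (LINT s|lebesgue. indicator {0<..<l} s *\<^sub>R (if s < t then f s else 0))"
    using assms by (intro Bochner_Integration.integral_cong) (auto simp: indicator_def)
  also have "\<dots> = (LINT s|Il l. (if s < t then f s else 0))"
    by (rule lebesgue_on_integral_eq[symmetric]) simp
  finally show ?thesis .
qed

lemma AE_Il_neq: "AE s in Il l. s \<noteq> t"
proof -
  have "AE s in lebesgue. s \<noteq> t"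
    by (rule AE_I'[of "{t}"]) (auto simp: negligible_iff_null_sets[symmetric])
  then show ?thesis unfolding AE_Il_iff by (rule eventually_mono) auto
qed

text \<open>Integration by parts for the primitives of a and b: the square splits into the triangles
  s < t and t < s, the diagonal being a null set.\<close>

lemma integral_product_rule:
  fixes a b :: "real \<Rightarrow> complex"
  assumes a: "integrable (Il l) a" and b: "integrable (Il l) b"
  shows "(LINT t|Il l. a t * (LINT s|Il t. b s)) + (LINT t|Il l. b t * (LINT s|Il t. a s))
      = (LINT t|Il l. a t) * (LINT t|Il l. b t)"
    and "integrable (Il l) (\<lambda>t. a t * (LINT s|Il t. b s))"
proof -
  define N where "N t s = (if s < t then 1 else 0 :: complex)" for t s :: real
  have [measurable]: "(\<lambda>(x, y). N x y) \<in> borel_measurable (Il l \<Otimes>\<^sub>M Il l)"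
    "(\<lambda>(x, y). N y x) \<in> borel_measurable (Il l \<Otimes>\<^sub>M Il l)"
    unfolding N_def case_prod_beta by measurable
  have N1: "norm (N t s) \<le> 1" for t s by (simp add: N_def)
  have sub: "(LINT s|Il t. f s) = (LINT s|Il l. N t s * f s)" if "t < l" for f :: "real \<Rightarrow> complex" and t
    using that by (subst Il_sub_integral[of t l]) (auto intro!: Bochner_Integration.integral_cong simp: N_def)
  have 1: "(LINT t|Il l. a t * (LINT s|Il t. b s)) = (LINT t|Il l. a t * (LINT s|Il l. N t s * b s))"
    by (intro Bochner_Integration.integral_cong) (auto simp: sub)
  have 2: "(LINT t|Il l. b t * (LINT s|Il t. a s)) = (LINT t|Il l. b t * (LINT s|Il l. N t s * a s))"
    by (intro Bochner_Integration.integral_cong) (auto simp: sub)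
  also have "\<dots> = (LINT s|Il l. a s * (LINT t|Il l. N t s * b t))"
    by (rule Fubini_Il_bounded(1)[OF b a, of _ 1]) (auto simp: N1)
  finally have 2: "(LINT t|Il l. b t * (LINT s|Il t. a s)) = (LINT s|Il l. a s * (LINT t|Il l. N t s * b t))" .
  have i1: "integrable (Il l) (\<lambda>t. a t * (LINT s|Il l. N t s * b s))"
    by (rule Fubini_Il_bounded(2)[OF a b, of _ 1]) (auto simp: N1)
  have i2: "integrable (Il l) (\<lambda>t. a t * (LINT s|Il l. N s t * b s))"
    by (rule Fubini_Il_bounded(2)[OF a b, of "\<lambda>t s. N s t" 1]) (auto simp: N1)
  have bN: "integrable (Il l) (\<lambda>s. N t s * b s)" "integrable (Il l) (\<lambda>s. N s t * b s)" for t
    by (rule Bochner_Integration.integrable_bound[OF b], use b in \<open>simp add: N_def\<close>, simp add: N_def)+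
  have 3: "(LINT s|Il l. N t s * b s) + (LINT s|Il l. N s t * b s) = (LINT s|Il l. b s)" for t
  proof -
    have "(LINT s|Il l. N t s * b s) + (LINT s|Il l. N s t * b s) = (LINT s|Il l. N t s * b s + N s t * b s)"
      using bN by simp
    also have "\<dots> = (LINT s|Il l. b s)"
    proof (rule integral_cong_AE)
      show "AE s in Il l. N t s * b s + N s t * b s = b s"
        using AE_Il_neq[of t] by eventually_elim (auto simp: N_def)
    qed (use bN b in auto)
    finally show ?thesis .
  qed
  have "(LINT t|Il l. a t * (LINT s|Il l. N t s * b s)) + (LINT t|Il l. a t * (LINT s|Il l. N s t * b s))
      = (LINT t|Il l. a t * (LINT s|Il l. N t s * b s) + a t * (LINT s|Il l. N s t * b s))"
    using i1 i2 by simp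
  also have "\<dots> = (LINT t|Il l. a t * (LINT s|Il l. b s))"
    by (simp add: 3 flip: distrib_left)
  also have "\<dots> = (LINT t|Il l. a t) * (LINT t|Il l. b t)" by simp
  finally show "(LINT t|Il l. a t * (LINT s|Il t. b s)) + (LINT t|Il l. b t * (LINT s|Il t. a s))
      = (LINT t|Il l. a t) * (LINT t|Il l. b t)" by (simp add: 1 2)
  show "integrable (Il l) (\<lambda>t. a t * (LINT s|Il t. b s))"
    using i1 by (rule Bochner_Integration.integrable_cong[THEN iffD1, rotated 2]) (auto simp: sub)
qed

lemma measurable_Il_affine [measurable]: "(\<lambda>p. a * fst p + b * snd p) \<in> borel_measurable (Il l \<Otimes>\<^sub>M Il m)"
  by measurable

text \<open>The kernel is unbounded, so domination comes from local integrability: the integral of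
  its modulus over the affine image of (0, y) is at most the integral over one interval (-M, M),
  whatever t in (0, l) is.\<close>

lemma Fubini_convolution:
  fixes \<phi> :: "real \<Rightarrow> complex"
  assumes \<kappa>: "loc_int \<kappa>" and a: "a \<noteq> 0" and b: "b \<noteq> 0" and \<phi>: "integrable (Il l) \<phi>"
  shows "(LINT x|Il y. LINT t|Il l. \<kappa> (a * x + b * t) * \<phi> t) = (LINT t|Il l. \<phi> t * (LINT x|Il y. \<kappa> (a * x + b * t)))"
    and "integrable (Il y) (\<lambda>x. LINT t|Il l. \<kappa> (a * x + b * t) * \<phi> t)"
proof -
  obtain \<kappa>0 where k0 [measurable]: "\<kappa>0 \<in> borel_measurable borel" and ae: "AE x in lebesgue. \<kappa> x = \<kappa>0 x" and k0l: "loc_int \<kappa>0"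
    by (rule loc_int_borel_version[OF \<kappa>])
  interpret pair_sigma_finite "Il l" "Il y" by (rule pair_Il)
  have [measurable]: "\<phi> \<in> borel_measurable (Il l)" using \<phi> by simp
  define M where "M = \<bar>a\<bar> * \<bar>y\<bar> + \<bar>b\<bar> * \<bar>l\<bar>"
  define C where "C = (LINT x|lebesgue_on {-M<..<M}. norm (\<kappa>0 x))"
  have bd: "\<bar>a\<bar> * (LINT x|Il y. norm (\<kappa>0 (b * t + a * x))) \<le> C" if t: "0 < t" "t < l" for t
  proof -
    let ?u = "min (b * t + a * 0) (b * t + a * y)" and ?v = "max (b * t + a * 0) (b * t + a * y)"
    have "\<bar>b * t\<bar> \<le> \<bar>b\<bar> * \<bar>l\<bar>" using t by (simp add: abs_mult mult_left_mono)
    moreover have "\<bar>a * y\<bar> = \<bar>a\<bar> * \<bar>y\<bar>" by (simp add: abs_mult)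
    moreover have "0 \<le> \<bar>a\<bar> * \<bar>y\<bar>" by simp
    ultimately have "- M \<le> ?u" "?v \<le> M" unfolding M_def by linarith+
    then have sub: "{?u<..<?v} \<subseteq> {-M<..<M}" by auto
    have "\<bar>a\<bar> * (LINT x|Il y. norm (\<kappa>0 (b * t + a * x))) \<le> (LINT x|lebesgue_on {?u<..<?v}. norm (\<kappa>0 x))"
      by (rule integrable_affine(2)[OF k0l a])
    also have "\<dots> \<le> C" unfolding C_def
    proof -
      have i: "integrable lebesgue (\<lambda>x. indicator {-M<..<M} x *\<^sub>R norm (\<kappa>0 x))"
        "integrable lebesgue (\<lambda>x. indicator {?u<..<?v} x *\<^sub>R norm (\<kappa>0 x))"
        using k0l unfolding loc_int_def
        by (subst lebesgue_on_integrable_iff[symmetric], simp, intro integrable_norm, simp)+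
      show "(LINT x|lebesgue_on {?u<..<?v}. norm (\<kappa>0 x)) \<le> (LINT x|lebesgue_on {-M<..<M}. norm (\<kappa>0 x))"
        unfolding lebesgue_on_integral_eq[OF lmeasurable_interval(2)[THEN fmeasurableD], unfolded box_real]
        using i(2) i(1)
      proof (rule integral_mono)
        fix x
        show "indicator {?u<..<?v} x *\<^sub>R norm (\<kappa>0 x) \<le> indicator {-M<..<M} x *\<^sub>R norm (\<kappa>0 x)"
        proof (cases "x \<in> {?u<..<?v}")
          case True
          then have "x \<in> {-M<..<M}" using sub by blast
          then show ?thesis using True by (simp only: indicator_simps)
        next
          case False
          then show ?thesis by (subst indicator_simps(2)) (assumption, simp)
        qed
      qed
    qed
    finally show ?thesis .
  qed
  have int: "integrable (Il l \<Otimes>\<^sub>M Il y) (\<lambda>(t, x). \<kappa>0 (a * x + b * t) * \<phi> t)"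
  proof (rule Fubini_integrable)
    show "(\<lambda>(t, x). \<kappa>0 (a * x + b * t) * \<phi> t) \<in> borel_measurable (Il l \<Otimes>\<^sub>M Il y)"
      unfolding case_prod_beta by measurable
    show "AE t in Il l. integrable (Il y) (\<lambda>x. case (t, x) of (t, x) \<Rightarrow> \<kappa>0 (a * x + b * t) * \<phi> t)"
    proof (rule AE_I2)
      fix t
      have "integrable (Il y) (\<lambda>x. \<kappa>0 (b * t + a * x))" by (rule integrable_affine(1)[OF k0l a])
      then have "integrable (Il y) (\<lambda>x. \<kappa>0 (b * t + a * x) * \<phi> t)" by (rule integrable_mult_left)
      then show "integrable (Il y) (\<lambda>x. case (t, x) of (t, x) \<Rightarrow> \<kappa>0 (a * x + b * t) * \<phi> t)"
        by (simp add: add.commute)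
    qed
    show "integrable (Il l) (\<lambda>t. LINT x|Il y. norm (case (t, x) of (t, x) \<Rightarrow> \<kappa>0 (a * x + b * t) * \<phi> t))"
    proof (rule Bochner_Integration.integrable_bound)
      show "integrable (Il l) (\<lambda>t. C / \<bar>a\<bar> * norm (\<phi> t))" using \<phi> by simp
      show "(\<lambda>t. LINT x|Il y. norm (case (t, x) of (t, x) \<Rightarrow> \<kappa>0 (a * x + b * t) * \<phi> t)) \<in> borel_measurable (Il l)"
        unfolding case_prod_beta by measurable
      show "AE t in Il l. norm (LINT x|Il y. norm (case (t, x) of (t, x) \<Rightarrow> \<kappa>0 (a * x + b * t) * \<phi> t)) \<le> norm (C / \<bar>a\<bar> * norm (\<phi> t))"
      proof (rule AE_I2)
        fix t assume "t \<in> space (Il l)"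
        then have t: "0 < t" "t < l" by auto
        have "(LINT x|Il y. norm (\<kappa>0 (a * x + b * t))) \<le> C / \<bar>a\<bar>"
          using bd[OF t] a by (simp add: field_simps add.commute)
        then have "(LINT x|Il y. norm (\<kappa>0 (a * x + b * t))) * norm (\<phi> t) \<le> C / \<bar>a\<bar> * norm (\<phi> t)"
          by (rule mult_right_mono) simp
        moreover have "(LINT x|Il y. norm (case (t, x) of (t, x) \<Rightarrow> \<kappa>0 (a * x + b * t) * \<phi> t))
            = (LINT x|Il y. norm (\<kappa>0 (a * x + b * t))) * norm (\<phi> t)"
          by (simp add: norm_mult)
        moreover have "0 \<le> (LINT x|Il y. norm (\<kappa>0 (a * x + b * t))) * norm (\<phi> t)" by simp
        ultimately show "norm (LINT x|Il y. norm (case (t, x) of (t, x) \<Rightarrow> \<kappa>0 (a * x + b * t) * \<phi> t)) \<le> norm (C / \<bar>a\<bar> * norm (\<phi> t))"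
          unfolding real_norm_def by linarith
      qed
    qed
  qed
  have eq1: "(LINT t|Il l. \<kappa> (a * x + b * t) * \<phi> t) = (LINT t|Il l. \<kappa>0 (a * x + b * t) * \<phi> t)" for x
  proof (rule integral_cong_AE)
    have "(\<lambda>t. \<kappa> (a * x + b * t)) \<in> borel_measurable (Il l)" "(\<lambda>t. \<kappa>0 (a * x + b * t)) \<in> borel_measurable (Il l)"
      by (rule borel_measurable_integrable, rule integrable_affine(1)[OF \<kappa> b],
          rule borel_measurable_integrable, rule integrable_affine(1)[OF k0l b])
    then show "(\<lambda>t. \<kappa> (a * x + b * t) * \<phi> t) \<in> borel_measurable (Il l)"
      "(\<lambda>t. \<kappa>0 (a * x + b * t) * \<phi> t) \<in> borel_measurable (Il l)" by measurable
    show "AE t in Il l. \<kappa> (a * x + b * t) * \<phi> t = \<kappa>0 (a * x + b * t) * \<phi> t"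
      unfolding AE_Il_iff using AE_affine[OF ae b, of "a * x"] by (rule eventually_mono) auto
  qed
  have eq2: "(LINT x|Il y. \<kappa> (a * x + b * t)) = (LINT x|Il y. \<kappa>0 (a * x + b * t))" for t
  proof (rule integral_cong_AE)
    show "(\<lambda>x. \<kappa> (a * x + b * t)) \<in> borel_measurable (Il y)" "(\<lambda>x. \<kappa>0 (a * x + b * t)) \<in> borel_measurable (Il y)"
      unfolding add.commute[of "a * _"]
      by (rule borel_measurable_integrable, rule integrable_affine(1)[OF \<kappa> a],
          rule borel_measurable_integrable, rule integrable_affine(1)[OF k0l a])
    show "AE x in Il y. \<kappa> (a * x + b * t) = \<kappa>0 (a * x + b * t)"
      unfolding AE_Il_iff using AE_affine[OF ae a, of "b * t"] by (rule eventually_mono) (auto simp: add.commute)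
  qed
  show "(LINT x|Il y. LINT t|Il l. \<kappa> (a * x + b * t) * \<phi> t) = (LINT t|Il l. \<phi> t * (LINT x|Il y. \<kappa> (a * x + b * t)))"
    unfolding eq1 eq2 using Fubini_integral[OF int] by (simp add: mult.commute)
  show "integrable (Il y) (\<lambda>x. LINT t|Il l. \<kappa> (a * x + b * t) * \<phi> t)"
    unfolding eq1 using integrable_snd[OF int] by simp
qed

section \<open>Restricting and cutting functions\<close>

definition clip :: "real \<Rightarrow> real \<Rightarrow> (real \<Rightarrow> 'b::zero) \<Rightarrow> real \<Rightarrow> 'b" where
  "clip a b f x = (if a < x \<and> x < b then f x else 0)"

lemma L2_restrict:
  assumes "f \<in> L2 l" "b \<le> l" shows "f \<in> L2 b"
proof -
  have "(\<lambda>x. if x \<in> {0<..<b} then f x else 0) \<in> borel_measurable lebesgue"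
  proof -
    have "(\<lambda>x. if x \<in> {0<..<l} then f x else 0) \<in> borel_measurable lebesgue"
      using assms by (intro borel_measurable_if_I L2_measurable) auto
    then have "(\<lambda>x. indicator {0<..<b} x *\<^sub>R (if x \<in> {0<..<l} then f x else 0)) \<in> borel_measurable lebesgue"
      by (intro borel_measurable_scaleR borel_measurable_indicator) auto
    then show ?thesis
      by (rule measurable_cong[THEN iffD1, rotated]) (use assms(2) in auto)
  qed
  then have "f \<in> borel_measurable (Il b)" by (rule borel_measurable_if_D)
  moreover have "integrable (Il b) (\<lambda>x. (norm (f x))\<^sup>2)"
  proof -
    have "(\<lambda>x. (norm (f x))\<^sup>2) absolutely_integrable_on {0..l}"
      using L2_integrable_sq[OF assms(1)] by (simp add: Ioo_integrable_iff)
    then have "(\<lambda>x. (norm (f x))\<^sup>2) absolutely_integrable_on {0..b}"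
      by (rule set_integrable_subset) (use assms in auto)
    then show ?thesis by (simp add: Ioo_integrable_iff)
  qed
  ultimately show ?thesis by (simp add: L2_iff)
qed

lemma L2_cut:
  assumes "f \<in> L2 b" "0 \<le> a" shows "clip a b f \<in> L2 l"
proof -
  have eq: "(\<lambda>x. if x \<in> {0<..<b} then clip a b f x else 0) = (\<lambda>x. indicator {a<..<b} x *\<^sub>R (if x \<in> {0<..<b} then f x else 0))"
    using assms(2) by (auto simp: clip_def fun_eq_iff)
  have "(\<lambda>x. if x \<in> {0<..<b} then f x else 0) \<in> borel_measurable lebesgue"
    using assms by (intro borel_measurable_if_I L2_measurable) auto
  then have m: "(\<lambda>x. indicator {a<..<b} x *\<^sub>R (if x \<in> {0<..<b} then f x else 0)) \<in> borel_measurable lebesgue"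
    by (intro borel_measurable_scaleR borel_measurable_indicator) auto
  have c: "clip a b f = (\<lambda>x. indicator {a<..<b} x *\<^sub>R (if x \<in> {0<..<b} then f x else 0))"
    using assms(2) by (auto simp: clip_def fun_eq_iff)
  then have m': "clip a b f \<in> borel_measurable lebesgue" using m by simp
  have "integrable lebesgue (\<lambda>x. indicator {0<..<b} x *\<^sub>R (norm (f x))\<^sup>2)"
    using L2_integrable_sq[OF assms(1)] by (subst (asm) lebesgue_on_integrable_iff) auto
  then have "integrable lebesgue (\<lambda>x. (norm (clip a b f x))\<^sup>2)"
  proof (rule Bochner_Integration.integrable_bound)
    show "(\<lambda>x. (norm (clip a b f x))\<^sup>2) \<in> borel_measurable lebesgue" using m' by measurable
  qed (use assms(2) in \<open>auto simp: clip_def indicator_def\<close>)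
  then have "integrable (Il l) (\<lambda>x. (norm (clip a b f x))\<^sup>2)"
    by (subst lebesgue_on_integrable_iff, simp) (rule integrable_mult_indicator, simp)
  then show ?thesis unfolding L2_iff using m' by (auto intro: measurable_restrict_space1)
qed

lemma integrable_Il_if:
  assumes "integrable (Il l) f" shows "integrable (Il l) (\<lambda>s. if s < b then f s else (0 :: 'b::euclidean_space))"
proof (rule Bochner_Integration.integrable_bound[OF assms])
  have [measurable]: "f \<in> borel_measurable (Il l)" using assms by simp
  show "(\<lambda>s. if s < b then f s else 0) \<in> borel_measurable (Il l)" by measurable
qed auto

text \<open>Inner products over (a, b) become differences of inner products over initial intervals,
  the only intervals on which the triangular operators obey identities.\<close>

lemma ip_cut:
  assumes "f \<in> L2 l" "g \<in> L2 l" "a \<le> b" "b \<le> l"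
  shows "L2_inner l f (clip a b g) = L2_inner b f g - L2_inner a f g"
proof -
  note i = integrable_hprod[OF assms(1,2)]
  have "L2_inner b f g - L2_inner a f g
      = (LINT s|Il l. (if s < b then hprod (f s) (g s) else 0) - (if s < a then hprod (f s) (g s) else 0))"
    unfolding L2_inner_eq using assms i
    by (subst (1 2) Il_sub_integral[of _ l]) (auto intro!: Bochner_Integration.integral_diff[symmetric] integrable_Il_if)
  also have "\<dots> = L2_inner l f (clip a b g)"
    unfolding L2_inner_eq
  proof (rule integral_cong_AE)
    show "AE s in Il l. (if s < b then hprod (f s) (g s) else 0) - (if s < a then hprod (f s) (g s) else 0) = hprod (f s) (clip a b g s)"
      using AE_Il_neq[of a] by (rule eventually_mono) (use assms(3) in \<open>auto simp: clip_def\<close>)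
    have [measurable]: "f \<in> borel_measurable (Il l)" "g \<in> borel_measurable (Il l)"
      using assms L2_measurable by auto
    have "(\<lambda>s. hprod (f s) (clip a b g s)) = (\<lambda>s. if a < s \<and> s < b then hprod (f s) (g s) else 0)"
      by (auto simp: clip_def)
    also have "\<dots> \<in> borel_measurable (Il l)" by measurable
    finally show "(\<lambda>s. hprod (f s) (clip a b g s)) \<in> borel_measurable (Il l)" .
  qed (use i integrable_Il_if[OF i] in \<open>auto intro!: borel_measurable_diff\<close>)
  finally show ?thesis ..
qed

lemma hprod_cut: "hprod (clip a b f x) (clip a b g x) = hprod (f x) (clip a b g x)"
  "hprod (clip a b f x) (g x) = hprod (f x) (clip a b g x)"
  by (auto simp: clip_def)

lemma ip_cut_left: "L2_inner l (clip a b f) g = L2_inner l f (clip a b g)"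
  and ip_cut_both: "L2_inner l (clip a b f) (clip a b g) = L2_inner l f (clip a b g)"
  unfolding L2_inner_eq by (simp only: hprod_cut(2), simp only: hprod_cut(1))

lemma L2_norm_cut_sq:
  assumes "f \<in> L2 l" "a \<le> b" "b \<le> l"
  shows "(L2_norm l (clip a b f))\<^sup>2 = (L2_norm b f)\<^sup>2 - (L2_norm a f)\<^sup>2"
proof -
  have "complex_of_real ((L2_norm l (clip a b f))\<^sup>2) = complex_of_real ((L2_norm b f)\<^sup>2 - (L2_norm a f)\<^sup>2)"
    using ip_cut[OF assms(1,1,2,3)] unfolding ip_self[symmetric] of_real_diff by (simp add: ip_cut_both)
  then show ?thesis by (simp only: of_real_eq_iff)
qed

lemma L2_norm_0 [simp]: "L2_norm 0 f = 0"
  by (simp add: L2_norm_def)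

lemma L2_norm_cut_0:
  assumes "f \<in> L2 l" "0 \<le> b" "b \<le> l" shows "L2_norm l (clip 0 b f) = L2_norm b f"
  using L2_norm_cut_sq[OF assms] by (intro power2_eq_imp_eq[of "L2_norm l (clip 0 b f)"]) auto

lemma L2_norm_mono:
  assumes "f \<in> L2 l" "b \<le> l" shows "L2_norm b f \<le> L2_norm l f"
proof -
  have "0 \<le> (L2_norm l (clip b l f))\<^sup>2" by simp
  then have "(L2_norm b f)\<^sup>2 \<le> (L2_norm l f)\<^sup>2" using L2_norm_cut_sq[OF assms(1), of b l] assms(2) by simp
  then show ?thesis by (rule power2_le_imp_le) simp
qed

lemma ae_eq_mono: "ae_eq l f g \<Longrightarrow> b \<le> l \<Longrightarrow> ae_eq b f g"
  unfolding ae_eq_def by (rule AE_Il_mono)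

lemma ae_eqI: "(\<And>x. 0 < x \<Longrightarrow> x < l \<Longrightarrow> f x = g x) \<Longrightarrow> ae_eq l f g"
  unfolding ae_eq_def by (rule AE_I2) auto

lemma continuous_on_Il_integral:
  fixes f :: "real \<Rightarrow> 'b::euclidean_space"
  assumes "integrable (Il l) f"
  shows "continuous_on {0..l} (\<lambda>x. LINT t|Il x. f t)"
proof -
  have i: "f absolutely_integrable_on {0..l}" using assms by (simp add: Ioo_integrable_iff)
  have "continuous_on {0..l} (\<lambda>x. integral {0..x} f)"
    by (rule indefinite_integral_continuous_1) (use i set_lebesgue_integral_eq_integral(1) in auto)
  then show ?thesis
  proof (rule continuous_on_eq)
    fix x assume x: "x \<in> {0..l}"
    have "f absolutely_integrable_on {0..x}" using i by (rule set_integrable_subset) (use x in auto)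
    then show "integral {0..x} f = (LINT t|Il x. f t)"
      by (intro Ioo_integral[symmetric]) (simp add: Ioo_integrable_iff)
  qed
qed

lemma continuous_on_ip:
  assumes "f \<in> L2 l" "g \<in> L2 l" shows "continuous_on {0..l} (\<lambda>x. L2_inner x f g)"
  unfolding L2_inner_eq by (intro continuous_on_Il_integral integrable_hprod assms)

lemma continuous_on_L2_norm_sq:
  assumes "f \<in> L2 l" shows "continuous_on {0..l} (\<lambda>x. (L2_norm x f)\<^sup>2)"
  unfolding L2_norm_sq by (intro continuous_on_Il_integral L2_integrable_sq assms)

lemma borel_measurable_Il_continuous:
  fixes c :: "real \<Rightarrow> 'b::euclidean_space"
  assumes "continuous_on {0..l} c" shows "c \<in> borel_measurable (Il l)"
proof -
  have "continuous_on {0<..<l} c" using assms by (rule continuous_on_subset) auto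
  then show ?thesis by (rule continuous_imp_measurable_on_sets_lebesgue) simp
qed

lemma L2_bounded_smult:
  assumes "c \<in> borel_measurable (Il l)" "\<And>x. 0 < x \<Longrightarrow> x < l \<Longrightarrow> cmod (c x) \<le> C" "f \<in> L2 l"
  shows "(\<lambda>x. c x *s f x) \<in> L2 l"
    and "L2_norm l (\<lambda>x. c x *s f x) \<le> \<bar>C\<bar> * L2_norm l f"
proof -
  have b: "(norm (c x *s f x))\<^sup>2 \<le> C\<^sup>2 * (norm (f x))\<^sup>2" if "0 < x" "x < l" for x
  proof -
    have "(cmod (c x))\<^sup>2 \<le> C\<^sup>2" using assms(2)[OF that] by (intro power_mono) auto
    then show ?thesis by (simp add: norm_smult power_mult_distrib mult_right_mono)
  qed
  have i: "integrable (Il l) (\<lambda>x. C\<^sup>2 * (norm (f x))\<^sup>2)" using assms(3) by (simp add: L2_integrable_sq)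
  show 1: "(\<lambda>x. c x *s f x) \<in> L2 l"
    by (rule L2_bound[OF _ i]) (use assms L2_measurable b in \<open>auto intro!: AE_I2 borel_measurable_smult\<close>)
  have "(L2_norm l (\<lambda>x. c x *s f x))\<^sup>2 \<le> (LINT x|Il l. C\<^sup>2 * (norm (f x))\<^sup>2)"
    unfolding L2_norm_sq by (rule integral_mono[OF L2_integrable_sq[OF 1] i]) (use b in auto)
  also have "\<dots> = (\<bar>C\<bar> * L2_norm l f)\<^sup>2"
    by (simp add: L2_norm_sq power_mult_distrib)
  finally show "L2_norm l (\<lambda>x. c x *s f x) \<le> \<bar>C\<bar> * L2_norm l f"
    by (rule power2_le_imp_le) simp
qed

lemma L2_continuous_smult:
  assumes "continuous_on {0..l} c" "f \<in> L2 l"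
  shows "(\<lambda>x. c x *s f x) \<in> L2 l"
proof -
  obtain C where "\<forall>y\<in>c ` {0..l}. cmod y \<le> C"
    using compact_imp_bounded[OF compact_continuous_image[OF assms(1) compact_Icc]] unfolding bounded_iff by blast
  then show ?thesis using assms by (intro L2_bounded_smult(1)[of c l C] borel_measurable_Il_continuous) auto
qed

lemma L2_norm_sum_le:
  assumes "finite I" "\<And>i. i \<in> I \<Longrightarrow> f i \<in> L2 l"
  shows "L2_norm l (\<lambda>x. \<Sum>i\<in>I. f i x) \<le> (\<Sum>i\<in>I. L2_norm l (f i))"
  using assms
proof (induction I)
  case empty
  then show ?case by (simp add: L2_norm_def)
next
  case (insert i I)
  have "L2_norm l (\<lambda>x. f i x + (\<Sum>i\<in>I. f i x)) \<le> L2_norm l (f i) + L2_norm l (\<lambda>x. \<Sum>i\<in>I. f i x)"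
    using insert by (intro L2_norm_triangle L2_sum) auto
  then show ?case using insert by simp
qed

section \<open>The integration operator and bounded operators\<close>

definition A_op :: "real^'p \<Rightarrow> ('p::finite) vfun \<Rightarrow> 'p vfun" where
  "A_op d f x = (\<chi> i. \<i> * complex_of_real (d $ i) * (LINT t|Il x. f t $ i))"

lemma L2_component_integrable: "f \<in> L2 l \<Longrightarrow> x \<le> l \<Longrightarrow> integrable (Il x) (\<lambda>t. f t $ i)"
  by (rule integrable_vec_nth, rule L2_integrable, rule L2_restrict)

lemma A_op_L2:
  assumes "f \<in> L2 l" shows "A_op d f \<in> L2 l"
proof -
  have c: "continuous_on {0..l} (A_op d f)"
    unfolding A_op_def
    by (intro continuous_intros continuous_on_vec_lambda continuous_on_Il_integral integrable_vec_nth L2_integrable assms)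
  obtain C where "\<forall>y\<in>A_op d f ` {0..l}. norm y \<le> C"
    using compact_imp_bounded[OF compact_continuous_image[OF c compact_Icc]] unfolding bounded_iff by blast
  then show ?thesis
    by (intro L2_bound[of _ _ "\<lambda>x. C\<^sup>2"] borel_measurable_Il_continuous c finite_measure.integrable_const finite_measure_Il AE_I2 power_mono) auto
qed

lemma A_op_add: "f \<in> L2 l \<Longrightarrow> g \<in> L2 l \<Longrightarrow> x \<le> l \<Longrightarrow> A_op d (\<lambda>x. f x + g x) x = A_op d f x + A_op d g x"
  and A_op_diff: "f \<in> L2 l \<Longrightarrow> g \<in> L2 l \<Longrightarrow> x \<le> l \<Longrightarrow> A_op d (\<lambda>x. f x - g x) x = A_op d f x - A_op d g x"
  and A_op_smult: "A_op d (\<lambda>x. c *s f x) x = c *s A_op d f x"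
  by (simp_all add: A_op_def vec_eq_iff L2_component_integrable algebra_simps)

lemma A_op_cong:
  assumes "f \<in> L2 l" "g \<in> L2 l" "ae_eq l f g" "x \<le> l"
  shows "A_op d f x = A_op d g x"
proof -
  have "(LINT t|Il x. f t $ i) = (LINT t|Il x. g t $ i)" for i
  proof (rule integral_cong_AE)
    show "AE t in Il x. f t $ i = g t $ i"
      using ae_eq_mono[OF assms(3,4)] unfolding ae_eq_def by (rule eventually_mono) simp
  qed (use assms in \<open>auto intro!: borel_measurable_integrable L2_component_integrable\<close>)
  then show ?thesis by (simp add: A_op_def)
qed

lemma L2_norm_const_sq: "0 \<le> l \<Longrightarrow> (L2_norm l (\<lambda>x. c))\<^sup>2 = l * (norm c)\<^sup>2"
  unfolding L2_norm_sq by (simp add: measure_restrict_space)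

lemma norm_axis_complex: "norm (axis i c :: complex^'p::finite) = cmod c"
proof -
  have "(norm (axis i c :: complex^'p))\<^sup>2 = (cmod c)\<^sup>2"
    unfolding norm_vec_sq by (simp add: axis_def if_distrib[of "\<lambda>x. (cmod x)\<^sup>2"] cong: if_cong)
  then show ?thesis by (simp add: power2_eq_iff_nonneg)
qed

text \<open>Because f starts at a, Cauchy-Schwarz over (a, b) gives a pointwise bound with the
  factor sqrt (b - a), and the L^2 norm over (a, b) contributes a second such factor.\<close>

lemma A_op_small:
  assumes f: "f \<in> L2 b" and z: "ae_eq a f (\<lambda>x. 0)" and ab: "0 \<le> a" "a \<le> b"
  shows "L2_norm b (A_op d f) \<le> (\<Sum>i\<in>UNIV. \<bar>d $ i\<bar>) * (b - a) * L2_norm b f"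
proof -
  define D where "D = (\<Sum>i\<in>UNIV. \<bar>d $ i\<bar>)"
  have A0: "A_op d f x = 0" if "x \<le> a" for x
    using A_op_cong[OF L2_restrict[OF f ab(2)] L2_zero z that, of d] by (simp add: A_op_def vec_eq_iff)
  have cmp: "cmod (LINT t|Il x. f t $ i) \<le> sqrt (b - a) * L2_norm b f" if x: "0 < x" "x < b" for x i
  proof -
    let ?e = "\<lambda>_::real. axis i (1::complex) :: complex^'a"
    have e: "?e \<in> L2 l" for l by (rule L2_const)
    have fx: "f \<in> L2 x" using x by (intro L2_restrict[OF f]) simp
    have "(LINT t|Il x. f t $ i) = L2_inner x f ?e"
      by (simp add: L2_inner_eq hprod_def axis_def if_distrib[of cnj] mult.commute[of "_ $ _"] if_distrib[of "\<lambda>c. c * _"] cong: if_cong)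
    also have "\<dots> = L2_inner x f (clip a b ?e)"
      unfolding L2_inner_eq
    proof (rule integral_cong_AE)
      have "AE t in Il x. t < a \<longrightarrow> f t = 0"
        using z unfolding ae_eq_def AE_Il_iff by (rule eventually_mono) auto
      then show "AE t in Il x. hprod (f t) (?e t) = hprod (f t) (clip a b ?e t)"
        using AE_Il_neq[of a] AE_space by eventually_elim (use x in \<open>auto simp: clip_def\<close>)
    qed (use fx e ab in \<open>auto intro!: borel_measurable_integrable integrable_hprod L2_cut\<close>)
    finally have "cmod (LINT t|Il x. f t $ i) \<le> L2_norm x f * L2_norm x (clip a b ?e)"
      using ip_Cauchy_Schwarz[OF fx L2_cut[OF e]] ab by simp
    also have "\<dots> \<le> L2_norm b f * L2_norm b (clip a b ?e)"
      using x f e ab by (intro mult_mono L2_norm_mono L2_cut) auto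
    also have "L2_norm b (clip a b ?e) = sqrt (b - a)"
    proof -
      have "(L2_norm b (clip a b ?e))\<^sup>2 = b - a"
        using L2_norm_cut_sq[OF e ab(2) order_refl] ab by (simp add: L2_norm_const_sq norm_axis_complex)
      then show ?thesis by (metis L2_norm_nonneg real_sqrt_unique)
    qed
    finally show ?thesis by (simp add: mult.commute)
  qed
  have pw: "norm (A_op d f x) \<le> D * (sqrt (b - a) * L2_norm b f)" if x: "0 < x" "x < b" for x
  proof -
    have "norm (A_op d f x) \<le> (\<Sum>i\<in>UNIV. norm (A_op d f x $ i))"
      unfolding norm_vec_def by (rule L2_set_le_sum) simp
    also have "\<dots> \<le> (\<Sum>i\<in>UNIV. \<bar>d $ i\<bar> * (sqrt (b - a) * L2_norm b f))"
      using cmp[OF x] by (intro sum_mono) (simp add: A_op_def norm_mult mult_left_mono)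
    also have "\<dots> = D * (sqrt (b - a) * L2_norm b f)" by (simp add: D_def sum_distrib_right)
    finally show ?thesis .
  qed
  have AL: "A_op d f \<in> L2 b" using f by (rule A_op_L2)
  have "L2_norm b (A_op d f) = L2_norm b (clip a b (A_op d f))"
  proof (rule L2_norm_cong[OF AL L2_cut[OF AL ab(1)]])
    show "ae_eq b (A_op d f) (clip a b (A_op d f))"
      by (rule ae_eqI) (use A0 in \<open>auto simp: clip_def not_less\<close>)
  qed
  also have "(\<dots>)\<^sup>2 \<le> (D * (b - a) * L2_norm b f)\<^sup>2"
  proof -
    let ?K = "D * (sqrt (b - a) * L2_norm b f)"
    \<comment> \<open>A constant vector, in an arbitrary coordinate, whose norm is the pointwise
      bound; its cut to (a, b) majorizes that of \<open>A_op d f\<close>.\<close>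
    define v where "v = (axis undefined (complex_of_real ?K) :: complex^'a)"
    have nv: "norm v = \<bar>?K\<bar>" unfolding v_def norm_axis_complex norm_of_real ..
    have "(L2_norm b (clip a b (A_op d f)))\<^sup>2 = (LINT x|Il b. (norm (clip a b (A_op d f) x))\<^sup>2)" by (rule L2_norm_sq)
    also have "\<dots> \<le> (LINT x|Il b. (norm (clip a b (\<lambda>x. v) x))\<^sup>2)"
    proof (rule integral_mono)
      show "integrable (Il b) (\<lambda>x. (norm (clip a b (A_op d f) x))\<^sup>2)"
        by (intro L2_integrable_sq L2_cut AL ab)
      show "integrable (Il b) (\<lambda>x. (norm (clip a b (\<lambda>x. v) x))\<^sup>2)"
        by (intro L2_integrable_sq L2_cut L2_const ab)
      fix x assume "x \<in> space (Il b)"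
      then have x: "0 < x" "x < b" by auto
      show "(norm (clip a b (A_op d f) x))\<^sup>2 \<le> (norm (clip a b (\<lambda>x. v) x))\<^sup>2"
        using pw[OF x] by (auto simp: clip_def nv intro!: power_mono)
    qed
    also have "\<dots> = (b - a) * ?K\<^sup>2"
      using L2_norm_cut_sq[OF L2_const ab(2) order_refl, of v] ab
      unfolding L2_norm_sq[symmetric] by (simp add: L2_norm_const_sq nv left_diff_distrib)
    also have "\<dots> = (D * (b - a) * L2_norm b f)\<^sup>2"
      using ab by (simp add: power_mult_distrib power2_eq_square[of "b - a"])
    finally show ?thesis .
  qed
  finally show ?thesis
    unfolding D_def by (rule power2_le_imp_le) (use ab in \<open>auto intro!: mult_nonneg_nonneg sum_nonneg\<close>)
qed

section \<open>Bounded operators on representatives and Hilbert-Schmidt kernels\<close>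

lemma bounded_opD:
  assumes "bounded_op l T"
  shows "f \<in> L2 l \<Longrightarrow> T f \<in> L2 l"
    and "f \<in> L2 l \<Longrightarrow> g \<in> L2 l \<Longrightarrow> ae_eq l (T (\<lambda>x. f x + g x)) (\<lambda>x. T f x + T g x)"
    and "f \<in> L2 l \<Longrightarrow> ae_eq l (T (\<lambda>x. c *s f x)) (\<lambda>x. c *s T f x)"
    and "\<exists>C\<ge>0. \<forall>f\<in>L2 l. L2_norm l (T f) \<le> C * L2_norm l f"
proof -
  obtain C where "\<forall>f\<in>L2 l. L2_norm l (T f) \<le> C * L2_norm l f"
    using assms by (auto simp: bounded_op_def)
  then have "\<forall>f\<in>L2 l. L2_norm l (T f) \<le> max C 0 * L2_norm l f"
    by (meson L2_norm_nonneg max.cobounded1 mult_right_mono order_trans)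
  then show "\<exists>C\<ge>0. \<forall>f\<in>L2 l. L2_norm l (T f) \<le> C * L2_norm l f" by (intro exI[of _ "max C 0"]) auto
qed (use assms in \<open>auto simp: bounded_op_def\<close>)

lemma bounded_op_diff:
  assumes T: "bounded_op l T" and "f \<in> L2 l" "g \<in> L2 l"
  shows "ae_eq l (T (\<lambda>x. f x - g x)) (\<lambda>x. T f x - T g x)"
proof -
  have e: "(\<lambda>x. f x - g x) = (\<lambda>x. f x + (-1) *s g x)" by (simp add: fun_eq_iff vec_eq_iff)
  have "ae_eq l (T (\<lambda>x. f x - g x)) (\<lambda>x. T f x + T (\<lambda>x. (-1) *s g x) x)"
    unfolding e by (intro bounded_opD(2)[OF T] assms L2_smult)
  also have "ae_eq l \<dots> (\<lambda>x. T f x + (-1) *s T g x)"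
    by (intro ae_eq_add ae_eq_refl bounded_opD(3)[OF T] assms)
  finally (ae_eq_trans) show ?thesis by (simp add: vec_eq_iff ae_eq_def)
qed

text \<open>Operators act on representatives. A function of norm zero has an image of norm zero, and
  with linearity this makes the operator well defined on almost everywhere classes.\<close>

lemma bounded_op_cong:
  assumes T: "bounded_op l T" and fg: "f \<in> L2 l" "g \<in> L2 l" "ae_eq l f g"
  shows "ae_eq l (T f) (T g)"
proof -
  have d: "(\<lambda>x. f x - g x) \<in> L2 l" using fg by (intro L2_diff)
  have "ae_eq l (\<lambda>x. f x - g x) (\<lambda>x. 0)"
    using fg(3) unfolding ae_eq_def by (rule eventually_mono) simp
  then have "L2_norm l (\<lambda>x. f x - g x) = 0" using L2_norm_zero_iff[OF d] by simp
  then have "L2_norm l (T (\<lambda>x. f x - g x)) \<le> 0"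
    using bounded_opD(4)[OF T] d by auto
  then have "ae_eq l (T (\<lambda>x. f x - g x)) (\<lambda>x. 0)"
    using L2_norm_zero_iff[OF bounded_opD(1)[OF T d]] L2_norm_nonneg order_antisym by blast
  then have "ae_eq l (\<lambda>x. T f x - T g x) (\<lambda>x. 0)"
    using bounded_op_diff[OF T fg(1,2)] ae_eq_sym ae_eq_trans by blast
  then show ?thesis unfolding ae_eq_def by (rule eventually_mono) simp
qed

lemma bounded_op_zero:
  assumes T: "bounded_op l T" shows "ae_eq l (T (\<lambda>x. 0)) (\<lambda>x. 0)"
  using bounded_opD(3)[OF T L2_zero, of 0] by simp

lemma bounded_op_sum:
  assumes T: "bounded_op l T" and "finite I" "\<And>i. i \<in> I \<Longrightarrow> f i \<in> L2 l"
  shows "ae_eq l (T (\<lambda>x. \<Sum>i\<in>I. f i x)) (\<lambda>x. \<Sum>i\<in>I. T (f i) x)"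
  using assms(2,3)
proof (induction I)
  case empty
  then show ?case using bounded_op_zero[OF T] by simp
next
  case (insert i I)
  have "ae_eq l (T (\<lambda>x. f i x + (\<Sum>i\<in>I. f i x))) (\<lambda>x. T (f i) x + T (\<lambda>x. \<Sum>i\<in>I. f i x) x)"
    using insert by (intro bounded_opD(2)[OF T] L2_sum) auto
  also have "ae_eq l \<dots> (\<lambda>x. T (f i) x + (\<Sum>i\<in>I. T (f i) x))"
    using insert by (intro ae_eq_add ae_eq_refl) auto
  finally (ae_eq_trans) show ?case using insert by simp
qed

text \<open>Scalars are regarded as vectors of length one, so the inequality for vector functions
  applies.\<close>

lemma real_Cauchy_Schwarz:
  fixes u v :: "real \<Rightarrow> real"
  assumes "u \<in> borel_measurable (Il l)" "integrable (Il l) (\<lambda>x. (u x)\<^sup>2)"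
    and "v \<in> borel_measurable (Il l)" "integrable (Il l) (\<lambda>x. (v x)\<^sup>2)"
  shows "integrable (Il l) (\<lambda>x. u x * v x)"
    and "\<bar>LINT x|Il l. u x * v x\<bar> \<le> sqrt (LINT x|Il l. (u x)\<^sup>2) * sqrt (LINT x|Il l. (v x)\<^sup>2)"
proof -
  define e where "e w = (\<lambda>x. axis 1 (complex_of_real (w x)) :: complex^1)" for w :: "real \<Rightarrow> real"
  have h: "hprod (e u x) (e v x) = complex_of_real (u x * v x)" for u v x
    by (simp add: e_def hprod_def axis_def)
  have n: "norm (e w x) = \<bar>w x\<bar>" for w x unfolding e_def norm_axis_complex by simp
  have L: "e w \<in> L2 l" if "w \<in> borel_measurable (Il l)" "integrable (Il l) (\<lambda>x. (w x)\<^sup>2)" for w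
  proof -
    have "e w \<in> borel_measurable (Il l)"
      using that(1) by (intro borel_measurable_vecI) (simp add: e_def axis_def)
    moreover have "integrable (Il l) (\<lambda>x. (norm (e w x))\<^sup>2)" using that(2) by (simp add: n)
    ultimately show ?thesis by (simp add: L2_iff)
  qed
  have N: "L2_norm l (e w) = sqrt (LINT x|Il l. (w x)\<^sup>2)" for w
    by (simp add: L2_norm_def n)
  have "integrable (Il l) (\<lambda>x. complex_of_real (u x * v x))"
    using integrable_hprod[OF L L, OF assms] by (simp only: h)
  then show "integrable (Il l) (\<lambda>x. u x * v x)" by (simp only: complex_of_real_integrable_eq)
  have "L2_inner l (e u) (e v) = complex_of_real (LINT x|Il l. u x * v x)"
    unfolding L2_inner_eq h by (rule integral_complex_of_real)
  then show "\<bar>LINT x|Il l. u x * v x\<bar> \<le> sqrt (LINT x|Il l. (u x)\<^sup>2) * sqrt (LINT x|Il l. (v x)\<^sup>2)"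
    using ip_Cauchy_Schwarz[OF L L, OF assms] by (simp only: N norm_of_real)
qed

lemma borel_measurable_Il_borel: "f \<in> borel_measurable borel \<Longrightarrow> f \<in> borel_measurable (lebesgue_on S)"
  by (intro measurable_restrict_space1 measurable_completion) simp

lemma norm_matrix_vector_mult_le: "norm (A *v v) \<le> norm A * norm v" for A :: "complex^'p::finite^'q::finite"
proof -
  have "cmod ((A *v v) $ i) \<le> norm (A $ i) * norm v" for i
  proof -
    have "cmod ((A *v v) $ i) \<le> (\<Sum>j\<in>UNIV. norm (A $ i $ j) * norm (v $ j))"
      unfolding matrix_vector_mult_def by (simp add: norm_mult order_trans[OF norm_sum])
    also have "\<dots> \<le> norm (A $ i) * norm v"
      unfolding norm_vec_def using L2_set_mult_ineq[of "\<lambda>j. norm (A $ i $ j)" "\<lambda>j. norm (v $ j)" UNIV] by simp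
    finally show ?thesis .
  qed
  then have "norm (A *v v) \<le> L2_set (\<lambda>i. norm (A $ i) * norm v) UNIV"
    unfolding norm_vec_def[of "A *v v"] by (intro L2_set_mono) auto
  also have "\<dots> = norm A * norm v"
    by (simp add: norm_vec_def[of A] L2_set_left_distrib)
  finally show ?thesis .
qed

text \<open>The weight a(x) is, up to null sets, the squared L^2 norm of t \<mapsto> E(x, t). Unlike
  an operator norm, its integral becomes small over short intervals, which is what a stepwise
  Volterra argument exploits.\<close>

lemma Hilbert_Schmidt_bound:
  fixes E :: "real \<Rightarrow> real \<Rightarrow> complex^'p::finite^'p"
  assumes HS: "sq_integrable_on (\<lambda>(x, t). E x t) {(x, t). 0 < t \<and> t < x \<and> x < l}"
  obtains a :: "real \<Rightarrow> real" where "integrable (Il l) a" "\<And>x. 0 \<le> a x"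
    "\<And>g. g \<in> L2 l \<Longrightarrow> AE x in Il l. (norm (E_op E g x - g x))\<^sup>2 \<le> a x * (L2_norm l g)\<^sup>2"
proof -
  define D where "D = {(x, t). 0 < t \<and> t < x \<and> x < l}"
  have "D = {p. 0 < snd p} \<inter> {p. snd p < fst p} \<inter> {p. fst p < l}" by (auto simp: D_def)
  moreover have "open \<dots>" by (intro open_Int open_Collect_less continuous_intros)
  ultimately have D: "D \<in> sets lebesgue" by auto
  define G where "G p = indicator D p *\<^sub>R (norm (case p of (x, t) \<Rightarrow> E x t))\<^sup>2" for p
  have G: "integrable lebesgue G"
    using HS unfolding sq_integrable_on_def D_def[symmetric] G_def
    by (subst lebesgue_on_integrable_iff[OF D, symmetric]) auto
  \<comment> \<open>Fubini is applied to Borel measure on the plane, so the squared norm of the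
    kernel is first replaced by a nonnegative Borel function \<open>G0\<close>; almost every slice
    of the two agrees almost everywhere.\<close>
  then obtain G1 where G1: "G1 \<in> borel_measurable lborel" "AE p in lborel. G p = G1 p"
    using completion_ex_borel_measurable_real[of G lborel] by auto
  define G0 where "G0 p = \<bar>G1 p\<bar>" for p
  have G0m: "G0 \<in> borel_measurable borel" using G1 unfolding G0_def by measurable
  have G0G: "AE p in lborel. G p = G0 p"
    using G1(2)
  proof (rule eventually_mono)
    fix p assume "G p = G1 p"
    moreover have "0 \<le> G p" by (simp add: G_def)
    ultimately show "G p = G0 p" by (simp add: G0_def)
  qed
  have G0i: "integrable lborel G0"
  proof -
    have "integrable lebesgue G0"
    proof (rule integrable_cong_AE_imp[OF G])
      show "G0 \<in> borel_measurable lebesgue" using G0m by (intro measurable_completion) simp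
      show "AE p in lebesgue. G p = G0 p" using G0G by (rule AE_completion)
    qed
    then show ?thesis using G0m integrable_completion[of G0 lborel] by simp
  qed
  then have G0i': "integrable (lborel \<Otimes>\<^sub>M lborel) G0" by (simp add: lborel_prod)
  define a where "a x = (LINT t|lborel. G0 (x, t))" for x
  have a_int: "integrable lborel a"
    unfolding a_def using lborel_pair.integrable_fst[of "\<lambda>x t. G0 (x, t)"] G0i' by simp
  have a0: "0 \<le> a x" for x unfolding a_def G0_def by simp
  have G0m2: "(\<lambda>t. G0 (x, t)) \<in> borel_measurable borel" for x
    using G0m by (rule measurable_compose[rotated]) (auto simp flip: borel_prod)
  have "AE x in lborel. integrable lborel (\<lambda>t. G0 (x, t))"
    using lborel_pair.AE_integrable_fst[of "\<lambda>x t. G0 (x, t)"] G0i' by simp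
  moreover have "AE x in lborel. AE t in lborel. G (x, t) = G0 (x, t)"
  proof (rule lborel_pair.AE_pair)
    show "AE p in lborel \<Otimes>\<^sub>M lborel. G p = G0 p" unfolding lborel_prod by (rule G0G)
  qed
  ultimately have slice: "AE x in lborel. integrable lborel (\<lambda>t. G0 (x, t)) \<and> (AE t in lborel. G (x, t) = G0 (x, t))"
    by eventually_elim simp
  show thesis
  proof (rule that)
    have "integrable lebesgue a" using a_int by (rule integrable_completion[THEN iffD2, rotated]) (use a_int in auto)
    then show "integrable (Il l) a"
      by (subst lebesgue_on_integrable_iff, simp) (rule integrable_mult_indicator, simp)
    show "0 \<le> a x" for x by (rule a0)
    fix g :: "'p vfun" assume g: "g \<in> L2 l"
    have "AE x in lebesgue. integrable lborel (\<lambda>t. G0 (x, t)) \<and> (AE t in lborel. G (x, t) = G0 (x, t))"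
      using slice by (rule AE_completion)
    then have "AE x in Il l. integrable lborel (\<lambda>t. G0 (x, t)) \<and> (AE t in lborel. G (x, t) = G0 (x, t))"
      unfolding AE_Il_iff by (rule eventually_mono) auto
    then show "AE x in Il l. (norm (E_op E g x - g x))\<^sup>2 \<le> a x * (L2_norm l g)\<^sup>2"
    proof (rule AE_mp, intro AE_I2 impI)
      fix x assume "x \<in> space (Il l)" and sl: "integrable lborel (\<lambda>t. G0 (x, t)) \<and> (AE t in lborel. G (x, t) = G0 (x, t))"
      then have x: "0 < x" "x < l" by auto
      define u where "u t = sqrt (G0 (x, t))" for t
      have um: "u \<in> borel_measurable (Il l)"
        unfolding u_def by (intro borel_measurable_Il_borel
          borel_measurable_continuous_on[where f=sqrt, OF continuous_on_real_sqrt[OF continuous_on_id] G0m2])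
      have u2: "(u t)\<^sup>2 = G0 (x, t)" for t by (simp add: u_def G0_def)
      have "integrable lebesgue (\<lambda>t. G0 (x, t))" using sl G0m2[of x] by (simp add: integrable_completion)
      then have ui: "integrable (Il l) (\<lambda>t. (u t)\<^sup>2)"
        unfolding u2 by (subst lebesgue_on_integrable_iff, simp) (rule integrable_mult_indicator, simp)
      have ua: "(LINT t|Il l. (u t)\<^sup>2) \<le> a x"
      proof -
        have "(LINT t|Il l. (u t)\<^sup>2) = (LINT t|lebesgue. indicator {0<..<l} t *\<^sub>R G0 (x, t))"
          unfolding u2 by (rule lebesgue_on_integral_eq) simp
        also have "\<dots> \<le> (LINT t|lebesgue. G0 (x, t))"
          using \<open>integrable lebesgue (\<lambda>t. G0 (x, t))\<close>
          by (intro integral_mono integrable_mult_indicator) (auto simp: indicator_def G0_def)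
        also have "\<dots> = a x" unfolding a_def using G0m2[of x] by (intro integral_completion) simp
        finally show ?thesis .
      qed
      have "AE t in lebesgue. G (x, t) = G0 (x, t)" using sl AE_completion by blast
      then have uE: "AE t in Il x. norm (E x t) = u t"
        unfolding AE_Il_iff
        by (rule eventually_mono) (use x in \<open>auto simp: u_def G_def D_def real_sqrt_unique\<close>)
      have gx: "g \<in> L2 x" using L2_restrict[OF g] x by simp
      have eq: "E_op E g x - g x = (LINT t|Il x. E x t *v g t)"
        unfolding E_op_def set_lebesgue_integral_def by (subst lebesgue_on_integral_eq) auto
      have umx: "u \<in> borel_measurable (Il x)"
        unfolding u_def by (intro borel_measurable_Il_borel
          borel_measurable_continuous_on[where f=sqrt, OF continuous_on_real_sqrt[OF continuous_on_id] G0m2])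
      have uix: "integrable (Il x) (\<lambda>t. (u t)\<^sup>2)"
        unfolding u2 using \<open>integrable lebesgue (\<lambda>t. G0 (x, t))\<close>
        by (subst lebesgue_on_integrable_iff, simp) (rule integrable_mult_indicator, simp)
      have gm: "(\<lambda>t. norm (g t)) \<in> borel_measurable (Il x)" using L2_measurable[OF gx] by measurable
      note CS = real_Cauchy_Schwarz[OF umx uix gm L2_integrable_sq[OF gx]]
      have "norm (E_op E g x - g x) \<le> (LINT t|Il x. u t * norm (g t))"
      proof (cases "integrable (Il x) (\<lambda>t. E x t *v g t)")
        case True
        have "norm (LINT t|Il x. E x t *v g t) \<le> (LINT t|Il x. norm (E x t *v g t))" by (rule integral_norm_bound)
        also have "\<dots> \<le> (LINT t|Il x. u t * norm (g t))"
        proof (rule integral_mono_AE)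
          show "AE t in Il x. norm (E x t *v g t) \<le> u t * norm (g t)"
            using uE by (rule eventually_mono) (metis norm_matrix_vector_mult_le)
        qed (use True CS in auto)
        finally show ?thesis by (simp only: eq)
      next
        \<comment> \<open>A non-integrable integrand gives the integral the default value 0, so the
          estimate holds at such x as well.\<close>
        case False
        then have "E_op E g x - g x = 0" unfolding eq by (rule not_integrable_integral_eq)
        then show ?thesis by (simp add: u_def G0_def)
      qed
      also have "\<dots> \<le> sqrt (LINT t|Il x. (u t)\<^sup>2) * sqrt (LINT t|Il x. (norm (g t))\<^sup>2)"
        using CS(2) by linarith
      also have "\<dots> \<le> sqrt (a x) * L2_norm l g"
      proof (intro mult_mono)
        have "(LINT t|Il x. (u t)\<^sup>2) \<le> (LINT t|Il l. (u t)\<^sup>2)"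
          using x by (subst Il_sub_integral[of x l]) (auto intro!: integral_mono integrable_Il_if ui)
        then show "sqrt (LINT t|Il x. (u t)\<^sup>2) \<le> sqrt (a x)" using ua by simp
        show "sqrt (LINT t|Il x. (norm (g t))\<^sup>2) \<le> L2_norm l g"
          using L2_norm_mono[OF g, of x] x by (simp add: L2_norm_def)
      qed (simp_all add: a0)
      finally have "(norm (E_op E g x - g x))\<^sup>2 \<le> (sqrt (a x) * L2_norm l g)\<^sup>2" by (intro power_mono) auto
      then show "(norm (E_op E g x - g x))\<^sup>2 \<le> a x * (L2_norm l g)\<^sup>2"
        using a0[of x] by (simp add: power_mult_distrib)
    qed
  qed
qed

section \<open>Triangular factorization\<close>

lemma uniform_partition:
  assumes "continuous_on {0..l} (\<alpha> :: real \<Rightarrow> real)" "0 < (\<epsilon> :: real)"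
  obtains \<eta> where "0 < \<eta>" "\<And>a b. 0 \<le> a \<Longrightarrow> a \<le> b \<Longrightarrow> b \<le> l \<Longrightarrow> b - a < \<eta> \<Longrightarrow> \<bar>\<alpha> b - \<alpha> a\<bar> < \<epsilon>"
proof -
  have "uniformly_continuous_on {0..l} \<alpha>"
    by (rule compact_uniformly_continuous[OF assms(1)]) simp
  then obtain \<eta> where \<eta>: "0 < \<eta>" "\<And>x y. x \<in> {0..l} \<Longrightarrow> y \<in> {0..l} \<Longrightarrow> dist y x < \<eta> \<Longrightarrow> dist (\<alpha> y) (\<alpha> x) < \<epsilon>"
    using assms(2) unfolding uniformly_continuous_on_def by metis
  show thesis by (rule that[OF \<eta>(1)]) (use \<eta>(2) in \<open>auto simp: dist_real_def\<close>)
qed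

text \<open>The function r is peeled off from the right end. If r vanishes beyond c, test with its
  restriction g to (b, c): as T g = g + h with h starting at b, orthogonality gives ||g||^2 = -<h,
  g>, and on a short interval h is strictly smaller than g unless g = 0.\<close>

lemma E_op_range_orthogonal:
  fixes E :: "real \<Rightarrow> real \<Rightarrow> complex^'p::finite^'p"
  assumes l: "0 < l" and T: "bounded_op l (E_op E)"
    and HS: "sq_integrable_on (\<lambda>(x, t). E x t) {(x, t). 0 < t \<and> t < x \<and> x < l}"
    and r: "r \<in> L2 l" and orth: "\<And>g. g \<in> L2 l \<Longrightarrow> L2_inner l (E_op E g) r = 0"
  shows "ae_eq l r (\<lambda>x. 0)"
proof -
  obtain a where a: "integrable (Il l) a" "\<And>x. 0 \<le> a x"
    "\<And>g. g \<in> L2 l \<Longrightarrow> AE x in Il l. (norm (E_op E g x - g x))\<^sup>2 \<le> a x * (L2_norm l g)\<^sup>2"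
    using Hilbert_Schmidt_bound[OF HS] by blast
  have "continuous_on {0..l} (\<lambda>x. LINT t|Il x. a t)" by (rule continuous_on_Il_integral[OF a(1)])
  \<comment> \<open>The threshold 1 makes g \<mapsto> h, restricted to (b, c), a strict contraction
    whenever c - b < \<eta>.\<close>
  then obtain \<eta> where \<eta>: "0 < \<eta>" "\<And>x y. 0 \<le> x \<Longrightarrow> x \<le> y \<Longrightarrow> y \<le> l \<Longrightarrow> y - x < \<eta> \<Longrightarrow> \<bar>(LINT t|Il y. a t) - (LINT t|Il x. a t)\<bar> < 1"
    by (rule uniform_partition[of l _ 1]) auto
  have step: "AE x in Il l. b < x \<longrightarrow> r x = 0"
    if bc: "0 \<le> b" "b \<le> c" "c \<le> l" "c - b < \<eta>" and z: "AE x in Il l. c < x \<longrightarrow> r x = 0" for b c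
  proof -
    define g where "g = clip b c r"
    have rc: "r \<in> L2 c" using L2_restrict[OF r bc(3)] .
    have g: "g \<in> L2 l" unfolding g_def by (rule L2_cut[OF rc bc(1)])
    define h where "h = (\<lambda>x. E_op E g x - g x)"
    have h: "h \<in> L2 l" unfolding h_def by (intro L2_diff bounded_opD(1)[OF T] g)
    \<comment> \<open>Triangularity: the correction at x only sees g on (0, x), and g is zero up to
      b.\<close>
    have h0: "h x = 0" if "x \<le> b" for x
    proof -
      have "(LINT t:{0<..<x}|lebesgue. E x t *v g t) = (LINT t:{0<..<x}|lebesgue. 0)"
        by (rule set_lebesgue_integral_cong) (use that in \<open>auto simp: g_def clip_def\<close>)
      then show ?thesis by (simp add: h_def E_op_def)
    qed
    have "L2_inner l (E_op E g) r = L2_inner l (\<lambda>x. g x + h x) r" by (simp add: h_def)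
    also have "\<dots> = L2_inner l g r + L2_inner l h r" by (rule ip_add_left[OF g h r])
    finally have "L2_inner l g r = - L2_inner l h r" using orth[OF g] by (simp add: eq_neg_iff_add_eq_0)
    moreover have "L2_inner l g r = of_real ((L2_norm l g)\<^sup>2)"
      using ip_cut_left[of l b c r r] ip_cut_both[of l b c r r] by (simp only: g_def ip_self[symmetric])
    ultimately have n1: "(L2_norm l g)\<^sup>2 = cmod (L2_inner l h r)"
      by (metis abs_norm_cancel norm_minus_cancel norm_of_real power2_abs abs_power2)
    have "L2_inner l h r = L2_inner l (clip b c h) g"
      unfolding g_def ip_cut_both
    proof -
      have "L2_inner l h r = L2_inner l h (clip b c r)"
      proof -
        have z2: "AE x in Il l. hprod (h x) (r x) = hprod (h x) (clip b c r x)"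
          using z AE_Il_neq[of c] by eventually_elim (use h0 in \<open>auto simp: clip_def not_less le_less\<close>)
        show ?thesis unfolding L2_inner_eq
          by (rule integral_cong_AE[OF _ _ z2])
            (use h r L2_cut[OF rc bc(1), of l] in \<open>auto intro!: borel_measurable_integrable integrable_hprod\<close>)
      qed
      then show "L2_inner l h r = L2_inner l h (clip b c r)" .
    qed
    then have n2: "cmod (L2_inner l h r) \<le> L2_norm l (clip b c h) * L2_norm l g"
      using ip_Cauchy_Schwarz[OF L2_cut[OF L2_restrict[OF h bc(3)] bc(1)] g] by simp
    define \<delta> where "\<delta> = (LINT t|Il c. a t) - (LINT t|Il b. a t)"
    have \<delta>1: "\<delta> < 1" using \<eta>(2)[OF bc] by (simp add: \<delta>_def)
    have n3: "(L2_norm l (clip b c h))\<^sup>2 \<le> \<delta> * (L2_norm l g)\<^sup>2"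
    proof -
      have ii: "integrable (Il l) (\<lambda>x. (if x < c then a x else 0) - (if x < b then a x else 0))"
        using integrable_Il_if[OF a(1)] by (intro Bochner_Integration.integrable_diff)
      have "(L2_norm l (clip b c h))\<^sup>2 = (LINT x|Il l. (norm (clip b c h x))\<^sup>2)" by (rule L2_norm_sq)
      also have "\<dots> \<le> (LINT x|Il l. ((if x < c then a x else 0) - (if x < b then a x else 0)) * (L2_norm l g)\<^sup>2)"
      proof (rule integral_mono_AE)
        show "integrable (Il l) (\<lambda>x. (norm (clip b c h x))\<^sup>2)"
          by (intro L2_integrable_sq L2_cut[OF L2_restrict[OF h bc(3)] bc(1)])
        show "integrable (Il l) (\<lambda>x. ((if x < c then a x else 0) - (if x < b then a x else 0)) * (L2_norm l g)\<^sup>2)"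
          using ii by (rule integrable_mult_left)
        show "AE x in Il l. (norm (clip b c h x))\<^sup>2 \<le> ((if x < c then a x else 0) - (if x < b then a x else 0)) * (L2_norm l g)\<^sup>2"
          using a(3)[OF g] by (rule eventually_mono) (use bc a(2) in \<open>auto simp: clip_def h_def\<close>)
      qed
      also have "\<dots> = (LINT x|Il l. (if x < c then a x else 0) - (if x < b then a x else 0)) * (L2_norm l g)\<^sup>2"
        by simp
      also have "(LINT x|Il l. (if x < c then a x else 0) - (if x < b then a x else 0)) = \<delta>"
        unfolding \<delta>_def using bc integrable_Il_if[OF a(1)]
        by (subst (1 2) Il_sub_integral[of _ l]) auto
      finally show ?thesis .
    qed
    have "L2_norm l g = 0"
    proof (rule ccontr)
      assume "L2_norm l g \<noteq> 0"
      then have pos: "0 < L2_norm l g" by (simp add: less_le)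
      have "L2_norm l g * L2_norm l g \<le> L2_norm l (clip b c h) * L2_norm l g"
        using n1 n2 by (simp add: power2_eq_square)
      then have "L2_norm l g \<le> L2_norm l (clip b c h)" using pos by simp
      then have "(L2_norm l g)\<^sup>2 \<le> \<delta> * (L2_norm l g)\<^sup>2"
        using n3 by (meson L2_norm_nonneg order_trans power_mono)
      then show False using \<delta>1 pos by (simp add: mult_le_cancel_right1 not_less[symmetric])
    qed
    then have "ae_eq l g (\<lambda>x. 0)" using L2_norm_zero_iff[OF g] by simp
    then show ?thesis
      using z AE_Il_neq[of c] unfolding ae_eq_def by eventually_elim (auto simp: g_def clip_def not_less le_less)
  qed
  obtain n :: nat where n: "l / \<eta> < real n" using reals_Archimedean2 by blast
  have np: "0 < real n" using n l \<eta>(1) by (smt (verit) divide_pos_pos)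
  define q where "q = l / real n"
  have q: "q < \<eta>" "0 \<le> q" "real n * q = l" using n np l \<eta>(1) by (simp_all add: q_def field_simps)
  have "AE x in Il l. l - real m * q < x \<longrightarrow> r x = 0" if "m \<le> n" for m
    using that
  proof (induction m)
    case 0
    show ?case by (rule AE_I2) auto
  next
    case (Suc m)
    have "real (Suc m) * q \<le> l"
      unfolding q(3)[symmetric] using Suc q(2) by (intro mult_right_mono) auto
    then have le: "q + real m * q \<le> l" by (simp add: algebra_simps)
    have "0 \<le> real m * q" using q(2) by simp
    have "AE x in Il l. l - (q + real m * q) < x \<longrightarrow> r x = 0"
    proof (rule step)
      show "AE x in Il l. l - real m * q < x \<longrightarrow> r x = 0" using Suc by simp
    qed (use le q \<open>0 \<le> real m * q\<close> in linarith)+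
    then show ?case by (simp add: algebra_simps)
  qed
  from this[of n] have "AE x in Il l. 0 < x \<longrightarrow> r x = 0" using q by simp
  then show ?thesis unfolding ae_eq_def using AE_space by eventually_elim auto
qed

text \<open>Summation over a uniform partition gives m l - m 0 \<le> \<epsilon> (n l - n 0) for
  every \<epsilon> > 0. It will show that a squared norm vanishes when its share in each short
  interval is an arbitrarily small multiple of another one.\<close>

lemma increments_le_imp_le:
  fixes m n :: "real \<Rightarrow> real"
  assumes l: "0 < l"
    and small: "\<And>\<epsilon>. 0 < \<epsilon> \<Longrightarrow> \<exists>\<eta>>0. \<forall>a b. 0 \<le> a \<longrightarrow> a < b \<longrightarrow> b \<le> l \<longrightarrow> b - a < \<eta> \<longrightarrow> m b - m a \<le> \<epsilon> * (n b - n a)"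
    and n: "n 0 \<le> n l"
  shows "m l \<le> m 0"
proof (rule ccontr)
  assume "\<not> m l \<le> m 0"
  then have pos: "0 < m l - m 0" by simp
  \<comment> \<open>The summand 1 keeps the divisor positive when n 0 = n l.\<close>
  define w where "w = n l - n 0 + 1"
  define \<epsilon> where "\<epsilon> = (m l - m 0) / w / 2"
  have n1: "0 < w" using n by (simp add: w_def)
  have \<epsilon>: "0 < \<epsilon>" using pos n1 by (simp add: \<epsilon>_def)
  obtain \<eta> where \<eta>: "\<eta> > 0" "\<And>a b. 0 \<le> a \<Longrightarrow> a < b \<Longrightarrow> b \<le> l \<Longrightarrow> b - a < \<eta> \<Longrightarrow> m b - m a \<le> \<epsilon> * (n b - n a)"
    using small[OF \<epsilon>] by blast
  obtain N :: nat where N: "l / \<eta> < real N" using reals_Archimedean2 by blast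
  have np: "0 < real N" using N l \<eta>(1) by (smt (verit) divide_pos_pos)
  define q where "q = l / real N"
  have q: "q < \<eta>" "0 < q" "real N * q = l" using N np l \<eta>(1) by (simp_all add: q_def field_simps)
  have "m (real j * q) - m 0 \<le> \<epsilon> * (n (real j * q) - n 0)" if "j \<le> N" for j
    using that
  proof (induction j)
    case (Suc j)
    have "real (Suc j) * q \<le> l"
      unfolding q(3)[symmetric] using Suc q(2) by (intro mult_right_mono) auto
    then have "m (real (Suc j) * q) - m (real j * q) \<le> \<epsilon> * (n (real (Suc j) * q) - n (real j * q))"
      using q by (intro \<eta>(2)) (auto simp: algebra_simps)
    then show ?case using Suc by (simp add: algebra_simps)
  qed simp
  from this[of N] have "m l - m 0 \<le> \<epsilon> * (n l - n 0)" by (simp add: q)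
  also have "\<dots> \<le> \<epsilon> * w" using \<epsilon> by (simp add: w_def)
  also have "\<dots> = (m l - m 0) / 2" using n1 by (simp add: \<epsilon>_def)
  finally show False using pos by simp
qed

text \<open>The setting in which the intertwining of A by T is proved. The \<gamma> are the columns
  of \<Pi>, and \<sigma> is the permutation of columns effected by J, so that
  \<open>operator_identity\<close> is the weak form of A S - S A* = i \<Pi> J \<Pi>*. The assumption
  \<open>T_range\<close> expresses that T has dense range.\<close>

locale triangular_factorization =
  fixes d :: "real^'p::finite" and S :: "real \<Rightarrow> 'p vfun \<Rightarrow> 'p vfun" and T :: "'p vfun \<Rightarrow> 'p vfun"
    and \<gamma> :: "'a::finite \<Rightarrow> 'p vfun" and \<sigma> :: "'a \<Rightarrow> 'a"
  assumes \<sigma>: "\<And>a. \<sigma> (\<sigma> a) = a"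
    and T_bounded: "\<And>l. 0 < l \<Longrightarrow> bounded_op l T"
    and S_bounded: "\<And>l. 0 < l \<Longrightarrow> bounded_op l (S l)"
    and factorization: "\<And>l. 0 < l \<Longrightarrow> \<exists>Tstar. adjoint_op l T Tstar \<and> bounded_inverse l (S l) (\<lambda>f. Tstar (T f))"
    and T_range: "\<And>l r. 0 < l \<Longrightarrow> r \<in> L2 l \<Longrightarrow> (\<And>g. g \<in> L2 l \<Longrightarrow> L2_inner l (T g) r = 0) \<Longrightarrow> ae_eq l r (\<lambda>x. 0)"
    and \<gamma>_L2: "\<And>a l. \<gamma> a \<in> L2 l"
    and operator_identity: "\<And>l f g. 0 < l \<Longrightarrow> f \<in> L2 l \<Longrightarrow> g \<in> L2 l \<Longrightarrow>
      L2_inner l (A_op d (S l f)) g - L2_inner l f (A_op d (S l g))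
        = \<i> * (\<Sum>a\<in>UNIV. L2_inner l f (\<gamma> (\<sigma> a)) * L2_inner l (\<gamma> a) g)"
begin

lemmas T_L2 = bounded_opD(1)[OF T_bounded]
lemmas S_L2 = bounded_opD(1)[OF S_bounded]
lemmas T_cong = bounded_op_cong[OF T_bounded]
lemmas T_diff = bounded_op_diff[OF T_bounded]

text \<open>This is T*T S = I with the adjoint moved to the other argument.\<close>

lemma T_S_inner:
  assumes "0 < l" "f \<in> L2 l" "g \<in> L2 l"
  shows "L2_inner l (T g) (T (S l f)) = L2_inner l g f"
proof -
  obtain Ts where Ts: "adjoint_op l T Ts" "bounded_inverse l (S l) (\<lambda>f. Ts (T f))"
    using factorization[OF assms(1)] by blast
  have TSf: "T (S l f) \<in> L2 l" using assms by (intro T_L2 S_L2)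
  have "L2_inner l (T g) (T (S l f)) = L2_inner l g (Ts (T (S l f)))"
    using Ts(1) TSf assms by (auto simp: adjoint_op_def)
  also have "\<dots> = L2_inner l g f"
  proof (rule ip_cong)
    show "Ts (T (S l f)) \<in> L2 l" using Ts(1) TSf by (auto simp: adjoint_op_def bounded_op_def)
    show "ae_eq l (Ts (T (S l f))) f" using Ts(2) assms by (auto simp: bounded_inverse_def)
  qed (use assms in auto)
  finally show ?thesis .
qed

lemma T_S_inner':
  assumes "0 < l" "f \<in> L2 l" "g \<in> L2 l"
  shows "L2_inner l (T (S l f)) (T g) = L2_inner l f g"
  using arg_cong[OF T_S_inner[OF assms], of cnj] by (simp add: ip_cnj)

lemma S_surj:
  assumes "0 < l" "g \<in> L2 l"
  obtains f where "f \<in> L2 l" "ae_eq l (S l f) g"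
proof -
  obtain Ts where Ts: "adjoint_op l T Ts" "bounded_inverse l (S l) (\<lambda>f. Ts (T f))"
    using factorization[OF assms(1)] by blast
  show thesis
    by (rule that[of "Ts (T g)"]) (use Ts assms T_L2 in \<open>auto simp: adjoint_op_def bounded_inverse_def bounded_op_def\<close>)
qed

text \<open>The preimage is S T* F. Since T*T S = I, the difference T S T* F - F is orthogonal to
  the range of T, hence zero.\<close>

lemma T_surj:
  assumes l: "0 < l" and F: "F \<in> L2 l"
  obtains f where "f \<in> L2 l" "ae_eq l (T f) F"
proof -
  obtain Ts where Ts: "adjoint_op l T Ts" using factorization[OF l] by blast
  have TsF: "Ts F \<in> L2 l" using Ts F by (auto simp: adjoint_op_def bounded_op_def)
  define f where "f = S l (Ts F)"
  have f: "f \<in> L2 l" unfolding f_def by (intro S_L2 l TsF)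
  have d: "(\<lambda>x. T f x - F x) \<in> L2 l" by (intro L2_diff T_L2 l f F)
  have "ae_eq l (\<lambda>x. T f x - F x) (\<lambda>x. 0)"
  proof (rule T_range[OF l d])
    fix g :: "'p vfun" assume g: "g \<in> L2 l"
    have "L2_inner l (T g) F = L2_inner l g (Ts F)" using Ts g F by (auto simp: adjoint_op_def)
    then show "L2_inner l (T g) (\<lambda>x. T f x - F x) = 0"
      using T_S_inner[OF l TsF g] f g F l by (simp add: ip_diff_right T_L2 f_def)
  qed
  then have "ae_eq l (T f) F" unfolding ae_eq_def by (rule eventually_mono) simp
  with f show thesis by (rule that)
qed

text \<open>One constant serves all initial intervals: T is a well defined operator on each (0, b)
  by the same formula, so extending f by zero beyond b leaves T f on (0, b) unchanged.\<close>

lemma T_bound: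
  assumes l: "0 < l"
  obtains C where "0 \<le> C" "\<And>b f. 0 < b \<Longrightarrow> b \<le> l \<Longrightarrow> f \<in> L2 b \<Longrightarrow> L2_norm b (T f) \<le> C * L2_norm b f"
proof -
  obtain C where C: "0 \<le> C" "\<And>f. f \<in> L2 l \<Longrightarrow> L2_norm l (T f) \<le> C * L2_norm l f"
    using bounded_opD(4)[OF T_bounded[OF l]] by blast
  show thesis
  proof (rule that[OF C(1)])
    fix b and f :: "'p vfun" assume b: "0 < b" "b \<le> l" "f \<in> L2 b"
    let ?f = "clip 0 b f"
    have f': "?f \<in> L2 l'" for l' by (rule L2_cut[OF b(3)]) simp
    have ae: "ae_eq b ?f f" by (rule ae_eqI) (simp add: clip_def)
    have "L2_norm b (T f) = L2_norm b (T ?f)"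
      by (intro L2_norm_cong T_L2 ae_eq_sym[OF T_cong[OF b(1) f' b(3) ae]] b f')
    also have "\<dots> \<le> L2_norm l (T ?f)" by (intro L2_norm_mono T_L2 l f' b)
    also have "\<dots> \<le> C * L2_norm l ?f" by (rule C(2)[OF f'])
    also have "?f = clip 0 b ?f" by (auto simp: clip_def fun_eq_iff)
    also have "L2_norm l (clip 0 b ?f) = L2_norm b ?f" using b by (intro L2_norm_cut_0 f') auto
    also have "\<dots> = L2_norm b f" by (intro L2_norm_cong f' b ae)
    finally show "L2_norm b (T f) \<le> C * L2_norm b f" .
  qed
qed

text \<open>Boundedness below comes from f = S T*T f.\<close>

lemma T_inverse_bound:
  assumes l: "0 < l"
  obtains C where "0 \<le> C" "\<And>f. f \<in> L2 l \<Longrightarrow> L2_norm l f \<le> C * L2_norm l (T f)"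
proof -
  obtain Ts where Ts: "adjoint_op l T Ts" "bounded_inverse l (S l) (\<lambda>f. Ts (T f))"
    using factorization[OF l] by blast
  have Tsb: "bounded_op l Ts" using Ts by (auto simp: adjoint_op_def)
  obtain C1 where C1: "0 \<le> C1" "\<And>f. f \<in> L2 l \<Longrightarrow> L2_norm l (Ts f) \<le> C1 * L2_norm l f"
    using bounded_opD(4)[OF Tsb] by blast
  obtain C2 where C2: "0 \<le> C2" "\<And>f. f \<in> L2 l \<Longrightarrow> L2_norm l (S l f) \<le> C2 * L2_norm l f"
    using bounded_opD(4)[OF S_bounded[OF l]] by blast
  show thesis
  proof (rule that[of "C2 * C1"])
    show "0 \<le> C2 * C1" using C1 C2 by simp
    fix f :: "'p vfun" assume f: "f \<in> L2 l"
    have TsTf: "Ts (T f) \<in> L2 l" by (intro bounded_opD(1)[OF Tsb] T_L2 l f)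
    have "L2_norm l f = L2_norm l (S l (Ts (T f)))"
      using Ts(2) f by (intro L2_norm_cong S_L2 l TsTf f) (auto simp: bounded_inverse_def intro: ae_eq_sym)
    also have "\<dots> \<le> C2 * L2_norm l (Ts (T f))" by (rule C2(2)[OF TsTf])
    also have "\<dots> \<le> C2 * (C1 * L2_norm l (T f))" by (intro mult_left_mono C1 C2 T_L2 l f)
    finally show "L2_norm l f \<le> C2 * C1 * L2_norm l (T f)" by (simp add: mult.assoc)
  qed
qed

lemma T_inj:
  assumes l: "0 < l" and f: "f \<in> L2 l" and z: "ae_eq l (T f) (\<lambda>x. 0)"
  shows "ae_eq l f (\<lambda>x. 0)"
proof -
  obtain C where "0 \<le> C" "\<And>f. f \<in> L2 l \<Longrightarrow> L2_norm l f \<le> C * L2_norm l (T f)"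
    by (rule T_inverse_bound[OF l]) blast
  then have "L2_norm l f \<le> C * L2_norm l (T f)" using f by blast
  moreover have "L2_norm l (T f) = 0" using L2_norm_zero_iff[OF T_L2[OF l f]] z by simp
  ultimately have "L2_norm l f = 0" using L2_norm_nonneg[of l f] by simp
  then show ?thesis using L2_norm_zero_iff[OF f] by simp
qed

definition \<beta> :: "'a \<Rightarrow> 'p vfun" where "\<beta> a = T (\<gamma> a)"

lemma \<beta>_L2: "\<beta> a \<in> L2 l"
proof (cases "0 < l")
  case True
  then show ?thesis unfolding \<beta>_def by (intro T_L2 \<gamma>_L2)
next
  case False
  have "\<beta> a \<in> L2 1" unfolding \<beta>_def by (intro T_L2 \<gamma>_L2) simp
  then show ?thesis by (rule L2_restrict) (use False in simp)
qed

text \<open>In matrix form Q u (x) = i \<beta>(x) J \<integral> \<beta>(t)* u(t) dt over 0 < t < x.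
  It is the operator into which T will turn A.\<close>

definition Q :: "'p vfun \<Rightarrow> 'p vfun" where
  "Q u x = (\<Sum>a\<in>UNIV. (\<i> * L2_inner x u (\<beta> a)) *s \<beta> (\<sigma> a) x)"

lemma Q_term_L2:
  assumes "u \<in> L2 l" shows "(\<lambda>x. (\<i> * L2_inner x u (\<beta> a)) *s \<beta> (\<sigma> a) x) \<in> L2 l"
  by (intro L2_continuous_smult continuous_intros continuous_on_ip assms \<beta>_L2)

lemma Q_L2: "u \<in> L2 l \<Longrightarrow> Q u \<in> L2 l"
  unfolding Q_def by (intro L2_sum Q_term_L2) auto

lemma Q_inner:
  assumes u: "u \<in> L2 l" and v: "v \<in> L2 l"
  shows "L2_inner l (Q u) v = (\<Sum>a\<in>UNIV. \<i> * (LINT x|Il l. hprod (\<beta> (\<sigma> a) x) (v x) * L2_inner x u (\<beta> a)))"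
proof -
  have "L2_inner l (Q u) v = (\<Sum>a\<in>UNIV. L2_inner l (\<lambda>x. (\<i> * L2_inner x u (\<beta> a)) *s \<beta> (\<sigma> a) x) v)"
    unfolding Q_def by (intro ip_sum_left Q_term_L2 u v) auto
  also have "\<dots> = (\<Sum>a\<in>UNIV. \<i> * (LINT x|Il l. hprod (\<beta> (\<sigma> a) x) (v x) * L2_inner x u (\<beta> a)))"
  proof (intro sum.cong refl)
    fix a
    have "L2_inner l (\<lambda>x. (\<i> * L2_inner x u (\<beta> a)) *s \<beta> (\<sigma> a) x) v
        = (LINT x|Il l. \<i> * (hprod (\<beta> (\<sigma> a) x) (v x) * L2_inner x u (\<beta> a)))"
      unfolding L2_inner_eq[of l] hprod_smult_left
      by (intro Bochner_Integration.integral_cong refl) (simp only: mult_ac)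
    then show "L2_inner l (\<lambda>x. (\<i> * L2_inner x u (\<beta> a)) *s \<beta> (\<sigma> a) x) v
        = \<i> * (LINT x|Il l. hprod (\<beta> (\<sigma> a) x) (v x) * L2_inner x u (\<beta> a))"
      by (simp only: integral_mult_right_zero)
  qed
  finally show ?thesis .
qed

text \<open>The kernel of Q is i \<beta>(x) J \<beta>(t)* on the triangle t < x. Subtracting the
  adjoint fills in the other triangle with the same expression, so the difference has finite
  rank.\<close>

lemma Q_skew:
  assumes u: "u \<in> L2 l" and v: "v \<in> L2 l" and l: "0 \<le> l"
  shows "L2_inner l (Q u) v - L2_inner l u (Q v) = \<i> * (\<Sum>a\<in>UNIV. L2_inner l u (\<beta> a) * L2_inner l (\<beta> (\<sigma> a)) v)"
proof -
  define p where "p w a x = hprod (w x) (\<beta> a x)" for w a x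
  define q where "q w a x = hprod (\<beta> a x) (w x)" for w a x
  have ip: "integrable (Il l) (p w a)" "integrable (Il l) (q w a)" if "w \<in> L2 l" for w a
    unfolding p_def q_def by (intro integrable_hprod that \<beta>_L2)+
  have pI: "L2_inner x w (\<beta> a) = (LINT t|Il x. p w a t)" for x w a by (simp add: L2_inner_eq p_def)
  have qI: "L2_inner x (\<beta> a) w = (LINT t|Il x. q w a t)" for x w a by (simp add: L2_inner_eq q_def)
  have 1: "L2_inner l (Q u) v = (\<Sum>a\<in>UNIV. \<i> * (LINT x|Il l. q v (\<sigma> a) x * (LINT t|Il x. p u a t)))"
    using Q_inner[OF u v] by (simp add: q_def pI)
  have "L2_inner l u (Q v) = cnj (L2_inner l (Q v) u)" by (simp add: ip_cnj)
  also have "\<dots> = (\<Sum>a\<in>UNIV. cnj (\<i> * (LINT x|Il l. q u (\<sigma> a) x * (LINT t|Il x. p v a t))))"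
    using Q_inner[OF v u] by (simp add: q_def pI)
  also have "\<dots> = (\<Sum>a\<in>UNIV. - \<i> * (LINT x|Il l. p u (\<sigma> a) x * (LINT t|Il x. q v a t)))"
  proof (intro sum.cong refl)
    fix a
    have "cnj (LINT x|Il l. q u (\<sigma> a) x * (LINT t|Il x. p v a t)) = (LINT x|Il l. p u (\<sigma> a) x * (LINT t|Il x. q v a t))"
      unfolding pI[symmetric] qI[symmetric]
      by (subst Bochner_Integration.integral_cnj[symmetric]) (simp add: p_def q_def hprod_cnj ip_cnj)
    then show "cnj (\<i> * (LINT x|Il l. q u (\<sigma> a) x * (LINT t|Il x. p v a t))) = - \<i> * (LINT x|Il l. p u (\<sigma> a) x * (LINT t|Il x. q v a t))"
      by simp
  qed
  also have "\<dots> = (\<Sum>a\<in>UNIV. - \<i> * (LINT x|Il l. p u a x * (LINT t|Il x. q v (\<sigma> a) t)))"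
    by (rule sum.reindex_bij_witness[of _ \<sigma> \<sigma>]) (auto simp: \<sigma>)
  finally have 2: "L2_inner l u (Q v) = (\<Sum>a\<in>UNIV. - \<i> * (LINT x|Il l. p u a x * (LINT t|Il x. q v (\<sigma> a) t)))" .
  have "L2_inner l (Q u) v - L2_inner l u (Q v)
      = (\<Sum>a\<in>UNIV. \<i> * ((LINT x|Il l. p u a x * (LINT t|Il x. q v (\<sigma> a) t)) + (LINT x|Il l. q v (\<sigma> a) x * (LINT t|Il x. p u a t))))"
    unfolding 1 2 by (simp add: sum_negf sum.distrib distrib_left)
  also have "\<dots> = (\<Sum>a\<in>UNIV. \<i> * (L2_inner l u (\<beta> a) * L2_inner l (\<beta> (\<sigma> a)) v))"
    unfolding pI qI by (intro sum.cong refl arg_cong[of _ _ "(*) \<i>"] integral_product_rule(1) ip u v)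
  finally show ?thesis by (simp add: sum_distrib_left)
qed

text \<open>The operator \<open>P\<close> turns out to vanish. By the operator identity \<open>P\<close> is symmetric relative to \<open>T\<close> on every
  initial interval, hence \<open>P f\<close> depends on \<open>T f\<close> locally; and on an interval of length \<open>h\<close> it is small with \<open>h\<close>.\<close>

definition P :: "'p vfun \<Rightarrow> 'p vfun" where "P f x = T (A_op d f) x - Q (T f) x"

lemma P_L2: "0 < l \<Longrightarrow> f \<in> L2 l \<Longrightarrow> P f \<in> L2 l"
  unfolding P_def by (intro L2_diff T_L2 Q_L2 A_op_L2)

text \<open>The operator identity is carried over by f = S f' and g = S g'; the columns \<gamma>
  turn into \<beta> because <T S f', T \<gamma>> = <f', \<gamma>>.\<close>

lemma A_skew:
  assumes l: "0 < l" and f: "f \<in> L2 l" and g: "g \<in> L2 l"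
  shows "L2_inner l (T (A_op d f)) (T g) - L2_inner l (T f) (T (A_op d g))
    = \<i> * (\<Sum>a\<in>UNIV. L2_inner l (T f) (\<beta> a) * L2_inner l (\<beta> (\<sigma> a)) (T g))"
proof -
  obtain f' where f': "f' \<in> L2 l" "ae_eq l (S l f') f" by (rule S_surj[OF l f])
  obtain g' where g': "g' \<in> L2 l" "ae_eq l (S l g') g" by (rule S_surj[OF l g])
  note m = S_L2[OF l f'(1)] S_L2[OF l g'(1)] A_op_L2 T_L2[OF l]
  have Af: "ae_eq l (A_op d (S l f')) (A_op d f)" "ae_eq l (A_op d (S l g')) (A_op d g)"
    by (rule ae_eqI, rule A_op_cong[OF m(1) f f'(2)], simp, rule ae_eqI, rule A_op_cong[OF m(2) g g'(2)], simp)
  note Tc = T_cong[OF l m(1) f f'(2)] T_cong[OF l m(2) g g'(2)] 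
  have 1: "L2_inner l (T (A_op d f)) (T g) = L2_inner l (A_op d (S l f')) g'"
  proof -
    have "L2_inner l (T (A_op d f)) (T g) = L2_inner l (T (A_op d f)) (T (S l g'))"
      by (intro ip_cong m f g ae_eq_refl ae_eq_sym[OF Tc(2)])
    also have "\<dots> = L2_inner l (A_op d f) g'" by (intro T_S_inner l g' A_op_L2 f)
    also have "\<dots> = L2_inner l (A_op d (S l f')) g'"
      by (intro ip_cong m f g' ae_eq_refl ae_eq_sym[OF Af(1)])
    finally show ?thesis .
  qed
  have 2: "L2_inner l (T f) (T (A_op d g)) = L2_inner l f' (A_op d (S l g'))"
  proof -
    have "L2_inner l (T f) (T (A_op d g)) = L2_inner l (T (S l f')) (T (A_op d g))"
      by (intro ip_cong m f g ae_eq_refl ae_eq_sym[OF Tc(1)])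
    also have "\<dots> = L2_inner l f' (A_op d g)" by (intro T_S_inner' l f' A_op_L2 g)
    also have "\<dots> = L2_inner l f' (A_op d (S l g'))"
      by (intro ip_cong m g f' ae_eq_refl ae_eq_sym[OF Af(2)])
    finally show ?thesis .
  qed
  have 3: "L2_inner l (T f) (\<beta> a) = L2_inner l f' (\<gamma> a)" for a
  proof -
    have "L2_inner l (T f) (\<beta> a) = L2_inner l (T (S l f')) (\<beta> a)"
      by (intro ip_cong m f \<beta>_L2 ae_eq_refl ae_eq_sym[OF Tc(1)])
    then show ?thesis unfolding \<beta>_def using T_S_inner'[OF l f'(1) \<gamma>_L2] by simp
  qed
  have 4: "L2_inner l (\<beta> a) (T g) = L2_inner l (\<gamma> a) g'" for a
  proof -
    have "L2_inner l (\<beta> a) (T g) = L2_inner l (\<beta> a) (T (S l g'))"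
      by (intro ip_cong m g \<beta>_L2 ae_eq_refl ae_eq_sym[OF Tc(2)])
    then show ?thesis unfolding \<beta>_def using T_S_inner[OF l g'(1) \<gamma>_L2] by simp
  qed
  have "(\<Sum>a\<in>UNIV. L2_inner l (T f) (\<beta> a) * L2_inner l (\<beta> (\<sigma> a)) (T g)) = (\<Sum>a\<in>UNIV. L2_inner l f' (\<gamma> (\<sigma> a)) * L2_inner l (\<gamma> a) g')"
    unfolding 3 4 by (rule sum.reindex_bij_witness[of _ \<sigma> \<sigma>]) (auto simp: \<sigma>)
  then show ?thesis using operator_identity[OF l f'(1) g'(1)] unfolding 1 2 by simp
qed

text \<open>T A and Q have the same skew part relative to T, so it cancels in P. The case l = 0 is
  included because differences over initial intervals (0, b) and (0, a) with a = 0 occur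
  next.\<close>

lemma P_symmetric:
  assumes l: "0 \<le> l" and f: "f \<in> L2 l" and g: "g \<in> L2 l"
  shows "L2_inner l (P f) (T g) = L2_inner l (T f) (P g)"
proof (cases "l = 0")
  case True
  then show ?thesis by (simp add: L2_inner_def)
next
  case False
  with l have l: "0 < l" by simp
  have "L2_inner l (P f) (T g) - L2_inner l (T f) (P g)
      = (L2_inner l (T (A_op d f)) (T g) - L2_inner l (T f) (T (A_op d g)))
        - (L2_inner l (Q (T f)) (T g) - L2_inner l (T f) (Q (T g)))"
    unfolding P_def using l f g by (simp add: ip_diff_left ip_diff_right T_L2 Q_L2 A_op_L2)
  also have "\<dots> = 0"
    using A_skew[OF l f g] Q_skew[OF T_L2[OF l f] T_L2[OF l g]] l by simp
  finally show ?thesis by simp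
qed

text \<open>Surjectivity gives g with T g = P h. Over (a, b), symmetry turns ||P h||^2 = <P h, T g>
  into <T h, P g>, which is zero since T h vanishes there.\<close>

lemma P_vanishes_locally:
  assumes ab: "0 \<le> a" "a \<le> b" "b \<le> l" "0 < l" and h: "h \<in> L2 l"
    and z: "ae_eq l (clip a b (T h)) (\<lambda>x. 0)"
  shows "ae_eq l (clip a b (P h)) (\<lambda>x. 0)"
proof -
  have hb: "h \<in> L2 x" if "x \<le> l" for x by (rule L2_restrict[OF h that])
  obtain g where g: "g \<in> L2 l" "ae_eq l (T g) (P h)" by (rule T_surj[OF ab(4) P_L2[OF ab(4) h]])
  have gb: "g \<in> L2 x" if "x \<le> l" for x by (rule L2_restrict[OF g(1) that])
  have L: "P h \<in> L2 l" "T g \<in> L2 l" "T h \<in> L2 l" "P g \<in> L2 l" using ab h g by (auto intro: P_L2 T_L2)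
  have c: "clip a b (T h) \<in> L2 l" "clip a b (P h) \<in> L2 l"
    by (intro L2_cut[OF L2_restrict[OF L(3) ab(3)]] L2_cut[OF L2_restrict[OF L(1) ab(3)]] ab)+
  have "L2_inner l (P h) (clip a b (T g)) = L2_inner b (P h) (T g) - L2_inner a (P h) (T g)"
    by (rule ip_cut[OF L(1,2) ab(2,3)])
  also have "\<dots> = L2_inner b (T h) (P g) - L2_inner a (T h) (P g)"
    using ab by (simp add: P_symmetric hb gb)
  also have "\<dots> = L2_inner l (clip a b (T h)) (P g)"
    unfolding ip_cut_left by (rule ip_cut[OF L(3,4) ab(2,3), symmetric])
  also have "\<dots> = 0"
    using ip_cong[OF c(1) L2_zero L(4) L(4) z ae_eq_refl] by simp
  finally have "L2_inner l (clip a b (P h)) (T g) = 0" by (simp add: ip_cut_left)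
  moreover have "L2_inner l (clip a b (P h)) (T g) = L2_inner l (clip a b (P h)) (P h)"
    by (rule ip_cong[OF c(2) c(2) L(2) L(1) ae_eq_refl g(2)])
  ultimately have "L2_inner l (clip a b (P h)) (clip a b (P h)) = 0"
    using ip_cut_left[of l a b "P h" "P h"] ip_cut_both[of l a b "P h" "P h"] by argo
  then have "L2_norm l (clip a b (P h)) = 0" by (simp add: ip_self)
  then show ?thesis using L2_norm_zero_iff[OF c(2)] by simp
qed

lemma Q_diff:
  assumes "u \<in> L2 l" "v \<in> L2 l" "x \<le> l"
  shows "Q (\<lambda>x. u x - v x) x = Q u x - Q v x"
proof -
  have "L2_inner x (\<lambda>x. u x - v x) (\<beta> a) = L2_inner x u (\<beta> a) - L2_inner x v (\<beta> a)" for a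
    by (intro ip_diff_left L2_restrict[OF assms(1,3)] L2_restrict[OF assms(2,3)] \<beta>_L2)
  moreover have "(\<i> * (c - e)) *s w = (\<i> * c) *s w - (\<i> * e) *s w" for c e and w :: "complex^'p"
    by (simp add: vec_eq_iff algebra_simps)
  ultimately show ?thesis by (simp add: Q_def sum_subtractf)
qed

lemma Q_cong:
  assumes "u \<in> L2 l" "v \<in> L2 l" "ae_eq l u v" "x \<le> l"
  shows "Q u x = Q v x"
proof -
  have "L2_inner x u (\<beta> a) = L2_inner x v (\<beta> a)" for a
    by (intro ip_cong L2_restrict[OF assms(1,4)] L2_restrict[OF assms(2,4)] \<beta>_L2 ae_eq_mono[OF assms(3,4)] ae_eq_refl)
  then show ?thesis by (simp add: Q_def)
qed

lemma P_diff:
  assumes l: "0 < l" and f: "f \<in> L2 l" and g: "g \<in> L2 l"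
  shows "ae_eq l (P (\<lambda>x. f x - g x)) (\<lambda>x. P f x - P g x)"
proof -
  have fg: "(\<lambda>x. f x - g x) \<in> L2 l" by (intro L2_diff f g)
  have 1: "ae_eq l (T (A_op d (\<lambda>x. f x - g x))) (\<lambda>x. T (A_op d f) x - T (A_op d g) x)"
  proof -
    have "ae_eq l (A_op d (\<lambda>x. f x - g x)) (\<lambda>x. A_op d f x - A_op d g x)"
      by (rule ae_eqI) (simp add: A_op_diff[OF f g])
    then have "ae_eq l (T (A_op d (\<lambda>x. f x - g x))) (T (\<lambda>x. A_op d f x - A_op d g x))"
      by (intro T_cong l A_op_L2 L2_diff f g)
    also have "ae_eq l \<dots> (\<lambda>x. T (A_op d f) x - T (A_op d g) x)" by (intro T_diff l A_op_L2 f g)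
    finally (ae_eq_trans) show ?thesis .
  qed
  have 2: "ae_eq l (Q (T (\<lambda>x. f x - g x))) (\<lambda>x. Q (T f) x - Q (T g) x)"
  proof (rule ae_eqI)
    fix x assume x: "0 < x" "x < l"
    have "Q (T (\<lambda>x. f x - g x)) x = Q (\<lambda>x. T f x - T g x) x"
      using x by (intro Q_cong[of _ l, OF _ _ T_diff] L2_diff T_L2 l f g fg) auto
    also have "\<dots> = Q (T f) x - Q (T g) x"
      using x by (intro Q_diff[of _ l] T_L2 l f g) auto
    finally show "Q (T (\<lambda>x. f x - g x)) x = Q (T f) x - Q (T g) x" .
  qed
  show ?thesis using 1 2 unfolding ae_eq_def P_def by eventually_elim simp
qed

text \<open>If T f lives on (a, b), injectivity of T on (0, a) makes f vanish there, so T A f is of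
  order b - a on (0, b). In Q (T f) the columns \<beta> occur twice, once integrated and once
  evaluated, and on (a, b) both occurrences see \<beta> on (a, b) only.\<close>

lemma P_local_bound:
  assumes l: "0 < l"
  obtains C where "0 \<le> C" "\<And>a b f. 0 \<le> a \<Longrightarrow> a < b \<Longrightarrow> b \<le> l \<Longrightarrow> f \<in> L2 l \<Longrightarrow>
    ae_eq l (T f) (clip a b (T f)) \<Longrightarrow>
    L2_norm l (clip a b (P f)) \<le> (C * (b - a) + (\<Sum>c\<in>UNIV. L2_norm l (clip a b (\<beta> c)) * L2_norm l (clip a b (\<beta> (\<sigma> c))))) * L2_norm l (T f)"
proof -
  obtain C1 where C1: "0 \<le> C1" "\<And>b f. 0 < b \<Longrightarrow> b \<le> l \<Longrightarrow> f \<in> L2 b \<Longrightarrow> L2_norm b (T f) \<le> C1 * L2_norm b f"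
    by (rule T_bound[OF l]) blast
  obtain C2 where C2: "0 \<le> C2" "\<And>f. f \<in> L2 l \<Longrightarrow> L2_norm l f \<le> C2 * L2_norm l (T f)"
    by (rule T_inverse_bound[OF l]) blast
  define D where "D = (\<Sum>i\<in>UNIV. \<bar>d $ i\<bar>)"
  have D: "0 \<le> D" unfolding D_def by (intro sum_nonneg) auto
  show thesis
  proof (rule that[of "C1 * D * C2"])
    show "0 \<le> C1 * D * C2" using C1 C2 D by simp
    fix a b and f :: "'p vfun"
    assume ab: "0 \<le> a" "a < b" "b \<le> l" and f: "f \<in> L2 l" and supp: "ae_eq l (T f) (clip a b (T f))"
    have b: "0 < b" using ab by simp
    have fb: "f \<in> L2 b" by (rule L2_restrict[OF f ab(3)])
    have za: "ae_eq a f (\<lambda>x. 0)"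
    proof (cases "a = 0")
      case True
      then show ?thesis by (intro ae_eqI) auto
    next
      case False
      have "ae_eq a (T f) (clip a b (T f))" using supp ab by (intro ae_eq_mono[OF supp]) auto
      also have "ae_eq a \<dots> (\<lambda>x. 0)" by (rule ae_eqI) (simp add: clip_def)
      finally (ae_eq_trans) have z: "ae_eq a (T f) (\<lambda>x. 0)" .
      have "0 < a" "a \<le> l" using False ab by auto
      then show ?thesis using T_inj[OF _ L2_restrict[OF f] z] by blast
    qed
    have TfL: "T f \<in> L2 l" by (intro T_L2 l f)
    have TAL: "T (A_op d f) \<in> L2 l" by (intro T_L2 A_op_L2 l f)
    have QL: "Q (T f) \<in> L2 l" by (intro Q_L2 TfL)
    have clipL: "clip a b g \<in> L2 l'" if "g \<in> L2 l" for g :: "'p vfun" and l'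
      by (rule L2_cut[OF L2_restrict[OF that ab(3)] ab(1)])
    have 1: "L2_norm l (clip a b (T (A_op d f))) \<le> C1 * D * C2 * (b - a) * L2_norm l (T f)"
    proof -
      have "(L2_norm l (clip a b (T (A_op d f))))\<^sup>2 \<le> (L2_norm b (T (A_op d f)))\<^sup>2"
        using L2_norm_cut_sq[OF TAL, of a b] ab by simp
      then have "L2_norm l (clip a b (T (A_op d f))) \<le> L2_norm b (T (A_op d f))"
        by (rule power2_le_imp_le) simp
      also have "\<dots> \<le> C1 * L2_norm b (A_op d f)" by (intro C1(2) b ab A_op_L2 fb)
      also have "\<dots> \<le> C1 * (D * (b - a) * L2_norm b f)"
        unfolding D_def using ab by (intro mult_left_mono A_op_small[OF fb za] C1) auto
      also have "\<dots> \<le> C1 * (D * (b - a) * (C2 * L2_norm l (T f)))"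
        using ab D C1 order_trans[OF L2_norm_mono[OF f ab(3)] C2(2)[OF f]] by (intro mult_left_mono) auto
      finally show ?thesis by (simp add: mult_ac)
    qed
    have qb: "cmod (L2_inner x (T f) (\<beta> c)) \<le> L2_norm l (T f) * L2_norm l (clip a b (\<beta> c))" if x: "0 < x" "x < l" for x c
    proof -
      have Tx: "T f \<in> L2 x" by (rule L2_restrict[OF TfL]) (use x in simp)
      have "L2_inner x (T f) (\<beta> c) = L2_inner x (clip a b (T f)) (\<beta> c)"
        using x by (intro ip_cong Tx clipL TfL \<beta>_L2 ae_eq_refl ae_eq_mono[OF supp]) auto
      also have "\<dots> = L2_inner x (T f) (clip a b (\<beta> c))" by (rule ip_cut_left)
      finally have "cmod (L2_inner x (T f) (\<beta> c)) \<le> L2_norm x (T f) * L2_norm x (clip a b (\<beta> c))"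
        using ip_Cauchy_Schwarz[OF Tx clipL[OF \<beta>_L2]] by simp
      also have "\<dots> \<le> L2_norm l (T f) * L2_norm l (clip a b (\<beta> c))"
        using x by (intro mult_mono L2_norm_mono TfL clipL \<beta>_L2) auto
      finally show ?thesis .
    qed
    have 2: "L2_norm l (clip a b (Q (T f))) \<le> (\<Sum>c\<in>UNIV. L2_norm l (clip a b (\<beta> c)) * L2_norm l (clip a b (\<beta> (\<sigma> c)))) * L2_norm l (T f)"
    proof -
      have eq: "clip a b (Q (T f)) = (\<lambda>x. \<Sum>c\<in>UNIV. (\<i> * L2_inner x (T f) (\<beta> c)) *s clip a b (\<beta> (\<sigma> c)) x)"
        by (auto simp: clip_def Q_def fun_eq_iff)
      have meas: "(\<lambda>x. \<i> * L2_inner x (T f) (\<beta> c)) \<in> borel_measurable (Il l)" for c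
        by (intro borel_measurable_Il_continuous continuous_intros continuous_on_ip TfL \<beta>_L2)
      have bd: "cmod (\<i> * L2_inner x (T f) (\<beta> c)) \<le> L2_norm l (T f) * L2_norm l (clip a b (\<beta> c))" if "0 < x" "x < l" for x c
        using qb[OF that] by (simp add: norm_mult)
      note s = L2_bounded_smult[OF meas bd clipL[OF \<beta>_L2]]
      have "L2_norm l (clip a b (Q (T f))) \<le> (\<Sum>c\<in>UNIV. L2_norm l (\<lambda>x. (\<i> * L2_inner x (T f) (\<beta> c)) *s clip a b (\<beta> (\<sigma> c)) x))"
        unfolding eq by (intro L2_norm_sum_le s) auto
      also have "\<dots> \<le> (\<Sum>c\<in>UNIV. \<bar>L2_norm l (T f) * L2_norm l (clip a b (\<beta> c))\<bar> * L2_norm l (clip a b (\<beta> (\<sigma> c))))"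
        by (intro sum_mono s)
      also have "\<dots> = (\<Sum>c\<in>UNIV. L2_norm l (clip a b (\<beta> c)) * L2_norm l (clip a b (\<beta> (\<sigma> c)))) * L2_norm l (T f)"
        unfolding sum_distrib_right by (rule sum.cong) simp_all
      finally show ?thesis .
    qed
    have "L2_norm l (clip a b (P f)) = L2_norm l (\<lambda>x. clip a b (T (A_op d f)) x + (-1) *s clip a b (Q (T f)) x)"
    proof -
      have "clip a b (P f) = (\<lambda>x. clip a b (T (A_op d f)) x + (-1) *s clip a b (Q (T f)) x)"
        by (rule ext) (simp add: clip_def P_def vec_eq_iff)
      then show ?thesis by simp
    qed
    also have "\<dots> \<le> L2_norm l (clip a b (T (A_op d f))) + L2_norm l (\<lambda>x. (-1) *s clip a b (Q (T f)) x)"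
      by (intro L2_norm_triangle L2_smult clipL TAL QL)
    also have "L2_norm l (\<lambda>x. (-1) *s clip a b (Q (T f)) x) = L2_norm l (clip a b (Q (T f)))"
      using L2_norm_smult[of l "-1" "clip a b (Q (T f))"] by simp
    finally show "L2_norm l (clip a b (P f)) \<le> (C1 * D * C2 * (b - a) + (\<Sum>c\<in>UNIV. L2_norm l (clip a b (\<beta> c)) * L2_norm l (clip a b (\<beta> (\<sigma> c))))) * L2_norm l (T f)"
      using 1 2 by (simp add: distrib_right)
  qed
qed

text \<open>On (a, b) the function f may be exchanged for the f1 with T f1 equal to T f cut to (a,
  b), since P of the difference vanishes there. Hence the increment of ||P f||^2 is at most a small
  multiple of the increment of ||T f||^2.\<close>

theorem T_A_op:
  assumes l: "0 < l" and f: "f \<in> L2 l"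
  shows "ae_eq l (T (A_op d f)) (Q (T f))"
proof -
  obtain C where C: "0 \<le> C" "\<And>a b f. 0 \<le> a \<Longrightarrow> a < b \<Longrightarrow> b \<le> l \<Longrightarrow> f \<in> L2 l \<Longrightarrow>
    ae_eq l (T f) (clip a b (T f)) \<Longrightarrow>
    L2_norm l (clip a b (P f)) \<le> (C * (b - a) + (\<Sum>c\<in>UNIV. L2_norm l (clip a b (\<beta> c)) * L2_norm l (clip a b (\<beta> (\<sigma> c))))) * L2_norm l (T f)"
    by (rule P_local_bound[OF l]) blast
  have TfL: "T f \<in> L2 l" and PfL: "P f \<in> L2 l" by (intro T_L2 P_L2 l f)+
  \<comment> \<open>The sum of products of norms of the \<beta> over (a, b) is at most twice the
    increment of B, and uniform continuity makes this small for all short intervals at once.\<close>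
  define B where "B x = (\<Sum>c\<in>UNIV. (L2_norm x (\<beta> c))\<^sup>2)" for x
  have Bc: "continuous_on {0..l} (\<lambda>x. C * x + 2 * B x)"
    unfolding B_def by (intro continuous_intros continuous_on_L2_norm_sq \<beta>_L2)
  have "(L2_norm l (P f))\<^sup>2 \<le> (L2_norm 0 (P f))\<^sup>2"
  proof (rule increments_le_imp_le[OF l, where n = "\<lambda>x. (L2_norm x (T f))\<^sup>2"])
    show "(L2_norm 0 (T f))\<^sup>2 \<le> (L2_norm l (T f))\<^sup>2" by simp
    fix \<epsilon> :: real assume "0 < \<epsilon>"
    obtain \<eta> where \<eta>: "0 < \<eta>" "\<And>a b. 0 \<le> a \<Longrightarrow> a \<le> b \<Longrightarrow> b \<le> l \<Longrightarrow> b - a < \<eta> \<Longrightarrow> \<bar>(C * b + 2 * B b) - (C * a + 2 * B a)\<bar> < sqrt \<epsilon>"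
      by (rule uniform_partition[OF Bc, of "sqrt \<epsilon>"]) (use \<open>0 < \<epsilon>\<close> in auto)
    have "(L2_norm b (P f))\<^sup>2 - (L2_norm a (P f))\<^sup>2 \<le> \<epsilon> * ((L2_norm b (T f))\<^sup>2 - (L2_norm a (T f))\<^sup>2)"
      if ab: "0 \<le> a" "a < b" "b \<le> l" "b - a < \<eta>" for a b
    proof -
      have clipL: "clip a b g \<in> L2 l'" if "g \<in> L2 l" for g :: "'p vfun" and l'
        by (rule L2_cut[OF L2_restrict[OF that ab(3)] ab(1)])
      \<comment> \<open>The cut is made on the side of T f, where P is local, and not on f
        itself.\<close>
      obtain f1 where f1: "f1 \<in> L2 l" "ae_eq l (T f1) (clip a b (T f))"
        by (rule T_surj[OF l clipL[OF TfL]])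
      define h where "h = (\<lambda>x. f x - f1 x)"
      have h: "h \<in> L2 l" unfolding h_def by (intro L2_diff f f1)
      have "ae_eq l (T h) (\<lambda>x. T f x - T f1 x)" unfolding h_def by (intro T_diff l f f1)
      then have "ae_eq l (clip a b (T h)) (\<lambda>x. 0)"
        using f1(2) unfolding ae_eq_def by eventually_elim (auto simp: clip_def)
      then have zh: "ae_eq l (clip a b (P h)) (\<lambda>x. 0)" using ab l by (intro P_vanishes_locally h) auto
      have "ae_eq l (P h) (\<lambda>x. P f x - P f1 x)" unfolding h_def by (intro P_diff l f f1)
      then have "ae_eq l (clip a b (P f)) (clip a b (P f1))"
        using zh unfolding ae_eq_def by eventually_elim (auto simp: clip_def)
      then have n1: "L2_norm l (clip a b (P f)) = L2_norm l (clip a b (P f1))"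
        by (intro L2_norm_cong clipL P_L2 l f f1)
      have s1: "ae_eq l (T f1) (clip a b (T f1))"
        using f1(2) unfolding ae_eq_def by eventually_elim (auto simp: clip_def)
      have n2: "L2_norm l (T f1) = L2_norm l (clip a b (T f))"
        by (intro L2_norm_cong clipL T_L2 l f f1)
      let ?K = "C * (b - a) + (\<Sum>c\<in>UNIV. L2_norm l (clip a b (\<beta> c)) * L2_norm l (clip a b (\<beta> (\<sigma> c))))"
      have n3: "L2_norm l (clip a b (P f)) \<le> ?K * L2_norm l (clip a b (T f))"
        using C(2)[OF ab(1-3) f1(1) s1] by (simp only: n1 n2)
      have K0: "0 \<le> ?K" using C ab by (intro add_nonneg_nonneg sum_nonneg mult_nonneg_nonneg) auto
      have "(\<Sum>c\<in>UNIV. L2_norm l (clip a b (\<beta> c)) * L2_norm l (clip a b (\<beta> (\<sigma> c))))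
          \<le> (\<Sum>c\<in>UNIV. (L2_norm l (clip a b (\<beta> c)))\<^sup>2 + (L2_norm l (clip a b (\<beta> (\<sigma> c))))\<^sup>2)"
      proof (rule sum_mono)
        fix c
        have "0 \<le> L2_norm l (clip a b (\<beta> c)) * L2_norm l (clip a b (\<beta> (\<sigma> c)))" by simp
        then show "L2_norm l (clip a b (\<beta> c)) * L2_norm l (clip a b (\<beta> (\<sigma> c))) \<le> (L2_norm l (clip a b (\<beta> c)))\<^sup>2 + (L2_norm l (clip a b (\<beta> (\<sigma> c))))\<^sup>2"
          using sum_squares_bound[of "L2_norm l (clip a b (\<beta> c))" "L2_norm l (clip a b (\<beta> (\<sigma> c)))"] by linarith
      qed
      also have "\<dots> = 2 * (\<Sum>c\<in>UNIV. (L2_norm l (clip a b (\<beta> c)))\<^sup>2)"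
      proof -
        have "(\<Sum>c\<in>UNIV. (L2_norm l (clip a b (\<beta> (\<sigma> c))))\<^sup>2) = (\<Sum>c\<in>UNIV. (L2_norm l (clip a b (\<beta> c)))\<^sup>2)"
          by (rule sum.reindex_bij_witness[of _ \<sigma> \<sigma>]) (auto simp: \<sigma>)
        then show ?thesis by (simp add: sum.distrib)
      qed
      also have "\<dots> = 2 * (B b - B a)"
        using ab by (simp add: L2_norm_cut_sq[OF \<beta>_L2] B_def sum_subtractf)
      finally have "?K \<le> sqrt \<epsilon>"
        using \<eta>(2)[OF ab(1) less_imp_le[OF ab(2)] ab(3,4)] by (simp add: algebra_simps)
      then have "L2_norm l (clip a b (P f)) \<le> sqrt \<epsilon> * L2_norm l (clip a b (T f))"
        using n3 by (meson L2_norm_nonneg mult_right_mono order_trans)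
      then have "(L2_norm l (clip a b (P f)))\<^sup>2 \<le> (sqrt \<epsilon> * L2_norm l (clip a b (T f)))\<^sup>2" by (intro power_mono) auto
      then show ?thesis
        using ab \<open>0 < \<epsilon>\<close> by (simp add: power_mult_distrib L2_norm_cut_sq[OF PfL] L2_norm_cut_sq[OF TfL])
    qed
    then show "\<exists>\<eta>>0. \<forall>a b. 0 \<le> a \<longrightarrow> a < b \<longrightarrow> b \<le> l \<longrightarrow> b - a < \<eta> \<longrightarrow>
        (L2_norm b (P f))\<^sup>2 - (L2_norm a (P f))\<^sup>2 \<le> \<epsilon> * ((L2_norm b (T f))\<^sup>2 - (L2_norm a (T f))\<^sup>2)"
      using \<eta>(1) by blast
  qed
  then have "L2_norm l (P f) = 0" by simp
  then have "ae_eq l (P f) (\<lambda>x. 0)" using L2_norm_zero_iff[OF PfL] by simp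
  then show ?thesis unfolding ae_eq_def P_def by (rule eventually_mono) simp
qed

end

section \<open>The resolvent of the integration operator\<close>

lemma integrable_continuous_mult:
  fixes c f :: "real \<Rightarrow> complex"
  assumes "continuous_on {0..l} c" "integrable (Il l) f"
  shows "integrable (Il l) (\<lambda>x. c x * f x)"
proof -
  obtain C where C: "\<forall>y\<in>c ` {0..l}. cmod y \<le> C"
    using compact_imp_bounded[OF compact_continuous_image[OF assms(1) compact_Icc]] unfolding bounded_iff by blast
  show ?thesis
  proof (rule Bochner_Integration.integrable_bound)
    show "integrable (Il l) (\<lambda>x. C * norm (f x))" using assms by (intro integrable_mult_right integrable_norm)
    show "(\<lambda>x. c x * f x) \<in> borel_measurable (Il l)"
      by (rule borel_measurable_times[OF borel_measurable_Il_continuous[OF assms(1)] borel_measurable_integrable[OF assms(2)]])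
    show "AE x in Il l. norm (c x * f x) \<le> norm (C * norm (f x))"
    proof (rule AE_I2)
      fix x assume "x \<in> space (Il l)"
      then have "cmod (c x) \<le> C" using C by auto
      then have "cmod (c x) \<le> \<bar>C\<bar>" by simp
      then show "norm (c x * f x) \<le> norm (C * norm (f x))" by (simp add: norm_mult abs_mult mult_right_mono)
    qed
  qed
qed

lemma integrable_Il_subset:
  fixes f :: "real \<Rightarrow> 'b::euclidean_space"
  assumes "integrable (Il l) f" "x \<le> l" shows "integrable (Il x) f"
  using assms unfolding Ioo_integrable_iff by (elim set_integrable_subset) auto

lemma integral_exp_Il:
  assumes "0 \<le> t" shows "(LINT s|Il t. c * exp (c * complex_of_real s)) = exp (c * complex_of_real t) - 1"
proof -
  have c: "continuous_on {0..t} (\<lambda>s. c * exp (c * complex_of_real s))" by (intro continuous_intros)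
  have i: "integrable (Il t) (\<lambda>s. c * exp (c * complex_of_real s))"
    unfolding Ioo_integrable_iff using absolutely_integrable_continuous_real[OF c] .
  have "((\<lambda>s. c * exp (c * complex_of_real s)) has_integral (exp (c * complex_of_real t) - exp (c * complex_of_real 0))) {0..t}"
  proof (rule fundamental_theorem_of_calculus[OF assms])
    fix x
    have "((\<lambda>s. exp (c * s)) has_field_derivative (c * exp (c * complex_of_real x))) (at (complex_of_real x))"
      by (auto intro!: derivative_eq_intros)
    then show "((\<lambda>s. exp (c * complex_of_real s)) has_vector_derivative c * exp (c * complex_of_real x)) (at x within {0..t})"
      by (rule has_vector_derivative_real_field)
  qed
  from Ioo_integral[OF i] integral_unique[OF this] show ?thesis
    by (simp only: of_real_0 mult_zero_right exp_zero)
qed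

text \<open>Variation of constants for f = h + c \<integral> f, the integral being over (0,
  x).\<close>

definition resolv :: "complex \<Rightarrow> (real \<Rightarrow> complex) \<Rightarrow> real \<Rightarrow> complex" where
  "resolv c h x = h x + c * exp (c * of_real x) * (LINT t|Il x. exp (- c * of_real t) * h t)"

text \<open>The right side is the known solution for the primitive of the resolvent; it is verified
  by integrating by parts the product of the primitives of c exp (c t) and exp (-c t) h(t).\<close>

lemma resolv_integral:
  assumes h: "integrable (Il x) h"
  shows "(LINT t|Il x. resolv c h t) = exp (c * of_real x) * (LINT t|Il x. exp (- c * of_real t) * h t)"
proof (cases "0 \<le> x")
  case False
  then have "{0<..<x} = {}" by auto
  then show ?thesis by simp
next
  case True
  define a where "a t = c * exp (c * of_real t)" for t :: real
  define b where "b t = exp (- c * of_real t) * h t" for t :: real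
  have ai: "integrable (Il x) a"
    unfolding a_def Ioo_integrable_iff by (intro absolutely_integrable_continuous_real continuous_intros)
  have bi: "integrable (Il x) b" unfolding b_def by (intro integrable_continuous_mult h continuous_intros)
  have "(LINT t|Il x. b t * (LINT s|Il t. a s)) = (LINT t|Il x. h t - b t)"
  proof (rule Bochner_Integration.integral_cong[OF refl])
    fix t assume "t \<in> space (Il x)"
    then have "0 \<le> t" by simp
    have e: "exp (- (c * of_real t)) * exp (c * of_real t) = (1 :: complex)" by (simp flip: exp_add)
    have A: "(LINT s|Il t. a s) = exp (c * of_real t) - 1"
      unfolding a_def by (rule integral_exp_Il[OF \<open>0 \<le> t\<close>])
    show "b t * (LINT s|Il t. a s) = h t - b t"
      unfolding A using e by (simp add: b_def algebra_simps)
  qed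
  also have "\<dots> = (LINT t|Il x. h t) - (LINT t|Il x. b t)" using h bi by simp
  finally have 1: "(LINT t|Il x. b t * (LINT s|Il t. a s)) = (LINT t|Il x. h t) - (LINT t|Il x. b t)" .
  have "(LINT t|Il x. resolv c h t) = (LINT t|Il x. h t + a t * (LINT s|Il t. b s))"
    by (simp add: resolv_def a_def b_def)
  also have "\<dots> = (LINT t|Il x. h t) + (LINT t|Il x. a t * (LINT s|Il t. b s))"
    using h integral_product_rule(2)[OF ai bi] by simp
  also have "\<dots> = (LINT t|Il x. b t) + (LINT t|Il x. a t) * (LINT t|Il x. b t)"
    using integral_product_rule(1)[OF ai bi] 1 by (simp add: algebra_simps)
  also have "(LINT t|Il x. a t) = exp (c * of_real x) - 1"
    unfolding a_def by (rule integral_exp_Il[OF True])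
  finally show ?thesis by (simp add: b_def algebra_simps)
qed

lemma resolv_eq:
  assumes "integrable (Il x) h" shows "resolv c h x = h x + c * (LINT t|Il x. resolv c h t)"
  unfolding resolv_integral[OF assms] by (simp add: resolv_def)

text \<open>Uniqueness by the integrating factor exp (-c x): integration by parts yields exp (-c x)
  F(x) = 0 for the primitive F of f.\<close>

lemma Volterra_unique:
  fixes f :: "real \<Rightarrow> complex"
  assumes f: "integrable (Il l) f" and eq: "AE x in Il l. f x = c * (LINT t|Il x. f t)"
  shows "AE x in Il l. f x = 0"
proof -
  have F0: "(LINT t|Il x. f t) = 0" if x: "0 < x" "x < l" for x
  proof -
    have fx: "integrable (Il x) f" using integrable_Il_subset[OF f] x by simp
    \<comment> \<open>The derivative of the integrating factor exp (-c t).\<close>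
    define a where "a t = - c * exp (- c * of_real t)" for t :: real
    have ai: "integrable (Il x) a"
      unfolding a_def Ioo_integrable_iff by (intro absolutely_integrable_continuous_real continuous_intros)
    define e where "e t = exp (- c * complex_of_real t) * f t" for t
    have ei: "integrable (Il x) e"
      unfolding e_def by (intro integrable_continuous_mult fx continuous_intros)
    have eqx: "AE t in Il x. f t = c * (LINT s|Il t. f s)"
      using AE_Il_mono[OF eq] x by simp
    have 1: "(LINT t|Il x. a t * (LINT s|Il t. f s)) = (LINT t|Il x. - e t)"
    proof (rule integral_cong_AE)
      show "AE t in Il x. a t * (LINT s|Il t. f s) = - e t"
        using eqx by (rule eventually_mono) (simp add: a_def e_def)
    qed (use integral_product_rule(2)[OF ai fx] ei in auto)
    have 2: "(LINT t|Il x. f t * (LINT s|Il t. a s)) = (LINT t|Il x. e t - f t)"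
    proof (rule Bochner_Integration.integral_cong[OF refl])
      fix t assume "t \<in> space (Il x)"
      then have "0 \<le> t" by simp
      then have A: "(LINT s|Il t. a s) = exp (- c * of_real t) - 1"
        unfolding a_def by (rule integral_exp_Il)
      show "f t * (LINT s|Il t. a s) = e t - f t"
        unfolding A by (simp add: e_def algebra_simps)
    qed
    have 3: "(LINT t|Il x. a t) = exp (- c * of_real x) - 1"
      unfolding a_def by (rule integral_exp_Il) (use x in simp)
    have "- (LINT t|Il x. f t) = (exp (- c * of_real x) - 1) * (LINT t|Il x. f t)"
      using integral_product_rule(1)[OF ai fx] ei fx unfolding 1 2 3 by simp
    then show ?thesis by (simp add: algebra_simps)
  qed
  show ?thesis using eq AE_space by eventually_elim (simp add: F0)
qed

text \<open>The inverse of I - z A, which acts on component i alone, with c = i z d_i.\<close>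

definition resolvent :: "real^'p \<Rightarrow> complex \<Rightarrow> ('p::finite) vfun \<Rightarrow> 'p vfun" where
  "resolvent d z h x = (\<chi> i. resolv (z * \<i> * of_real (d $ i)) (\<lambda>t. h t $ i) x)"

lemma resolvent_diff_continuous:
  assumes "h \<in> L2 l"
  shows "continuous_on {0..l} (\<lambda>x. resolvent d z h x - h x)"
proof -
  have "continuous_on {0..l} (\<lambda>x. (\<chi> i. z * \<i> * of_real (d $ i) * exp (z * \<i> * of_real (d $ i) * of_real x)
      * (LINT t|Il x. exp (- (z * \<i> * of_real (d $ i)) * of_real t) * h t $ i)))"
    by (intro continuous_on_vec_lambda continuous_intros continuous_on_Il_integral integrable_continuous_mult
        integrable_vec_nth L2_integrable assms)
  moreover have "resolvent d z h x - h x = (\<chi> i. z * \<i> * of_real (d $ i) * exp (z * \<i> * of_real (d $ i) * of_real x)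
      * (LINT t|Il x. exp (- (z * \<i> * of_real (d $ i)) * of_real t) * h t $ i))" for x
    by (simp add: resolvent_def resolv_def vec_eq_iff)
  ultimately show ?thesis by simp
qed

lemma L2_continuous:
  assumes "continuous_on {0..l} f" shows "f \<in> L2 l"
proof -
  obtain C where "\<forall>y\<in>f ` {0..l}. norm y \<le> C"
    using compact_imp_bounded[OF compact_continuous_image[OF assms compact_Icc]] unfolding bounded_iff by blast
  then show ?thesis
    by (intro L2_bound[of _ _ "\<lambda>x. C\<^sup>2"] borel_measurable_Il_continuous assms finite_measure.integrable_const finite_measure_Il AE_I2 power_mono) auto
qed

lemma resolvent_L2:
  assumes "h \<in> L2 l" shows "resolvent d z h \<in> L2 l"
  using L2_add[OF L2_continuous[OF resolvent_diff_continuous[OF assms]] assms, of d z] by simp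

lemma resolvent_eq:
  assumes h: "h \<in> L2 l" and x: "x \<le> l"
  shows "resolvent d z h x = h x + z *s A_op d (resolvent d z h) x"
  unfolding vec_eq_iff
proof
  fix i
  have "integrable (Il x) (\<lambda>t. h t $ i)" by (rule L2_component_integrable[OF h x])
  from resolv_eq[OF this, of "z * \<i> * of_real (d $ i)"]
  show "resolvent d z h x $ i = (h x + z *s A_op d (resolvent d z h) x) $ i"
    by (simp add: resolvent_def A_op_def mult.assoc)
qed

text \<open>Functions are recognized as resolvents by the equation they satisfy rather than by the
  explicit formula: so are linear combinations, the exponentials and the images \<open>gN\<close>
  below.\<close>

lemma resolvent_unique:
  assumes h: "h \<in> L2 l" and f: "f \<in> L2 l" and eq: "ae_eq l f (\<lambda>x. h x + z *s A_op d f x)"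
  shows "ae_eq l f (resolvent d z h)"
proof -
  define g where "g = (\<lambda>x. f x - resolvent d z h x)"
  have g: "g \<in> L2 l" unfolding g_def by (intro L2_diff f resolvent_L2 h)
  have "AE x in Il l. g x $ i = z * \<i> * of_real (d $ i) * (LINT t|Il x. g t $ i)" for i
  proof -
    have "AE x in Il l. g x = z *s A_op d g x"
      using eq AE_space unfolding ae_eq_def
    proof eventually_elim
      case (elim x)
      then have x: "x \<le> l" by simp
      have "A_op d g x = A_op d f x - A_op d (resolvent d z h) x"
        unfolding g_def by (rule A_op_diff[OF f resolvent_L2[OF h] x])
      then have A: "A_op d f x = A_op d g x + A_op d (resolvent d z h) x" by simp
      have R: "resolvent d z h x = h x + z *s A_op d (resolvent d z h) x" by (rule resolvent_eq[OF h x])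
      have "f x = h x + z *s A_op d f x" using elim by simp
      then show ?case
        unfolding A g_def[THEN fun_cong] using R by (simp add: vec_eq_iff algebra_simps)
    qed
    then show ?thesis by (rule eventually_mono) (simp add: vec_eq_iff A_op_def mult.assoc)
  qed
  then have "AE x in Il l. g x $ i = 0" for i
    by (intro Volterra_unique[of l "\<lambda>x. g x $ i"] integrable_vec_nth L2_integrable g)
  then have "AE x in Il l. \<forall>i\<in>UNIV. g x $ i = 0" by (intro AE_finite_allI) auto
  then show ?thesis unfolding ae_eq_def by (rule eventually_mono) (simp add: vec_eq_iff g_def)
qed

text \<open>Crude exponentials in l are harmless, since the bound is applied for fixed l while the
  argument tends to zero.\<close>

lemma resolvent_bound:
  assumes l: "0 \<le> l"
  obtains C where "0 \<le> C" "\<And>h. h \<in> L2 l \<Longrightarrow> L2_norm l (resolvent d z h) \<le> C * L2_norm l h"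
proof -
  define c where "c i = z * \<i> * of_real (d $ i)" for i
  define K where "K = (\<Sum>i\<in>UNIV. cmod (c i) * exp (2 * cmod (c i) * l)) * sqrt l"
  have K0: "0 \<le> K" unfolding K_def using l by (intro mult_nonneg_nonneg sum_nonneg) auto
  have e: "cmod (exp (c i * of_real x)) \<le> exp (cmod (c i) * l)" "cmod (exp (- c i * of_real x)) \<le> exp (cmod (c i) * l)"
    if "0 \<le> x" "x \<le> l" for x i
  proof -
    have "cmod (c i * of_real x) \<le> cmod (c i) * l" "cmod (- c i * of_real x) \<le> cmod (c i) * l"
      using that by (simp_all add: norm_mult mult_left_mono)
    then show "cmod (exp (c i * of_real x)) \<le> exp (cmod (c i) * l)" "cmod (exp (- c i * of_real x)) \<le> exp (cmod (c i) * l)"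
      using norm_exp[of "c i * of_real x"] norm_exp[of "- c i * of_real x"] by (meson exp_le_cancel_iff order_trans)+
  qed
  show thesis
  proof (rule that[of "K * sqrt l + 1"])
    show "0 \<le> K * sqrt l + 1" using K0 l by simp
    fix h :: "'a vfun" assume h: "h \<in> L2 l"
    have h1: "(LINT t|Il l. norm (h t)) \<le> sqrt l * L2_norm l h"
    proof -
      have m: "(\<lambda>t. norm (h t)) \<in> borel_measurable (Il l)" using L2_measurable[OF h] by measurable
      have "integrable (Il l) (\<lambda>t. (1::real)\<^sup>2)" by (intro finite_measure.integrable_const finite_measure_Il)
      from real_Cauchy_Schwarz(2)[OF _ this m L2_integrable_sq[OF h]]
      show ?thesis using l by (simp add: L2_norm_def measure_restrict_space)
    qed
    have pw: "norm (resolvent d z h x - h x) \<le> K * L2_norm l h" if x: "0 < x" "x < l" for x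
    proof -
      have comp: "cmod ((resolvent d z h x - h x) $ i) \<le> cmod (c i) * exp (2 * cmod (c i) * l) * (sqrt l * L2_norm l h)" for i
      proof -
        have "cmod (LINT t|Il x. exp (- c i * of_real t) * h t $ i) \<le> (LINT t|Il x. exp (cmod (c i) * l) * norm (h t))"
        proof (rule order_trans[OF integral_norm_bound integral_mono])
          show "integrable (Il x) (\<lambda>t. norm (exp (- c i * of_real t) * h t $ i))"
            using x by (intro integrable_norm integrable_continuous_mult continuous_intros L2_component_integrable[OF h]) auto
          show "integrable (Il x) (\<lambda>t. exp (cmod (c i) * l) * norm (h t))"
            using x by (intro integrable_mult_right integrable_norm L2_integrable L2_restrict[OF h]) auto
          fix t assume "t \<in> space (Il x)"
          then show "norm (exp (- c i * of_real t) * h t $ i) \<le> exp (cmod (c i) * l) * norm (h t)"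
            unfolding norm_mult using e(2)[of t i] x by (intro mult_mono Finite_Cartesian_Product.norm_nth_le) auto
        qed
        also have "\<dots> = exp (cmod (c i) * l) * (LINT t|Il x. norm (h t))" by simp
        also have "\<dots> \<le> exp (cmod (c i) * l) * (LINT t|Il l. norm (h t))"
        proof (rule mult_left_mono)
          have hi: "integrable (Il l) (\<lambda>t. norm (h t))" by (intro integrable_norm L2_integrable h)
          show "(LINT t|Il x. norm (h t)) \<le> (LINT t|Il l. norm (h t))"
            using x by (subst Il_sub_integral[of x l]) (auto intro!: integral_mono integrable_Il_if hi)
        qed simp
        also have "\<dots> \<le> exp (cmod (c i) * l) * (sqrt l * L2_norm l h)" by (intro mult_left_mono h1) simp
        finally have b: "cmod (LINT t|Il x. exp (- c i * of_real t) * h t $ i) \<le> exp (cmod (c i) * l) * (sqrt l * L2_norm l h)" .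
        have "cmod ((resolvent d z h x - h x) $ i)
            = cmod (c i) * cmod (exp (c i * of_real x)) * cmod (LINT t|Il x. exp (- c i * of_real t) * h t $ i)"
          by (simp add: resolvent_def resolv_def c_def[symmetric] norm_mult)
        also have "\<dots> \<le> cmod (c i) * exp (cmod (c i) * l) * (exp (cmod (c i) * l) * (sqrt l * L2_norm l h))"
          using e(1)[of x i] x l by (intro mult_mono b) auto
        also have "\<dots> = cmod (c i) * exp (2 * cmod (c i) * l) * (sqrt l * L2_norm l h)"
        proof -
          have "exp (2 * cmod (c i) * l) = exp (cmod (c i) * l) * exp (cmod (c i) * l)" by (simp flip: exp_add)
          then show ?thesis by simp
        qed
        finally show ?thesis .
      qed
      have "norm (resolvent d z h x - h x) \<le> (\<Sum>i\<in>UNIV. cmod ((resolvent d z h x - h x) $ i))"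
        unfolding norm_vec_def by (rule L2_set_le_sum) simp
      also have "\<dots> \<le> (\<Sum>i\<in>UNIV. cmod (c i) * exp (2 * cmod (c i) * l) * (sqrt l * L2_norm l h))"
        by (rule sum_mono[OF comp])
      also have "\<dots> = K * L2_norm l h" by (simp add: K_def sum_distrib_right mult.assoc)
      finally show ?thesis .
    qed
    define r where "r = (\<lambda>x. resolvent d z h x - h x)"
    have rL: "r \<in> L2 l" unfolding r_def by (intro L2_diff resolvent_L2 h)
    have "(L2_norm l r)\<^sup>2 \<le> (LINT x|Il l. (K * L2_norm l h)\<^sup>2)"
      unfolding L2_norm_sq[of l r]
    proof (rule integral_mono)
      show "integrable (Il l) (\<lambda>x. (K * L2_norm l h)\<^sup>2)" by (intro finite_measure.integrable_const finite_measure_Il)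
    qed (use pw L2_integrable_sq[OF rL] in \<open>auto simp: r_def intro!: power_mono\<close>)
    also have "\<dots> = (K * sqrt l * L2_norm l h)\<^sup>2"
      using l by (simp add: power_mult_distrib measure_restrict_space)
    finally have "L2_norm l r \<le> K * sqrt l * L2_norm l h"
      by (rule power2_le_imp_le) (use K0 l in auto)
    moreover have "L2_norm l (resolvent d z h) \<le> L2_norm l r + L2_norm l h"
      using L2_norm_triangle[OF rL h] by (simp add: r_def)
    ultimately show "L2_norm l (resolvent d z h) \<le> (K * sqrt l + 1) * L2_norm l h" by (simp add: algebra_simps)
  qed
qed

section \<open>The operator identity\<close>

text \<open>Integrability of u and of its reflection on (0, M): the hermitian symmetry of k supplies
  the second from the first.\<close>

lemma loc_intI:
  fixes u :: "real \<Rightarrow> complex"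
  assumes "\<And>M. integrable (Il M) u" "\<And>M. integrable (Il M) (\<lambda>x. u (- x))"
  shows "loc_int u"
  unfolding loc_int_def
proof (intro allI)
  fix a b :: real
  define M where "M = \<bar>a\<bar> + \<bar>b\<bar>"
  have 1: "u absolutely_integrable_on {0..M}" using assms(1) by (simp add: Ioo_integrable_iff)
  have "(\<lambda>x. u (- x)) absolutely_integrable_on {0..M}" using assms(2) by (simp add: Ioo_integrable_iff)
  then have 2: "u absolutely_integrable_on {-M..0}"
    using absolutely_integrable_reflect_real[of 0 "-M" u] by simp
  have "u absolutely_integrable_on ({-M..0} \<union> {0..M})"
    by (rule absolutely_integrable_Un[OF 2 1])
  then have "u absolutely_integrable_on {a..b}"
    by (rule set_integrable_subset) (auto simp: M_def)
  then show "integrable (lebesgue_on {a<..<b}) u" by (simp add: Ioo_integrable_iff)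
qed

lemma bounded_linear_matrix_nth: "bounded_linear (\<lambda>A :: complex^'p::finite^'q::finite. A $ i $ j)"
  using bounded_linear_compose[OF bounded_linear_vec_nth[of j] bounded_linear_vec_nth[of i]] by simp

lemma norm_matrix_nth_le: "norm (A $ i $ j) \<le> norm A" for A :: "complex^'p::finite^'q::finite"
  by (meson Finite_Cartesian_Product.norm_nth_le order_trans)

lemma norm_matrix_le: "norm A \<le> (\<Sum>i\<in>UNIV. \<Sum>j\<in>UNIV. norm (A $ i $ j))" for A :: "complex^'p::finite^'q::finite"
proof -
  have "norm A \<le> (\<Sum>i\<in>UNIV. norm (A $ i))" unfolding norm_vec_def[of A] by (rule L2_set_le_sum) simp
  also have "\<dots> \<le> (\<Sum>i\<in>UNIV. \<Sum>j\<in>UNIV. norm (A $ i $ j))"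
    unfolding norm_vec_def[of "A $ _"] by (intro sum_mono L2_set_le_sum) simp
  finally show ?thesis .
qed

lemma borel_measurable_matrixI:
  fixes f :: "'a \<Rightarrow> complex^'p::finite^'q::finite"
  assumes "\<And>i j. (\<lambda>x. f x $ i $ j) \<in> borel_measurable M"
  shows "f \<in> borel_measurable M"
proof -
  have "(\<lambda>x. f x \<bullet> b) \<in> borel_measurable M" if b: "b \<in> Basis" for b
  proof -
    from b obtain i u where b: "b = axis i u" "u \<in> Basis" by (auto simp: Basis_vec_def)
    have "(\<lambda>x. f x $ i) \<in> borel_measurable M" using assms by (rule borel_measurable_vecI)
    then have "(\<lambda>x. f x $ i \<bullet> u) \<in> borel_measurable M" by measurable
    then show ?thesis using b by (simp add: inner_axis)
  qed
  then show ?thesis using borel_measurable_euclidean_space[of f M] by blast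
qed

lemma integrable_matrixI:
  fixes f :: "'a \<Rightarrow> complex^'p::finite^'q::finite"
  assumes "\<And>i j. integrable M (\<lambda>x. f x $ i $ j)"
  shows "integrable M f"
proof (rule Bochner_Integration.integrable_bound)
  show "integrable M (\<lambda>x. \<Sum>i\<in>UNIV. \<Sum>j\<in>UNIV. norm (f x $ i $ j))"
    using assms by (intro Bochner_Integration.integrable_sum integrable_norm)
  show "f \<in> borel_measurable M" using assms by (intro borel_measurable_matrixI borel_measurable_integrable)
  show "AE x in M. norm (f x) \<le> norm (\<Sum>i\<in>UNIV. \<Sum>j\<in>UNIV. norm (f x $ i $ j))"
    using norm_matrix_le by (auto simp: sum_nonneg intro!: AE_I2)
qed

lemma integrable_matrix_nth:
  fixes f :: "'a \<Rightarrow> complex^'p::finite^'q::finite"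
  shows "integrable M f \<Longrightarrow> integrable M (\<lambda>x. f x $ i $ j)"
  using integrable_bounded_linear[OF bounded_linear_matrix_nth] by blast

lemma integral_matrix_nth:
  fixes f :: "'a \<Rightarrow> complex^'p::finite^'q::finite"
  assumes "integrable M f"
  shows "(LINT x|M. f x) $ i $ j = (LINT x|M. f x $ i $ j)"
  using integral_bounded_linear[OF bounded_linear_matrix_nth assms] by simp

lemma diag_mat_mult_nth: "(diag_mat d ** M) $ i $ j = of_real (d $ i) * M $ i $ j"
  for M :: "complex^'q::finite^'p::finite"
  by (simp add: diag_mat_def matrix_matrix_mult_def if_distrib[of "\<lambda>c. c * _"] cong: if_cong)

lemma mat_mult_nth: "(mat c ** M) $ i $ j = c * M $ i $ j"
  for M :: "complex^'q::finite^'p::finite"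
  by (simp add: mat_def matrix_matrix_mult_def if_distrib[of "\<lambda>c. c * _"] cong: if_cong)

lemma matrix_inv_eqI:
  fixes A B :: "complex^'p::finite^'p"
  assumes "A ** B = mat 1" "B ** A = mat 1" shows "matrix_inv A = B"
proof -
  have "A ** matrix_inv A = mat 1 \<and> matrix_inv A ** A = mat 1"
    unfolding matrix_inv_def by (rule someI[of _ B]) (use assms in simp)
  then have "matrix_inv A = (B ** A) ** matrix_inv A" "B ** (A ** matrix_inv A) = B" using assms by simp_all
  then show ?thesis by (simp add: matrix_mul_assoc)
qed

lemma matrix_inv_abs_diag:
  fixes M :: "complex^'q::finite^'p::finite"
  assumes "\<And>i. d $ i < 0"
  shows "(matrix_inv (abs_diag d) ** M) $ i $ j = M $ i $ j / of_real \<bar>d $ i\<bar>"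
proof -
  have m: "diag_mat a ** diag_mat b = (diag_mat (\<chi> i. a $ i * b $ i) :: complex^'p^'p)" for a b :: "real^'p"
    by (simp add: vec_eq_iff diag_mat_mult_nth) (simp add: diag_mat_def)
  let ?e = "(\<chi> i. 1 / \<bar>d $ i\<bar>) :: real^'p"
  have one: "diag_mat (\<chi> i. 1) = (mat 1 :: complex^'p^'p)" by (simp add: diag_mat_def mat_def vec_eq_iff)
  have "abs_diag d ** diag_mat ?e = mat 1" "diag_mat ?e ** abs_diag d = mat 1"
    unfolding abs_diag_def m using assms less_imp_neq[OF assms] by (simp_all add: one)
  then have "matrix_inv (abs_diag d) = diag_mat ?e" by (rule matrix_inv_eqI)
  then show ?thesis by (simp add: diag_mat_mult_nth)
qed

section \<open>The kernel k, its primitives and the columns of \<Pi>\<close>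

locale hermitian_kernel =
  fixes d :: "real^'p::finite" and k :: "real \<Rightarrow> complex^'p^'p"
  assumes d_neg: "\<And>i. d $ i < 0"
    and k_L2: "\<And>l. 0 < l \<Longrightarrow> sq_integrable_on k {0<..<l}"
    and k_hermitian: "\<And>x. k (- x) = ctranspose (k x)"
begin

text \<open>Positive parameters: the argument d_j t - d_i x of the kernel becomes \<delta>_i x -
  \<delta>_j t.\<close>

definition \<delta> :: "'p \<Rightarrow> real" where "\<delta> i = - d $ i"

lemma \<delta>_pos: "0 < \<delta> i" using d_neg[of i] by (simp add: \<delta>_def)

lemma d_eq: "d $ i = - \<delta> i" by (simp add: \<delta>_def)

definition \<kappa> :: "'p \<Rightarrow> 'p \<Rightarrow> real \<Rightarrow> complex" where "\<kappa> i j x = k x $ i $ j"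

abbreviation K :: "'p \<Rightarrow> 'p \<Rightarrow> real \<Rightarrow> complex" where "K i j \<equiv> prim (\<kappa> i j)"

lemma \<kappa>_uminus: "\<kappa> i j (- x) = cnj (\<kappa> j i x)"
  by (simp add: \<kappa>_def k_hermitian ctranspose_def)

lemma \<kappa>_Il_pos:
  assumes M: "0 < M"
  shows "integrable (Il M) (\<lambda>x. complex_of_real ((cmod (\<kappa> i j x))\<^sup>2))" and "integrable (Il M) (\<kappa> i j)"
proof -
  have k: "k \<in> borel_measurable (Il M)" "integrable (Il M) (\<lambda>x. (norm (k x))\<^sup>2)"
    using k_L2[OF M] unfolding sq_integrable_on_def by blast+
  have m: "\<kappa> i j \<in> borel_measurable (Il M)"
    unfolding \<kappa>_def
    by (rule borel_measurable_continuous_on[OF linear_continuous_on[OF bounded_linear_matrix_nth] k(1)])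
  have le: "cmod (\<kappa> i j x) \<le> norm (k x)" for x unfolding \<kappa>_def by (rule norm_matrix_nth_le)
  have "integrable (Il M) (\<lambda>x. (cmod (\<kappa> i j x))\<^sup>2)"
  proof (rule Bochner_Integration.integrable_bound[OF k(2)])
    show "(\<lambda>x. (cmod (\<kappa> i j x))\<^sup>2) \<in> borel_measurable (Il M)" using m by measurable
  qed (use le in \<open>auto intro!: power_mono\<close>)
  then show "integrable (Il M) (\<lambda>x. complex_of_real ((cmod (\<kappa> i j x))\<^sup>2))" by (rule integrable_of_real)
  show "integrable (Il M) (\<kappa> i j)"
  proof (rule Bochner_Integration.integrable_bound)
    show "integrable (Il M) (\<lambda>x. (norm (k x))\<^sup>2 + 1)"
      by (intro Bochner_Integration.integrable_add k finite_measure.integrable_const finite_measure_Il)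
    have "norm (\<kappa> i j x) \<le> norm ((norm (k x))\<^sup>2 + 1)" for x
    proof -
      have "norm (\<kappa> i j x) \<le> (norm (k x))\<^sup>2 + 1"
        using le[of x] sum_squares_bound[of "norm (k x)" 1] norm_ge_zero[of "k x"]
        unfolding mult_1_right power_one by linarith
      then show ?thesis by simp
    qed
    then show "AE x in Il M. norm (\<kappa> i j x) \<le> norm ((norm (k x))\<^sup>2 + 1)" by simp
  qed (rule m)
qed

lemma \<kappa>_Il:
  shows "integrable (Il M) (\<lambda>x. complex_of_real ((cmod (\<kappa> i j x))\<^sup>2))" and "integrable (Il M) (\<kappa> i j)"
  by (rule integrable_Il_subset[of "max M 1"], rule \<kappa>_Il_pos, simp_all)+

lemma \<kappa>_loc: "loc_int (\<kappa> i j)"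
proof (rule loc_intI)
  fix M
  show "integrable (Il M) (\<kappa> i j)" by (rule \<kappa>_Il)
  show "integrable (Il M) (\<lambda>x. \<kappa> i j (- x))" unfolding \<kappa>_uminus using \<kappa>_Il(2) by (rule integrable_cnj)
qed

text \<open>The square is regarded as complex-valued so that the affine substitution for
  \<open>loc_int\<close> functions applies to it.\<close>

lemma \<kappa>_sq_loc: "loc_int (\<lambda>x. complex_of_real ((cmod (\<kappa> i j x))\<^sup>2))"
proof (rule loc_intI)
  fix M
  show "integrable (Il M) (\<lambda>x. complex_of_real ((cmod (\<kappa> i j x))\<^sup>2))" by (rule \<kappa>_Il)
  show "integrable (Il M) (\<lambda>x. complex_of_real ((cmod (\<kappa> i j (- x)))\<^sup>2))"
    unfolding \<kappa>_uminus complex_mod_cnj by (rule \<kappa>_Il)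
qed

lemma K_continuous: "continuous_on A (K i j)"
  using continuous_on_subset[OF prim_continuous[OF \<kappa>_loc]] by blast

text \<open>Reflection of the integration variable produces the minus sign, and k(-x) = k(x)* the
  conjugate and the exchanged indices. The rule brings A S and its adjoint to common terms.\<close>

lemma K_uminus: "K i j (- x) = - cnj (K j i x)"
proof -
  have nonneg: "K i j (- x) = - cnj (K j i x)" if "0 \<le> x" for x i j
  proof -
    have "K i j (- x) = - integral {-x..0} (\<kappa> i j)"
      using that by (cases "x = 0") (auto simp: prim_def)
    also have "integral {-x..0} (\<kappa> i j) = integral {0..x} (\<lambda>x. \<kappa> i j (- x))"
      using Henstock_Kurzweil_Integration.integral_reflect_real[where f="\<kappa> i j" and a="-x" and b=0] by simp
    also have "\<dots> = cnj (integral {0..x} (\<kappa> j i))"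
      unfolding \<kappa>_uminus using integral_cnj[of "{0..x}" "\<kappa> j i"] by simp
    also have "integral {0..x} (\<kappa> j i) = K j i x" using that by (cases "x = 0") (auto simp: prim_def)
    finally show ?thesis .
  qed
  show ?thesis
  proof (cases "0 \<le> x")
    case False
    then have "K j i (- (- x)) = - cnj (K i j (- x))" by (intro nonneg) simp
    then have "cnj (K j i x) = - K i j (- x)" by simp
    then show ?thesis by simp
  qed (rule nonneg)
qed

lemma s_fun_nth:
  assumes "0 \<le> x"
  shows "s_fun d k x $ i $ j = (if i = j then 1/2 else 0) + K i j x / of_real (\<delta> i)"
proof -
  have ik: "integrable (Il x) k"
  proof (rule integrable_matrixI)
    fix i j
    have "(\<lambda>x. k x $ i $ j) = \<kappa> i j" by (simp add: \<kappa>_def fun_eq_iff)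
    then show "integrable (Il x) (\<lambda>x. k x $ i $ j)" using \<kappa>_Il(2) by simp
  qed
  have "(LINT t:{0..x}|lebesgue. k t) = integral {0..x} k"
    using ik unfolding Ioo_integrable_iff by (rule set_lebesgue_integral_eq_integral(2))
  also have "\<dots> = (LINT t|Il x. k t)" by (rule Ioo_integral[OF ik, symmetric])
  finally have "(LINT t:{0..x}|lebesgue. k t) $ i $ j = K i j x"
    using integral_matrix_nth[OF ik] prim_nonneg[OF \<kappa>_loc assms, of i j] by (simp add: \<kappa>_def)
  then show ?thesis
    using d_neg[of i] by (simp add: matrix_inv_abs_diag[OF d_neg] s_fun_def mat_def \<delta>_def)
qed

definition Pi_col :: "'p + 'p \<Rightarrow> 'p vfun" where "Pi_col a x = column a (Pi_fun d k x)"

text \<open>The factor D in \<Pi> cancels the inverse of |D| in s up to sign, so K enters without a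
  weight.\<close>

lemma Pi_col_Inl: "0 \<le> x \<Longrightarrow> Pi_col (Inl c) x $ i = - of_real (\<delta> i) * (if i = c then 1/2 else 0) - K i c (\<delta> i * x)"
  using \<delta>_pos[of i] less_imp_neq[OF \<delta>_pos[of i]] d_neg[of i]
  by (simp add: Pi_col_def column_def Pi_fun_def hblock_def diag_mat_mult_nth s_fun_nth d_eq field_simps)

lemma Pi_col_Inr: "Pi_col (Inr c) x = axis c 1"
  by (auto simp: Pi_col_def column_def Pi_fun_def hblock_def mat_def axis_def vec_eq_iff)

lemma Pi_col_L2: "Pi_col a \<in> L2 l"
proof (cases a)
  case (Inr c)
  have "Pi_col (Inr c) = (\<lambda>x. axis c 1)" by (simp add: fun_eq_iff Pi_col_Inr)
  then show ?thesis using L2_const[of "axis c 1"] Inr by simp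
next
  case (Inl c)
  have "continuous_on {0..l} (\<lambda>x. \<chi> i. - of_real (\<delta> i) * (if i = c then 1/2 else 0) - K i c (\<delta> i * x))"
    by (intro continuous_on_vec_lambda continuous_intros continuous_on_compose2[OF K_continuous[of UNIV]]) auto
  then have "(\<lambda>x. \<chi> i. - of_real (\<delta> i) * (if i = c then 1/2 else 0) - K i c (\<delta> i * x)) \<in> L2 l" by (rule L2_continuous)
  then show ?thesis by (rule L2_cong) (simp add: Inl Pi_col_Inl vec_eq_iff)
qed

lemma \<kappa>_mult_integrable:
  assumes c: "c \<noteq> 0" and f: "f \<in> borel_measurable (lebesgue_on {a<..<b})" "integrable (lebesgue_on {a<..<b}) (\<lambda>x. (cmod (f x))\<^sup>2)"
  shows "integrable (lebesgue_on {a<..<b}) (\<lambda>x. \<kappa> i j (e + c * x) * f x)"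
proof (rule Bochner_Integration.integrable_bound)
  have "integrable (lebesgue_on {a<..<b}) (\<lambda>x. complex_of_real ((cmod (\<kappa> i j (e + c * x)))\<^sup>2))"
    by (rule integrable_affine(1)[OF \<kappa>_sq_loc c])
  then have "integrable (lebesgue_on {a<..<b}) (\<lambda>x. (cmod (\<kappa> i j (e + c * x)))\<^sup>2)"
    by (simp only: complex_of_real_integrable_eq)
  with f show "integrable (lebesgue_on {a<..<b}) (\<lambda>x. (cmod (\<kappa> i j (e + c * x)))\<^sup>2 + (cmod (f x))\<^sup>2)" by simp
  show "(\<lambda>x. \<kappa> i j (e + c * x) * f x) \<in> borel_measurable (lebesgue_on {a<..<b})"
    using borel_measurable_integrable[OF integrable_affine(1)[OF \<kappa>_loc c]] f(1) by (rule borel_measurable_times)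
  have "norm (u * v) \<le> norm ((cmod u)\<^sup>2 + (cmod v)\<^sup>2)" for u v
  proof -
    have "0 \<le> cmod u * cmod v" by simp
    then have "cmod u * cmod v \<le> (cmod u)\<^sup>2 + (cmod v)\<^sup>2"
      using sum_squares_bound[of "cmod u" "cmod v"] by linarith
    then show ?thesis by (simp add: norm_mult)
  qed
  then show "AE x in lebesgue_on {a<..<b}. norm (\<kappa> i j (e + c * x) * f x) \<le> norm ((cmod (\<kappa> i j (e + c * x)))\<^sup>2 + (cmod (f x))\<^sup>2)"
    by simp
qed

lemma L2_nth_sq: "f \<in> L2 l \<Longrightarrow> integrable (Il l) (\<lambda>x. (cmod (f x $ i))\<^sup>2)"
proof (rule Bochner_Integration.integrable_bound[OF L2_integrable_sq])
  assume "f \<in> L2 l"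
  then show "(\<lambda>x. (cmod (f x $ i))\<^sup>2) \<in> borel_measurable (Il l)" using L2_measurable[of f l] by measurable
qed (auto intro!: power_mono Finite_Cartesian_Product.norm_nth_le)

lemma L2_nth_measurable: "f \<in> L2 l \<Longrightarrow> (\<lambda>x. f x $ i) \<in> borel_measurable (Il l)"
  using L2_measurable by (rule borel_measurable_vec_nth)

lemma S_op_nth:
  assumes f: "f \<in> L2 l"
  shows "S_op d k l f x $ i = f x $ i + (\<Sum>j\<in>UNIV. LINT t|Il l. \<kappa> i j (\<delta> i * x + - \<delta> j * t) * f t $ j)"
proof -
  have i: "integrable (Il l) (\<lambda>t. \<kappa> i j (\<delta> i * x + - \<delta> j * t) * f t $ j)" for i j
    using \<delta>_pos[of j] by (intro \<kappa>_mult_integrable L2_nth_measurable L2_nth_sq f) simp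
  let ?M = "\<lambda>t. ((\<chi> i j. k (d $ j * t - d $ i * x) $ i $ j) :: complex^'p^'p)"
  have eq: "(?M t *v f t) $ i = (\<Sum>j\<in>UNIV. \<kappa> i j (\<delta> i * x + - \<delta> j * t) * f t $ j)" for t i
    by (simp add: matrix_vector_mult_def \<kappa>_def \<delta>_def algebra_simps)
  have int: "integrable (Il l) (\<lambda>t. ?M t *v f t)"
    using i by (intro integrable_vecI) (simp only: eq, intro Bochner_Integration.integrable_sum)
  have "(LINT t:{0<..<l}|lebesgue. ?M t *v f t) = (LINT t|Il l. ?M t *v f t)"
    unfolding set_lebesgue_integral_def by (rule lebesgue_on_integral_eq[symmetric]) simp
  then have "(LINT t:{0<..<l}|lebesgue. ?M t *v f t) $ i = (LINT t|Il l. (\<Sum>j\<in>UNIV. \<kappa> i j (\<delta> i * x + - \<delta> j * t) * f t $ j))"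
    using integral_vec_nth[OF int] by (simp only: eq)
  also have "\<dots> = (\<Sum>j\<in>UNIV. LINT t|Il l. \<kappa> i j (\<delta> i * x + - \<delta> j * t) * f t $ j)"
    using i by (intro Bochner_Integration.integral_sum)
  finally show ?thesis by (simp add: S_op_def)
qed

text \<open>The integration in A turns \<kappa> into increments of K, and the Jacobian 1 /
  \<delta>_i cancels the factor \<delta>_i of A. Apart from the Volterra term of the identity, the
  result has a continuous kernel.\<close>

lemma A_S_nth:
  assumes f: "f \<in> L2 l" and y: "0 \<le> y" "y \<le> l"
  shows "A_op d (S_op d k l f) y $ i = - \<i> * of_real (\<delta> i) * (LINT t|Il y. f t $ i)
      + (\<Sum>j\<in>UNIV. LINT t|Il l. - \<i> * (K i j (\<delta> i * y - \<delta> j * t) - K i j (- \<delta> j * t)) * f t $ j)"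
proof -
  have fi: "integrable (Il l) (\<lambda>t. f t $ j)" for j by (rule integrable_vec_nth[OF L2_integrable[OF f]])
  have nz: "\<delta> j \<noteq> 0" for j using \<delta>_pos[of j] by simp
  note F = Fubini_convolution[OF \<kappa>_loc nz _ fi, of "- \<delta> j" for j]
  have in1: "integrable (Il y) (\<lambda>x. LINT t|Il l. \<kappa> i j (\<delta> i * x + - \<delta> j * t) * f t $ j)" for j
    using nz by (intro F(2)) simp
  have c1: "(LINT x|Il y. LINT t|Il l. \<kappa> i j (\<delta> i * x + - \<delta> j * t) * f t $ j)
      = (LINT t|Il l. f t $ j * (LINT x|Il y. \<kappa> i j (\<delta> i * x + - \<delta> j * t)))" for j
    using nz by (intro F(1)) simp
  have c2: "(LINT x|Il y. \<kappa> i j (\<delta> i * x + - \<delta> j * t)) = (K i j (\<delta> i * y - \<delta> j * t) - K i j (- \<delta> j * t)) / of_real (\<delta> i)" for j t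
    using integral_affine[OF \<kappa>_loc \<delta>_pos y(1), of i j "- \<delta> j * t" i] by (simp add: add.commute)
  have c: "of_real (\<delta> i) * (LINT x|Il y. LINT t|Il l. \<kappa> i j (\<delta> i * x + - \<delta> j * t) * f t $ j)
      = (LINT t|Il l. (K i j (\<delta> i * y - \<delta> j * t) - K i j (- \<delta> j * t)) * f t $ j)" for j
    unfolding c1 c2 integral_mult_right_zero[symmetric]
    using nz[of i] by (intro Bochner_Integration.integral_cong refl) simp
  have "A_op d (S_op d k l f) y $ i = \<i> * of_real (d $ i) * (LINT x|Il y. f x $ i + (\<Sum>j\<in>UNIV. LINT t|Il l. \<kappa> i j (\<delta> i * x + - \<delta> j * t) * f t $ j))"
    by (simp only: A_op_def S_op_nth[OF f] vec_lambda_beta)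
  also have "(LINT x|Il y. f x $ i + (\<Sum>j\<in>UNIV. LINT t|Il l. \<kappa> i j (\<delta> i * x + - \<delta> j * t) * f t $ j))
      = (LINT x|Il y. f x $ i) + (\<Sum>j\<in>UNIV. LINT x|Il y. LINT t|Il l. \<kappa> i j (\<delta> i * x + - \<delta> j * t) * f t $ j)"
    using in1 L2_component_integrable[OF f y(2)] by (simp only: Bochner_Integration.integral_add Bochner_Integration.integrable_sum Bochner_Integration.integral_sum)
  also have "\<i> * of_real (d $ i) * \<dots> = - \<i> * of_real (\<delta> i) * (LINT t|Il y. f t $ i)
      + (\<Sum>j\<in>UNIV. - \<i> * (of_real (\<delta> i) * (LINT x|Il y. LINT t|Il l. \<kappa> i j (\<delta> i * x + - \<delta> j * t) * f t $ j)))"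
    by (simp add: d_eq distrib_left sum_distrib_left sum_negf mult.assoc)
  also have "\<dots> = - \<i> * of_real (\<delta> i) * (LINT t|Il y. f t $ i)
      + (\<Sum>j\<in>UNIV. LINT t|Il l. - \<i> * (K i j (\<delta> i * y - \<delta> j * t) - K i j (- \<delta> j * t)) * f t $ j)"
    unfolding c by (simp only: mult.assoc integral_mult_right_zero)
  finally show ?thesis .
qed

lemma ip_nth:
  fixes f g :: "'p vfun"
  assumes "f \<in> L2 l" "g \<in> L2 l"
  shows "L2_inner l f g = (\<Sum>i\<in>UNIV. LINT x|Il l. f x $ i * cnj (g x $ i))"
    and "integrable (Il l) (\<lambda>x. f x $ i * cnj (g x $ i))"
proof -
  show i: "integrable (Il l) (\<lambda>x. f x $ i * cnj (g x $ i))" for i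
  proof -
    have L: "(\<lambda>x. axis i (h x $ i) :: complex^'p) \<in> L2 l" if "h \<in> L2 l" for h :: "'p vfun"
    proof (rule L2_bound[OF _ L2_integrable_sq[OF that]])
      show "(\<lambda>x. axis i (h x $ i) :: complex^'p) \<in> borel_measurable (Il l)"
      proof (rule borel_measurable_vecI)
        fix j show "(\<lambda>x. (axis i (h x $ i) :: complex^'p) $ j) \<in> borel_measurable (Il l)"
          using L2_nth_measurable[OF that] by (cases "j = i") (simp_all add: axis_def)
      qed
    qed (auto simp: norm_axis_complex intro!: power_mono Finite_Cartesian_Product.norm_nth_le)
    have e: "hprod (axis i u) (axis i v :: complex^'p) = u * cnj v" for u v
      by (simp add: hprod_def axis_def if_distrib[of cnj] if_distrib[of "\<lambda>c. c * _"] cong: if_cong)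
    show ?thesis using integrable_hprod[OF L L, OF assms] by (simp only: e)
  qed
  then show "L2_inner l f g = (\<Sum>i\<in>UNIV. LINT x|Il l. f x $ i * cnj (g x $ i))"
    unfolding L2_inner_def by (intro Bochner_Integration.integral_sum)
qed


text \<open>The difference has the kernel N - N2. The terms with K(\<delta>_i y - \<delta>_j t)
  cancel, and what is left is a function of y plus a function of t, that is, a kernel of finite
  rank.\<close>

lemma scalar_operator_identity:
  fixes f g :: "real \<Rightarrow> complex"
  assumes f: "integrable (Il l) f" and g: "integrable (Il l) g"
  shows "(LINT y|Il l. g y * (LINT t|Il l. - \<i> * (K i j (\<delta> i * y - \<delta> j * t) - K i j (- \<delta> j * t)) * f t))
      - (LINT t|Il l. f t * (LINT y|Il l. \<i> * (cnj (K j i (\<delta> j * t - \<delta> i * y)) - cnj (K j i (- \<delta> i * y))) * g y))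
    = - \<i> * ((LINT t|Il l. f t) * (LINT y|Il l. K i j (\<delta> i * y) * g y)
        + (LINT t|Il l. cnj (K j i (\<delta> j * t)) * f t) * (LINT y|Il l. g y))"
proof -
  define N where "N y t = - \<i> * (K i j (\<delta> i * y - \<delta> j * t) - K i j (- \<delta> j * t))" for y t
  define N2 where "N2 y t = \<i> * (cnj (K j i (\<delta> j * t - \<delta> i * y)) - cnj (K j i (- \<delta> i * y)))" for y t
  have contK: "continuous_on UNIV (K i j)" for i j by (rule K_continuous)
  \<comment> \<open>Both kernels are expressed by the same entry K_ij, which exposes the common
    term.\<close>
  have N2_alt: "N2 y t = \<i> * (K i j (\<delta> i * y) - K i j (\<delta> i * y - \<delta> j * t))" for y t
    using K_uminus[of i j "\<delta> j * t - \<delta> i * y"] K_uminus[of i j "- \<delta> i * y"] by (simp add: N2_def)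
  have diff: "N y t - N2 y t = - \<i> * (K i j (\<delta> i * y) + cnj (K j i (\<delta> j * t)))" for y t
    using K_uminus[of i j "\<delta> j * t"] by (simp add: N_def N2_alt algebra_simps)
  have meas: "(\<lambda>(y, t). N y t) \<in> borel_measurable (Il l \<Otimes>\<^sub>M Il l)"
  proof -
    have Km: "K i j \<in> borel_measurable borel" by (rule borel_measurable_continuous_onI[OF contK])
    have "(\<lambda>p. \<delta> i * fst p - \<delta> j * snd p) \<in> borel_measurable (Il l \<Otimes>\<^sub>M Il l)"
      "(\<lambda>p. - \<delta> j * snd p) \<in> borel_measurable (Il l \<Otimes>\<^sub>M Il l)" by measurable
    from measurable_compose[OF this(1) Km] measurable_compose[OF this(2) Km]
    show ?thesis unfolding N_def case_prod_beta by (intro borel_measurable_times borel_measurable_diff borel_measurable_const)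
  qed
  obtain C where C: "\<And>y t. 0 < y \<Longrightarrow> y < l \<Longrightarrow> 0 < t \<Longrightarrow> t < l \<Longrightarrow> norm (N y t) \<le> C"
  proof -
    have "continuous_on ({0..l} \<times> {0..l}) (\<lambda>p. N (fst p) (snd p))"
      unfolding N_def by (intro continuous_intros continuous_on_compose2[OF contK]) auto
    then have "bounded ((\<lambda>p. N (fst p) (snd p)) ` ({0..l} \<times> {0..l}))"
      by (intro compact_imp_bounded compact_continuous_image compact_Times) auto
    then obtain C where "\<forall>z\<in>(\<lambda>p. N (fst p) (snd p)) ` ({0..l} \<times> {0..l}). norm z \<le> C"
      unfolding bounded_iff by blast
    then have "norm (N y t) \<le> C" if "0 < y" "y < l" "0 < t" "t < l" for y t
      using that by force
    then show thesis by (rule that)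
  qed
  have 1: "(LINT y|Il l. g y * (LINT t|Il l. N y t * f t)) = (LINT t|Il l. f t * (LINT y|Il l. N y t * g y))"
    by (rule Fubini_Il_bounded(1)[OF g f meas C])
  have i1: "integrable (Il l) (\<lambda>t. f t * (LINT y|Il l. N y t * g y))"
    by (rule Fubini_Il_bounded(3)[OF g f meas C])
  have Ng: "integrable (Il l) (\<lambda>y. N y t * g y)" for t
    unfolding N_def by (intro integrable_continuous_mult g continuous_intros continuous_on_compose2[OF contK]) auto
  have N2g: "integrable (Il l) (\<lambda>y. N2 y t * g y)" for t
    unfolding N2_alt by (intro integrable_continuous_mult g continuous_intros continuous_on_compose2[OF contK]) auto
  have Kg: "integrable (Il l) (\<lambda>y. K i j (\<delta> i * y) * g y)"
    by (intro integrable_continuous_mult g continuous_intros continuous_on_compose2[OF contK]) auto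
  have Kf: "integrable (Il l) (\<lambda>t. cnj (K j i (\<delta> j * t)) * f t)"
    by (intro integrable_continuous_mult f continuous_intros continuous_on_compose2[OF contK]) auto
  define G where "G = (LINT y|Il l. g y)"
  define KG where "KG = (LINT y|Il l. K i j (\<delta> i * y) * g y)"
  have in2: "(LINT y|Il l. N y t * g y) - (LINT y|Il l. N2 y t * g y) = - \<i> * (KG + cnj (K j i (\<delta> j * t)) * G)" for t
  proof -
    have "(LINT y|Il l. N y t * g y) - (LINT y|Il l. N2 y t * g y) = (LINT y|Il l. N y t * g y - N2 y t * g y)"
      using Ng N2g by simp
    also have "\<dots> = (LINT y|Il l. - \<i> * (K i j (\<delta> i * y) * g y + cnj (K j i (\<delta> j * t)) * g y))"
    proof (intro Bochner_Integration.integral_cong refl)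
      fix y
      have "N y t * g y - N2 y t * g y = (N y t - N2 y t) * g y" by (simp only: left_diff_distrib)
      then show "N y t * g y - N2 y t * g y = - \<i> * (K i j (\<delta> i * y) * g y + cnj (K j i (\<delta> j * t)) * g y)"
        unfolding diff by (simp add: algebra_simps)
    qed
    also have "\<dots> = - \<i> * (LINT y|Il l. K i j (\<delta> i * y) * g y + cnj (K j i (\<delta> j * t)) * g y)"
      by (rule integral_mult_right_zero)
    also have "(LINT y|Il l. K i j (\<delta> i * y) * g y + cnj (K j i (\<delta> j * t)) * g y) = KG + cnj (K j i (\<delta> j * t)) * G"
      using Kg g by (simp add: KG_def G_def)
    finally show ?thesis .
  qed
  have N2_eq: "(LINT y|Il l. N2 y t * g y) = (LINT y|Il l. N y t * g y) + \<i> * (KG + cnj (K j i (\<delta> j * t)) * G)" for t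
    using in2[of t] by (simp add: algebra_simps)
  have i3: "integrable (Il l) (\<lambda>t. \<i> * (KG * f t + (cnj (K j i (\<delta> j * t)) * f t) * G))"
    using Kf f by (intro integrable_mult_right Bochner_Integration.integrable_add integrable_mult_left) auto
  have "(LINT t|Il l. f t * (LINT y|Il l. N2 y t * g y))
      = (LINT t|Il l. f t * (LINT y|Il l. N y t * g y) + \<i> * (KG * f t + (cnj (K j i (\<delta> j * t)) * f t) * G))"
    unfolding N2_eq by (simp add: algebra_simps)
  also have "\<dots> = (LINT t|Il l. f t * (LINT y|Il l. N y t * g y)) + \<i> * (KG * (LINT t|Il l. f t) + (LINT t|Il l. cnj (K j i (\<delta> j * t)) * f t) * G)"
    using i1 i3 Kf f by simp
  finally show ?thesis
    using 1 unfolding N_def[symmetric] N2_def[symmetric] G_def[symmetric] KG_def[symmetric]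
    by (simp add: algebra_simps)
qed

text \<open>The identity part of S contributes -i \<delta>_c F_c G_c by the product rule, and the
  summand 1/2 of s shares this equally between the two products that J pairs off. The remaining
  terms are collected entry by entry from the scalar identity.\<close>

theorem operator_identity:
  assumes l: "0 < l" and f: "f \<in> L2 l" and g: "g \<in> L2 l"
    and Sf: "S_op d k l f \<in> L2 l" and Sg: "S_op d k l g \<in> L2 l"
  shows "L2_inner l (A_op d (S_op d k l f)) g - L2_inner l f (A_op d (S_op d k l g))
    = \<i> * (\<Sum>c\<in>UNIV. L2_inner l f (Pi_col (Inr c)) * L2_inner l (Pi_col (Inl c)) g
        + L2_inner l f (Pi_col (Inl c)) * L2_inner l (Pi_col (Inr c)) g)"
proof -
  define N where "N i j y t = - \<i> * (K i j (\<delta> i * y - \<delta> j * t) - K i j (- \<delta> j * t))" for i j y t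
  define F where "F i = (LINT t|Il l. f t $ i)" for i
  define G where "G i = (LINT t|Il l. cnj (g t $ i))" for i
  define KG where "KG i j = (LINT y|Il l. K i j (\<delta> i * y) * cnj (g y $ i))" for i j
  define KF where "KF i j = (LINT t|Il l. cnj (K j i (\<delta> j * t)) * f t $ j)" for i j
  have fi: "integrable (Il l) (\<lambda>t. f t $ i)" and gi: "integrable (Il l) (\<lambda>t. g t $ i)" for i
    by (intro integrable_vec_nth L2_integrable f g)+
  have cgi: "integrable (Il l) (\<lambda>t. cnj (g t $ i))" and cfi: "integrable (Il l) (\<lambda>t. cnj (f t $ i))" for i
    by (intro integrable_cnj fi gi)+
  have contK: "continuous_on UNIV (K i j)" for i j by (rule K_continuous)
  have Nint: "integrable (Il l) (\<lambda>y. u y * (LINT t|Il l. N i j y t * v t))"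
    if "integrable (Il l) u" "integrable (Il l) v" for u v i j
  proof -
    have Km: "K i j \<in> borel_measurable borel" by (rule borel_measurable_continuous_onI[OF contK])
    have "(\<lambda>p. \<delta> i * fst p - \<delta> j * snd p) \<in> borel_measurable (Il l \<Otimes>\<^sub>M Il l)"
      "(\<lambda>p. - \<delta> j * snd p) \<in> borel_measurable (Il l \<Otimes>\<^sub>M Il l)" by measurable
    from measurable_compose[OF this(1) Km] measurable_compose[OF this(2) Km]
    have meas: "(\<lambda>(y, t). N i j y t) \<in> borel_measurable (Il l \<Otimes>\<^sub>M Il l)"
      unfolding N_def case_prod_beta by (intro borel_measurable_times borel_measurable_diff borel_measurable_const)
    have "continuous_on ({0..l} \<times> {0..l}) (\<lambda>p. N i j (fst p) (snd p))"
      unfolding N_def by (intro continuous_intros continuous_on_compose2[OF contK]) auto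
    then have "bounded ((\<lambda>p. N i j (fst p) (snd p)) ` ({0..l} \<times> {0..l}))"
      by (intro compact_imp_bounded compact_continuous_image compact_Times) auto
    then obtain C where "\<forall>z\<in>(\<lambda>p. N i j (fst p) (snd p)) ` ({0..l} \<times> {0..l}). norm z \<le> C"
      unfolding bounded_iff by blast
    then have C: "norm (N i j y t) \<le> C" if "0 < y" "y < l" "0 < t" "t < l" for y t
      using that by force
    show ?thesis by (rule Fubini_Il_bounded(2)[OF that meas C])
  qed
  have expand: "L2_inner l (A_op d (S_op d k l u)) v
      = (\<Sum>i\<in>UNIV. - \<i> * of_real (\<delta> i) * (LINT y|Il l. cnj (v y $ i) * (LINT t|Il y. u t $ i)))
        + (\<Sum>i\<in>UNIV. \<Sum>j\<in>UNIV. LINT y|Il l. cnj (v y $ i) * (LINT t|Il l. N i j y t * u t $ j))"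
    if u: "u \<in> L2 l" "S_op d k l u \<in> L2 l" and v: "v \<in> L2 l" for u v
  proof -
    have ui: "integrable (Il l) (\<lambda>t. u t $ i)" and vi: "integrable (Il l) (\<lambda>t. cnj (v t $ i))" for i
      by (intro integrable_cnj integrable_vec_nth L2_integrable u v)+
    have "(LINT y|Il l. A_op d (S_op d k l u) y $ i * cnj (v y $ i))
        = - \<i> * of_real (\<delta> i) * (LINT y|Il l. cnj (v y $ i) * (LINT t|Il y. u t $ i))
          + (\<Sum>j\<in>UNIV. LINT y|Il l. cnj (v y $ i) * (LINT t|Il l. N i j y t * u t $ j))" for i
    proof -
      have "(LINT y|Il l. A_op d (S_op d k l u) y $ i * cnj (v y $ i))
          = (LINT y|Il l. - \<i> * of_real (\<delta> i) * (cnj (v y $ i) * (LINT t|Il y. u t $ i))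
              + (\<Sum>j\<in>UNIV. cnj (v y $ i) * (LINT t|Il l. N i j y t * u t $ j)))"
      proof (intro Bochner_Integration.integral_cong refl)
        fix y assume "y \<in> space (Il l)"
        then have e: "A_op d (S_op d k l u) y $ i = - \<i> * of_real (\<delta> i) * (LINT t|Il y. u t $ i) + (\<Sum>j\<in>UNIV. LINT t|Il l. N i j y t * u t $ j)"
          unfolding N_def by (intro A_S_nth[OF u(1)]) auto
        show "A_op d (S_op d k l u) y $ i * cnj (v y $ i) = - \<i> * of_real (\<delta> i) * (cnj (v y $ i) * (LINT t|Il y. u t $ i))
              + (\<Sum>j\<in>UNIV. cnj (v y $ i) * (LINT t|Il l. N i j y t * u t $ j))"
          unfolding e distrib_right sum_distrib_right by (intro arg_cong2[of _ _ _ _ "(+)"] sum.cong refl) simp_all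
      qed
      also have "\<dots> = (LINT y|Il l. - \<i> * of_real (\<delta> i) * (cnj (v y $ i) * (LINT t|Il y. u t $ i)))
          + (LINT y|Il l. (\<Sum>j\<in>UNIV. cnj (v y $ i) * (LINT t|Il l. N i j y t * u t $ j)))"
        by (intro Bochner_Integration.integral_add integrable_mult_right integral_product_rule(2) Bochner_Integration.integrable_sum Nint ui vi)
      also have "(LINT y|Il l. (\<Sum>j\<in>UNIV. cnj (v y $ i) * (LINT t|Il l. N i j y t * u t $ j)))
          = (\<Sum>j\<in>UNIV. LINT y|Il l. cnj (v y $ i) * (LINT t|Il l. N i j y t * u t $ j))"
        by (intro Bochner_Integration.integral_sum Nint ui vi)
      also have "(LINT y|Il l. - \<i> * of_real (\<delta> i) * (cnj (v y $ i) * (LINT t|Il y. u t $ i)))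
          = - \<i> * of_real (\<delta> i) * (LINT y|Il l. cnj (v y $ i) * (LINT t|Il y. u t $ i))"
        by (rule integral_mult_right_zero)
      finally show ?thesis .
    qed
    then show ?thesis unfolding ip_nth(1)[OF A_op_L2[OF u(2)] v] by (simp only: sum.distrib)
  qed
  have cnjN: "cnj (N j i t y) = \<i> * (cnj (K j i (\<delta> j * t - \<delta> i * y)) - cnj (K j i (- \<delta> i * y)))" for i j t y
    by (simp add: N_def)
  have second: "L2_inner l f (A_op d (S_op d k l g))
      = (\<Sum>i\<in>UNIV. \<i> * of_real (\<delta> i) * (LINT y|Il l. f y $ i * (LINT t|Il y. cnj (g t $ i))))
        + (\<Sum>j\<in>UNIV. \<Sum>i\<in>UNIV. LINT t|Il l. f t $ j * (LINT y|Il l. cnj (N j i t y) * cnj (g y $ i)))"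
  proof -
    have "L2_inner l f (A_op d (S_op d k l g)) = cnj (L2_inner l (A_op d (S_op d k l g)) f)" by (simp add: ip_cnj)
    also have "\<dots> = (\<Sum>i\<in>UNIV. \<i> * of_real (\<delta> i) * (LINT y|Il l. f y $ i * (LINT t|Il y. cnj (g t $ i))))
        + (\<Sum>j\<in>UNIV. \<Sum>i\<in>UNIV. LINT t|Il l. f t $ j * (LINT y|Il l. cnj (N j i t y) * cnj (g y $ i)))"
      unfolding expand[OF g Sg f]
      by (simp add: cnj_sum flip: Bochner_Integration.integral_cnj del: complex_cnj_cancel_iff)
    finally show ?thesis .
  qed
  have pair: "(LINT y|Il l. cnj (g y $ i) * (LINT t|Il l. N i j y t * f t $ j))
      - (LINT t|Il l. f t $ j * (LINT y|Il l. cnj (N j i t y) * cnj (g y $ i)))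
      = - \<i> * (F j * KG i j + KF i j * G i)" for i j
    unfolding cnjN unfolding N_def F_def G_def KG_def KF_def by (rule scalar_operator_identity[OF fi cgi])
  have prod: "(LINT y|Il l. cnj (g y $ i) * (LINT t|Il y. f t $ i)) + (LINT y|Il l. f y $ i * (LINT t|Il y. cnj (g t $ i))) = F i * G i" for i
    using integral_product_rule(1)[OF cgi fi, of i i] by (simp add: F_def G_def mult.commute)
  have "L2_inner l (A_op d (S_op d k l f)) g - L2_inner l f (A_op d (S_op d k l g))
      = (\<Sum>i\<in>UNIV. - \<i> * of_real (\<delta> i) * (F i * G i)) + (\<Sum>i\<in>UNIV. \<Sum>j\<in>UNIV. - \<i> * (F j * KG i j + KF i j * G i))"
  proof -
    have sw: "(\<Sum>j\<in>UNIV. \<Sum>i\<in>UNIV. LINT t|Il l. f t $ j * (LINT y|Il l. cnj (N j i t y) * cnj (g y $ i)))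
        = (\<Sum>i\<in>UNIV. \<Sum>j\<in>UNIV. LINT t|Il l. f t $ j * (LINT y|Il l. cnj (N j i t y) * cnj (g y $ i)))"
      by (rule sum.swap)
    show ?thesis
      unfolding expand[OF f Sf g] second sw pair[symmetric] prod[symmetric]
      by (simp add: sum_subtractf sum.distrib distrib_left sum_negf)
  qed
  also have "\<dots> = \<i> * (\<Sum>c\<in>UNIV. F c * (- of_real (\<delta> c) / 2 * G c - (\<Sum>i\<in>UNIV. KG i c))
      + (- of_real (\<delta> c) / 2 * F c - (\<Sum>j\<in>UNIV. KF c j)) * G c)"
  proof -
    have s1: "(\<Sum>i\<in>UNIV. \<Sum>j\<in>UNIV. - \<i> * (F j * KG i j + KF i j * G i))
        = - \<i> * ((\<Sum>j\<in>UNIV. F j * (\<Sum>i\<in>UNIV. KG i j)) + (\<Sum>i\<in>UNIV. (\<Sum>j\<in>UNIV. KF i j) * G i))"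
    proof -
      have "(\<Sum>i\<in>UNIV. \<Sum>j\<in>UNIV. F j * KG i j + KF i j * G i)
          = (\<Sum>i\<in>UNIV. \<Sum>j\<in>UNIV. F j * KG i j) + (\<Sum>i\<in>UNIV. \<Sum>j\<in>UNIV. KF i j * G i)"
        by (simp only: sum.distrib)
      also have "(\<Sum>i\<in>UNIV. \<Sum>j\<in>UNIV. F j * KG i j) = (\<Sum>j\<in>UNIV. F j * (\<Sum>i\<in>UNIV. KG i j))"
        unfolding sum_distrib_left by (rule sum.swap)
      also have "(\<Sum>i\<in>UNIV. \<Sum>j\<in>UNIV. KF i j * G i) = (\<Sum>i\<in>UNIV. (\<Sum>j\<in>UNIV. KF i j) * G i)"
        unfolding sum_distrib_right ..
      finally show ?thesis by (simp only: sum_distrib_left[symmetric])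
    qed
    have s2: "(\<Sum>i\<in>UNIV. - \<i> * of_real (\<delta> i) * (F i * G i)) = - \<i> * (\<Sum>i\<in>UNIV. of_real (\<delta> i) * (F i * G i))"
      by (simp add: sum_distrib_left mult.assoc)
    have s3: "F c * (- of_real (\<delta> c) / 2 * G c - (\<Sum>i\<in>UNIV. KG i c)) + (- of_real (\<delta> c) / 2 * F c - (\<Sum>j\<in>UNIV. KF c j)) * G c
        = - (of_real (\<delta> c) * (F c * G c)) - (F c * (\<Sum>i\<in>UNIV. KG i c) + (\<Sum>j\<in>UNIV. KF c j) * G c)" for c
      by (simp add: algebra_simps)
    show ?thesis unfolding s1 s2 s3 by (simp add: sum_subtractf sum.distrib sum_negf algebra_simps)
  qed
  also have "\<dots> = \<i> * (\<Sum>c\<in>UNIV. L2_inner l f (Pi_col (Inr c)) * L2_inner l (Pi_col (Inl c)) g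
        + L2_inner l f (Pi_col (Inl c)) * L2_inner l (Pi_col (Inr c)) g)"
  proof -
    have r1: "L2_inner l f (Pi_col (Inr c)) = F c" for c
      by (simp add: L2_inner_def Pi_col_Inr F_def axis_def if_distrib[of cnj] mult.commute[of "_ $ _"] if_distrib[of "\<lambda>c. c * _"] cong: if_cong)
    have r2: "L2_inner l (Pi_col (Inr c)) g = G c" for c
      by (simp add: L2_inner_def Pi_col_Inr G_def axis_def if_distrib[of "\<lambda>c. c * _"] cong: if_cong)
    have Kgi: "integrable (Il l) (\<lambda>y. K i c (\<delta> i * y) * cnj (g y $ i))" for i c
      by (intro integrable_continuous_mult cgi continuous_intros continuous_on_compose2[OF contK]) auto
    have Kfi: "integrable (Il l) (\<lambda>t. cnj (K j c (\<delta> j * t)) * f t $ j)" for j c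
      by (intro integrable_continuous_mult fi continuous_intros continuous_on_compose2[OF contK]) auto
    have r3: "L2_inner l (Pi_col (Inl c)) g = - of_real (\<delta> c) / 2 * G c - (\<Sum>i\<in>UNIV. KG i c)" for c
    proof -
      have "(LINT y|Il l. Pi_col (Inl c) y $ i * cnj (g y $ i)) = (if i = c then - of_real (\<delta> c) / 2 * G c else 0) - KG i c" for i
      proof -
        have "(LINT y|Il l. Pi_col (Inl c) y $ i * cnj (g y $ i))
            = (LINT y|Il l. (if i = c then - of_real (\<delta> c) / 2 else 0) * cnj (g y $ i) - K i c (\<delta> i * y) * cnj (g y $ i))"
          by (intro Bochner_Integration.integral_cong refl) (auto simp: Pi_col_Inl left_diff_distrib)
        also have "\<dots> = (LINT y|Il l. (if i = c then - of_real (\<delta> c) / 2 else 0) * cnj (g y $ i)) - KG i c"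
          unfolding KG_def by (intro Bochner_Integration.integral_diff integrable_mult_right cgi Kgi)
        finally show ?thesis by (simp add: G_def)
      qed
      then show ?thesis using ip_nth(1)[OF Pi_col_L2 g, of "Inl c"] by (simp add: sum_subtractf)
    qed
    have r4: "L2_inner l f (Pi_col (Inl c)) = - of_real (\<delta> c) / 2 * F c - (\<Sum>j\<in>UNIV. KF c j)" for c
    proof -
      have "(LINT y|Il l. f y $ j * cnj (Pi_col (Inl c) y $ j)) = (if j = c then - of_real (\<delta> c) / 2 * F c else 0) - KF c j" for j
      proof -
        have "(LINT y|Il l. f y $ j * cnj (Pi_col (Inl c) y $ j))
            = (LINT y|Il l. (if j = c then - of_real (\<delta> c) / 2 else 0) * f y $ j - cnj (K j c (\<delta> j * y)) * f y $ j)"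
          by (intro Bochner_Integration.integral_cong refl) (auto simp: Pi_col_Inl algebra_simps)
        also have "\<dots> = (LINT y|Il l. (if j = c then - of_real (\<delta> c) / 2 else 0) * f y $ j) - KF c j"
          unfolding KF_def by (intro Bochner_Integration.integral_diff integrable_mult_right fi Kfi)
        finally show ?thesis by (simp add: F_def)
      qed
      then show ?thesis using ip_nth(1)[OF f Pi_col_L2, of "Inl c"] by (simp add: sum_subtractf)
    qed
    show ?thesis unfolding r1 r2 r3 r4 ..
  qed
  finally show ?thesis .
qed

end

section \<open>The translation invariant form\<close>

lemma lebesgue_integral_supported:
  fixes F :: "real \<Rightarrow> 'b::euclidean_space"
  assumes "\<And>x. x \<notin> {a<..<b} \<Longrightarrow> F x = 0"
  shows "(LINT x|lebesgue. F x) = (LINT x|lebesgue_on {a<..<b}. F x)"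
    and "integrable lebesgue F \<longleftrightarrow> integrable (lebesgue_on {a<..<b}) F"
proof -
  have *: "(\<lambda>x. indicator {a<..<b} x *\<^sub>R F x) = F"
  proof
    fix x show "indicator {a<..<b} x *\<^sub>R F x = F x"
      using assms[of x] by (cases "x \<in> {a<..<b}") auto
  qed
  have S: "{a<..<b} \<in> sets lebesgue" by simp
  show "(LINT x|lebesgue. F x) = (LINT x|lebesgue_on {a<..<b}. F x)"
    unfolding lebesgue_on_integral_eq[OF S] * ..
  show "integrable lebesgue F \<longleftrightarrow> integrable (lebesgue_on {a<..<b}) F"
    unfolding lebesgue_on_integrable_iff[OF S] * ..
qed

section \<open>Compactly supported square integrable functions on the line\<close>

definition Lc :: "real \<Rightarrow> ('p::finite) vfun set" where
  "Lc M = {f. f \<in> borel_measurable lebesgue \<and> integrable lebesgue (\<lambda>x. (norm (f x))\<^sup>2) \<and> (\<forall>x. M \<le> \<bar>x\<bar> \<longrightarrow> f x = 0)}"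

lemma Lc_mono: "f \<in> Lc M \<Longrightarrow> M \<le> M' \<Longrightarrow> f \<in> Lc M'"
  by (auto simp: Lc_def)

lemma Lc_L2:
  assumes "f \<in> Lc M" shows "f \<in> L2 l"
proof -
  have "integrable (Il l) (\<lambda>x. (norm (f x))\<^sup>2)"
    using assms unfolding Lc_def
    by (subst lebesgue_on_integrable_iff, simp) (rule integrable_mult_indicator, simp_all)
  moreover have "f \<in> borel_measurable (Il l)"
    using assms unfolding Lc_def by (auto intro: measurable_restrict_space1)
  ultimately show ?thesis by (simp add: L2_iff)
qed

lemma L2_clip_Lc:
  assumes "f \<in> L2 l" "l \<le> M" shows "clip 0 l f \<in> Lc M"
proof -
  have c: "clip 0 l f = (\<lambda>x. if x \<in> {0<..<l} then f x else 0)" by (auto simp: clip_def fun_eq_iff)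
  have "clip 0 l f \<in> borel_measurable lebesgue"
    unfolding c by (rule borel_measurable_if_I[OF L2_measurable[OF assms(1)]]) simp
  moreover have "integrable lebesgue (\<lambda>x. (norm (clip 0 l f x))\<^sup>2)"
  proof (subst lebesgue_integral_supported(2)[of 0 l])
    show "integrable (Il l) (\<lambda>x. (norm (clip 0 l f x))\<^sup>2)" by (intro L2_integrable_sq L2_cut assms) simp
  qed (auto simp: clip_def)
  ultimately show ?thesis using assms(2) by (auto simp: Lc_def clip_def)
qed

lemma Lc_add:
  assumes "f \<in> Lc M" "g \<in> Lc M" shows "(\<lambda>x. f x + g x) \<in> Lc M"
proof -
  have m: "f \<in> borel_measurable lebesgue" "g \<in> borel_measurable lebesgue" using assms by (auto simp: Lc_def)
  have "integrable lebesgue (\<lambda>x. (norm (f x + g x))\<^sup>2)"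
  proof (rule Bochner_Integration.integrable_bound)
    show "integrable lebesgue (\<lambda>x. 2 * (norm (f x))\<^sup>2 + 2 * (norm (g x))\<^sup>2)" using assms by (auto simp: Lc_def)
    show "(\<lambda>x. (norm (f x + g x))\<^sup>2) \<in> borel_measurable lebesgue" using m by measurable
    have "norm ((norm (f x + g x))\<^sup>2) \<le> norm (2 * (norm (f x))\<^sup>2 + 2 * (norm (g x))\<^sup>2)" for x
    proof -
      have "(norm (f x + g x))\<^sup>2 \<le> (norm (f x) + norm (g x))\<^sup>2"
        by (intro power_mono norm_triangle_ineq) simp
      also have "\<dots> \<le> 2 * (norm (f x))\<^sup>2 + 2 * (norm (g x))\<^sup>2"
        using zero_le_power2[of "norm (f x) - norm (g x)"] by (simp add: power2_diff power2_sum)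
      finally show ?thesis by simp
    qed
    then show "AE x in lebesgue. norm ((norm (f x + g x))\<^sup>2) \<le> norm (2 * (norm (f x))\<^sup>2 + 2 * (norm (g x))\<^sup>2)" by simp
  qed
  then show ?thesis using assms m by (auto simp: Lc_def)
qed

lemma Lc_smult:
  assumes "f \<in> Lc M" shows "(\<lambda>x. c *s f x) \<in> Lc M"
  using assms by (auto simp: Lc_def norm_smult power_mult_distrib intro!: borel_measurable_smult)

lemma Lc_nth:
  assumes "f \<in> Lc M"
  shows "(\<lambda>x. f x $ i) \<in> borel_measurable lebesgue" "integrable lebesgue (\<lambda>x. (cmod (f x $ i))\<^sup>2)"
proof -
  have m: "f \<in> borel_measurable lebesgue" using assms by (simp add: Lc_def)
  then show mi: "(\<lambda>x. f x $ i) \<in> borel_measurable lebesgue" by (rule borel_measurable_vec_nth)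
  show "integrable lebesgue (\<lambda>x. (cmod (f x $ i))\<^sup>2)"
  proof (rule Bochner_Integration.integrable_bound)
    show "integrable lebesgue (\<lambda>x. (norm (f x))\<^sup>2)" using assms by (simp add: Lc_def)
    show "(\<lambda>x. (cmod (f x $ i))\<^sup>2) \<in> borel_measurable lebesgue" using mi by measurable
  qed (auto intro!: power_mono Finite_Cartesian_Product.norm_nth_le)
qed

lemma LcI:
  assumes "\<And>i. (\<lambda>x. f x $ i) \<in> borel_measurable lebesgue" "\<And>i. integrable lebesgue (\<lambda>x. (cmod (f x $ i))\<^sup>2)"
    "\<And>x. M \<le> \<bar>x\<bar> \<Longrightarrow> f x = 0"
  shows "f \<in> Lc M"
  unfolding Lc_def using assms by (auto simp: norm_vec_sq intro!: borel_measurable_vecI)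

context hermitian_kernel
begin

text \<open>The formula of S_l with the integral taken over the whole line; for f supported in (0,
  l) it agrees with S_l f.\<close>

definition Shat :: "'p vfun \<Rightarrow> 'p vfun" where
  "Shat f x = (\<chi> i. f x $ i + (\<Sum>j\<in>UNIV. LINT t|lebesgue. \<kappa> i j (\<delta> i * x + - \<delta> j * t) * f t $ j))"

text \<open>Each component has its own speed 1 / \<delta>_i, because then \<delta>_i x - \<delta>_j
  t, the argument of the kernel, changes by \<tau> - \<tau> = 0.\<close>

definition shift :: "real \<Rightarrow> 'p vfun \<Rightarrow> 'p vfun" where
  "shift \<tau> f x = (\<chi> i. f (- (\<tau> / \<delta> i) + x) $ i)"

definition q :: "'p vfun \<Rightarrow> 'p vfun \<Rightarrow> complex" where
  "q f g = (\<Sum>i\<in>UNIV. LINT x|lebesgue. Shat f x $ i * cnj (g x $ i))"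

lemma Shat_shift: "Shat (shift \<tau> f) x $ i = Shat f (- (\<tau> / \<delta> i) + x) $ i"
proof -
  have "(LINT t|lebesgue. \<kappa> i j (\<delta> i * x + - \<delta> j * t) * shift \<tau> f t $ j)
      = (LINT t|lebesgue. \<kappa> i j (\<delta> i * (- (\<tau> / \<delta> i) + x) + - \<delta> j * t) * f t $ j)" for j
  proof -
    have "(LINT t|lebesgue. \<kappa> i j (\<delta> i * x + - \<delta> j * t) * shift \<tau> f t $ j)
      = \<bar>1\<bar> *\<^sub>R (LINT t|lebesgue. \<kappa> i j (\<delta> i * x + - \<delta> j * (\<tau> / \<delta> j + 1 * t)) * shift \<tau> f (\<tau> / \<delta> j + 1 * t) $ j)"
      by (rule lebesgue_integral_real_affine) simp
    also have "\<dots> = (LINT t|lebesgue. \<kappa> i j (\<delta> i * (- (\<tau> / \<delta> i) + x) + - \<delta> j * t) * f t $ j)"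
      using less_imp_neq[OF \<delta>_pos[of i]] less_imp_neq[OF \<delta>_pos[of j]]
      by (auto simp: shift_def algebra_simps intro!: Bochner_Integration.integral_cong)
    finally show ?thesis .
  qed
  then show ?thesis by (simp add: Shat_def shift_def)
qed

lemma q_shift: "q (shift \<tau> f) (shift \<tau> g) = q f g"
  unfolding q_def
proof (intro sum.cong refl)
  fix i
  have "(LINT x|lebesgue. Shat f x $ i * cnj (g x $ i))
      = \<bar>1\<bar> *\<^sub>R (LINT x|lebesgue. Shat f (- (\<tau> / \<delta> i) + 1 * x) $ i * cnj (g (- (\<tau> / \<delta> i) + 1 * x) $ i))"
    by (rule lebesgue_integral_real_affine) simp
  then show "(LINT x|lebesgue. Shat (shift \<tau> f) x $ i * cnj (shift \<tau> g x $ i)) = (LINT x|lebesgue. Shat f x $ i * cnj (g x $ i))"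
    unfolding Shat_shift by (simp add: shift_def)
qed

lemma Shat_eq_S_op:
  assumes f: "f \<in> L2 l" and s: "\<And>x. x \<notin> {0<..<l} \<Longrightarrow> f x = 0"
  shows "Shat f x = S_op d k l f x"
proof -
  have "(LINT t|lebesgue. \<kappa> i j (\<delta> i * x + - \<delta> j * t) * f t $ j) = (LINT t|Il l. \<kappa> i j (\<delta> i * x + - \<delta> j * t) * f t $ j)" for i j
    by (rule lebesgue_integral_supported(1)) (simp add: s)
  then show ?thesis by (simp add: vec_eq_iff S_op_nth[OF f] Shat_def)
qed

lemma q_eq_ip:
  assumes f: "f \<in> L2 l" and sf: "\<And>x. x \<notin> {0<..<l} \<Longrightarrow> f x = 0"
    and g: "g \<in> L2 l" and sg: "\<And>x. x \<notin> {0<..<l} \<Longrightarrow> g x = 0" and S: "S_op d k l f \<in> L2 l"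
  shows "q f g = L2_inner l (S_op d k l f) g"
proof -
  have e: "Shat f x = S_op d k l f x" for x using f sf by (rule Shat_eq_S_op)
  have "(LINT x|lebesgue. Shat f x $ i * cnj (g x $ i)) = (LINT x|Il l. S_op d k l f x $ i * cnj (g x $ i))" for i
    unfolding e by (rule lebesgue_integral_supported(1)) (simp add: sg)
  then show ?thesis unfolding q_def ip_nth(1)[OF S g] by simp
qed

text \<open>The lower bound on \<tau> moves every component to the right by at least M, and L leaves
  room for the fastest one. The sums are simple upper bounds for their individual terms.\<close>

lemma shift_support:
  assumes "\<And>x. M \<le> \<bar>x\<bar> \<Longrightarrow> f x = 0" "0 < M" "M * (\<Sum>i\<in>UNIV. \<delta> i) \<le> \<tau>" "M + \<tau> * (\<Sum>i\<in>UNIV. 1 / \<delta> i) \<le> L"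
    and x: "x \<notin> {0<..<L}"
  shows "shift \<tau> f x = 0"
proof -
  have "f (- (\<tau> / \<delta> i) + x) = 0" for i
  proof (rule assms(1))
    have i: "\<delta> i \<le> (\<Sum>i\<in>UNIV. \<delta> i)" "1 / \<delta> i \<le> (\<Sum>i\<in>UNIV. 1 / \<delta> i)"
      using less_imp_le[OF \<delta>_pos] by (auto intro!: member_le_sum)
    have "M * \<delta> i \<le> \<tau>" using mult_left_mono[OF i(1), of M] assms(2,3) by linarith
    then have 1: "M \<le> \<tau> / \<delta> i" using \<delta>_pos[of i] by (simp add: field_simps)
    have "0 \<le> (\<Sum>i\<in>UNIV. \<delta> i)" using less_imp_le[OF \<delta>_pos] by (intro sum_nonneg) auto
    then have "0 \<le> M * (\<Sum>i\<in>UNIV. \<delta> i)" using assms(2) by (intro mult_nonneg_nonneg) auto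
    then have "0 \<le> \<tau>" using assms(3) by linarith
    then have "\<tau> * (1 / \<delta> i) \<le> \<tau> * (\<Sum>i\<in>UNIV. 1 / \<delta> i)" by (intro mult_left_mono i)
    then have 2: "M + \<tau> / \<delta> i \<le> L" using assms(4) by simp
    show "M \<le> \<bar>- (\<tau> / \<delta> i) + x\<bar>"
      using 1 2 x by auto
  qed
  then show ?thesis by (simp add: shift_def vec_eq_iff)
qed

lemma shift_Lc:
  assumes f: "f \<in> Lc M" and s: "\<And>x. M' \<le> \<bar>x\<bar> \<Longrightarrow> shift \<tau> f x = 0"
  shows "shift \<tau> f \<in> Lc M'"
proof (rule LcI)
  fix i
  have "(\<lambda>x. f (- (\<tau> / \<delta> i) + 1 *\<^sub>R x) $ i) \<in> borel_measurable lebesgue"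
    by (rule borel_measurable_affine[OF Lc_nth(1)[OF f]]) simp
  then show "(\<lambda>x. shift \<tau> f x $ i) \<in> borel_measurable lebesgue" by (simp add: shift_def)
  have "integrable lebesgue (\<lambda>x. (cmod (f (- (\<tau> / \<delta> i) + 1 * x) $ i))\<^sup>2)"
    by (rule lebesgue_integrable_real_affine[OF Lc_nth(2)[OF f]]) simp
  then show "integrable lebesgue (\<lambda>x. (cmod (shift \<tau> f x $ i))\<^sup>2)" by (simp add: shift_def)
qed (rule s)

end

section \<open>Positivity and Cauchy-Schwarz for the form\<close>

locale positive_kernel = hermitian_kernel d k
  for d :: "real^'p::finite" and k :: "real \<Rightarrow> complex^'p^'p" +
  assumes S_positive: "\<And>l. 0 < l \<Longrightarrow> positive_op l (S_op d k l)"
    and S_bounded: "\<And>l. 0 < l \<Longrightarrow> bounded_op l (S_op d k l)"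
begin

text \<open>Shifting the component \<open>i\<close> by \<open>\<tau> / \<delta> i\<close> leaves \<open>q\<close> invariant and moves every compact support
  into some \<open>(0, L)\<close>, so \<open>q\<close> inherits the properties of the forms of the operators \<open>S\<close>.\<close>

lemma q_transport:
  fixes M :: real
  assumes M: "0 < M"
  obtains \<tau> L where "0 < L" "\<And>f. f \<in> Lc M \<Longrightarrow> shift \<tau> f \<in> L2 L"
    "\<And>f g. f \<in> Lc M \<Longrightarrow> g \<in> Lc M \<Longrightarrow> q f g = L2_inner L (S_op d k L (shift \<tau> f)) (shift \<tau> g)"
proof -
  \<comment> \<open>The least values that \<open>shift_support\<close> admits.\<close>
  define \<tau> where "\<tau> = M * (\<Sum>i\<in>UNIV. \<delta> i)"
  define L where "L = M + \<tau> * (\<Sum>i\<in>UNIV. 1 / \<delta> i)"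
  have "0 \<le> \<tau> * (\<Sum>i\<in>UNIV. 1 / \<delta> i)"
    unfolding \<tau>_def using M less_imp_le[OF \<delta>_pos] by (intro mult_nonneg_nonneg sum_nonneg) auto
  then have L: "0 < L" using M by (simp add: L_def)
  have supp: "shift \<tau> f x = 0" if "f \<in> Lc M" "x \<notin> {0<..<L}" for f x
    by (rule shift_support[OF _ M _ _ that(2)]) (use that(1) in \<open>auto simp: Lc_def \<tau>_def L_def\<close>)
  have sL: "shift \<tau> f \<in> L2 L" if "f \<in> Lc M" for f
    by (rule Lc_L2[of _ L], rule shift_Lc[OF that], rule supp[OF that]) auto
  show thesis
  proof (rule that[OF L sL])
    fix f g :: "'p vfun" assume f: "f \<in> Lc M" and g: "g \<in> Lc M"
    have "q f g = q (shift \<tau> f) (shift \<tau> g)" by (simp add: q_shift)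
    also have "\<dots> = L2_inner L (S_op d k L (shift \<tau> f)) (shift \<tau> g)"
      by (intro q_eq_ip sL supp f g bounded_opD(1)[OF S_bounded[OF L]])
    finally show "q f g = L2_inner L (S_op d k L (shift \<tau> f)) (shift \<tau> g)" .
  qed
qed

text \<open>A single pair \<tau>, L serves all functions in \<open>Lc M\<close>, so each property is
  read off from the operator S_L on one interval.\<close>

lemma q_props:
  assumes M: "0 < M" and f: "f \<in> Lc M" and g: "g \<in> Lc M" and h: "h \<in> Lc M"
  shows "q f f \<in> \<real>\<^sub>\<ge>\<^sub>0"
    and "q (\<lambda>x. f x + g x) h = q f h + q g h" and "q h (\<lambda>x. f x + g x) = q h f + q h g"
    and "q (\<lambda>x. c *s f x) g = c * q f g" and "q f (\<lambda>x. c *s g x) = cnj c * q f g"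
proof -
  obtain \<tau> L where L: "0 < L" and sL: "\<And>f. f \<in> Lc M \<Longrightarrow> shift \<tau> f \<in> L2 L"
    and q: "\<And>f g. f \<in> Lc M \<Longrightarrow> g \<in> Lc M \<Longrightarrow> q f g = L2_inner L (S_op d k L (shift \<tau> f)) (shift \<tau> g)"
    by (rule q_transport[OF M]) blast
  note SL = bounded_opD(1)[OF S_bounded[OF L] sL]
  have sadd: "shift \<tau> (\<lambda>x. f x + g x) = (\<lambda>x. shift \<tau> f x + shift \<tau> g x)" for f g
    by (simp add: shift_def fun_eq_iff vec_eq_iff)
  have ssm: "shift \<tau> (\<lambda>x. c *s f x) = (\<lambda>x. c *s shift \<tau> f x)" for c f
    by (simp add: shift_def fun_eq_iff vec_eq_iff)
  show "q f f \<in> \<real>\<^sub>\<ge>\<^sub>0" using S_positive[OF L] sL[OF f] by (simp add: q f positive_op_def)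
  have "q (\<lambda>x. f x + g x) h = L2_inner L (S_op d k L (\<lambda>x. shift \<tau> f x + shift \<tau> g x)) (shift \<tau> h)"
    unfolding q[OF Lc_add[OF f g] h] sadd ..
  also have "\<dots> = L2_inner L (\<lambda>x. S_op d k L (shift \<tau> f) x + S_op d k L (shift \<tau> g) x) (shift \<tau> h)"
    by (intro ip_cong bounded_opD[OF S_bounded[OF L]] L2_add SL sL f g h ae_eq_refl)
  also have "\<dots> = q f h + q g h" by (simp add: ip_add_left SL sL q f g h)
  finally show "q (\<lambda>x. f x + g x) h = q f h + q g h" .
  show "q h (\<lambda>x. f x + g x) = q h f + q h g"
    unfolding q[OF h Lc_add[OF f g]] sadd by (simp add: ip_add_right SL sL q f g h)
  have "q (\<lambda>x. c *s f x) g = L2_inner L (S_op d k L (\<lambda>x. c *s shift \<tau> f x)) (shift \<tau> g)"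
    unfolding q[OF Lc_smult[OF f] g] ssm ..
  also have "\<dots> = L2_inner L (\<lambda>x. c *s S_op d k L (shift \<tau> f) x) (shift \<tau> g)"
    by (intro ip_cong bounded_opD[OF S_bounded[OF L]] L2_smult SL sL f g h ae_eq_refl)
  also have "\<dots> = c * q f g" by (simp add: ip_smult_left q f g)
  finally show "q (\<lambda>x. c *s f x) g = c * q f g" .
  show "q f (\<lambda>x. c *s g x) = cnj c * q f g"
    unfolding q[OF f Lc_smult[OF g]] ssm by (simp add: ip_smult_right q f g)
qed

lemma q_nonneg: "f \<in> Lc M \<Longrightarrow> q f f \<in> \<real>\<^sub>\<ge>\<^sub>0"
  using q_props(1)[of "max M 1" f f f] Lc_mono[of f M "max M 1"] by simp

lemma q_Re_nonneg: "f \<in> Lc M \<Longrightarrow> 0 \<le> Re (q f f)"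
  using q_nonneg by (auto simp: complex_nonneg_Reals_iff)

text \<open>Symmetry of the form is obtained from positivity, as for any nonnegative form over the
  complex scalars, and not computed from the kernel.\<close>

lemma q_Cauchy_Schwarz:
  assumes "f \<in> Lc M" "g \<in> Lc M"
  shows "(cmod (q f g))\<^sup>2 \<le> Re (q f f) * Re (q g g)" and "q g f = cnj (q f g)"
proof -
  let ?M = "max M 1"
  have M: "0 < ?M" by simp
  have f: "f \<in> Lc ?M" and g: "g \<in> Lc ?M" using assms by (auto intro: Lc_mono)
  have psd: "q f f + cnj c * q f g + c * q g f + c * cnj c * q g g \<in> \<real>\<^sub>\<ge>\<^sub>0" for c
  proof -
    have cg: "(\<lambda>x. c *s g x) \<in> Lc ?M" by (rule Lc_smult[OF g])
    have fcg: "(\<lambda>x. f x + c *s g x) \<in> Lc ?M" by (rule Lc_add[OF f cg])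
    have "q (\<lambda>x. f x + c *s g x) (\<lambda>x. f x + c *s g x)
        = q f (\<lambda>x. f x + c *s g x) + q (\<lambda>x. c *s g x) (\<lambda>x. f x + c *s g x)"
      by (rule q_props(2)[OF M f cg fcg])
    also have "\<dots> = q f f + cnj c * q f g + (c * q g f + c * (cnj c * q g g))"
      using q_props(3)[OF M f cg f] q_props(3)[OF M f cg cg] q_props(5)[OF M f g f] q_props(4)[OF M g f f]
        q_props(4)[OF M g cg f] q_props(5)[OF M g g f] by simp
    finally show ?thesis using q_props(1)[OF M fcg f f] by (simp add: algebra_simps)
  qed
  have "q g g \<in> \<real>\<^sub>\<ge>\<^sub>0" by (rule q_nonneg[OF g])
  from psd_form_Cauchy_Schwarz[OF psd this] show "(cmod (q f g))\<^sup>2 \<le> Re (q f f) * Re (q g g)" "q g f = cnj (q f g)" by blast+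
qed

text \<open>Makes sqrt (q f f) a seminorm, so that a function can be estimated piece by piece over
  unit intervals.\<close>

lemma q_triangle:
  assumes "f \<in> Lc M" "g \<in> Lc M"
  shows "sqrt (Re (q (\<lambda>x. f x + g x) (\<lambda>x. f x + g x))) \<le> sqrt (Re (q f f)) + sqrt (Re (q g g))"
proof -
  let ?M = "max M 1"
  have M: "0 < ?M" by simp
  have f: "f \<in> Lc ?M" and g: "g \<in> Lc ?M" using assms by (auto intro: Lc_mono)
  note fg = Lc_add[OF f g]
  have nn: "0 \<le> Re (q f f)" "0 \<le> Re (q g g)" using q_Re_nonneg f g by auto
  have "q (\<lambda>x. f x + g x) (\<lambda>x. f x + g x) = q f f + q f g + (cnj (q f g) + q g g)"
    using q_props(2)[OF M f g fg] q_props(3)[OF M f g f] q_props(3)[OF M f g g] q_Cauchy_Schwarz(2)[OF f g] by simp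
  then have "Re (q (\<lambda>x. f x + g x) (\<lambda>x. f x + g x)) = Re (q f f) + 2 * Re (q f g) + Re (q g g)" by simp
  also have "Re (q f g) \<le> sqrt (Re (q f f)) * sqrt (Re (q g g))"
  proof -
    have "Re (q f g) \<le> cmod (q f g)" by (rule complex_Re_le_cmod)
    also have "\<dots> \<le> sqrt (Re (q f f) * Re (q g g))" using q_Cauchy_Schwarz(1)[OF f g] by (rule real_le_rsqrt)
    finally show ?thesis by (simp add: real_sqrt_mult)
  qed
  then have "Re (q f f) + 2 * Re (q f g) + Re (q g g) \<le> (sqrt (Re (q f f)) + sqrt (Re (q g g)))\<^sup>2"
    using nn by (simp add: power2_sum)
  finally have "Re (q (\<lambda>x. f x + g x) (\<lambda>x. f x + g x)) \<le> (sqrt (Re (q f f)) + sqrt (Re (q g g)))\<^sup>2" .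
  then show ?thesis using nn by (intro real_le_lsqrt) (auto intro: add_nonneg_nonneg)
qed

section \<open>Bounds that are uniform over unit intervals\<close>

definition single :: "'p \<Rightarrow> (real \<Rightarrow> complex) \<Rightarrow> 'p vfun" where "single i u x = axis i (u x)"

lemma single_Lc:
  assumes "u \<in> borel_measurable lebesgue" "integrable lebesgue (\<lambda>x. (cmod (u x))\<^sup>2)" "\<And>x. M \<le> \<bar>x\<bar> \<Longrightarrow> u x = 0"
  shows "single i u \<in> Lc M"
proof (rule LcI)
  fix j
  show "(\<lambda>x. single i u x $ j) \<in> borel_measurable lebesgue" "integrable lebesgue (\<lambda>x. (cmod (single i u x $ j))\<^sup>2)"
    using assms by (cases "j = i"; simp add: single_def axis_def)+
qed (use assms in \<open>auto simp: single_def axis_def vec_eq_iff\<close>)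

text \<open>The shift with \<tau> / \<delta>_i = 1/2 - a centres [a, a + 1] in (0, 2). There the
  form is that of S_2, so C is the bound of this one operator and depends neither on a nor on
  i.\<close>

lemma q_local_bound:
  obtains C where "0 \<le> C" "\<And>i u a. u \<in> borel_measurable lebesgue \<Longrightarrow> integrable lebesgue (\<lambda>x. (cmod (u x))\<^sup>2) \<Longrightarrow>
    (\<And>x. x \<notin> {a..a+1} \<Longrightarrow> u x = 0) \<Longrightarrow> Re (q (single i u) (single i u)) \<le> C * (LINT x|lebesgue. (cmod (u x))\<^sup>2)"
proof -
  obtain C where C: "0 \<le> C" "\<And>f. f \<in> L2 2 \<Longrightarrow> L2_norm 2 (S_op d k 2 f) \<le> C * L2_norm 2 f"
    using bounded_opD(4)[OF S_bounded[of 2]] by auto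
  show thesis
  proof (rule that[OF C(1)])
    fix i :: 'p and u :: "real \<Rightarrow> complex" and a :: real
    assume u: "u \<in> borel_measurable lebesgue" "integrable lebesgue (\<lambda>x. (cmod (u x))\<^sup>2)" "\<And>x. x \<notin> {a..a+1} \<Longrightarrow> u x = 0"
    define \<tau> where "\<tau> = \<delta> i * (1/2 - a)"
    have \<tau>: "\<tau> / \<delta> i = 1/2 - a" using \<delta>_pos[of i] by (simp add: \<tau>_def)
    have sLc: "single i u \<in> Lc (\<bar>a\<bar> + 2)" by (rule single_Lc[OF u(1,2)], rule u(3)) auto
    have supp: "shift \<tau> (single i u) x = 0" if "x \<notin> {0<..<2}" for x
    proof -
      have "u (- (\<tau> / \<delta> i) + x) = 0" by (rule u(3)) (use that \<tau> in auto)
      then show ?thesis by (simp add: shift_def single_def axis_def vec_eq_iff)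
    qed
    define f where "f = shift \<tau> (single i u)"
    have fL: "f \<in> L2 2" unfolding f_def by (rule Lc_L2[of _ 2], rule shift_Lc[OF sLc], rule supp) auto
    have Sf: "S_op d k 2 f \<in> L2 2" by (rule bounded_opD(1)[OF S_bounded fL]) simp
    have "q (single i u) (single i u) = q f f" by (simp add: f_def q_shift)
    also have "\<dots> = L2_inner 2 (S_op d k 2 f) f"
      using supp by (intro q_eq_ip fL Sf) (auto simp: f_def)
    finally have "Re (q (single i u) (single i u)) \<le> cmod (L2_inner 2 (S_op d k 2 f) f)"
      using complex_Re_le_cmod by simp
    also have "\<dots> \<le> L2_norm 2 (S_op d k 2 f) * L2_norm 2 f" by (rule ip_Cauchy_Schwarz[OF Sf fL])
    also have "\<dots> \<le> C * L2_norm 2 f * L2_norm 2 f" by (intro mult_right_mono C fL) simp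
    also have "\<dots> = C * (L2_norm 2 f)\<^sup>2" by (simp add: power2_eq_square)
    also have "(L2_norm 2 f)\<^sup>2 = (LINT x|lebesgue. (cmod (u x))\<^sup>2)"
    proof -
      have nf: "norm (f x) = cmod (u (- (\<tau> / \<delta> i) + x))" for x
      proof -
        have "f x = axis i (u (- (\<tau> / \<delta> i) + x))" by (simp add: f_def shift_def single_def axis_def vec_eq_iff)
        then show ?thesis by (simp add: norm_axis_complex)
      qed
      have "(L2_norm 2 f)\<^sup>2 = (LINT x|lebesgue. (norm (f x))\<^sup>2)"
        unfolding L2_norm_sq by (rule lebesgue_integral_supported(1)[symmetric]) (use supp in \<open>auto simp: f_def\<close>)
      also have "\<dots> = \<bar>1\<bar> *\<^sub>R (LINT x|lebesgue. (cmod (u (- (\<tau> / \<delta> i) + 1 * x)))\<^sup>2)" by (simp add: nf)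
      also have "\<dots> = (LINT x|lebesgue. (cmod (u x))\<^sup>2)" by (rule lebesgue_integral_real_affine[symmetric]) simp
      finally show ?thesis .
    qed
    finally show "Re (q (single i u) (single i u)) \<le> C * (LINT x|lebesgue. (cmod (u x))\<^sup>2)" .
  qed
qed

lemma Shat_single:
  "Shat (single j u) x $ i = (if i = j then u x else 0) + (LINT t|lebesgue. \<kappa> i j (\<delta> i * x + - \<delta> j * t) * u t)"
proof -
  have "(LINT t|lebesgue. \<kappa> i j' (\<delta> i * x + - \<delta> j' * t) * single j u t $ j')
      = (if j' = j then (LINT t|lebesgue. \<kappa> i j (\<delta> i * x + - \<delta> j * t) * u t) else 0)" for j'
    by (simp add: single_def axis_def)
  then show ?thesis by (simp add: Shat_def) (simp add: single_def axis_def)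
qed

lemma q_single_right: "q f (single i u) = (LINT x|lebesgue. Shat f x $ i * cnj (u x))"
proof -
  have "(LINT x|lebesgue. Shat f x $ j * cnj (single i u x $ j)) = (if j = i then (LINT x|lebesgue. Shat f x $ i * cnj (u x)) else 0)" for j
    by (simp add: single_def axis_def)
  then show ?thesis by (simp add: q_def)
qed

lemma indicator_sq_Lc:
  fixes w :: "real \<Rightarrow> complex"
  assumes "continuous_on UNIV w"
  shows "(\<lambda>x. if a \<le> x \<and> x < b then w x else 0) \<in> borel_measurable lebesgue"
    and "integrable lebesgue (\<lambda>x. (cmod (if a \<le> x \<and> x < b then w x else 0))\<^sup>2)"
proof -
  have "w \<in> borel_measurable borel" by (rule borel_measurable_continuous_onI[OF assms])
  then have b: "(\<lambda>x. if a \<le> x \<and> x < b then w x else 0) \<in> borel_measurable borel" by measurable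
  then show "(\<lambda>x. if a \<le> x \<and> x < b then w x else 0) \<in> borel_measurable lebesgue"
    by (intro measurable_completion) simp
  have "continuous_on {a..b} (\<lambda>x. (cmod (w x))\<^sup>2)"
    by (intro continuous_intros continuous_on_subset[OF assms]) auto
  then have "(\<lambda>x. (cmod (w x))\<^sup>2) absolutely_integrable_on {a..b}" by (rule absolutely_integrable_continuous_real)
  then have "(\<lambda>x. (cmod (w x))\<^sup>2) absolutely_integrable_on {a..<b}" by (rule set_integrable_subset) auto
  moreover have "(cmod (if a \<le> x \<and> x < b then w x else 0))\<^sup>2 = indicator {a..<b} x *\<^sub>R (cmod (w x))\<^sup>2" for x
    by (simp add: indicator_def)
  ultimately show "integrable lebesgue (\<lambda>x. (cmod (if a \<le> x \<and> x < b then w x else 0))\<^sup>2)"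
    unfolding set_integrable_def by simp
qed

text \<open>The increment of K is, up to the factor 1 / \<delta>_j, the image under the kernel of
  the indicator of [-r, 0). Testing that image with the increment itself on [a, a + 1) gives (I /
  \<delta>_j)^2 \<le> Q C I by Cauchy-Schwarz, and one factor I cancels. So nonnegativity controls
  the kernel at arbitrary distance from 0.\<close>

lemma K_increment_bound:
  obtains N where "0 \<le> N" "\<And>a. 0 \<le> a \<Longrightarrow> (LINT x|Il 1. (cmod (K i j (\<delta> i * (a + x + 1)) - K i j (\<delta> i * (a + x))))\<^sup>2) \<le> N"
proof -
  obtain C where C: "0 \<le> C" "\<And>i u a. u \<in> borel_measurable lebesgue \<Longrightarrow> integrable lebesgue (\<lambda>x. (cmod (u x))\<^sup>2) \<Longrightarrow>
    (\<And>x. x \<notin> {a..a+1} \<Longrightarrow> u x = 0) \<Longrightarrow> Re (q (single i u) (single i u)) \<le> C * (LINT x|lebesgue. (cmod (u x))\<^sup>2)"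
    using q_local_bound by blast
  \<comment> \<open>Chosen so that \<delta>_j r = \<delta>_i: integrating the kernel over an
    interval of length r in t then gives the increment from \<delta>_i x to \<delta>_i (x +
    1).\<close>
  define r where "r = \<delta> i / \<delta> j"
  have r: "0 < r" "\<delta> j * r = \<delta> i" using \<delta>_pos[of i] \<delta>_pos[of j] by (auto simp: r_def)
  define e where "e = (\<lambda>t. if - r \<le> t \<and> t < 0 then 1 else 0 :: complex)"
  have e: "e \<in> borel_measurable lebesgue" "integrable lebesgue (\<lambda>x. (cmod (e x))\<^sup>2)"
    unfolding e_def by (rule indicator_sq_Lc, simp)+
  have eLc: "single j e \<in> Lc (r + 1)" by (rule single_Lc[OF e]) (use r in \<open>auto simp: e_def\<close>)
  define Q where "Q = Re (q (single j e) (single j e))"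
  have Q: "0 \<le> Q" unfolding Q_def by (rule q_Re_nonneg[OF eLc])
  \<comment> \<open>For x \<ge> 0 the identity part contributes nothing, because e is supported on
    the negative half-line.\<close>
  have Se: "Shat (single j e) x $ i = (K i j (\<delta> i * (x + 1)) - K i j (\<delta> i * x)) / \<delta> j" if "0 \<le> x" for x
  proof -
    have "(LINT t|lebesgue. \<kappa> i j (\<delta> i * x + - \<delta> j * t) * e t)
        = \<bar>-1\<bar> *\<^sub>R (LINT t|lebesgue. \<kappa> i j (\<delta> i * x + - \<delta> j * (0 + (-1) * t)) * e (0 + (-1) * t))"
      by (rule lebesgue_integral_real_affine) simp
    also have "\<dots> = (LINT t|lebesgue. \<kappa> i j (\<delta> i * x + \<delta> j * t) * e (- t))" by simp
    also have "\<dots> = (LINT t|lebesgue. indicator {0<..<r} t *\<^sub>R \<kappa> i j (\<delta> i * x + \<delta> j * t))"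
    proof (rule integral_cong_AE)
      have m: "(\<lambda>t. \<kappa> i j (\<delta> i * x + \<delta> j *\<^sub>R t)) \<in> borel_measurable lebesgue"
        using \<delta>_pos[of j] by (intro borel_measurable_affine loc_int_measurable \<kappa>_loc) simp
      have "(\<lambda>t. e (0 + (-1) *\<^sub>R t)) \<in> borel_measurable lebesgue" by (rule borel_measurable_affine[OF e(1)]) simp
      with m show "(\<lambda>t. \<kappa> i j (\<delta> i * x + \<delta> j * t) * e (- t)) \<in> borel_measurable lebesgue" by simp
      show "(\<lambda>t. indicator {0<..<r} t *\<^sub>R \<kappa> i j (\<delta> i * x + \<delta> j * t)) \<in> borel_measurable lebesgue"
        using m by (intro borel_measurable_scaleR borel_measurable_indicator) auto
      have "AE t in lebesgue. t \<noteq> r"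
        by (rule AE_I'[of "{r}"]) (auto simp: negligible_iff_null_sets[symmetric])
      then show "AE t in lebesgue. \<kappa> i j (\<delta> i * x + \<delta> j * t) * e (- t) = indicator {0<..<r} t *\<^sub>R \<kappa> i j (\<delta> i * x + \<delta> j * t)"
        by (rule eventually_mono) (auto simp: e_def indicator_def)
    qed
    also have "\<dots> = (LINT t|Il r. \<kappa> i j (\<delta> i * x + \<delta> j * t))" by (rule lebesgue_on_integral_eq[symmetric]) simp
    also have "\<dots> = (K i j (\<delta> i * x + \<delta> j * r) - K i j (\<delta> i * x)) / \<delta> j"
      by (rule integral_affine[OF \<kappa>_loc \<delta>_pos]) (use r in simp)
    finally show ?thesis using that r by (simp add: Shat_single e_def algebra_simps)
  qed
  show thesis
  proof (rule that[of "C * Q * (\<delta> j)\<^sup>2"])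
    show "0 \<le> C * Q * (\<delta> j)\<^sup>2" using C Q by simp
    fix a :: real assume a: "0 \<le> a"
    define w where "w x = K i j (\<delta> i * (x + 1)) - K i j (\<delta> i * x)" for x
    have wc: "continuous_on UNIV w"
      unfolding w_def by (intro continuous_intros continuous_on_compose2[OF K_continuous[of UNIV]]) auto
    define u where "u = (\<lambda>x. if a \<le> x \<and> x < a + 1 then w x else 0)"
    have u: "u \<in> borel_measurable lebesgue" "integrable lebesgue (\<lambda>x. (cmod (u x))\<^sup>2)"
      unfolding u_def by (rule indicator_sq_Lc[OF wc])+
    have uLc: "single i u \<in> Lc (a + 1)" by (rule single_Lc[OF u]) (use a in \<open>auto simp: u_def\<close>)
    define I where "I = (LINT x|lebesgue. (cmod (u x))\<^sup>2)"
    have I0: "0 \<le> I" unfolding I_def by simp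
    have "q (single j e) (single i u) = (LINT x|lebesgue. complex_of_real ((cmod (u x))\<^sup>2) / \<delta> j)"
      unfolding q_single_right
    proof (intro Bochner_Integration.integral_cong refl)
      fix x show "Shat (single j e) x $ i * cnj (u x) = complex_of_real ((cmod (u x))\<^sup>2) / \<delta> j"
        using Se[of x] a by (auto simp: u_def w_def[symmetric] complex_norm_square simp del: of_real_power)
    qed
    also have "\<dots> = complex_of_real (I / \<delta> j)"
      unfolding I_def of_real_divide integral_complex_of_real[symmetric] by simp
    finally have "cmod (q (single j e) (single i u)) = I / \<delta> j" using I0 \<delta>_pos[of j] by (simp add: norm_divide)
    then have "(I / \<delta> j)\<^sup>2 \<le> Q * Re (q (single i u) (single i u))"
      using q_Cauchy_Schwarz(1)[OF Lc_mono[OF eLc, of "max (r+1) (a+1)"] Lc_mono[OF uLc]] unfolding Q_def by simp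
    also have "\<dots> \<le> Q * (C * I)" unfolding I_def by (intro mult_left_mono Q C(2)[of u a] u) (auto simp: u_def)
    finally have "I * I \<le> (C * Q * (\<delta> j)\<^sup>2) * I" using \<delta>_pos[of j] by (simp add: power_divide field_simps power2_eq_square)
    then have "I \<le> C * Q * (\<delta> j)\<^sup>2"
      using I0 C Q by (cases "I = 0") (auto simp: mult_le_cancel_right)
    moreover have "(LINT x|Il 1. (cmod (K i j (\<delta> i * (a + x + 1)) - K i j (\<delta> i * (a + x))))\<^sup>2) = I"
    proof -
      have "I = \<bar>1\<bar> *\<^sub>R (LINT x|lebesgue. (cmod (u (a + 1 * x)))\<^sup>2)"
        unfolding I_def by (rule lebesgue_integral_real_affine) simp
      also have "\<dots> = (LINT x|lebesgue. (cmod (u (a + x)))\<^sup>2)" by simp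
      also have "\<dots> = (LINT x|lebesgue. indicator {0<..<1} x *\<^sub>R (cmod (w (a + x)))\<^sup>2)"
      proof (rule integral_cong_AE)
        have "(\<lambda>x. u (a + 1 *\<^sub>R x)) \<in> borel_measurable lebesgue" by (rule borel_measurable_affine[OF u(1)]) simp
        then show "(\<lambda>x. (cmod (u (a + x)))\<^sup>2) \<in> borel_measurable lebesgue" by simp
        have wb: "w \<in> borel_measurable lebesgue"
          using borel_measurable_continuous_onI[OF wc] by (intro measurable_completion) simp
        have "(\<lambda>x. w (a + 1 *\<^sub>R x)) \<in> borel_measurable lebesgue" by (rule borel_measurable_affine[OF wb]) simp
        then show "(\<lambda>x. indicator {0<..<1} x *\<^sub>R (cmod (w (a + x)))\<^sup>2) \<in> borel_measurable lebesgue"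
          by (intro borel_measurable_scaleR borel_measurable_indicator borel_measurable_power borel_measurable_norm) auto
        have "AE x in lebesgue. x \<noteq> (0::real)"
          by (rule AE_I'[of "{0}"]) (auto simp: negligible_iff_null_sets[symmetric])
        then show "AE x in lebesgue. (cmod (u (a + x)))\<^sup>2 = indicator {0<..<1} x *\<^sub>R (cmod (w (a + x)))\<^sup>2"
          by (rule eventually_mono) (auto simp: u_def indicator_def)
      qed
      also have "\<dots> = (LINT x|Il 1. (cmod (w (a + x)))\<^sup>2)" by (rule lebesgue_on_integral_eq[symmetric]) simp
      finally show ?thesis by (simp add: w_def add.assoc)
    qed
    ultimately show "(LINT x|Il 1. (cmod (K i j (\<delta> i * (a + x + 1)) - K i j (\<delta> i * (a + x))))\<^sup>2) \<le> C * Q * (\<delta> j)\<^sup>2" by simp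
  qed
qed

end

section \<open>Laplace transforms\<close>

lemma integrable_half_line:
  fixes w :: "real \<Rightarrow> real"
  assumes i: "\<And>n::nat. integrable (Il (real n)) w" and b: "\<And>n::nat. (LINT x|Il (real n). w x) \<le> C"
    and nn: "\<And>x. 0 < x \<Longrightarrow> 0 \<le> w x"
  shows "set_integrable lebesgue {0<..} w"
proof -
  define f where "f n x = indicator {0<..<real n} x *\<^sub>R w x" for n x
  define u where "u x = indicator {0<..} x *\<^sub>R w x" for x
  have fi: "integrable lebesgue (f n)" for n
    using i[of n] unfolding f_def by (subst (asm) lebesgue_on_integrable_iff) auto
  have fI: "(LINT x|lebesgue. f n x) = (LINT x|Il (real n). w x)" for n
    unfolding f_def by (rule lebesgue_on_integral_eq[symmetric]) simp
  have fmono: "f m x \<le> f n x" if "m \<le> n" for m n x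
    using that nn[of x] by (auto simp: f_def indicator_def)
  have lim: "(\<lambda>n. f n x) \<longlonglongrightarrow> u x" for x
  proof (rule tendsto_eventually)
    obtain N :: nat where "x < real N" using reals_Archimedean2 by blast
    then show "\<forall>\<^sub>F n in sequentially. f n x = u x"
      by (intro eventually_sequentiallyI[of N]) (auto simp: f_def u_def indicator_def)
  qed
  have inc: "incseq (\<lambda>n. LINT x|lebesgue. f n x)"
    by (intro incseq_SucI integral_mono fi fmono) auto
  have bd: "(LINT x|lebesgue. f n x) \<le> C" for n unfolding fI by (rule b)
  obtain L where "(\<lambda>n. LINT x|lebesgue. f n x) \<longlonglongrightarrow> L"
    using incseq_convergent[OF inc, of C] bd by blast
  moreover have "u \<in> borel_measurable lebesgue"
    by (rule borel_measurable_LIMSEQ_real[OF lim borel_measurable_integrable[OF fi]])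
  ultimately have "integrable lebesgue u"
    by (intro integrable_monotone_convergence[where f = f and u = u and x = L]) (auto intro!: AE_I2 monoI fmono lim fi)
  then show ?thesis by (simp add: set_integrable_def u_def[abs_def])
qed

lemma half_line_limit:
  fixes f :: "real \<Rightarrow> 'b::euclidean_space"
  assumes f: "set_integrable lebesgue {0<..} f" and X: "filterlim X at_top sequentially"
  shows "(\<lambda>n. LINT x|Il (X n). f x) \<longlonglongrightarrow> (LINT x:{0<..}|lebesgue. f x)"
proof -
  have "(\<lambda>n. LINT x|lebesgue. indicator {0<..<X n} x *\<^sub>R f x) \<longlonglongrightarrow> (LINT x|lebesgue. indicator {0<..} x *\<^sub>R f x)"
  proof (rule integral_dominated_convergence)
    show "integrable lebesgue (\<lambda>x. norm (indicator {0<..} x *\<^sub>R f x))"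
      using f by (intro integrable_norm) (simp add: set_integrable_def)
    show fm: "(\<lambda>x. indicator {0<..} x *\<^sub>R f x) \<in> borel_measurable lebesgue"
      using f by (intro borel_measurable_integrable) (simp add: set_integrable_def)
    show "(\<lambda>x. indicator {0<..<X n} x *\<^sub>R f x) \<in> borel_measurable lebesgue" for n
    proof -
      have "(\<lambda>x. indicator {0<..<X n} x *\<^sub>R (indicator {0<..} x *\<^sub>R f x)) \<in> borel_measurable lebesgue"
        by (intro borel_measurable_scaleR borel_measurable_indicator fm) auto
      moreover have "(\<lambda>x. indicator {0<..<X n} x *\<^sub>R (indicator {0<..} x *\<^sub>R f x)) = (\<lambda>x. indicator {0<..<X n} x *\<^sub>R f x)"
        by (auto simp: indicator_def fun_eq_iff)
      ultimately show ?thesis by simp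
    qed
    show "AE x in lebesgue. (\<lambda>n. indicator {0<..<X n} x *\<^sub>R f x) \<longlonglongrightarrow> indicator {0<..} x *\<^sub>R f x"
    proof (intro AE_I2 tendsto_eventually)
      fix x
      have "\<forall>\<^sub>F n in sequentially. x < X n" using X by (auto simp: filterlim_at_top_dense)
      then show "\<forall>\<^sub>F n in sequentially. indicator {0<..<X n} x *\<^sub>R f x = indicator {0<..} x *\<^sub>R f x"
        by eventually_elim (auto simp: indicator_def)
    qed
    show "AE x in lebesgue. norm (indicator {0<..<X n} x *\<^sub>R f x) \<le> norm (indicator {0<..} x *\<^sub>R f x)" for n
      by (auto simp: indicator_def)
  qed
  then show ?thesis
    unfolding set_lebesgue_integral_def by (subst lebesgue_on_integral_eq) auto
qed

text \<open>The representation formula integrates over x \<ge> 0, the L^2 estimates over x > 0; the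
  two differ by the null set {0}.\<close>

lemma set_integrable_Ici_Ioi:
  fixes f :: "real \<Rightarrow> 'b::euclidean_space"
  shows "set_integrable lebesgue {0..} f \<longleftrightarrow> set_integrable lebesgue {0<..} f"
proof (rule absolutely_integrable_spike_set_eq)
  show "negligible {x \<in> {0..} - {0<..}. f x \<noteq> 0}" by (rule negligible_subset[of "{0}"]) auto
  show "negligible {x \<in> {0<..} - {0..}. f x \<noteq> 0}" by (rule negligible_subset[of "{0}"]) auto
qed

lemma set_integral_Ici_Ioi:
  fixes f :: "real \<Rightarrow> 'b::euclidean_space"
  assumes "set_integrable lebesgue {0<..} f"
  shows "(LINT x:{0..}|lebesgue. f x) = (LINT x:{0<..}|lebesgue. f x)"
proof -
  have "(LINT x:{0..}|lebesgue. f x) = integral {0..} f"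
    using assms by (intro set_lebesgue_integral_eq_integral(2)) (simp add: set_integrable_Ici_Ioi)
  also have "\<dots> = integral {0<..} f"
    by (rule integral_spike_set) (rule negligible_subset[of "{0}"]; auto)+
  also have "\<dots> = (LINT x:{0<..}|lebesgue. f x)"
    using assms by (intro set_lebesgue_integral_eq_integral(2)[symmetric])
  finally show ?thesis .
qed

lemma L2_norm_continuous_shift:
  fixes m :: "real \<Rightarrow> 'a::euclidean_space"
  assumes "continuous_on UNIV m" 
  shows "(LINT x|Il l. (norm (m (a + x)))\<^sup>2) = integral {a..a + l} (\<lambda>x. (norm (m x))\<^sup>2)"
    and "integrable (Il l) (\<lambda>x. (norm (m (a + x)))\<^sup>2)"
proof -
  have c: "continuous_on A (\<lambda>x. (norm (m (a + x)))\<^sup>2)" for A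
    by (intro continuous_intros continuous_on_compose2[OF assms]) auto
  show i: "integrable (Il l) (\<lambda>x. (norm (m (a + x)))\<^sup>2)"
    unfolding Ioo_integrable_iff by (rule absolutely_integrable_continuous_real[OF c])
  have "(LINT x|Il l. (norm (m (a + x)))\<^sup>2) = integral {0..l} (\<lambda>x. (norm (m (a + x)))\<^sup>2)" by (rule Ioo_integral[OF i])
  also have "\<dots> = integral {a..a + l} (\<lambda>x. (norm (m x))\<^sup>2)"
    using integral_shift_Icc_real[of 0 l "\<lambda>x. (norm (m x))\<^sup>2" a] by (simp add: o_def add.commute)
  finally show "(LINT x|Il l. (norm (m (a + x)))\<^sup>2) = integral {a..a + l} (\<lambda>x. (norm (m x))\<^sup>2)" .
qed

text \<open>By the triangle inequality the L^2 norm over [a, a + 1] increases by at most sqrt N per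
  unit step. The growth is measured in windows because only window norms of the increments are
  controlled.\<close>

lemma linear_growth_windows:
  fixes m :: "real \<Rightarrow> complex"
  assumes m: "continuous_on UNIV m" and N: "0 \<le> N" "\<And>a. 0 \<le> a \<Longrightarrow> (LINT x|Il 1. (cmod (m (a + x + 1) - m (a + x)))\<^sup>2) \<le> N"
  obtains A B where "0 \<le> A" "0 \<le> B" "\<And>a. 0 \<le> a \<Longrightarrow> integral {a..a + 1} (\<lambda>x. (cmod (m x))\<^sup>2) \<le> (A + B * a)\<^sup>2"
proof -
  define e where "e v = (\<lambda>x. axis 1 (v x) :: complex^1)" for v :: "real \<Rightarrow> complex"
  have eN: "(L2_norm 1 (e v))\<^sup>2 = (LINT x|Il 1. (cmod (v x))\<^sup>2)" for v
    by (simp add: L2_norm_sq e_def norm_axis_complex)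
  have eL: "e v \<in> L2 1" if "continuous_on UNIV v" for v
  proof (rule L2_continuous)
    have "e v = (\<lambda>x. \<chi> i. v x)" by (simp add: e_def axis_def fun_eq_iff vec_eq_iff)
    then show "continuous_on {0..1} (e v)" using continuous_on_subset[OF that]
      by (auto intro!: continuous_on_vec_lambda)
  qed
  define \<rho> where "\<rho> a = L2_norm 1 (e (\<lambda>x. m (a + x)))" for a
  have mc: "continuous_on UNIV (\<lambda>x. m (a + x))" for a by (intro continuous_on_compose2[OF m] continuous_intros) auto
  define B where "B = sqrt N"
  have step: "\<rho> (a + 1) \<le> \<rho> a + B" if a: "0 \<le> a" for a
  proof -
    have m1: "continuous_on UNIV (\<lambda>x. m (a + x + 1) - m (a + x))"
      by (intro continuous_intros continuous_on_compose2[OF m]) auto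
    have "e (\<lambda>x. m (a + 1 + x)) = (\<lambda>x. e (\<lambda>x. m (a + x)) x + e (\<lambda>x. m (a + x + 1) - m (a + x)) x)"
      by (simp add: e_def axis_def fun_eq_iff vec_eq_iff add_ac)
    then have "\<rho> (a + 1) \<le> \<rho> a + L2_norm 1 (e (\<lambda>x. m (a + x + 1) - m (a + x)))"
      unfolding \<rho>_def using L2_norm_triangle[OF eL[OF mc] eL[OF m1]] by simp
    moreover have "L2_norm 1 (e (\<lambda>x. m (a + x + 1) - m (a + x))) \<le> B"
      unfolding B_def using N(2)[OF a] by (intro real_le_rsqrt) (simp only: eN)
    ultimately show ?thesis by simp
  qed
  \<comment> \<open>Windows that start in [0, 1] stay inside [0, 2], and every other window is
    reached from these by unit steps.\<close>
  have "continuous_on {0..2} (\<lambda>x. m x)" by (rule continuous_on_subset[OF m]) simp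
  from compact_imp_bounded[OF compact_continuous_image[OF this compact_Icc]]
  obtain A where A: "\<forall>y\<in>m ` {0..2}. cmod y \<le> A" unfolding bounded_iff by blast
  have "cmod (m 0) \<le> A" using A by auto
  then have A0: "0 \<le> A" using norm_ge_zero order_trans by blast
  have base: "\<rho> a \<le> A" if a: "0 \<le> a" "a \<le> 1" for a
  proof -
    have "(\<rho> a)\<^sup>2 = (LINT x|Il 1. (cmod (m (a + x)))\<^sup>2)" by (simp add: \<rho>_def eN)
    also have "\<dots> \<le> (LINT x|Il 1. A\<^sup>2)"
    proof (rule integral_mono)
      show "integrable (Il 1) (\<lambda>x. (cmod (m (a + x)))\<^sup>2)" by (rule L2_norm_continuous_shift(2)[OF m])
      show "integrable (Il 1) (\<lambda>x. A\<^sup>2)" by (intro finite_measure.integrable_const finite_measure_Il)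
      fix x assume "x \<in> space (Il 1)"
      then show "(cmod (m (a + x)))\<^sup>2 \<le> A\<^sup>2" using A a by (intro power_mono) auto
    qed
    also have "\<dots> = A\<^sup>2" by (simp add: measure_restrict_space)
    finally show ?thesis by (rule power2_le_imp_le[OF _ A0])
  qed
  have B0: "0 \<le> B" using N by (simp add: B_def)
  have all: "\<rho> a \<le> A + B * a" if "0 \<le> a" "a \<le> real n + 1" for a n
    using that
  proof (induction n arbitrary: a)
    case 0
    then have "\<rho> a \<le> A" by (intro base) auto
    then show ?case using B0 0 by (smt (verit) mult_nonneg_nonneg)
  next
    case (Suc n)
    show ?case
    proof (cases "a \<le> 1")
      case True
      then have "\<rho> a \<le> A" using Suc by (intro base) auto
      then show ?thesis using B0 Suc by (smt (verit) mult_nonneg_nonneg)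
    next
      case False
      then have "\<rho> ((a - 1) + 1) \<le> \<rho> (a - 1) + B" by (intro step) auto
      moreover have "\<rho> (a - 1) \<le> A + B * (a - 1)" using Suc False by (intro Suc.IH) auto
      ultimately show ?thesis by (simp add: algebra_simps)
    qed
  qed
  show thesis
  proof (rule that[OF A0 B0])
    fix a :: real assume a: "0 \<le> a"
    obtain n :: nat where "a < real n" using reals_Archimedean2 by blast
    then have "\<rho> a \<le> A + B * a" using a by (intro all[of a n]) auto
    then have "(\<rho> a)\<^sup>2 \<le> (A + B * a)\<^sup>2" by (rule power_mono) (simp add: \<rho>_def)
    then show "integral {a..a + 1} (\<lambda>x. (cmod (m x))\<^sup>2) \<le> (A + B * a)\<^sup>2"
      by (simp add: \<rho>_def eN L2_norm_continuous_shift[OF m])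
  qed
qed

lemma geometric_window_integrable:
  fixes w :: "real \<Rightarrow> real"
  assumes w: "continuous_on UNIV w" "\<And>x. 0 \<le> w x" and q: "0 \<le> q" "q < 1" and C: "0 \<le> C"
    and b: "\<And>n::nat. integral {real n..real n + 1} w \<le> C * q ^ n"
  shows "set_integrable lebesgue {0<..} w"
proof (rule integrable_half_line)
  have ci: "integrable (Il l) w" for l
    unfolding Ioo_integrable_iff by (intro absolutely_integrable_continuous_real continuous_on_subset[OF w(1)]) simp
  then show "integrable (Il (real n)) w" for n .
  fix n
  have "integral {0..real n} w \<le> (\<Sum>i<n. C * q ^ i)"
  proof (induction n)
    case (Suc n)
    have "integral {0..real n} w + integral {real n..real n + 1} w = integral {0..real n + 1} w"
      by (intro Henstock_Kurzweil_Integration.integral_combine integrable_continuous_real continuous_on_subset[OF w(1)]) auto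
    then show ?case using Suc b[of n] by (simp add: add.commute)
  qed simp
  also have "\<dots> = C * (\<Sum>i<n. q ^ i)" by (simp add: sum_distrib_left)
  also have "\<dots> \<le> C * (1 / (1 - q))"
    using q by (intro mult_left_mono C) (simp add: sum_gp_strict divide_right_mono)
  finally show "(LINT x|Il (real n). w x) \<le> C * (1 / (1 - q))" using Ioo_integral[OF ci] by simp
qed (use w in auto)

text \<open>Half of the exponential decay is spent on the linear growth, through \<eta> n / 2 \<le>
  exp (\<eta> n / 2). This explains the ratio exp (-\<eta> / 2) and the constant A + 2 B /
  \<eta>.\<close>

lemma exp_mult_growth_integrable:
  fixes m :: "real \<Rightarrow> complex"
  assumes m: "continuous_on UNIV m" and \<eta>: "0 < \<eta>" and AB: "0 \<le> A" "0 \<le> B"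
    and g: "\<And>a. 0 \<le> a \<Longrightarrow> integral {a..a + 1} (\<lambda>x. (cmod (m x))\<^sup>2) \<le> (A + B * a)\<^sup>2"
  shows "set_integrable lebesgue {0<..} (\<lambda>x. exp (- \<eta> * x) * cmod (m x))"
proof (rule geometric_window_integrable[where q = "exp (- \<eta> / 2)" and C = "A + 2 * B / \<eta>"])
  show "continuous_on UNIV (\<lambda>x. exp (- \<eta> * x) * cmod (m x))" by (intro continuous_intros m)
  show "0 \<le> A + 2 * B / \<eta>" using AB \<eta> by simp
  fix n :: nat
  have w: "continuous_on S (\<lambda>x. exp (- \<eta> * x) * cmod (m x))" "continuous_on S (\<lambda>x. cmod (m x))" for S
    by (intro continuous_intros continuous_on_subset[OF m]; simp)+
  have "integral {real n..real n + 1} (\<lambda>x. exp (- \<eta> * x) * cmod (m x)) \<le> integral {real n..real n + 1} (\<lambda>x. exp (- \<eta> * n) * cmod (m x))"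
    using \<eta> by (intro integral_le integrable_continuous_real w continuous_intros mult_right_mono) auto
  also have "\<dots> = exp (- \<eta> * n) * integral {real n..real n + 1} (\<lambda>x. cmod (m x))" by simp
  also have "integral {real n..real n + 1} (\<lambda>x. cmod (m x)) \<le> A + B * n"
  proof -
    let ?v = "\<lambda>x. cmod (m (real n + x))"
    have vm: "?v \<in> borel_measurable (Il 1)"
      by (intro borel_measurable_Il_continuous continuous_intros continuous_on_compose2[OF m]) auto
    have v2: "integrable (Il 1) (\<lambda>x. (?v x)\<^sup>2)" by (rule L2_norm_continuous_shift(2)[OF m])
    have one: "integrable (Il 1) (\<lambda>x. (1::real)\<^sup>2)" by (intro finite_measure.integrable_const finite_measure_Il)
    have c1: "continuous_on {0..1} ?v" by (intro continuous_intros continuous_on_compose2[OF m]) auto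
    have "integral {real n..real n + 1} (\<lambda>x. cmod (m x)) = integral {0..1} ?v"
      using integral_shift_Icc_real[of 0 1 "\<lambda>x. cmod (m x)" "real n"] by (simp add: o_def add.commute)
    also have "\<dots> = (LINT x|Il 1. ?v x)"
      by (intro Ioo_integral[symmetric]) (simp add: Ioo_integrable_iff absolutely_integrable_continuous_real[OF c1])
    also have "\<dots> \<le> \<bar>LINT x|Il 1. 1 * ?v x\<bar>" by simp
    also have "\<dots> \<le> sqrt (LINT x|Il 1. 1\<^sup>2) * sqrt (LINT x|Il 1. (?v x)\<^sup>2)"
      by (rule real_Cauchy_Schwarz(2)[OF _ one vm v2]) simp
    also have "\<dots> = sqrt (integral {real n..real n + 1} (\<lambda>x. (cmod (m x))\<^sup>2))"
      using L2_norm_continuous_shift(1)[where a = "real n" and l = 1, OF m] by (simp add: measure_restrict_space)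
    also have "\<dots> \<le> A + B * n" using g[of "real n"] AB by (intro real_le_lsqrt) auto
    finally show ?thesis .
  qed
  also have "A + B * n \<le> (A + 2 * B / \<eta>) * exp (\<eta> / 2 * n)"
  proof -
    have "\<eta> / 2 * n \<le> exp (\<eta> / 2 * n)" using exp_ge_add_one_self[of "\<eta> / 2 * n"] by linarith
    then have "2 * B / \<eta> * (\<eta> / 2 * n) \<le> 2 * B / \<eta> * exp (\<eta> / 2 * n)" using AB \<eta> by (intro mult_left_mono) auto
    moreover have "2 * B / \<eta> * (\<eta> / 2 * n) = B * n" using \<eta> by simp
    moreover have "A * 1 \<le> A * exp (\<eta> / 2 * n)" using AB \<eta> by (intro mult_left_mono) auto
    ultimately show ?thesis by (simp add: distrib_right)
  qed
  also have "exp (- \<eta> * n) * ((A + 2 * B / \<eta>) * exp (\<eta> / 2 * n)) = (A + 2 * B / \<eta>) * exp (- \<eta> / 2) ^ n"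
  proof -
    have "exp (- \<eta> * n) * exp (\<eta> / 2 * n) = exp (- \<eta> / 2) ^ n"
      by (simp flip: exp_add exp_of_nat_mult)
    then show ?thesis by simp
  qed
  finally show "integral {real n..real n + 1} (\<lambda>x. exp (- \<eta> * x) * cmod (m x)) \<le> (A + 2 * B / \<eta>) * exp (- \<eta> / 2) ^ n"
    by simp
qed (use \<eta> in auto)

text \<open>The truncated transforms are holomorphic and converge locally uniformly: on the ball of
  radius Im z / 2 around z all tails are dominated by one real tail with exponent Im z / 2.\<close>

lemma Laplace_holomorphic:
  fixes h :: "real \<Rightarrow> complex"
  assumes h: "continuous_on UNIV h" and i: "\<And>\<eta>. 0 < \<eta> \<Longrightarrow> set_integrable lebesgue {0<..} (\<lambda>x. exp (- \<eta> * x) * cmod (h x))"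
  shows "\<And>z. 0 < Im z \<Longrightarrow> set_integrable lebesgue {0<..} (\<lambda>x. exp (\<i> * z * of_real x) * h x)"
    and "(\<lambda>z. LINT x:{0<..}|lebesgue. exp (\<i> * z * of_real x) * h x) holomorphic_on {z. 0 < Im z}"
proof -
  have nrm: "cmod (exp (\<i> * z * of_real x)) = exp (- Im z * x)" for z x by simp
  have hm: "(\<lambda>x. exp (\<i> * z * of_real x) * h x) \<in> borel_measurable lebesgue" for z
    using borel_measurable_continuous_onI[of "\<lambda>x. exp (\<i> * z * of_real x) * h x"] h
    by (intro measurable_completion) (simp add: continuous_intros)
  have sm: "(\<lambda>x. indicator A x *\<^sub>R (exp (\<i> * z * of_real x) * h x)) \<in> borel_measurable lebesgue" if "A \<in> sets lebesgue" for z A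
    by (intro borel_measurable_scaleR borel_measurable_indicator hm that)
  show si: "set_integrable lebesgue {0<..} (\<lambda>x. exp (\<i> * z * of_real x) * h x)" if z: "0 < Im z" for z
    unfolding set_integrable_def
  proof (rule Bochner_Integration.integrable_bound)
    show "integrable lebesgue (\<lambda>x. indicator {0<..} x *\<^sub>R (exp (- Im z * x) * cmod (h x)))"
      using i[OF z] by (simp only: set_integrable_def)
    show "(\<lambda>x. indicator {0<..} x *\<^sub>R (exp (\<i> * z * of_real x) * h x)) \<in> borel_measurable lebesgue"
      by (rule sm) simp
  qed (auto simp: norm_mult indicator_def)
  define F where "F n z = integral (cbox 0 (real n)) (\<lambda>x. exp (\<i> * z * of_real x) * h x)" for n z
  define G where "G z = (LINT x:{0<..}|lebesgue. exp (\<i> * z * of_real x) * h x)" for z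
  have Fi: "integrable (Il l) (\<lambda>x. exp (\<i> * z * of_real x) * h x)" for l z
    unfolding Ioo_integrable_iff
    by (intro absolutely_integrable_continuous_real continuous_intros continuous_on_subset[OF h]) simp
  have F_eq: "F n z = (LINT x|Il (real n). exp (\<i> * z * of_real x) * h x)" for n z
    unfolding F_def using Ioo_integral[OF Fi] by simp
  have "G holomorphic_on {z. 0 < Im z}"
  proof (rule holomorphic_uniform_sequence)
    show "open {z. 0 < Im z}" by (rule open_halfspace_Im_gt)
    show "F n holomorphic_on {z. 0 < Im z}" for n
      unfolding F_def
    proof (rule leibniz_rule_holomorphic)
      show "convex {z. 0 < Im z}" by (rule convex_halfspace_Im_gt)
      show "continuous_on ({z. 0 < Im z} \<times> cbox 0 (real n)) (\<lambda>(z, t). \<i> * of_real t * exp (\<i> * z * of_real t) * h t)"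
        unfolding case_prod_beta by (intro continuous_intros continuous_on_compose2[OF h]) auto
      show "(\<lambda>x. exp (\<i> * z * of_real x) * h x) integrable_on cbox 0 (real n)" for z
        by (intro integrable_continuous continuous_intros continuous_on_subset[OF h]) simp
      show "((\<lambda>z. exp (\<i> * z * of_real t) * h t) has_field_derivative \<i> * of_real t * exp (\<i> * z * of_real t) * h t) (at z within {z. 0 < Im z})" for z t
        by (auto intro!: derivative_eq_intros)
    qed
    fix z assume "z \<in> {z. 0 < Im z}"
    then have z: "0 < Im z" by simp
    define \<eta> where "\<eta> = Im z / 2"
    have \<eta>: "0 < \<eta>" using z by (simp add: \<eta>_def)
    have sub: "\<eta> \<le> Im y" if "y \<in> cball z \<eta>" for y
    proof -
      have "\<bar>Im (z - y)\<bar> \<le> cmod (z - y)" by (rule abs_Im_le_cmod)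
      also have "\<dots> \<le> \<eta>" using that by (simp add: dist_norm)
      finally have "\<bar>Im (z - y)\<bar> \<le> \<eta>" .
      moreover have "Im z - Im y \<le> \<bar>Im (z - y)\<bar>" by simp
      ultimately have "Im z - Im y \<le> \<eta>" by linarith
      then show ?thesis by (simp add: \<eta>_def)
    qed
    let ?w = "\<lambda>x. exp (- \<eta> * x) * cmod (h x)"
    have tail: "cmod (G y - F n y) \<le> (LINT x:{0<..}|lebesgue. ?w x) - (LINT x|Il (real n). ?w x)" if y: "y \<in> cball z \<eta>" for n y
    proof -
      have yp: "0 < Im y" using sub[OF y] \<eta> by simp
      have wi: "integrable lebesgue (\<lambda>x. indicator {0<..} x *\<^sub>R ?w x)" using i[OF \<eta>] by (simp only: set_integrable_def)
      have wi2: "integrable lebesgue (\<lambda>x. indicator {0<..<real n} x *\<^sub>R ?w x)"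
      proof -
        have "integrable (Il (real n)) ?w"
          unfolding Ioo_integrable_iff
          by (intro absolutely_integrable_continuous_real continuous_intros continuous_on_subset[OF h]) simp
        then show ?thesis by (subst (asm) lebesgue_on_integrable_iff) auto
      qed
      have "G y - F n y = (LINT x|lebesgue. indicator {0<..} x *\<^sub>R (exp (\<i> * y * of_real x) * h x))
          - (LINT x|lebesgue. indicator {0<..<real n} x *\<^sub>R (exp (\<i> * y * of_real x) * h x))"
        unfolding G_def F_eq set_lebesgue_integral_def by (subst lebesgue_on_integral_eq) auto
      also have "\<dots> = (LINT x|lebesgue. indicator {0<..} x *\<^sub>R (exp (\<i> * y * of_real x) * h x) - indicator {0<..<real n} x *\<^sub>R (exp (\<i> * y * of_real x) * h x))"
        using si[OF yp] Fi[of "real n" y]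
        by (intro Bochner_Integration.integral_diff[symmetric]) (auto simp: set_integrable_def lebesgue_on_integrable_iff)
      also have "cmod \<dots> \<le> (LINT x|lebesgue. norm (indicator {0<..} x *\<^sub>R (exp (\<i> * y * of_real x) * h x) - indicator {0<..<real n} x *\<^sub>R (exp (\<i> * y * of_real x) * h x)))"
        by (rule integral_norm_bound)
      also have "\<dots> \<le> (LINT x|lebesgue. indicator {0<..} x *\<^sub>R ?w x - indicator {0<..<real n} x *\<^sub>R ?w x)"
      proof (rule integral_mono)
        show "integrable lebesgue (\<lambda>x. norm (indicator {0<..} x *\<^sub>R (exp (\<i> * y * of_real x) * h x) - indicator {0<..<real n} x *\<^sub>R (exp (\<i> * y * of_real x) * h x)))"
          using si[OF yp] Fi[of "real n" y]
          by (intro integrable_norm Bochner_Integration.integrable_diff) (auto simp: set_integrable_def lebesgue_on_integrable_iff)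
        show "integrable lebesgue (\<lambda>x. indicator {0<..} x *\<^sub>R ?w x - indicator {0<..<real n} x *\<^sub>R ?w x)"
          using wi wi2 by (rule Bochner_Integration.integrable_diff)
        fix x :: real
        have "cmod (exp (\<i> * y * of_real x) * h x) \<le> ?w x" if "0 < x"
          unfolding norm_mult nrm using sub[OF y] that by (intro mult_right_mono) auto
        then show "norm (indicator {0<..} x *\<^sub>R (exp (\<i> * y * of_real x) * h x) - indicator {0<..<real n} x *\<^sub>R (exp (\<i> * y * of_real x) * h x))
            \<le> indicator {0<..} x *\<^sub>R ?w x - indicator {0<..<real n} x *\<^sub>R ?w x"
          by (cases "0 < x"; cases "x < real n") (simp_all add: indicator_def)
      qed
      also have "\<dots> = (LINT x:{0<..}|lebesgue. ?w x) - (LINT x|Il (real n). ?w x)"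
        unfolding set_lebesgue_integral_def using wi wi2
        by (subst lebesgue_on_integral_eq) auto
      finally show ?thesis .
    qed
    have lim: "(\<lambda>n. (LINT x|Il (real n). ?w x)) \<longlonglongrightarrow> (LINT x:{0<..}|lebesgue. ?w x)"
      by (rule half_line_limit[OF i[OF \<eta>] filterlim_real_sequentially])
    have "uniform_limit (cball z \<eta>) F G sequentially"
    proof (rule uniform_limitI)
      fix e :: real assume "0 < e"
      with lim have "\<forall>\<^sub>F n in sequentially. dist (LINT x|Il (real n). ?w x) (LINT x:{0<..}|lebesgue. ?w x) < e"
        by (rule tendstoD)
      then show "\<forall>\<^sub>F n in sequentially. \<forall>y\<in>cball z \<eta>. dist (F n y) (G y) < e"
      proof eventually_elim
        case (elim n)
        show ?case
        proof
          fix y assume y: "y \<in> cball z \<eta>"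
          have "dist (F n y) (G y) = cmod (G y - F n y)" by (simp add: dist_norm norm_minus_commute)
          also have "\<dots> \<le> (LINT x:{0<..}|lebesgue. ?w x) - (LINT x|Il (real n). ?w x)" by (rule tail[OF y])
          also have "\<dots> < e" using elim by (simp add: dist_real_def)
          finally show "dist (F n y) (G y) < e" .
        qed
      qed
    qed
    moreover have "cball z \<eta> \<subseteq> {z. 0 < Im z}" using sub \<eta> by force
    ultimately show "\<exists>d. 0 < d \<and> cball z d \<subseteq> {z. 0 < Im z} \<and> uniform_limit (cball z d) F G sequentially"
      using \<eta> by blast
  qed
  then show "(\<lambda>z. LINT x:{0<..}|lebesgue. exp (\<i> * z * of_real x) * h x) holomorphic_on {z. 0 < Im z}"
    by (simp add: G_def[abs_def])
qed

lemma integral_windows_le: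
  fixes w :: "real \<Rightarrow> real"
  assumes w: "continuous_on UNIV w" and b: "\<And>a. 0 \<le> a \<Longrightarrow> integral {a..a + 1} w \<le> (A + B * a)\<^sup>2"
    and AB: "0 \<le> A" "0 \<le> B" and a: "0 \<le> a"
  shows "integral {a..a + real n} w \<le> real n * (A + B * (a + real n))\<^sup>2"
proof -
  have "integral {a..a + real m} w \<le> real m * (A + B * (a + real n))\<^sup>2" if "m \<le> n" for m
    using that
  proof (induction m)
    case (Suc m)
    have "integral {a..a + real m} w + integral {a + real m..a + real m + 1} w = integral {a..a + real m + 1} w"
      by (intro Henstock_Kurzweil_Integration.integral_combine integrable_continuous_real continuous_on_subset[OF w]) auto
    moreover have "integral {a + real m..a + real m + 1} w \<le> (A + B * (a + real m))\<^sup>2" using a by (intro b) auto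
    moreover have "(A + B * (a + real m))\<^sup>2 \<le> (A + B * (a + real n))\<^sup>2"
      using Suc AB a by (intro power_mono add_left_mono mult_left_mono) auto
    ultimately have "integral {a..a + real m + 1} w \<le> integral {a..a + real m} w + (A + B * (a + real n))\<^sup>2" by linarith
    then show ?case using Suc by (simp add: algebra_simps)
  qed simp
  then show ?thesis by simp
qed

lemma Laplace_one:
  assumes z: "0 < Im z"
  shows "set_integrable lebesgue {0<..} (\<lambda>x. exp (\<i> * z * complex_of_real x))"
    and "(LINT x:{0<..}|lebesgue. exp (\<i> * z * complex_of_real x)) = \<i> / z"
proof -
  have e: "set_integrable lebesgue {0<..} (\<lambda>x. exp (- \<eta> * x) * cmod 1)" if "0 < \<eta>" for \<eta>
    by (rule exp_mult_growth_integrable[of "\<lambda>_. 1" \<eta> 1 0]) (use that in auto)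
  show i: "set_integrable lebesgue {0<..} (\<lambda>x. exp (\<i> * z * complex_of_real x))"
    using Laplace_holomorphic(1)[of "\<lambda>_. 1", OF _ e z] by simp
  have z0: "z \<noteq> 0" using z by auto
  have "(\<lambda>n. LINT x|Il (real n). exp (\<i> * z * complex_of_real x)) \<longlonglongrightarrow> (LINT x:{0<..}|lebesgue. exp (\<i> * z * complex_of_real x))"
    by (rule half_line_limit[OF i filterlim_real_sequentially])
  moreover have "(LINT x|Il (real n). exp (\<i> * z * complex_of_real x)) = (exp (\<i> * z * real n) - 1) / (\<i> * z)" for n
  proof -
    have "\<i> * z * (LINT x|Il (real n). exp (\<i> * z * complex_of_real x)) = exp (\<i> * z * real n) - 1"
      using integral_exp_Il[of "real n" "\<i> * z"] unfolding integral_mult_right_zero by simp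
    then show ?thesis using z0 by (simp add: field_simps)
  qed
  moreover have "(\<lambda>n. (exp (\<i> * z * real n) - 1) / (\<i> * z)) \<longlonglongrightarrow> (0 - 1) / (\<i> * z)"
  proof (intro tendsto_intros)
    show "(\<lambda>n. exp (\<i> * z * real n)) \<longlonglongrightarrow> 0"
    proof (rule tendsto_norm_zero_cancel)
      have "(\<lambda>n. exp (- Im z) ^ n) \<longlonglongrightarrow> 0" using z by (intro LIMSEQ_realpow_zero) auto
      then show "(\<lambda>n. cmod (exp (\<i> * z * real n))) \<longlonglongrightarrow> 0" by (simp add: exp_of_nat_mult[symmetric] mult.commute)
    qed
  qed (use z0 in auto)
  ultimately have "(LINT x:{0<..}|lebesgue. exp (\<i> * z * complex_of_real x)) = (0 - 1) / (\<i> * z)"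
    using LIMSEQ_unique by force
  also have "\<dots> = (\<i> * \<i>) / (\<i> * z)" by simp
  also have "\<dots> = \<i> / z" by (rule mult_divide_mult_cancel_left) simp
  finally show "(LINT x:{0<..}|lebesgue. exp (\<i> * z * complex_of_real x)) = \<i> / z" .
qed

section \<open>Laplace transforms of K and s, the candidate phi, and the images of
  exponentials\<close>

context positive_kernel
begin

lemma K_growth:
  obtains A B where "0 \<le> A" "0 \<le> B"
    "\<And>a. 0 \<le> a \<Longrightarrow> integral {a..a + 1} (\<lambda>x. (cmod (K i j (\<delta> i * x)))\<^sup>2) \<le> (A + B * a)\<^sup>2"
proof -
  obtain N where N: "0 \<le> N" "\<And>a. 0 \<le> a \<Longrightarrow> (LINT x|Il 1. (cmod (K i j (\<delta> i * (a + x + 1)) - K i j (\<delta> i * (a + x))))\<^sup>2) \<le> N"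
    using K_increment_bound[of i j] by blast
  have c: "continuous_on UNIV (\<lambda>x. K i j (\<delta> i * x))"
    by (intro continuous_on_compose2[OF K_continuous[of UNIV]] continuous_intros) auto
  show thesis using linear_growth_windows[OF c N] that by blast
qed

lemma K_scaled_continuous: "continuous_on S (\<lambda>x. K i j (c * x + e))"
  by (intro continuous_on_compose2[OF K_continuous[of UNIV]] continuous_intros) auto

text \<open>The growth bound concerns x \<mapsto> K(\<delta>_i x), so the integral is first taken
  with exponent \<eta> \<delta>_i and then rescaled.\<close>

lemma exp_K_integrable:
  assumes "0 < \<eta>" shows "set_integrable lebesgue {0<..} (\<lambda>x. exp (- \<eta> * x) * cmod (K i j x))"
proof -
  obtain A B where AB: "0 \<le> A" "0 \<le> B"
    "\<And>a. 0 \<le> a \<Longrightarrow> integral {a..a + 1} (\<lambda>x. (cmod (K i j (\<delta> i * x)))\<^sup>2) \<le> (A + B * a)\<^sup>2"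
    using K_growth[of i j] by blast
  have c: "continuous_on UNIV (\<lambda>x. K i j (\<delta> i * x))"
    using K_scaled_continuous[of UNIV i j "\<delta> i" 0] by simp
  have "0 < \<eta> * \<delta> i" using assms \<delta>_pos by simp
  from exp_mult_growth_integrable[OF c this AB]
  have "integrable lebesgue (\<lambda>x. indicator {0<..} x *\<^sub>R (exp (- (\<eta> * \<delta> i) * x) * cmod (K i j (\<delta> i * x))))"
    by (simp only: set_integrable_def)
  from lebesgue_integrable_real_affine[OF this, of "1 / \<delta> i" 0]
  have "integrable lebesgue (\<lambda>x. indicator {0<..} (x / \<delta> i) *\<^sub>R (exp (- (\<eta> * \<delta> i) * (x / \<delta> i)) * cmod (K i j (\<delta> i * (x / \<delta> i)))))"
    using \<delta>_pos[of i] by simp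
  moreover have "indicator {0<..} (x / \<delta> i) = (indicator {0<..} x :: real)" for x
    using \<delta>_pos[of i] by (simp add: indicator_def zero_less_divide_iff)
  ultimately show ?thesis using \<delta>_pos[of i] by (simp add: set_integrable_def)
qed

definition K_Laplace :: "'p \<Rightarrow> 'p \<Rightarrow> complex \<Rightarrow> complex" where
  "K_Laplace i j z = (LINT r:{0<..}|lebesgue. exp (\<i> * z * of_real r) * K i j r)"

lemma K_Laplace_integrable: "0 < Im z \<Longrightarrow> set_integrable lebesgue {0<..} (\<lambda>r. exp (\<i> * z * of_real r) * K i j r)"
  by (rule Laplace_holomorphic(1)[OF K_continuous exp_K_integrable])

lemma K_Laplace_holomorphic: "K_Laplace i j holomorphic_on {z. 0 < Im z}"
  unfolding K_Laplace_def[abs_def] by (rule Laplace_holomorphic(2)[OF K_continuous exp_K_integrable])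

text \<open>Taking the claimed formula as the definition leaves integrability of the integrand and
  the Weyl property as the things to prove.\<close>

definition phi :: "complex \<Rightarrow> complex^'p^'p" where
  "phi z = mat (- z) ** diag_mat d ** (LINT x:{0..}|lebesgue. mat (exp (\<i> * z * complex_of_real x)) ** s_fun d k x)"

lemma s_Laplace:
  assumes z: "0 < Im z"
  shows "set_integrable lebesgue {0..} (\<lambda>x. mat (exp (\<i> * z * complex_of_real x)) ** s_fun d k x)"
    and "(LINT x:{0..}|lebesgue. mat (exp (\<i> * z * complex_of_real x)) ** s_fun d k x) $ i $ j
      = (if i = j then \<i> / z / 2 else 0) + K_Laplace i j z / of_real (\<delta> i)"
proof -
  let ?e = "\<lambda>x. exp (\<i> * z * complex_of_real x)"
  let ?F = "\<lambda>x. mat (?e x) ** s_fun d k x"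
  have nth: "?F x $ i $ j = (if i = j then 1/2 else 0) * ?e x + ?e x * K i j x / of_real (\<delta> i)" if "0 < x" for x i j
    using that by (simp add: mat_mult_nth s_fun_nth distrib_left)
  have i1: "integrable lebesgue (\<lambda>x. indicator {0<..} x *\<^sub>R ?e x)" using Laplace_one(1)[OF z] by (simp add: set_integrable_def)
  have i2: "integrable lebesgue (\<lambda>x. indicator {0<..} x *\<^sub>R (?e x * K i j x))" for i j
    using K_Laplace_integrable[OF z, of i j] by (simp add: set_integrable_def)
  have eq: "(indicator {0<..} x *\<^sub>R ?F x) $ i $ j
      = (if i = j then 1/2 else 0) * (indicator {0<..} x *\<^sub>R ?e x) + (indicator {0<..} x *\<^sub>R (?e x * K i j x)) / of_real (\<delta> i)" for x i j
    using nth[of x i j] by (cases "0 < x") (simp_all add: indicator_def)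
  have int: "integrable lebesgue (\<lambda>x. indicator {0<..} x *\<^sub>R ?F x)"
  proof (rule integrable_matrixI)
    fix i j
    show "integrable lebesgue (\<lambda>x. (indicator {0<..} x *\<^sub>R ?F x) $ i $ j)"
      unfolding eq by (intro Bochner_Integration.integrable_add integrable_mult_right integrable_divide i1 i2)
  qed
  then have si: "set_integrable lebesgue {0<..} ?F" by (simp add: set_integrable_def)
  then show "set_integrable lebesgue {0..} ?F" by (simp add: set_integrable_Ici_Ioi)
  have "(LINT x:{0..}|lebesgue. ?F x) $ i $ j = (LINT x|lebesgue. (indicator {0<..} x *\<^sub>R ?F x) $ i $ j)"
    unfolding set_integral_Ici_Ioi[OF si] unfolding set_lebesgue_integral_def by (rule integral_matrix_nth[OF int])
  also have "\<dots> = (if i = j then 1/2 else 0) * (LINT x|lebesgue. indicator {0<..} x *\<^sub>R ?e x)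
      + (LINT x|lebesgue. indicator {0<..} x *\<^sub>R (?e x * K i j x)) / of_real (\<delta> i)"
    unfolding eq
    using Bochner_Integration.integral_add[OF integrable_mult_right[OF i1, of "if i = j then 1/2 else 0"] integrable_divide[OF i2[of i j], of "of_real (\<delta> i)"]]
    by (simp only: integral_mult_right_zero integral_divide_zero)
  also have "\<dots> = (if i = j then 1/2 else 0) * (\<i> / z) + K_Laplace i j z / of_real (\<delta> i)"
    using Laplace_one(2)[OF z] by (simp add: K_Laplace_def set_lebesgue_integral_def)
  finally show "(LINT x:{0..}|lebesgue. ?F x) $ i $ j = (if i = j then \<i> / z / 2 else 0) + K_Laplace i j z / of_real (\<delta> i)"
    by simp
qed

text \<open>The factor -z D cancels the denominators in the transform of s. The constant 1/2 of s
  has the transform i / (2 z) and yields the diagonal term.\<close>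

lemma phi_nth:
  assumes z: "0 < Im z"
  shows "phi z $ i $ j = z * K_Laplace i j z + (if i = j then \<i> * of_real (\<delta> i) / 2 else 0)"
proof -
  have z0: "z \<noteq> 0" using z by auto
  have "phi z $ i $ j = - z * (of_real (d $ i) * ((if i = j then \<i> / z / 2 else 0) + K_Laplace i j z / of_real (\<delta> i)))"
    unfolding phi_def by (simp only: matrix_mul_assoc[symmetric] mat_mult_nth diag_mat_mult_nth s_Laplace(2)[OF z])
  also have "\<dots> = of_real (\<delta> i) * (z * (if i = j then \<i> / z / 2 else 0)) + z * (of_real (\<delta> i) * (K_Laplace i j z / of_real (\<delta> i)))"
    unfolding d_eq of_real_minus by (simp only: distrib_left minus_mult_minus mult_minus_left mult_minus_right minus_minus mult.left_commute)
  also have "of_real (\<delta> i) * (K_Laplace i j z / of_real (\<delta> i)) = K_Laplace i j z" using \<delta>_pos[of i] by simp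
  also have "z * (if i = j then \<i> / z / 2 else 0) = (if i = j then \<i> / 2 else 0)" using z0 by simp
  finally show ?thesis by (simp add: mult.commute)
qed

lemma phi_holomorphic: "(\<lambda>z. phi z $ i $ j) holomorphic_on {z. 0 < Im z}"
proof -
  have "(\<lambda>z. z * K_Laplace i j z + (if i = j then \<i> * of_real (\<delta> i) / 2 else 0)) holomorphic_on {z. 0 < Im z}"
    by (intro holomorphic_intros K_Laplace_holomorphic)
  then show ?thesis by (rule holomorphic_transform) (simp add: phi_nth)
qed

text \<open>For \<open>x > 0\<close>, \<open>Shat (fN j z N) x\<close> is \<open>gN j z N x\<close> defined below, and \<open>gN j z N\<close> solves
  \<open>g - z A g = h_phi + defect\<close>, where \<open>h_phi\<close> is the \<open>j\<close>-th column of \<open>\<Pi> [I; -i phi]\<close> and \<open>defect\<close> tends to 0.\<close>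

definition fN :: "'p \<Rightarrow> complex \<Rightarrow> nat \<Rightarrow> 'p vfun" where
  "fN j z N = single j (\<lambda>t. if - real N \<le> t \<and> t < 0 then of_real (\<delta> j) * exp (- \<i> * z * of_real (\<delta> j * t)) else 0)"

lemma exp_piece:
  "continuous_on UNIV (\<lambda>t. of_real (\<delta> j) * exp (- \<i> * z * of_real (\<delta> j * t)))"
  by (intro continuous_intros)

lemma fN_Lc: "fN j z N \<in> Lc (real N + 1)"
  unfolding fN_def by (rule single_Lc[OF indicator_sq_Lc[OF exp_piece]]) auto

text \<open>Going left from 0 in unit pieces, the n-th piece has seminorm at most a multiple of r^n
  with r = exp (-Im z \<delta>_j) < 1. The triangle inequality and the geometric series give a bound
  independent of N.\<close>

lemma fN_q_bound:
  assumes z: "0 < Im z"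
  obtains C where "0 \<le> C" "\<And>N. Re (q (fN j z N) (fN j z N)) \<le> C"
proof -
  obtain C where C: "0 \<le> C" "\<And>i u a. u \<in> borel_measurable lebesgue \<Longrightarrow> integrable lebesgue (\<lambda>x. (cmod (u x))\<^sup>2) \<Longrightarrow>
    (\<And>x. x \<notin> {a..a+1} \<Longrightarrow> u x = 0) \<Longrightarrow> Re (q (single i u) (single i u)) \<le> C * (LINT x|lebesgue. (cmod (u x))\<^sup>2)"
    using q_local_bound by blast
  define r where "r = exp (- Im z * \<delta> j)"
  have r: "0 < r" "r < 1" using z \<delta>_pos[of j] by (auto simp: r_def)
  define e where "e = (\<lambda>t. of_real (\<delta> j) * exp (- \<i> * z * of_real (\<delta> j * t)))"
  \<comment> \<open>Half-open pieces are disjoint, so that passing from N to N + 1 adds exactly one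
    of them to \<open>fN\<close>.\<close>
  define piece where "piece n = (\<lambda>t. if - real n - 1 \<le> t \<and> t < - real n then e t else 0)" for n :: nat
  have pm: "piece n \<in> borel_measurable lebesgue" "integrable lebesgue (\<lambda>x. (cmod (piece n x))\<^sup>2)" for n
    unfolding piece_def e_def by (rule indicator_sq_Lc[OF exp_piece])+
  have pI: "(LINT x|lebesgue. (cmod (piece n x))\<^sup>2) \<le> (\<delta> j * r ^ n)\<^sup>2" for n
  proof -
    have "(LINT x|lebesgue. (cmod (piece n x))\<^sup>2) \<le> (LINT x|lebesgue. indicator {- real n - 1..<- real n} x * (\<delta> j * r ^ n)\<^sup>2)"
    proof (rule integral_mono[OF pm(2)])
      show "integrable lebesgue (\<lambda>x. indicator {- real n - 1..<- real n} x * (\<delta> j * r ^ n)\<^sup>2)"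
        by (intro integrable_mult_left) (simp add: integrable_completion)
      fix x
      have "cmod (e x) \<le> \<delta> j * r ^ n" if "x < - real n"
      proof -
        have "cmod (e x) = \<delta> j * exp (Im z * (\<delta> j * x))"
          using \<delta>_pos[of j] by (simp add: e_def norm_mult)
        also have "Im z * (\<delta> j * x) \<le> Im z * (\<delta> j * - real n)"
          using z \<delta>_pos[of j] that by (intro mult_left_mono) auto
        then have "\<delta> j * exp (Im z * (\<delta> j * x)) \<le> \<delta> j * exp (Im z * (\<delta> j * - real n))"
          using \<delta>_pos[of j] by (intro mult_left_mono) auto
        also have "exp (Im z * (\<delta> j * - real n)) = r ^ n"
          by (simp add: r_def exp_of_nat_mult[symmetric] mult_ac)
        finally show ?thesis .
      qed
      then show "(cmod (piece n x))\<^sup>2 \<le> indicator {- real n - 1..<- real n} x * (\<delta> j * r ^ n)\<^sup>2"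
        by (auto simp: piece_def indicator_def intro!: power_mono)
    qed
    also have "\<dots> = (\<delta> j * r ^ n)\<^sup>2" by (simp add: integral_completion)
    finally show ?thesis .
  qed
  have qp: "sqrt (Re (q (single j (piece n)) (single j (piece n)))) \<le> sqrt C * \<delta> j * r ^ n" for n
  proof -
    have "Re (q (single j (piece n)) (single j (piece n))) \<le> C * (LINT x|lebesgue. (cmod (piece n x))\<^sup>2)"
      by (rule C(2)[of _ "- real n - 1", OF pm]) (auto simp: piece_def)
    also have "\<dots> \<le> C * (\<delta> j * r ^ n)\<^sup>2" by (intro mult_left_mono pI C)
    finally have "sqrt (Re (q (single j (piece n)) (single j (piece n)))) \<le> sqrt (C * (\<delta> j * r ^ n)\<^sup>2)" by simp
    then show ?thesis using r \<delta>_pos[of j] by (simp add: real_sqrt_mult mult.assoc)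
  qed
  have fS: "fN j z (Suc n) = (\<lambda>x. fN j z n x + single j (piece n) x)" for n
    by (auto simp: fN_def single_def piece_def e_def axis_def fun_eq_iff vec_eq_iff)
  have pLc: "single j (piece n) \<in> Lc (real n + 2)" for n
    by (rule single_Lc[OF pm]) (auto simp: piece_def)
  have "sqrt (Re (q (fN j z N) (fN j z N))) \<le> (\<Sum>n<N. sqrt C * \<delta> j * r ^ n)" for N
  proof (induction N)
    case 0
    have "fN j z 0 = (\<lambda>x. 0)" by (auto simp: fN_def single_def axis_def fun_eq_iff vec_eq_iff)
    then show ?case by (simp add: q_def)
  next
    case (Suc n)
    have "sqrt (Re (q (fN j z (Suc n)) (fN j z (Suc n)))) \<le> sqrt (Re (q (fN j z n) (fN j z n))) + sqrt (Re (q (single j (piece n)) (single j (piece n))))"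
      unfolding fS by (rule q_triangle[OF Lc_mono[OF fN_Lc] pLc]) simp
    then show ?case using Suc qp[of n] by simp
  qed
  also have "(\<Sum>n<N. sqrt C * \<delta> j * r ^ n) = sqrt C * \<delta> j * (\<Sum>n<N. r ^ n)" for N by (simp add: sum_distrib_left)
  also have "sqrt C * \<delta> j * (\<Sum>n<N. r ^ n) \<le> sqrt C * \<delta> j * (1 / (1 - r))" for N
    using r C \<delta>_pos[of j] by (intro mult_left_mono) (auto simp: sum_gp_strict divide_right_mono)
  finally have b: "sqrt (Re (q (fN j z N) (fN j z N))) \<le> sqrt C * \<delta> j * (1 / (1 - r))" for N .
  show thesis
  proof (rule that[of "(sqrt C * \<delta> j * (1 / (1 - r)))\<^sup>2"])
    fix N
    have "Re (q (fN j z N) (fN j z N)) = (sqrt (Re (q (fN j z N) (fN j z N))))\<^sup>2" by (simp add: q_Re_nonneg[OF fN_Lc])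
    also have "\<dots> \<le> (sqrt C * \<delta> j * (1 / (1 - r)))\<^sup>2" by (intro power_mono b) (simp add: q_Re_nonneg[OF fN_Lc])
    finally show "Re (q (fN j z N) (fN j z N)) \<le> (sqrt C * \<delta> j * (1 / (1 - r)))\<^sup>2" .
  qed simp
qed

text \<open>Truncated at R because growth bounds over the half-line have been obtained for the
  primitive K, not for \<kappa>.\<close>

definition kappa_Laplace :: "'p \<Rightarrow> 'p \<Rightarrow> complex \<Rightarrow> real \<Rightarrow> real \<Rightarrow> complex" where
  "kappa_Laplace i j z R u = (LINT r|Il R. \<kappa> i j (u + r) * exp (\<i> * z * of_real r))"

text \<open>Substitution of t = -r / \<delta>_j; the weight \<delta>_j in \<open>fN\<close> is there
  to cancel the Jacobian. At x > 0 the identity part does not see a function living on t <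
  0.\<close>

lemma Shat_fN:
  assumes x: "0 < x"
  shows "Shat (fN j z N) x $ i = kappa_Laplace i j z (\<delta> j * real N) (\<delta> i * x)"
proof -
  define e where "e = (\<lambda>t. if - real N \<le> t \<and> t < 0 then of_real (\<delta> j) * exp (- \<i> * z * of_real (\<delta> j * t)) else 0)"
  define R where "R = \<delta> j * real N"
  have nz: "\<delta> j \<noteq> 0" "0 < \<delta> j" using \<delta>_pos[of j] by auto
  have em: "e \<in> borel_measurable lebesgue" unfolding e_def by (rule indicator_sq_Lc(1)[OF exp_piece])
  have "(LINT t|lebesgue. \<kappa> i j (\<delta> i * x + - \<delta> j * t) * e t)
      = \<bar>- (1 / \<delta> j)\<bar> *\<^sub>R (LINT t|lebesgue. \<kappa> i j (\<delta> i * x + - \<delta> j * (0 + - (1 / \<delta> j) * t)) * e (0 + - (1 / \<delta> j) * t))"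
    by (rule lebesgue_integral_real_affine) (use nz in simp)
  also have "\<dots> = (1 / \<delta> j) *\<^sub>R (LINT t|lebesgue. \<kappa> i j (\<delta> i * x + t) * e (- (t / \<delta> j)))" using nz by simp
  also have "(LINT t|lebesgue. \<kappa> i j (\<delta> i * x + t) * e (- (t / \<delta> j)))
      = (LINT t|lebesgue. indicator {0<..<R} t *\<^sub>R (of_real (\<delta> j) * (\<kappa> i j (\<delta> i * x + t) * exp (\<i> * z * of_real t))))"
  proof (rule integral_cong_AE)
    have "(\<lambda>t. \<kappa> i j (\<delta> i * x + 1 *\<^sub>R t)) \<in> borel_measurable lebesgue"
      by (intro borel_measurable_affine loc_int_measurable \<kappa>_loc) simp
    then have m: "(\<lambda>t. \<kappa> i j (\<delta> i * x + t)) \<in> borel_measurable lebesgue" by simp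
    have "(\<lambda>t. e (0 + (- (1 / \<delta> j)) *\<^sub>R t)) \<in> borel_measurable lebesgue"
      by (rule borel_measurable_affine[OF em]) (use nz in simp)
    with m show "(\<lambda>t. \<kappa> i j (\<delta> i * x + t) * e (- (t / \<delta> j))) \<in> borel_measurable lebesgue" by simp
    have ex: "(\<lambda>t. exp (\<i> * z * complex_of_real t)) \<in> borel_measurable lebesgue"
      by (intro measurable_completion) (simp add: borel_measurable_continuous_onI continuous_intros)
    show "(\<lambda>t. indicator {0<..<R} t *\<^sub>R (of_real (\<delta> j) * (\<kappa> i j (\<delta> i * x + t) * exp (\<i> * z * of_real t)))) \<in> borel_measurable lebesgue"
      by (intro borel_measurable_scaleR borel_measurable_indicator borel_measurable_times borel_measurable_const m ex) auto
    have "AE t in lebesgue. t \<noteq> R"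
      by (rule AE_I'[of "{R}"]) (auto simp: negligible_iff_null_sets[symmetric])
    then show "AE t in lebesgue. \<kappa> i j (\<delta> i * x + t) * e (- (t / \<delta> j))
        = indicator {0<..<R} t *\<^sub>R (of_real (\<delta> j) * (\<kappa> i j (\<delta> i * x + t) * exp (\<i> * z * of_real t)))"
    proof (rule eventually_mono)
      fix t assume t: "t \<noteq> R"
      have pos: "0 < t / \<delta> j \<longleftrightarrow> 0 < t" and le: "t / \<delta> j \<le> real N \<longleftrightarrow> t \<le> R"
        using nz by (simp_all add: zero_less_divide_iff pos_divide_le_eq R_def mult.commute)
      show "\<kappa> i j (\<delta> i * x + t) * e (- (t / \<delta> j))
          = indicator {0<..<R} t *\<^sub>R (of_real (\<delta> j) * (\<kappa> i j (\<delta> i * x + t) * exp (\<i> * z * of_real t)))"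
      proof (cases "0 < t \<and> t < R")
        case True
        then have "e (- (t / \<delta> j)) = of_real (\<delta> j) * exp (- \<i> * z * of_real (\<delta> j * (- (t / \<delta> j))))"
          using pos le by (simp add: e_def)
        moreover have "- \<i> * z * of_real (\<delta> j * (- (t / \<delta> j))) = \<i> * z * of_real t" using nz by simp
        ultimately show ?thesis using True by simp
      next
        case False
        then have "e (- (t / \<delta> j)) = 0" using pos le t by (auto simp: e_def)
        then show ?thesis using False by (simp add: indicator_def)
      qed
    qed
  qed
  also have "\<dots> = (LINT t|Il R. of_real (\<delta> j) * (\<kappa> i j (\<delta> i * x + t) * exp (\<i> * z * of_real t)))"
    by (rule lebesgue_on_integral_eq[symmetric]) simp
  also have "\<dots> = of_real (\<delta> j) * kappa_Laplace i j z R (\<delta> i * x)" unfolding kappa_Laplace_def by (rule integral_mult_right_zero)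
  finally have "(LINT t|lebesgue. \<kappa> i j (\<delta> i * x + - \<delta> j * t) * e t) = kappa_Laplace i j z R (\<delta> i * x)"
    using nz by (simp add: scaleR_conv_of_real)
  then show ?thesis using x by (simp add: fN_def Shat_single e_def[symmetric] R_def[symmetric]) (simp add: e_def)
qed

lemma \<kappa>_exp_loc: "loc_int (\<lambda>r. exp (\<i> * z * of_real r) * \<kappa> i j r)"
proof (rule loc_intI)
  fix M
  show "integrable (Il M) (\<lambda>r. exp (\<i> * z * of_real r) * \<kappa> i j r)"
    by (intro integrable_continuous_mult \<kappa>_Il continuous_intros)
  have "integrable (Il M) (\<lambda>r. \<kappa> i j (0 + (-1) * r))" by (rule integrable_affine(1)[OF \<kappa>_loc]) simp
  then show "integrable (Il M) (\<lambda>r. exp (\<i> * z * of_real (- r)) * \<kappa> i j (- r))"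
    by (intro integrable_continuous_mult continuous_intros) simp
qed

text \<open>Extracting exp (-i z u) leaves an increment of a primitive, so continuity in u follows
  although \<kappa> itself need not be continuous.\<close>

lemma kappa_Laplace_continuous:
  assumes "0 \<le> R" shows "continuous_on UNIV (kappa_Laplace i j z R)"
proof -
  let ?P = "prim (\<lambda>r. exp (\<i> * z * of_real r) * \<kappa> i j r)"
  have "kappa_Laplace i j z R u = exp (- \<i> * z * of_real u) * (?P (u + R) - ?P u)" for u
  proof -
    have "(?P (u + 1 * R) - ?P u) / of_real 1 = (LINT r|Il R. exp (\<i> * z * of_real (u + 1 * r)) * \<kappa> i j (u + 1 * r))"
      by (rule integral_affine[OF \<kappa>_exp_loc _ assms, symmetric]) simp
    also have "\<dots> = (LINT r|Il R. exp (\<i> * z * of_real u) * (\<kappa> i j (u + r) * exp (\<i> * z * of_real r)))"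
      by (simp add: exp_add distrib_left mult_ac)
    also have "\<dots> = exp (\<i> * z * of_real u) * kappa_Laplace i j z R u" unfolding kappa_Laplace_def by (rule integral_mult_right_zero)
    finally have "?P (u + R) - ?P u = exp (\<i> * z * of_real u) * kappa_Laplace i j z R u" by simp
    then show ?thesis by (simp add: exp_minus field_simps)
  qed
  moreover have "continuous_on UNIV (\<lambda>u. exp (- \<i> * z * of_real u) * (?P (u + R) - ?P u))"
    by (intro continuous_intros continuous_on_compose2[OF prim_continuous[OF \<kappa>_exp_loc]]) auto
  ultimately show ?thesis by simp
qed

text \<open>Integration by parts in r passes from \<kappa> to K and produces -i z I1; Fubini
  evaluates the integral over (0, u) as I1 - I0. The shifted transform I1 cancels, and only K at u
  and u + R and the unshifted transform I0 survive.\<close>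

lemma kappa_Laplace_equation:
  assumes u: "0 \<le> u" and R: "0 \<le> R"
  shows "kappa_Laplace i j z R u + \<i> * z * (LINT y|Il u. kappa_Laplace i j z R y)
    = exp (\<i> * z * of_real R) * K i j (u + R) - K i j u - \<i> * z * (LINT r|Il R. exp (\<i> * z * of_real r) * K i j r)"
proof -
  define c where "c = \<i> * z"
  define a where "a = (\<lambda>r. \<kappa> i j (u + r))"
  define b where "b = (\<lambda>r. c * exp (c * complex_of_real r))"
  have ai: "integrable (Il R) a" unfolding a_def using integrable_affine(1)[OF \<kappa>_loc, of 1 0 R i j u] by simp
  have bi: "integrable (Il R) b"
    unfolding b_def Ioo_integrable_iff by (intro absolutely_integrable_continuous_real continuous_intros)
  have bI: "(LINT s|Il r. b s) = exp (c * of_real r) - 1" if "0 \<le> r" for r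
    unfolding b_def by (rule integral_exp_Il[OF that])
  have aI: "(LINT s|Il r. a s) = K i j (u + r) - K i j u" if "0 \<le> r" for r
    unfolding a_def using integral_affine[OF \<kappa>_loc zero_less_one that, of i j u] by simp
  have ei: "integrable (Il R) (\<lambda>r. exp (c * of_real r) * a r)"
    by (intro integrable_continuous_mult ai continuous_intros)
  have G: "kappa_Laplace i j z R u = (LINT r|Il R. exp (c * of_real r) * a r)"
    unfolding kappa_Laplace_def a_def c_def by (simp add: mult.commute)
  have 1: "(LINT r|Il R. a r * (LINT s|Il r. b s)) = kappa_Laplace i j z R u - (K i j (u + R) - K i j u)"
  proof -
    have "(LINT r|Il R. a r * (LINT s|Il r. b s)) = (LINT r|Il R. exp (c * of_real r) * a r - a r)"
      by (intro Bochner_Integration.integral_cong refl) (simp add: bI algebra_simps)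
    also have "\<dots> = (LINT r|Il R. exp (c * of_real r) * a r) - (LINT r|Il R. a r)"
      by (rule Bochner_Integration.integral_diff[OF ei ai])
    finally show ?thesis using aI[OF R] by (simp only: G)
  qed
  have Ei: "integrable (Il R) (\<lambda>r. exp (c * of_real r) * K i j (e + 1 * r))" for e
    using K_scaled_continuous[of "{0..R}" i j 1 e]
    by (intro integrable_continuous_mult continuous_intros) (simp add: Ioo_integrable_iff absolutely_integrable_continuous_real add.commute)
  define I1 where "I1 = (LINT r|Il R. exp (c * of_real r) * K i j (u + r))"
  define I0 where "I0 = (LINT r|Il R. exp (c * of_real r) * K i j r)"
  have Ei': "integrable (Il R) (\<lambda>r. exp (c * of_real r) * K i j (u + r))" "integrable (Il R) (\<lambda>r. exp (c * of_real r) * K i j r)"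
    using Ei[of u] Ei[of 0] by simp_all
  have 2: "(LINT r|Il R. b r * (LINT s|Il r. a s)) = c * I1 - K i j u * (exp (c * of_real R) - 1)"
  proof -
    have "(LINT r|Il R. b r * (LINT s|Il r. a s)) = (LINT r|Il R. c * (exp (c * of_real r) * K i j (u + r)) - K i j u * b r)"
      by (intro Bochner_Integration.integral_cong refl) (simp add: aI b_def algebra_simps)
    also have "\<dots> = c * I1 - K i j u * (LINT r|Il R. b r)"
      using Ei'(1) bi by (simp add: I1_def)
    finally show ?thesis by (simp add: bI[OF R])
  qed
  have prod: "kappa_Laplace i j z R u - (K i j (u + R) - K i j u) + (c * I1 - K i j u * (exp (c * of_real R) - 1))
      = (K i j (u + R) - K i j u) * (exp (c * of_real R) - 1)"
    using integral_product_rule(1)[OF ai bi] unfolding 1 2 aI[OF R] bI[OF R] .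
  have ee: "integrable (Il R) (\<lambda>r. exp (c * complex_of_real r))"
    unfolding Ioo_integrable_iff by (intro absolutely_integrable_continuous_real continuous_intros)
  have 3: "(LINT y|Il u. kappa_Laplace i j z R y) = I1 - I0"
  proof -
    have "(LINT y|Il u. kappa_Laplace i j z R y) = (LINT y|Il u. LINT r|Il R. \<kappa> i j (1 * y + 1 * r) * exp (c * of_real r))"
      by (simp add: kappa_Laplace_def c_def)
    also have "\<dots> = (LINT r|Il R. exp (c * of_real r) * (LINT y|Il u. \<kappa> i j (1 * y + 1 * r)))"
      by (rule Fubini_convolution(1)[OF \<kappa>_loc _ _ ee]) auto
    also have "\<dots> = (LINT r|Il R. exp (c * of_real r) * K i j (u + r) - exp (c * of_real r) * K i j r)"
    proof (intro Bochner_Integration.integral_cong refl)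
      fix r
      have "(LINT y|Il u. \<kappa> i j (1 * y + 1 * r)) = K i j (u + r) - K i j r"
        using integral_affine[OF \<kappa>_loc zero_less_one u, of i j r] by (simp add: add.commute)
      then show "exp (c * of_real r) * (LINT y|Il u. \<kappa> i j (1 * y + 1 * r)) = exp (c * of_real r) * K i j (u + r) - exp (c * of_real r) * K i j r"
        by (simp add: right_diff_distrib)
    qed
    also have "\<dots> = I1 - I0" unfolding I1_def I0_def by (rule Bochner_Integration.integral_diff[OF Ei'])
    finally show ?thesis .
  qed
  show ?thesis using prod unfolding c_def[symmetric] I0_def[symmetric] 3 by (simp add: algebra_simps)
qed

end


section \<open>The Weyl function\<close>

lemma sum_UNIV_sum:
  "(\<Sum>a\<in>(UNIV :: ('p::finite + 'q::finite) set). f a) = (\<Sum>c\<in>UNIV. f (Inl c)) + (\<Sum>c\<in>UNIV. f (Inr c))"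
proof -
  have "(\<Sum>a\<in>(UNIV <+> UNIV :: ('p + 'q) set). f a) = (\<Sum>c\<in>UNIV. f (Inl c)) + (\<Sum>c\<in>UNIV. f (Inr c))"
    using sum.Plus[of "UNIV :: 'p set" "UNIV :: 'q set" f] by (simp add: o_def)
  then show ?thesis by simp
qed

lemma A_op_sum:
  assumes "finite I" "\<And>b. b \<in> I \<Longrightarrow> h b \<in> L2 l" "x \<le> l"
  shows "A_op d (\<lambda>x. \<Sum>b\<in>I. c b *s h b x) x = (\<Sum>b\<in>I. c b *s A_op d (h b) x)"
  using assms
proof (induction I)
  case empty
  then show ?case by (simp add: A_op_def vec_eq_iff)
next
  case (insert b I)
  have "A_op d (\<lambda>x. c b *s h b x + (\<Sum>b\<in>I. c b *s h b x)) x = A_op d (\<lambda>x. c b *s h b x) x + A_op d (\<lambda>x. \<Sum>b\<in>I. c b *s h b x) x"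
    using insert by (intro A_op_add[of _ l] L2_smult L2_sum) auto
  then show ?case using insert by (simp add: A_op_smult)
qed

lemma resolvent_sum:
  assumes "finite I" "\<And>b. b \<in> I \<Longrightarrow> h b \<in> L2 l"
  shows "ae_eq l (\<lambda>x. \<Sum>b\<in>I. c b *s resolvent d z (h b) x) (resolvent d z (\<lambda>x. \<Sum>b\<in>I. c b *s h b x))"
proof (rule resolvent_unique)
  show "(\<lambda>x. \<Sum>b\<in>I. c b *s h b x) \<in> L2 l" using assms by (intro L2_sum L2_smult) auto
  show "(\<lambda>x. \<Sum>b\<in>I. c b *s resolvent d z (h b) x) \<in> L2 l" using assms by (intro L2_sum L2_smult resolvent_L2) auto
  show "ae_eq l (\<lambda>x. \<Sum>b\<in>I. c b *s resolvent d z (h b) x)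
     (\<lambda>x. (\<Sum>b\<in>I. c b *s h b x) + z *s A_op d (\<lambda>x. \<Sum>b\<in>I. c b *s resolvent d z (h b) x) x)"
  proof (rule ae_eqI)
    fix x assume x: "0 < x" "x < l"
    have "(\<Sum>b\<in>I. c b *s resolvent d z (h b) x) = (\<Sum>b\<in>I. c b *s (h b x + z *s A_op d (resolvent d z (h b)) x))"
      using x by (intro sum.cong refl arg_cong[of _ _ "(*s) _"] resolvent_eq[of _ l] assms) auto
    also have "\<dots> = (\<Sum>b\<in>I. c b *s h b x) + z *s (\<Sum>b\<in>I. c b *s A_op d (resolvent d z (h b)) x)"
      by (simp add: vec_eq_iff sum.distrib sum_distrib_left algebra_simps)
    also have "(\<Sum>b\<in>I. c b *s A_op d (resolvent d z (h b)) x) = A_op d (\<lambda>x. \<Sum>b\<in>I. c b *s resolvent d z (h b) x) x"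
      using x by (intro A_op_sum[of _ _ l, symmetric] resolvent_L2 assms) auto
    finally show "(\<Sum>b\<in>I. c b *s resolvent d z (h b) x) = (\<Sum>b\<in>I. c b *s h b x) + z *s A_op d (\<lambda>x. \<Sum>b\<in>I. c b *s resolvent d z (h b) x) x" .
  qed
qed

text \<open>J as a permutation of coordinates.\<close>

definition swap_sum :: "'p + 'p \<Rightarrow> 'p + 'p" where
  "swap_sum a = (case a of Inl c \<Rightarrow> Inr c | Inr c \<Rightarrow> Inl c)"

lemma swap_sum_simps [simp]: "swap_sum (Inl c) = Inr c" "swap_sum (Inr c) = Inl c"
  by (simp_all add: swap_sum_def)

locale factorized_kernel = positive_kernel d k
  for d :: "real^'p::finite" and k :: "real \<Rightarrow> complex^'p^'p" +
  fixes E :: "real \<Rightarrow> real \<Rightarrow> complex^'p^'p"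
  assumes E_factorizing: "factorizing_kernel d k E"
begin

text \<open>The Hilbert-Schmidt condition enters here, through the density of the range of
  T.\<close>

sublocale triangular_factorization d "S_op d k" "E_op E" Pi_col swap_sum
proof
  show "swap_sum (swap_sum a) = a" for a :: "'p + 'p" by (cases a) auto
  fix l :: real assume l: "0 < l"
  show T: "bounded_op l (E_op E)" using E_factorizing l by (simp add: factorizing_kernel_def)
  show Sb: "bounded_op l (S_op d k l)" by (rule S_bounded[OF l])
  show "\<exists>Tstar. adjoint_op l (E_op E) Tstar \<and> bounded_inverse l (S_op d k l) (\<lambda>f. Tstar (E_op E f))"
    using E_factorizing l by (simp add: factorizing_kernel_def)
  have HS: "sq_integrable_on (\<lambda>(x, t). E x t) {(x, t). 0 < t \<and> t < x \<and> x < l}"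
    using E_factorizing l by (simp add: factorizing_kernel_def)
  show "ae_eq l r (\<lambda>x. 0)" if "r \<in> L2 l" "\<And>g. g \<in> L2 l \<Longrightarrow> L2_inner l (E_op E g) r = 0" for r
    by (rule E_op_range_orthogonal[OF l T HS that])
  show "L2_inner l (A_op d (S_op d k l f)) g - L2_inner l f (A_op d (S_op d k l g))
      = \<i> * (\<Sum>a\<in>UNIV. L2_inner l f (Pi_col (swap_sum a)) * L2_inner l (Pi_col a) g)"
    if f: "f \<in> L2 l" and g: "g \<in> L2 l" for f g
    using operator_identity[OF l f g bounded_opD(1)[OF Sb f] bounded_opD(1)[OF Sb g]]
    by (simp add: sum_UNIV_sum sum.distrib)
qed (rule Pi_col_L2)

abbreviation T :: "'p vfun \<Rightarrow> 'p vfun" where "T \<equiv> E_op E"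

text \<open>T carries the Volterra equation for A to the one for Q, and the latter is the integrated
  canonical system multiplied by \<beta>.\<close>

lemma T_volterra_eq:
  assumes l: "0 < l" and f: "f \<in> L2 l" and h: "h \<in> L2 l" and eq: "ae_eq l f (\<lambda>x. h x + z *s A_op d f x)"
  shows "ae_eq l (T f) (\<lambda>x. T h x + z *s Q (T f) x)"
proof -
  have A: "A_op d f \<in> L2 l" by (rule A_op_L2[OF f])
  have "ae_eq l (T f) (T (\<lambda>x. h x + z *s A_op d f x))"
    by (intro T_cong l f eq L2_add h L2_smult A)
  also have "ae_eq l \<dots> (\<lambda>x. T h x + T (\<lambda>x. z *s A_op d f x) x)"
    by (intro bounded_opD(2)[OF T_bounded[OF l]] h L2_smult A)
  also have "ae_eq l \<dots> (\<lambda>x. T h x + z *s T (A_op d f) x)"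
    by (intro ae_eq_add ae_eq_refl bounded_opD(3)[OF T_bounded[OF l]] A)
  also have "ae_eq l \<dots> (\<lambda>x. T h x + z *s Q (T f) x)"
    by (intro ae_eq_add ae_eq_refl ae_eq_smult T_A_op l f)
  finally (ae_eq_trans) show ?thesis .
qed

text \<open>Writing u = T f, injectivity of T pulls the equation back to A, where uniqueness is
  explicit. This takes the place of a Gronwall argument for the canonical system.\<close>

lemma T_volterra_unique:
  assumes l: "0 < l" and h: "h \<in> L2 l" and u: "u \<in> L2 l" and eq: "ae_eq l u (\<lambda>x. T h x + z *s Q u x)"
  shows "ae_eq l u (T (resolvent d z h))"
proof -
  obtain f where f: "f \<in> L2 l" "ae_eq l (T f) u" by (rule T_surj[OF l u])
  have Af: "A_op d f \<in> L2 l" by (rule A_op_L2[OF f(1)])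
  have Qu: "ae_eq l (Q (T f)) (Q u)"
    by (rule ae_eqI) (use f u l in \<open>auto intro!: Q_cong[of _ l] T_L2\<close>)
  have TA: "ae_eq l (T (A_op d f)) (Q u)" using T_A_op[OF l f(1)] Qu by (rule ae_eq_trans)
  define r where "r = (\<lambda>x. f x - (h x + z *s A_op d f x))"
  have hA: "(\<lambda>x. h x + z *s A_op d f x) \<in> L2 l" by (intro L2_add h L2_smult Af)
  have r: "r \<in> L2 l" unfolding r_def by (intro L2_diff f hA)
  have "ae_eq l (T (\<lambda>x. h x + z *s A_op d f x)) (\<lambda>x. T h x + T (\<lambda>x. z *s A_op d f x) x)"
    by (intro bounded_opD(2)[OF T_bounded[OF l]] h L2_smult Af)
  also have "ae_eq l \<dots> (\<lambda>x. T h x + z *s T (A_op d f) x)"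
    by (intro ae_eq_add ae_eq_refl bounded_opD(3)[OF T_bounded[OF l]] Af)
  also have "ae_eq l \<dots> (\<lambda>x. T h x + z *s Q u x)"
    by (intro ae_eq_add ae_eq_refl ae_eq_smult TA)
  also have "ae_eq l \<dots> u" by (rule ae_eq_sym[OF eq])
  also have "ae_eq l u (T f)" by (rule ae_eq_sym[OF f(2)])
  finally (ae_eq_trans) have ThA: "ae_eq l (T (\<lambda>x. h x + z *s A_op d f x)) (T f)" .
  have "ae_eq l (T r) (\<lambda>x. T f x - T (\<lambda>x. h x + z *s A_op d f x) x)"
    unfolding r_def by (intro T_diff l f hA)
  then have "ae_eq l (T r) (\<lambda>x. 0)" using ThA unfolding ae_eq_def by eventually_elim simp
  then have "ae_eq l r (\<lambda>x. 0)" by (rule T_inj[OF l r])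
  then have "ae_eq l f (\<lambda>x. h x + z *s A_op d f x)"
    unfolding ae_eq_def r_def by (rule eventually_mono) simp
  then have "ae_eq l f (resolvent d z h)" by (rule resolvent_unique[OF h f(1)])
  then have "ae_eq l (T f) (T (resolvent d z h))" by (intro T_cong l f resolvent_L2 h)
  with ae_eq_sym[OF f(2)] show ?thesis by (rule ae_eq_trans)
qed

text \<open>Over \<open>(-\<infinity>, l)\<close> the form \<open>q\<close> is a nonnegative block operator, \<open>g\<close> is the image of \<open>f\<close> under
  the off-diagonal block, and \<open>(L2_norm l (T g))\<^sup>2\<close> is the form of \<open>S\<^sub>l\<^sup>-\<^sup>1\<close> at \<open>g\<close>.\<close>

lemma T_norm_le_q:
  assumes l: "0 < l" and f: "f \<in> Lc M" and g: "g \<in> L2 l" and fg: "\<And>x. 0 < x \<Longrightarrow> x < l \<Longrightarrow> Shat f x = g x"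
  shows "(L2_norm l (T g))\<^sup>2 \<le> Re (q f f)"
proof -
  obtain h where h: "h \<in> L2 l" "ae_eq l (S_op d k l h) g" by (rule S_surj[OF l g])
  \<comment> \<open>Cutting h outside (0, l) makes it an admissible argument of \<open>q\<close> and
    does not affect S_l h on (0, l).\<close>
  define h' where "h' = clip 0 l h"
  have h'L: "h' \<in> L2 l" unfolding h'_def by (rule L2_cut[OF h(1)]) simp
  have h'ae: "ae_eq l h' h" by (rule ae_eqI) (simp add: h'_def clip_def)
  have h'0: "h' x = 0" if "x \<notin> {0<..<l}" for x using that by (auto simp: h'_def clip_def)
  define M' where "M' = max M l"
  have fM: "f \<in> Lc M'" by (rule Lc_mono[OF f]) (simp add: M'_def)
  have hM: "h' \<in> Lc M'" unfolding h'_def by (rule L2_clip_Lc[OF h(1)]) (simp add: M'_def)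
  have Sh: "S_op d k l h \<in> L2 l" by (rule S_L2[OF l h(1)])
  have Sh': "S_op d k l h' \<in> L2 l" by (rule S_L2[OF l h'L])
  \<comment> \<open>Both the pairing of f with h' and the form at h' will equal t, so Cauchy-Schwarz
    reads t^2 \<le> Re (q f f) t.\<close>
  define t where "t = (L2_norm l (T g))\<^sup>2"
  have gh: "L2_inner l g h = of_real t"
  proof -
    have "L2_inner l g h = L2_inner l (T g) (T (S_op d k l h))" by (rule T_S_inner[OF l h(1) g, symmetric])
    also have "\<dots> = L2_inner l (T g) (T g)"
      by (intro ip_cong T_L2 l g Sh ae_eq_refl T_cong h(2))
    finally show ?thesis by (simp add: ip_self t_def)
  qed
  have "q f h' = (\<Sum>i\<in>UNIV. LINT x|Il l. g x $ i * cnj (h' x $ i))"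
    unfolding q_def
  proof (intro sum.cong refl)
    fix i
    have "(LINT x|lebesgue. Shat f x $ i * cnj (h' x $ i)) = (LINT x|Il l. Shat f x $ i * cnj (h' x $ i))"
      by (rule lebesgue_integral_supported(1)) (simp add: h'0)
    also have "\<dots> = (LINT x|Il l. g x $ i * cnj (h' x $ i))"
      by (intro Bochner_Integration.integral_cong refl) (simp add: fg)
    finally show "(LINT x|lebesgue. Shat f x $ i * cnj (h' x $ i)) = (LINT x|Il l. g x $ i * cnj (h' x $ i))" .
  qed
  also have "\<dots> = L2_inner l g h'" by (rule ip_nth(1)[OF g h'L, symmetric])
  also have "\<dots> = L2_inner l g h" by (intro ip_cong g h'L h ae_eq_refl h'ae)
  finally have 1: "q f h' = of_real t" by (simp only: gh)
  have "q h' h' = L2_inner l (S_op d k l h') h'" by (intro q_eq_ip h'L h'0 Sh') auto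
  also have "\<dots> = L2_inner l g h"
    by (intro ip_cong Sh' g h'L h h'ae ae_eq_trans[OF bounded_op_cong[OF S_bounded[OF l] h'L h(1) h'ae] h(2)])
  finally have 2: "q h' h' = of_real t" by (simp only: gh)
  have t0: "0 \<le> t" by (simp add: t_def)
  have "t\<^sup>2 \<le> Re (q f f) * t" using q_Cauchy_Schwarz(1)[OF fM hM] t0 by (simp add: 1 2)
  then have "t \<le> Re (q f f)"
    using t0 q_Re_nonneg[OF f] by (cases "t = 0") (auto simp: power2_eq_square)
  then show ?thesis by (simp add: t_def)
qed

definition h_phi :: "'p \<Rightarrow> complex \<Rightarrow> 'p vfun" where
  "h_phi j z x = (\<chi> i. - K i j (\<delta> i * x) - \<i> * z * K_Laplace i j z)"

definition gN :: "'p \<Rightarrow> complex \<Rightarrow> nat \<Rightarrow> 'p vfun" where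
  "gN j z N x = (\<chi> i. kappa_Laplace i j z (\<delta> j * real N) (\<delta> i * x))"

text \<open>The two errors of truncating at R = \<delta>_j N: the boundary term of the integration
  by parts and the missing tail of the transform of K.\<close>

definition defect :: "'p \<Rightarrow> complex \<Rightarrow> nat \<Rightarrow> 'p vfun" where
  "defect j z N x = (\<chi> i. exp (\<i> * z * of_real (\<delta> j * real N)) * K i j (\<delta> i * x + \<delta> j * real N)
      + \<i> * z * (K_Laplace i j z - (LINT r|Il (\<delta> j * real N). exp (\<i> * z * of_real r) * K i j r)))"

lemma h_phi_L2: "h_phi j z \<in> L2 l"
proof (rule L2_continuous)
  show "continuous_on {0..l} (h_phi j z)"
    unfolding h_phi_def using K_scaled_continuous[of "{0..l}" _ j _ 0]
    by (intro continuous_on_vec_lambda continuous_intros) simp_all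
qed

lemma gN_L2: "gN j z N \<in> L2 l"
proof (rule L2_continuous)
  have "0 \<le> \<delta> j * real N" using \<delta>_pos[of j] by simp
  then show "continuous_on {0..l} (gN j z N)"
    unfolding gN_def
    by (intro continuous_on_vec_lambda continuous_on_compose2[OF kappa_Laplace_continuous] continuous_intros) auto
qed

lemma defect_L2: "defect j z N \<in> L2 l"
  unfolding defect_def
  by (intro L2_continuous continuous_on_vec_lambda continuous_intros K_scaled_continuous)

lemma gN_eq:
  assumes x: "0 < x"
  shows "gN j z N x = (h_phi j z x + defect j z N x) + z *s A_op d (gN j z N) x"
  unfolding vec_eq_iff
proof
  fix i
  let ?R = "\<delta> j * real N"
  have R: "0 \<le> ?R" using \<delta>_pos[of j] by simp
  have c: "continuous_on {0..\<delta> i * x} (kappa_Laplace i j z ?R)" by (rule continuous_on_subset[OF kappa_Laplace_continuous[OF R]]) simp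
  have "(LINT y|Il x. kappa_Laplace i j z ?R (0 + \<delta> i * y)) = (LINT y|Il (\<delta> i * x). kappa_Laplace i j z ?R y) / of_real (\<delta> i)"
  proof -
    have lc: "loc_int (kappa_Laplace i j z ?R)"
      unfolding loc_int_def Ioo_integrable_iff
      by (intro allI absolutely_integrable_continuous_real continuous_on_subset[OF kappa_Laplace_continuous[OF R]]) simp
    have "0 \<le> \<delta> i * x" using \<delta>_pos[of i] x by simp
    then show ?thesis
      using integral_affine[OF lc \<delta>_pos less_imp_le[OF x], of 0 i] prim_nonneg[OF lc, of "\<delta> i * x"] by simp
  qed
  then have A: "A_op d (gN j z N) x $ i = - \<i> * (LINT y|Il (\<delta> i * x). kappa_Laplace i j z ?R y)"
    using \<delta>_pos[of i] by (simp add: A_op_def gN_def d_eq)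
  have "0 \<le> \<delta> i * x" using \<delta>_pos[of i] x by simp
  from kappa_Laplace_equation[OF this R, of i j z]
  show "gN j z N x $ i = ((h_phi j z x + defect j z N x) + z *s A_op d (gN j z N) x) $ i"
    unfolding vector_add_component vector_smult_component A by (simp add: gN_def h_phi_def defect_def algebra_simps)
qed

lemma gN_resolvent:
  assumes "0 < l"
  shows "ae_eq l (gN j z N) (\<lambda>x. resolvent d z (h_phi j z) x + resolvent d z (defect j z N) x)"
proof -
  have he: "(\<lambda>x. h_phi j z x + defect j z N x) \<in> L2 l" by (intro L2_add h_phi_L2 defect_L2)
  have "ae_eq l (gN j z N) (resolvent d z (\<lambda>x. h_phi j z x + defect j z N x))"
    by (rule resolvent_unique[OF he gN_L2]) (rule ae_eqI, rule gN_eq)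
  moreover have "ae_eq l (\<lambda>x. resolvent d z (h_phi j z) x + resolvent d z (defect j z N) x) (resolvent d z (\<lambda>x. h_phi j z x + defect j z N x))"
  proof -
    \<comment> \<open>Summation over the two truth values presents a sum of two functions as an
      instance of \<open>resolvent_sum\<close>.\<close>
    have "ae_eq l (\<lambda>x. \<Sum>b\<in>UNIV. 1 *s resolvent d z ((\<lambda>b. if b then h_phi j z else defect j z N) b) x) (resolvent d z (\<lambda>x. \<Sum>b\<in>UNIV. 1 *s (\<lambda>b. if b then h_phi j z else defect j z N) b x))"
      by (rule resolvent_sum) (auto simp: h_phi_L2 defect_L2)
    then show ?thesis by (simp add: UNIV_bool add.commute)
  qed
  ultimately show ?thesis using ae_eq_sym ae_eq_trans by blast
qed

text \<open>In the boundary term the exponential decay in R beats the linear growth of the window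
  norms of K; the tail term is constant in x. The interval (0, l) stays fixed.\<close>

lemma defect_tendsto:
  assumes z: "0 < Im z" and l: "0 < l"
  shows "(\<lambda>N. L2_norm l (defect j z N)) \<longlonglongrightarrow> 0"
proof -
  define R where "R N = \<delta> j * real N" for N :: nat
  have R0: "0 \<le> R N" for N using \<delta>_pos[of j] by (simp add: R_def)
  have Rlim: "filterlim R at_top sequentially"
    unfolding R_def using \<delta>_pos[of j] by (intro filterlim_tendsto_pos_mult_at_top[OF tendsto_const _ filterlim_real_sequentially])
  define c where "c i N = \<i> * z * (K_Laplace i j z - (LINT r|Il (R N). exp (\<i> * z * of_real r) * K i j r))" for i N
  \<comment> \<open>Separating components and the two kinds of error reduces the claim to scalar
    functions.\<close>
  define p where "p i N = single i (\<lambda>x. exp (\<i> * z * of_real (R N)) * K i j (\<delta> i * x + R N))" for i N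
  define p2 where "p2 i N = (single i (\<lambda>x. c i N) :: 'p vfun)" for i N
  have pL: "p i N \<in> L2 l" for i N
  proof (rule L2_continuous)
    have "p i N = (\<lambda>x. \<chi> i'. if i' = i then exp (\<i> * z * of_real (R N)) * K i j (\<delta> i * x + R N) else 0)"
      by (simp add: p_def single_def axis_def fun_eq_iff)
    moreover have "continuous_on {0..l} \<dots>"
    proof (rule continuous_on_vec_lambda)
      fix i'
      show "continuous_on {0..l} (\<lambda>x. if i' = i then exp (\<i> * z * of_real (R N)) * K i j (\<delta> i * x + R N) else 0)"
        by (cases "i' = i") (auto intro!: continuous_intros K_scaled_continuous)
    qed
    ultimately show "continuous_on {0..l} (p i N)" by simp
  qed
  have p2L: "p2 i N \<in> L2 l" for i N
    unfolding p2_def single_def by (rule L2_const)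
  have defect_eq: "defect j z N = (\<lambda>x. (\<Sum>i\<in>UNIV. p i N x) + (\<Sum>i\<in>UNIV. p2 i N x))" for N
    by (simp add: fun_eq_iff vec_eq_iff defect_def p_def p2_def single_def axis_def c_def R_def)
  have le: "L2_norm l (defect j z N) \<le> (\<Sum>i\<in>UNIV. L2_norm l (p i N)) + (\<Sum>i\<in>UNIV. L2_norm l (p2 i N))" for N
  proof -
    have "L2_norm l (defect j z N) \<le> L2_norm l (\<lambda>x. \<Sum>i\<in>UNIV. p i N x) + L2_norm l (\<lambda>x. \<Sum>i\<in>UNIV. p2 i N x)"
      unfolding defect_eq by (intro L2_norm_triangle L2_sum pL p2L) auto
    also have "\<dots> \<le> (\<Sum>i\<in>UNIV. L2_norm l (p i N)) + (\<Sum>i\<in>UNIV. L2_norm l (p2 i N))"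
      by (intro add_mono L2_norm_sum_le pL p2L) auto
    finally show ?thesis .
  qed
  have plim: "(\<lambda>N. L2_norm l (p i N)) \<longlonglongrightarrow> 0" for i
  proof -
    obtain A B where AB: "0 \<le> A" "0 \<le> B"
      "\<And>a. 0 \<le> a \<Longrightarrow> integral {a..a + 1} (\<lambda>x. (cmod (K i j (\<delta> i * x)))\<^sup>2) \<le> (A + B * a)\<^sup>2"
      using K_growth[of i j] by blast
    \<comment> \<open>The interval (0, l) is covered by n unit windows, the scale on which the
      growth of K is known.\<close>
    obtain n :: nat where n: "l \<le> real n" using real_arch_simple by blast
    have mc: "continuous_on UNIV (\<lambda>x. K i j (\<delta> i * x))" using K_scaled_continuous[of UNIV i j "\<delta> i" 0] by simp
    have m2c: "continuous_on UNIV (\<lambda>x. (cmod (K i j (\<delta> i * x)))\<^sup>2)" by (intro continuous_intros mc)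
    have b: "L2_norm l (p i N) \<le> exp (- Im z * R N) * (sqrt n * (A + B * (R N / \<delta> i + n)))" for N
    proof -
      define a where "a = R N / \<delta> i"
      have a0: "0 \<le> a" using R0[of N] \<delta>_pos[of i] by (simp add: a_def)
      have ax: "\<delta> i * x + R N = \<delta> i * (a + x)" for x using \<delta>_pos[of i] by (simp add: a_def field_simps)
      have "(L2_norm l (p i N))\<^sup>2 = (LINT x|Il l. (exp (- Im z * R N))\<^sup>2 * (cmod (K i j (\<delta> i * (a + x))))\<^sup>2)"
        unfolding L2_norm_sq p_def single_def norm_axis_complex ax by (simp add: norm_mult power_mult_distrib)
      also have "\<dots> = (exp (- Im z * R N))\<^sup>2 * integral {a..a + l} (\<lambda>x. (cmod (K i j (\<delta> i * x)))\<^sup>2)"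
        using L2_norm_continuous_shift(1)[OF mc, where a = a and l = l] by simp
      also have "integral {a..a + l} (\<lambda>x. (cmod (K i j (\<delta> i * x)))\<^sup>2) \<le> integral {a..a + real n} (\<lambda>x. (cmod (K i j (\<delta> i * x)))\<^sup>2)"
        using n by (intro integral_subset_le integrable_continuous_real continuous_on_subset[OF m2c]) auto
      also have "\<dots> \<le> real n * (A + B * (a + real n))\<^sup>2"
        by (rule integral_windows_le[OF m2c AB(3) AB(1,2) a0])
      finally have "(L2_norm l (p i N))\<^sup>2 \<le> (exp (- Im z * R N) * (sqrt n * (A + B * (a + n))))\<^sup>2"
        by (simp add: power_mult_distrib mult_left_mono)
      then show ?thesis unfolding a_def
        by (rule power2_le_imp_le) (use AB R0[of N] \<delta>_pos[of i] in simp)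
    qed
    have "(\<lambda>N. exp (- Im z * R N) * (sqrt n * (A + B * (R N / \<delta> i + n)))) \<longlonglongrightarrow> 0"
    proof -
      have "((\<lambda>y. exp (- Im z * y) * (sqrt n * (A + B * (y / \<delta> i + n)))) \<longlongrightarrow> 0) at_top"
        using z \<delta>_pos[of i] by real_asymp
      then show ?thesis using Rlim by (rule filterlim_compose)
    qed
    then show ?thesis by (rule tendsto_sandwich[OF _ _ tendsto_const, rotated 2]) (use b in auto)
  qed
  have p2lim: "(\<lambda>N. L2_norm l (p2 i N)) \<longlonglongrightarrow> 0" for i
  proof -
    have "(\<lambda>N. LINT r|Il (R N). exp (\<i> * z * of_real r) * K i j r) \<longlonglongrightarrow> K_Laplace i j z"
      unfolding K_Laplace_def by (rule half_line_limit[OF K_Laplace_integrable[OF z] Rlim])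
    then have "(\<lambda>N. sqrt l * cmod (c i N)) \<longlonglongrightarrow> sqrt l * cmod (\<i> * z * (K_Laplace i j z - K_Laplace i j z))"
      unfolding c_def by (intro tendsto_intros)
    moreover have "L2_norm l (p2 i N) = sqrt l * cmod (c i N)" for N
      using l by (simp add: L2_norm_def p2_def single_def norm_axis_complex measure_restrict_space real_sqrt_mult)
    ultimately show ?thesis by simp
  qed
  have "(\<lambda>N. (\<Sum>i\<in>UNIV. L2_norm l (p i N)) + (\<Sum>i\<in>UNIV. L2_norm l (p2 i N))) \<longlonglongrightarrow> (\<Sum>i\<in>(UNIV::'p set). 0) + (\<Sum>i\<in>(UNIV::'p set). 0)"
    by (intro tendsto_add tendsto_sum plim p2lim)
  then have "(\<lambda>N. (\<Sum>i\<in>UNIV. L2_norm l (p i N)) + (\<Sum>i\<in>UNIV. L2_norm l (p2 i N))) \<longlonglongrightarrow> 0" by simp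
  then show ?thesis by (rule tendsto_sandwich[OF _ _ tendsto_const, rotated 2]) (use le in auto)
qed

text \<open>The bound sqrt C for T (gN j z N) depends neither on N nor on l. For fixed l the defect
  disappears as N grows, by boundedness of T and of the resolvent on (0, l). The order matters: C1
  and C2 depend on l and have dropped out before l varies.\<close>

lemma T_h_phi_bounded:
  assumes z: "0 < Im z"
  obtains C where "\<And>l. 0 < l \<Longrightarrow> L2_norm l (T (resolvent d z (h_phi j z))) \<le> C"
proof -
  obtain C where C: "0 \<le> C" "\<And>N. Re (q (fN j z N) (fN j z N)) \<le> C"
    using fN_q_bound[OF z, of j] by blast
  show thesis
  proof (rule that[of "sqrt C"])
    fix l :: real assume l: "0 < l"
    obtain C1 where C1: "0 \<le> C1" "\<And>f. f \<in> L2 l \<Longrightarrow> L2_norm l (T f) \<le> C1 * L2_norm l f"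
      using bounded_opD(4)[OF T_bounded[OF l]] by blast
    obtain C2 where C2: "0 \<le> C2" "\<And>h. h \<in> L2 l \<Longrightarrow> L2_norm l (resolvent d z h) \<le> C2 * L2_norm l h"
      using resolvent_bound[of l d z] l by (metis less_imp_le)
    define g where "g = resolvent d z (h_phi j z)"
    have g: "g \<in> L2 l" unfolding g_def by (intro resolvent_L2 h_phi_L2)
    have b: "L2_norm l (T g) \<le> sqrt C + C1 * (C2 * L2_norm l (defect j z N))" for N
    proof -
      let ?e = "resolvent d z (defect j z N)"
      have e: "?e \<in> L2 l" by (intro resolvent_L2 defect_L2)
      have 1: "L2_norm l (T (gN j z N)) \<le> sqrt C"
      proof -
        have "(L2_norm l (T (gN j z N)))\<^sup>2 \<le> Re (q (fN j z N) (fN j z N))"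
          by (rule T_norm_le_q[OF l fN_Lc gN_L2]) (simp add: vec_eq_iff Shat_fN gN_def)
        then show ?thesis using C(2)[of N] by (intro real_le_rsqrt) linarith
      qed
      have "ae_eq l (T (gN j z N)) (T (\<lambda>x. g x + ?e x))"
        unfolding g_def using gN_resolvent[OF l, of j z N] g e by (intro T_cong l gN_L2 L2_add) (auto simp: g_def)
      also have "ae_eq l \<dots> (\<lambda>x. T g x + T ?e x)" by (intro bounded_opD(2)[OF T_bounded[OF l]] g e)
      finally (ae_eq_trans) have "ae_eq l (T g) (\<lambda>x. T (gN j z N) x + (-1) *s T ?e x)"
        unfolding ae_eq_def by (rule eventually_mono) (simp add: vec_eq_iff)
      then have "L2_norm l (T g) = L2_norm l (\<lambda>x. T (gN j z N) x + (-1) *s T ?e x)"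
        by (intro L2_norm_cong T_L2 L2_add L2_smult l g e gN_L2)
      also have "\<dots> \<le> L2_norm l (T (gN j z N)) + L2_norm l (\<lambda>x. (-1) *s T ?e x)"
        by (intro L2_norm_triangle T_L2 L2_smult l e gN_L2)
      also have "L2_norm l (\<lambda>x. (-1) *s T ?e x) = L2_norm l (T ?e)" using L2_norm_smult[of l "-1" "T ?e"] by simp
      also have "L2_norm l (T ?e) \<le> C1 * (C2 * L2_norm l (defect j z N))"
        using C1(2)[OF e] mult_left_mono[OF C2(2)[OF defect_L2] C1(1)] by (rule order_trans)
      finally show ?thesis using 1 by simp
    qed
    have "(\<lambda>N. sqrt C + C1 * (C2 * L2_norm l (defect j z N))) \<longlonglongrightarrow> sqrt C + C1 * (C2 * 0)"
      by (intro tendsto_intros defect_tendsto z l)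
    then have "L2_norm l (T g) \<le> sqrt C + C1 * (C2 * 0)" by (rule LIMSEQ_le_const) (use b in auto)
    then show "L2_norm l (T (resolvent d z (h_phi j z))) \<le> sqrt C" by (simp add: g_def)
  qed
qed

text \<open>For constant \<xi> the resolvent is the exponential f with entries \<xi>_i exp (i z d_i
  x), growing because d_i < 0. Let h be the part of f in component i over [a, a + 1), with squared
  norm I. Then I = <T f, T S h> and ||T S h||^2 = q h h \<le> C I, so I \<le> C M^2 for all windows,
  which growth excludes unless \<xi>_i = 0.\<close>

lemma exponential_unbounded:
  assumes z: "0 < Im z" and M: "\<And>l. 0 < l \<Longrightarrow> L2_norm l (T (resolvent d z (\<lambda>x. \<xi>))) \<le> M"
  shows "\<xi> = 0"
proof -
  obtain C where C: "0 \<le> C" "\<And>i u a. u \<in> borel_measurable lebesgue \<Longrightarrow> integrable lebesgue (\<lambda>x. (cmod (u x))\<^sup>2) \<Longrightarrow>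
    (\<And>x. x \<notin> {a..a+1} \<Longrightarrow> u x = 0) \<Longrightarrow> Re (q (single i u) (single i u)) \<le> C * (LINT x|lebesgue. (cmod (u x))\<^sup>2)"
    using q_local_bound by blast
  define f where "f = (\<lambda>x. \<chi> i. \<xi> $ i * exp (z * \<i> * of_real (d $ i) * of_real x))"
  have fL: "f \<in> L2 l" for l
    unfolding f_def by (intro L2_continuous continuous_on_vec_lambda continuous_intros)
  have fR: "ae_eq l f (resolvent d z (\<lambda>x. \<xi>))" for l
  proof (rule resolvent_unique[OF L2_const fL], rule ae_eqI)
    fix x :: real assume x: "0 < x" "x < l"
    show "f x = \<xi> + z *s A_op d f x"
      unfolding vec_eq_iff
    proof
      fix i
      define c where "c = z * \<i> * of_real (d $ i)"
      have "z * A_op d f x $ i = c * (LINT t|Il x. \<xi> $ i * exp (c * of_real t))"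
        by (simp add: A_op_def f_def c_def)
      also have "\<dots> = \<xi> $ i * (LINT t|Il x. c * exp (c * of_real t))" by simp
      also have "(LINT t|Il x. c * exp (c * of_real t)) = exp (c * of_real x) - 1"
        using x by (intro integral_exp_Il) simp
      finally show "f x $ i = (\<xi> + z *s A_op d f x) $ i"
        by (simp add: f_def c_def algebra_simps)
    qed
  qed
  have Tf: "L2_norm l (T f) \<le> M" if "0 < l" for l
  proof -
    have "L2_norm l (T f) = L2_norm l (T (resolvent d z (\<lambda>x. \<xi>)))"
      by (intro L2_norm_cong T_L2 that fL resolvent_L2 L2_const T_cong fR)
    then show ?thesis using M[OF that] by simp
  qed
  have bound: "(cmod (\<xi> $ i) * exp (Im z * \<delta> i * a))\<^sup>2 \<le> C * M\<^sup>2" if a: "0 < a" for i a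
  proof -
    \<comment> \<open>Large enough for the window [a, a + 1) to lie inside (0, l).\<close>
    define l where "l = a + 2"
    have l: "0 < l" using a by (simp add: l_def)
    have fc: "continuous_on UNIV (\<lambda>x. f x $ i)" unfolding f_def by (simp, intro continuous_intros)
    define u where "u = (\<lambda>x. if a \<le> x \<and> x < a + 1 then f x $ i else 0)"
    have u: "u \<in> borel_measurable lebesgue" "integrable lebesgue (\<lambda>x. (cmod (u x))\<^sup>2)"
      unfolding u_def by (rule indicator_sq_Lc[OF fc])+
    define h where "h = single i u"
    have hLc: "h \<in> Lc l" unfolding h_def by (rule single_Lc[OF u]) (use a in \<open>auto simp: u_def l_def\<close>)
    have hL: "h \<in> L2 l" by (rule Lc_L2[OF hLc])
    have h0: "h x = 0" if "x \<notin> {0<..<l}" for x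
    proof -
      have "u x = 0" using that a by (auto simp: u_def l_def)
      then show ?thesis by (simp add: h_def single_def vec_eq_iff axis_def)
    qed
    define I where "I = (LINT x|lebesgue. (cmod (u x))\<^sup>2)"
    have I0: "0 \<le> I" unfolding I_def by simp
    \<comment> \<open>On its support h coincides with component i of f, so the pairing is the
      squared norm over the window.\<close>
    have fh: "L2_inner l f h = of_real I"
    proof -
      have "hprod (f x) (h x) = of_real ((cmod (u x))\<^sup>2)" for x
      proof -
        have "hprod (f x) (h x) = f x $ i * cnj (u x)"
          by (simp add: hprod_def h_def single_def axis_def if_distrib[of cnj] if_distrib[of "\<lambda>c. _ * c"] cong: if_cong)
        then show ?thesis by (auto simp: u_def complex_norm_square simp del: of_real_power)
      qed
      then have "L2_inner l f h = (LINT x|Il l. complex_of_real ((cmod (u x))\<^sup>2))" by (simp only: L2_inner_eq)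
      also have "\<dots> = (LINT x|lebesgue. complex_of_real ((cmod (u x))\<^sup>2))"
        by (rule lebesgue_integral_supported(1)[symmetric]) (use a in \<open>auto simp: u_def l_def\<close>)
      also have "\<dots> = of_real I" unfolding I_def by (rule integral_complex_of_real)
      finally show ?thesis .
    qed
    have Sh: "S_op d k l h \<in> L2 l" by (rule S_L2[OF l hL])
    have n: "(L2_norm l (T (S_op d k l h)))\<^sup>2 \<le> C * I"
    proof -
      have "complex_of_real ((L2_norm l (T (S_op d k l h)))\<^sup>2) = L2_inner l (T (S_op d k l h)) (T (S_op d k l h))" by (rule ip_self[symmetric])
      also have "\<dots> = L2_inner l (S_op d k l h) h" by (rule T_S_inner[OF l hL Sh])
      also have "\<dots> = q h h" by (rule q_eq_ip[OF hL h0 hL h0 Sh, symmetric])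
      finally have "(L2_norm l (T (S_op d k l h)))\<^sup>2 = Re (q h h)" by (metis Re_complex_of_real)
      also have "\<dots> \<le> C * I" unfolding h_def I_def by (rule C(2)[of u a, OF u]) (auto simp: u_def)
      finally show ?thesis .
    qed
    have "I = cmod (L2_inner l (T f) (T (S_op d k l h)))"
      using T_S_inner[OF l hL fL] fh I0 by simp
    also have "\<dots> \<le> L2_norm l (T f) * L2_norm l (T (S_op d k l h))" by (intro ip_Cauchy_Schwarz T_L2 l fL Sh)
    also have "\<dots> \<le> M * L2_norm l (T (S_op d k l h))" by (intro mult_right_mono Tf l) simp
    finally have "I \<le> M * L2_norm l (T (S_op d k l h))" .
    then have "I\<^sup>2 \<le> (M * L2_norm l (T (S_op d k l h)))\<^sup>2" using I0 by (rule power_mono)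
    also have "\<dots> \<le> M\<^sup>2 * (C * I)" unfolding power_mult_distrib by (intro mult_left_mono n) simp
    finally have "I * I \<le> (C * M\<^sup>2) * I" by (simp add: power2_eq_square mult_ac)
    then have I1: "I \<le> C * M\<^sup>2" using I0 C by (cases "I = 0") (auto simp: mult_le_cancel_right)
    have "(cmod (\<xi> $ i) * exp (Im z * \<delta> i * a))\<^sup>2 = (LINT x|lebesgue. indicator {a..<a+1} x * (cmod (\<xi> $ i) * exp (Im z * \<delta> i * a))\<^sup>2)"
      by (simp add: integral_completion)
    also have "\<dots> \<le> I"
      unfolding I_def
    proof (rule integral_mono[OF _ u(2)])
      show "integrable lebesgue (\<lambda>x. indicator {a..<a+1} x * (cmod (\<xi> $ i) * exp (Im z * \<delta> i * a))\<^sup>2)"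
        by (intro integrable_mult_left) (simp add: integrable_completion)
      fix x
      have "cmod (f x $ i) = cmod (\<xi> $ i) * exp (Im z * \<delta> i * x)" by (simp add: f_def norm_mult d_eq)
      moreover have "cmod (\<xi> $ i) * exp (Im z * \<delta> i * a) \<le> cmod (\<xi> $ i) * exp (Im z * \<delta> i * x)" if "a \<le> x"
        using that z \<delta>_pos[of i] by (intro mult_left_mono) auto
      ultimately show "indicator {a..<a+1} x * (cmod (\<xi> $ i) * exp (Im z * \<delta> i * a))\<^sup>2 \<le> (cmod (u x))\<^sup>2"
        by (auto simp: u_def indicator_def intro!: power_mono)
    qed
    finally show ?thesis using I1 by simp
  qed
  have "\<xi> $ i = 0" for i
  proof (rule ccontr)
    assume nz: "\<xi> $ i \<noteq> 0"
    have "filterlim (\<lambda>a. (cmod (\<xi> $ i) * exp (Im z * \<delta> i * a))\<^sup>2) at_top at_top"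
      using nz z \<delta>_pos[of i] by real_asymp
    then have "\<forall>\<^sub>F a in at_top. C * M\<^sup>2 < (cmod (\<xi> $ i) * exp (Im z * \<delta> i * a))\<^sup>2"
      by (simp add: filterlim_at_top_dense)
    then have "\<forall>\<^sub>F a in at_top. C * M\<^sup>2 < (cmod (\<xi> $ i) * exp (Im z * \<delta> i * a))\<^sup>2 \<and> 0 < a"
      using eventually_gt_at_top[of 0] by (rule eventually_conj)
    then obtain a where "C * M\<^sup>2 < (cmod (\<xi> $ i) * exp (Im z * \<delta> i * a))\<^sup>2" "0 < a"
      using eventually_happens'[OF trivial_limit_at_top_linorder] by blast
    then show False using bound[of a i] by simp
  qed
  then show ?thesis by (simp add: vec_eq_iff)
qed

end

section \<open>Null sets on the half-line and block matrices\<close>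

lemma AE_imp_negligible:
  assumes "AE x in lebesgue. P x" obtains N where "negligible N" "\<And>x. x \<notin> N \<Longrightarrow> P x"
proof -
  obtain N where N: "{x \<in> space lebesgue. \<not> P x} \<subseteq> N" "emeasure lebesgue N = 0" "N \<in> sets lebesgue"
    by (rule AE_E[OF assms]) 
  show thesis
    by (rule that[of N]) (use N in \<open>auto simp: negligible_iff_null_sets null_sets_def\<close>)
qed

text \<open>H equals \<beta>* \<beta> only almost everywhere, so integrands have to be exchanged
  outside a null set.\<close>

lemma set_integrable_spike_AE:
  fixes f g :: "real \<Rightarrow> 'b::euclidean_space"
  assumes ae: "AE x in lebesgue. x \<in> S \<longrightarrow> g x = f x" and f: "set_integrable lebesgue S f"
  shows "set_integrable lebesgue S g" and "(LINT x:S|lebesgue. g x) = (LINT x:S|lebesgue. f x)"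
proof -
  obtain N where N: "negligible N" "\<And>x. x \<notin> N \<Longrightarrow> x \<in> S \<longrightarrow> g x = f x" using AE_imp_negligible[OF ae] by blast
  show g: "set_integrable lebesgue S g"
    by (rule absolutely_integrable_spike[OF f N(1)]) (use N(2) in auto)
  have "(LINT x:S|lebesgue. g x) = integral S g" by (rule set_lebesgue_integral_eq_integral(2)[OF g])
  also have "\<dots> = integral S f" by (rule integral_spike[OF N(1)]) (use N(2) in auto)
  also have "\<dots> = (LINT x:S|lebesgue. f x)" by (rule set_lebesgue_integral_eq_integral(2)[OF f, symmetric])
  finally show "(LINT x:S|lebesgue. g x) = (LINT x:S|lebesgue. f x)" .
qed

lemma set_integral_Icc_Il:
  fixes f :: "real \<Rightarrow> 'b::euclidean_space"
  shows "set_integrable lebesgue {0..x} f \<longleftrightarrow> integrable (Il x) f"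
    and "integrable (Il x) f \<Longrightarrow> (LINT t:{0..x}|lebesgue. f t) = (LINT t|Il x. f t)"
  by (simp_all only: Ioo_integrable_iff)
    (metis Ioo_integral Ioo_integrable_iff set_lebesgue_integral_eq_integral(2))

lemma AE_half_line:
  assumes "\<And>n::nat. AE x in Il (real n). P x"
  shows "AE x in lebesgue. 0 < x \<longrightarrow> P x"
proof -
  have "AE x in lebesgue. \<forall>n::nat. 0 < x \<longrightarrow> x < real n \<longrightarrow> P x"
    unfolding AE_all_countable using assms unfolding AE_Il_iff by blast
  then show ?thesis
    by (rule eventually_mono) (use reals_Archimedean2 in blast)
qed

lemma borel_measurable_half_line:
  fixes f :: "real \<Rightarrow> 'b::euclidean_space"
  assumes "\<And>n::nat. f \<in> borel_measurable (Il (real n))"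
  shows "(\<lambda>x. indicator {0<..} x *\<^sub>R f x) \<in> borel_measurable lebesgue"
proof (rule borel_measurable_LIMSEQ_metric)
  show "(\<lambda>x. if x \<in> {0<..<real n} then f x else 0) \<in> borel_measurable lebesgue" for n
    by (rule borel_measurable_if_I[OF assms]) simp
  fix x :: real
  show "(\<lambda>n. if x \<in> {0<..<real n} then f x else 0) \<longlonglongrightarrow> indicator {0<..} x *\<^sub>R f x"
  proof (rule tendsto_eventually)
    obtain N :: nat where "x < real N" using reals_Archimedean2 by blast
    then show "\<forall>\<^sub>F n in sequentially. (if x \<in> {0<..<real n} then f x else 0) = indicator {0<..} x *\<^sub>R f x"
      by (intro eventually_sequentiallyI[of N]) (auto simp: indicator_def)
  qed
qed

lemma ctranspose_mult: "ctranspose (A ** B) = ctranspose B ** ctranspose A"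
  for A :: "complex^'n::finite^'m::finite" and B :: "complex^'k::finite^'n"
  by (simp add: ctranspose_def matrix_matrix_mult_def vec_eq_iff mult.commute)

lemma ctranspose_mult_nth: "(ctranspose A ** M) $ a $ b = (\<Sum>i\<in>UNIV. cnj (A $ i $ a) * M $ i $ b)"
  for A :: "complex^'n::finite^'m::finite" and M :: "complex^'k::finite^'m"
  by (simp add: matrix_matrix_mult_def ctranspose_def)

lemma Jmat_mult_nth: "(Jmat ** M) $ a $ b = M $ swap_sum a $ b"
  for M :: "complex^'q::finite^('p::finite + 'p)"
proof (cases a)
  case (Inl c)
  then show ?thesis
    by (simp add: Jmat_def matrix_matrix_mult_def sum_UNIV_sum vblock_def hblock_def mat_def if_distrib[of "\<lambda>c. c * _"] cong: if_cong)
next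
  case (Inr c)
  then show ?thesis
    by (simp add: Jmat_def matrix_matrix_mult_def sum_UNIV_sum vblock_def hblock_def mat_def if_distrib[of "\<lambda>c. c * _"] cong: if_cong)
qed

definition Vmat :: "complex^'p^'p \<Rightarrow> complex^'p::finite^('p + 'p)" where
  "Vmat F = vblock (mat 1) (mat (- \<i>) ** F)"

lemma Vmat_nth: "Vmat F $ Inl c $ j = (if c = j then 1 else 0)" "Vmat F $ Inr c $ j = - \<i> * F $ c $ j"
  by (simp_all add: Vmat_def vblock_def mat_def[of 1]) (simp add: mat_mult_nth)

lemma ctranspose_Vmat: "hblock (mat 1) (mat \<i> ** ctranspose F) = ctranspose (Vmat F)"
proof -
  have "hblock (mat 1) (mat \<i> ** ctranspose F) $ j $ a = ctranspose (Vmat F) $ j $ a" for j a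
  proof (cases a)
    case (Inl c)
    then show ?thesis by (simp add: hblock_def ctranspose_def Vmat_nth mat_def)
  next
    case (Inr c)
    then show ?thesis by (simp add: hblock_def ctranspose_def[of "Vmat F"] Vmat_nth mat_mult_nth) (simp add: ctranspose_def)
  qed
  then show ?thesis by (simp add: vec_eq_iff)
qed

section \<open>Solutions of the canonical system through the operator T\<close>

context factorized_kernel
begin

text \<open>Column b of \<beta>(x) W.\<close>

definition comb :: "complex^('p + 'p)^('p + 'p) \<Rightarrow> real \<Rightarrow> 'p + 'p \<Rightarrow> complex^'p" where
  "comb W x b = (\<Sum>c\<in>UNIV. W $ c $ b *s \<beta> c x)"

abbreviation B :: "real \<Rightarrow> complex^('p + 'p)^'p" where "B \<equiv> beta_fun d k E"

lemma B_nth: "B x $ i $ a = \<beta> a x $ i"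
proof -
  have "Pi_col a = (\<lambda>t. column a (Pi_fun d k t))" by (simp add: Pi_col_def fun_eq_iff)
  then show ?thesis by (simp add: beta_fun_def \<beta>_def)
qed

lemma B_mult_nth: "(B x ** W) $ i $ b = comb W x b $ i"
  by (simp add: comb_def matrix_matrix_mult_def B_nth mult.commute)

lemma HW_nth: "(ctranspose (B x) ** B x ** W) $ a $ b = hprod (comb W x b) (\<beta> a x)"
  unfolding matrix_mul_assoc[symmetric] ctranspose_mult_nth B_mult_nth B_nth
  by (simp add: hprod_def mult.commute)

text \<open>Column j of \<beta>(x) W [I; -i F]. The Weyl integrand is the Gram matrix of these
  columns.\<close>

definition Ycol :: "complex^'p^'p \<Rightarrow> complex^('p + 'p)^('p + 'p) \<Rightarrow> real \<Rightarrow> 'p \<Rightarrow> complex^'p" where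
  "Ycol F W x j = (\<Sum>b\<in>UNIV. Vmat F $ b $ j *s comb W x b)"

lemma Weyl_integrand:
  "(hblock (mat 1) (mat \<i> ** ctranspose F) ** ctranspose W ** (ctranspose (B x) ** B x) ** W ** vblock (mat 1) (mat (- \<i>) ** F)) $ j $ j'
    = hprod (Ycol F W x j') (Ycol F W x j)"
proof -
  let ?Y = "B x ** W ** Vmat F"
  have Y: "?Y $ i $ j = Ycol F W x j $ i" for i j
    by (simp add: matrix_matrix_mult_def[of "B x ** W"] B_mult_nth Ycol_def mult.commute)
  have "hblock (mat 1) (mat \<i> ** ctranspose F) ** ctranspose W ** (ctranspose (B x) ** B x) ** W ** vblock (mat 1) (mat (- \<i>) ** F)
      = ctranspose ?Y ** ?Y"
    unfolding ctranspose_Vmat Vmat_def[symmetric] ctranspose_mult by (simp only: matrix_mul_assoc)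
  moreover have "(ctranspose ?Y ** ?Y) $ j $ j' = hprod (Ycol F W x j') (Ycol F W x j)"
    unfolding ctranspose_mult_nth Y by (simp add: hprod_def mult.commute)
  ultimately show ?thesis by simp
qed

definition sol :: "complex \<Rightarrow> 'p + 'p \<Rightarrow> 'p vfun" where "sol z b = T (resolvent d z (Pi_col b))"

lemma sol_L2: "0 < l \<Longrightarrow> sol z b \<in> L2 l"
  unfolding sol_def by (intro T_L2 resolvent_L2 Pi_col_L2)

text \<open>The assumption is the integrated canonical system with v in the place of \<beta> w.
  Multiplying by \<beta>(x) turns J into the permutation of the columns and the integral into
  Q.\<close>

lemma comb_eq_Q:
  assumes "\<And>a. W $ a $ b = (if a = b then 1 else 0) + \<i> * z * L2_inner x v (\<beta> (swap_sum a))"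
  shows "comb W x b = \<beta> b x + z *s Q v x"
proof -
  have "comb W x b = (\<Sum>a\<in>UNIV. (if a = b then \<beta> b x else 0) + (\<i> * z * L2_inner x v (\<beta> (swap_sum a))) *s \<beta> a x)"
    unfolding comb_def by (intro sum.cong refl) (simp add: assms vec_eq_iff algebra_simps)
  also have "\<dots> = \<beta> b x + (\<Sum>a\<in>UNIV. (\<i> * z * L2_inner x v (\<beta> (swap_sum a))) *s \<beta> a x)"
    by (simp add: sum.distrib)
  also have "(\<Sum>a\<in>UNIV. (\<i> * z * L2_inner x v (\<beta> (swap_sum a))) *s \<beta> a x) = (\<Sum>a\<in>UNIV. (\<i> * z * L2_inner x v (\<beta> a)) *s \<beta> (swap_sum a) x)"
    by (rule sum.reindex_bij_witness[of _ swap_sum swap_sum]) (auto simp: \<sigma>)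
  also have "\<dots> = z *s Q v x"
    by (simp add: Q_def vec_eq_iff sum_distrib_left algebra_simps)
  finally show ?thesis .
qed

text \<open>The right side of w = I + i z \<integral> J \<beta>* (\<beta> w) involves w only through
  \<beta> w. Inserting the expected value \<open>sol\<close> of that product therefore produces w
  itself.\<close>

definition wsol :: "real \<Rightarrow> complex \<Rightarrow> complex^('p + 'p)^('p + 'p)" where
  "wsol x z = (\<chi> a b. (if a = b then 1 else 0) + \<i> * z * L2_inner x (sol z b) (\<beta> (swap_sum a)))"

lemma comb_wsol:
  assumes l: "0 < l" shows "ae_eq l (\<lambda>x. comb (wsol x z) x b) (sol z b)"
proof -
  have "ae_eq l (sol z b) (\<lambda>x. T (Pi_col b) x + z *s Q (sol z b) x)"
    unfolding sol_def
  proof (rule T_volterra_eq[OF l resolvent_L2[OF Pi_col_L2] Pi_col_L2], rule ae_eqI)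
    fix x :: real assume "0 < x" "x < l"
    then show "resolvent d z (Pi_col b) x = Pi_col b x + z *s A_op d (resolvent d z (Pi_col b)) x"
      by (intro resolvent_eq[of _ l] Pi_col_L2) simp
  qed
  moreover have "comb (wsol x z) x b = T (Pi_col b) x + z *s Q (sol z b) x" for x
    using comb_eq_Q[of "wsol x z" b z x "sol z b"] by (simp add: wsol_def \<beta>_def)
  ultimately show ?thesis by (simp add: ae_eq_sym)
qed

text \<open>Linearity of T and of the resolvent gathers the columns into one resolvent with
  right-hand side \<Pi> [I; -i F].\<close>

lemma Ycol_eq:
  assumes l: "0 < l" and W: "\<And>b. ae_eq l (\<lambda>x. comb (W x) x b) (sol z b)"
  shows "ae_eq l (\<lambda>x. Ycol F (W x) x j) (T (resolvent d z (\<lambda>x. \<Sum>b\<in>UNIV. Vmat F $ b $ j *s Pi_col b x)))"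
proof -
  let ?R = "\<lambda>b. resolvent d z (Pi_col b)"
  have R: "?R b \<in> L2 l" for b by (intro resolvent_L2 Pi_col_L2)
  have "AE x in Il l. \<forall>b\<in>UNIV. comb (W x) x b = sol z b x"
    using W unfolding ae_eq_def by (intro AE_finite_allI) auto
  moreover have "AE x in Il l. \<forall>b\<in>UNIV. T (\<lambda>x. Vmat F $ b $ j *s ?R b x) x = Vmat F $ b $ j *s T (?R b) x"
    using bounded_opD(3)[OF T_bounded[OF l] R] unfolding ae_eq_def by (intro AE_finite_allI) auto
  moreover have "ae_eq l (T (\<lambda>x. \<Sum>b\<in>UNIV. Vmat F $ b $ j *s ?R b x)) (\<lambda>x. \<Sum>b\<in>UNIV. T (\<lambda>x. Vmat F $ b $ j *s ?R b x) x)"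
    by (rule bounded_op_sum[OF T_bounded[OF l]]) (auto intro: L2_smult R)
  ultimately have "ae_eq l (\<lambda>x. Ycol F (W x) x j) (T (\<lambda>x. \<Sum>b\<in>UNIV. Vmat F $ b $ j *s ?R b x))"
    unfolding ae_eq_def by eventually_elim (simp add: Ycol_def sol_def)
  also have "ae_eq l \<dots> (T (resolvent d z (\<lambda>x. \<Sum>b\<in>UNIV. Vmat F $ b $ j *s Pi_col b x)))"
    by (intro T_cong l L2_sum L2_smult R resolvent_L2 Pi_col_L2 resolvent_sum) auto
  finally (ae_eq_trans) show ?thesis .
qed

lemma Vmat_Pi_sum:
  assumes "0 \<le> x"
  shows "(\<Sum>b\<in>UNIV. Vmat F $ b $ j *s Pi_col b x) $ i
    = - of_real (\<delta> i) * (if i = j then 1/2 else 0) - K i j (\<delta> i * x) - \<i> * F $ i $ j"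
proof -
  have "(\<Sum>c\<in>UNIV. Vmat F $ Inl c $ j *s Pi_col (Inl c) x) = (\<Sum>c\<in>UNIV. if c = j then Pi_col (Inl j) x else 0)"
    by (intro sum.cong refl) (auto simp: Vmat_nth)
  then have 1: "(\<Sum>c\<in>UNIV. Vmat F $ Inl c $ j *s Pi_col (Inl c) x) = Pi_col (Inl j) x" by simp
  have 2: "(\<Sum>c\<in>UNIV. Vmat F $ Inr c $ j *s Pi_col (Inr c) x) $ i = - \<i> * F $ i $ j"
    by (simp add: Vmat_nth Pi_col_Inr axis_def if_distrib[of "\<lambda>c. _ * c"] sum_negf cong: if_cong)
  show ?thesis unfolding sum_UNIV_sum vector_add_component 1 2 Pi_col_Inl[OF assms] by simp
qed

text \<open>This is where the value of phi is dictated: its diagonal part i \<delta>_i / 2 removes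
  the constant contributed by s, and the rest is the free term of the equation satisfied by the
  images of exponentials.\<close>

lemma Vmat_Pi_sum_phi:
  assumes z: "0 < Im z" and x: "0 \<le> x"
  shows "(\<Sum>b\<in>UNIV. Vmat (phi z) $ b $ j *s Pi_col b x) = h_phi j z x"
  unfolding vec_eq_iff
proof
  fix i
  show "(\<Sum>b\<in>UNIV. Vmat (phi z) $ b $ j *s Pi_col b x) $ i = h_phi j z x $ i"
    unfolding Vmat_Pi_sum[OF x] phi_nth[OF z] h_phi_def by (auto simp: algebra_simps)
qed

lemma Vmat_Pi_L2: "(\<lambda>x. \<Sum>b\<in>UNIV. Vmat F $ b $ j *s Pi_col b x) \<in> L2 l"
  by (intro L2_sum L2_smult Pi_col_L2) auto

lemma T_Vmat_phi_bounded:
  assumes z: "0 < Im z"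
  obtains C where "\<And>l. 0 < l \<Longrightarrow> L2_norm l (T (resolvent d z (\<lambda>x. \<Sum>b\<in>UNIV. Vmat (phi z) $ b $ j *s Pi_col b x))) \<le> C"
proof -
  obtain C where C: "\<And>l. 0 < l \<Longrightarrow> L2_norm l (T (resolvent d z (h_phi j z))) \<le> C"
    using T_h_phi_bounded[OF z, of j] by blast
  show thesis
  proof (rule that)
    fix l :: real assume l: "0 < l"
    let ?h = "\<lambda>x. \<Sum>b\<in>UNIV. Vmat (phi z) $ b $ j *s Pi_col b x"
    have hh: "ae_eq l ?h (h_phi j z)" by (rule ae_eqI) (simp add: Vmat_Pi_sum_phi[OF z])
    have "ae_eq l (resolvent d z ?h) (resolvent d z (h_phi j z))"
    proof (rule resolvent_unique[OF h_phi_L2 resolvent_L2[OF Vmat_Pi_L2]], rule ae_eqI)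
      fix x :: real assume x: "0 < x" "x < l"
      show "resolvent d z ?h x = h_phi j z x + z *s A_op d (resolvent d z ?h) x"
        using resolvent_eq[OF Vmat_Pi_L2, of x l d z "phi z" j] x Vmat_Pi_sum_phi[OF z, of x j] by simp
    qed
    then have "L2_norm l (T (resolvent d z ?h)) = L2_norm l (T (resolvent d z (h_phi j z)))"
      by (intro L2_norm_cong T_L2 T_cong l resolvent_L2 Vmat_Pi_L2 h_phi_L2)
    then show "L2_norm l (T (resolvent d z ?h)) \<le> C" using C[OF l] by simp
  qed
qed

text \<open>The terms with K are the same in both columns, so their difference is the constant
  vector \<xi> with entries -i (F - G)_ij. Two bounded columns would bound T applied to the growing
  exponential belonging to \<xi>.\<close>

lemma bounded_difference:
  fixes F G :: "complex^'p^'p"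
  assumes z: "0 < Im z"
    and F: "\<And>l. 0 < l \<Longrightarrow> L2_norm l (T (resolvent d z (\<lambda>x. \<Sum>b\<in>UNIV. Vmat F $ b $ j *s Pi_col b x))) \<le> C"
    and G: "\<And>l. 0 < l \<Longrightarrow> L2_norm l (T (resolvent d z (\<lambda>x. \<Sum>b\<in>UNIV. Vmat G $ b $ j *s Pi_col b x))) \<le> D"
  shows "F $ i $ j = G $ i $ j"
proof -
  let ?h = "\<lambda>F x. \<Sum>b\<in>UNIV. Vmat F $ b $ j *s Pi_col b x"
  define \<xi> where "\<xi> = (\<chi> i. - \<i> * (F $ i $ j - G $ i $ j))"
  have hL: "?h F \<in> L2 l" for F l by (rule Vmat_Pi_L2)
  have RL: "resolvent d z (?h F) \<in> L2 l" for F l by (intro resolvent_L2 hL)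
  have "L2_norm l (T (resolvent d z (\<lambda>x. \<xi>))) \<le> C + D" if l: "0 < l" for l
  proof -
    have "ae_eq l (\<lambda>x. resolvent d z (?h F) x - resolvent d z (?h G) x) (resolvent d z (\<lambda>x. \<xi>))"
    proof (rule resolvent_unique[OF L2_const L2_diff[OF RL RL]], rule ae_eqI)
      fix x :: real assume x: "0 < x" "x < l"
      have hd: "?h F x - ?h G x = \<xi>"
        unfolding vec_eq_iff vector_minus_component Vmat_Pi_sum[OF less_imp_le[OF x(1)]]
        by (simp add: \<xi>_def algebra_simps)
      have "resolvent d z (?h F) x - resolvent d z (?h G) x
          = (?h F x - ?h G x) + z *s (A_op d (resolvent d z (?h F)) x - A_op d (resolvent d z (?h G)) x)"
        using resolvent_eq[OF hL, of x l d z F] resolvent_eq[OF hL, of x l d z G] x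
        by (simp add: vec_eq_iff algebra_simps)
      also have "A_op d (resolvent d z (?h F)) x - A_op d (resolvent d z (?h G)) x
          = A_op d (\<lambda>x. resolvent d z (?h F) x - resolvent d z (?h G) x) x"
        using x by (intro A_op_diff[OF RL RL, of x l, symmetric]) simp
      finally show "resolvent d z (?h F) x - resolvent d z (?h G) x
          = \<xi> + z *s A_op d (\<lambda>x. resolvent d z (?h F) x - resolvent d z (?h G) x) x"
        by (simp only: hd)
    qed
    then have "ae_eq l (T (resolvent d z (\<lambda>x. \<xi>))) (T (\<lambda>x. resolvent d z (?h F) x - resolvent d z (?h G) x))"
      by (intro T_cong l resolvent_L2 L2_const L2_diff RL) (rule ae_eq_sym)
    also have "ae_eq l \<dots> (\<lambda>x. T (resolvent d z (?h F)) x - T (resolvent d z (?h G)) x)"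
      by (intro T_diff l RL)
    finally (ae_eq_trans) have "ae_eq l (T (resolvent d z (\<lambda>x. \<xi>))) (\<lambda>x. T (resolvent d z (?h F)) x + (-1) *s T (resolvent d z (?h G)) x)"
      unfolding ae_eq_def by (rule eventually_mono) (simp add: vec_eq_iff)
    then have "L2_norm l (T (resolvent d z (\<lambda>x. \<xi>))) = L2_norm l (\<lambda>x. T (resolvent d z (?h F)) x + (-1) *s T (resolvent d z (?h G)) x)"
      by (intro L2_norm_cong T_L2 L2_add L2_smult l RL resolvent_L2 L2_const)
    also have "\<dots> \<le> L2_norm l (T (resolvent d z (?h F))) + L2_norm l (\<lambda>x. (-1) *s T (resolvent d z (?h G)) x)"
      by (intro L2_norm_triangle L2_smult T_L2 l RL)
    also have "L2_norm l (\<lambda>x. (-1) *s T (resolvent d z (?h G)) x) = L2_norm l (T (resolvent d z (?h G)))"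
      using L2_norm_smult[of l "-1" "T (resolvent d z (?h G))"] by simp
    finally show ?thesis using F[OF l] G[OF l] by simp
  qed
  then have "\<xi> = 0" by (rule exponential_unbounded[OF z])
  then have "\<xi> $ i = 0" by simp
  then show ?thesis by (simp add: \<xi>_def)
qed

section \<open>The canonical system with Hamiltonian H\<close>

context
  fixes H :: "real \<Rightarrow> complex^('p + 'p)^('p + 'p)"
  assumes H: "AE x in lebesgue_on {0<..}. H x = ctranspose (B x) ** B x"
begin

lemma H_AE: "AE x in lebesgue. 0 < x \<longrightarrow> H x = ctranspose (B x) ** B x"
  using H by (simp add: AE_restrict_space_iff)

lemma H_Il: "AE x in Il l. H x = ctranspose (B x) ** B x"
  unfolding AE_Il_iff using H_AE by (rule eventually_mono) auto

lemma system_nth: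
  assumes "H t = ctranspose (B t) ** B t"
  shows "(mat (\<i> * z) ** Jmat ** H t ** W) $ a $ b = \<i> * z * hprod (comb W t b) (\<beta> (swap_sum a) t)"
proof -
  have "mat (\<i> * z) ** Jmat ** H t ** W = mat (\<i> * z) ** (Jmat ** (ctranspose (B t) ** B t ** W))"
    unfolding assms by (simp only: matrix_mul_assoc)
  then show ?thesis by (simp add: mat_mult_nth Jmat_mult_nth HW_nth)
qed

text \<open>Almost everywhere \<beta> wsol = sol, so the integrand of the system is i z J \<beta>*
  sol, and its integral is what \<open>wsol\<close> was defined by.\<close>

lemma fundamental_solution_wsol: "fundamental_solution H wsol"
  unfolding fundamental_solution_def
proof (intro allI impI)
  fix z and x :: real assume x: "0 \<le> x"
  define G where "G t = (\<chi> a b. \<i> * z * hprod (sol z b t) (\<beta> (swap_sum a) t))" for t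
  \<comment> \<open>The passage to x + 1 covers x = 0, as \<open>sol_L2\<close> asks for an interval
    of positive length.\<close>
  have sL: "sol z b \<in> L2 x" for b by (rule L2_restrict[OF sol_L2[of "x + 1"]]) (use x in auto)
  have Gi: "integrable (Il x) G"
    by (intro integrable_matrixI) (simp add: G_def integrable_hprod sL \<beta>_L2)
  have "AE t in Il x. \<forall>b\<in>UNIV. comb (wsol t z) t b = sol z b t"
  proof (intro AE_finite_allI)
    fix b
    show "AE t in Il x. comb (wsol t z) t b = sol z b t"
      using ae_eq_mono[OF comb_wsol[of "x + 1" z b], of x] x by (simp add: ae_eq_def)
  qed simp
  then have "AE t in Il x. mat (\<i> * z) ** Jmat ** H t ** wsol t z = G t"
    using H_Il[of x]
  proof eventually_elim
    case (elim t)
    show ?case unfolding vec_eq_iff system_nth[OF elim(2)] using elim(1) by (simp add: G_def)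
  qed
  then have "AE t in lebesgue. 0 < t \<longrightarrow> t < x \<longrightarrow> mat (\<i> * z) ** Jmat ** H t ** wsol t z = G t"
    unfolding AE_Il_iff .
  moreover have "AE t in lebesgue. t \<noteq> 0 \<and> t \<noteq> x"
    by (rule AE_I'[of "{0, x}"]) (auto simp: negligible_iff_null_sets[symmetric])
  ultimately have ae: "AE t in lebesgue. t \<in> {0..x} \<longrightarrow> mat (\<i> * z) ** Jmat ** H t ** wsol t z = G t"
    by eventually_elim auto
  have Gs: "set_integrable lebesgue {0..x} G" using Gi by (simp add: set_integral_Icc_Il)
  note sp = set_integrable_spike_AE[OF ae Gs]
  have "wsol x z = mat 1 + (LINT t:{0..x}|lebesgue. mat (\<i> * z) ** Jmat ** H t ** wsol t z)"
    unfolding vec_eq_iff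
  proof (intro allI)
    fix a b
    have "(LINT t:{0..x}|lebesgue. mat (\<i> * z) ** Jmat ** H t ** wsol t z) $ a $ b = (LINT t|Il x. G t) $ a $ b"
      unfolding sp(2) set_integral_Icc_Il(2)[OF Gi] ..
    also have "\<dots> = (LINT t|Il x. \<i> * z * hprod (sol z b t) (\<beta> (swap_sum a) t))"
      unfolding integral_matrix_nth[OF Gi] by (simp add: G_def)
    also have "\<dots> = \<i> * z * L2_inner x (sol z b) (\<beta> (swap_sum a))"
      unfolding L2_inner_eq by (rule integral_mult_right_zero)
    finally show "wsol x z $ a $ b = (mat 1 + (LINT t:{0..x}|lebesgue. mat (\<i> * z) ** Jmat ** H t ** wsol t z)) $ a $ b"
      by (simp add: wsol_def mat_def)
  qed
  with sp(1) show "set_integrable lebesgue {0..x} (\<lambda>t. mat (\<i> * z) ** Jmat ** H t ** wsol t z) \<and>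
      wsol x z = mat 1 + (LINT t:{0..x}|lebesgue. mat (\<i> * z) ** Jmat ** H t ** wsol t z)" by blast
qed

text \<open>In \<open>Weyl_function\<close> the fundamental solution is existentially quantified, so
  the identification is made for an arbitrary one. Knowing \<beta> w is enough, since the Weyl
  integrand depends on w only through it.\<close>

lemma fundamental_solution_comb:
  assumes w: "fundamental_solution H w" and l: "0 < l"
  shows "ae_eq l (\<lambda>x. comb (w x z) x b) (sol z b)"
proof -
  define F where "F t = mat (\<i> * z) ** Jmat ** H t ** w t z" for t
  have Fi: "integrable (Il x) F" and Fw: "w x z = mat 1 + (LINT t|Il x. F t)" if "0 \<le> x" for x
  proof -
    have s: "set_integrable lebesgue {0..x} F" and e: "w x z = mat 1 + (LINT t:{0..x}|lebesgue. F t)"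
      using w that unfolding fundamental_solution_def F_def by blast+
    show i: "integrable (Il x) F" using s by (simp add: set_integral_Icc_Il)
    show "w x z = mat 1 + (LINT t|Il x. F t)" using e by (simp add: set_integral_Icc_Il(2)[OF i])
  qed
  have Fab: "integrable (Il l) (\<lambda>t. F t $ a $ b)" for a b
    using l by (intro integrable_matrix_nth Fi) simp
  have wab: "w x z $ a $ b = (if a = b then 1 else 0) + (LINT t|Il x. F t $ a $ b)" if "0 \<le> x" for x a b
    unfolding Fw[OF that] by (simp add: integral_matrix_nth[OF Fi[OF that]] mat_def)
  define u where "u = (\<lambda>x. comb (w x z) x b)"
  have "(\<lambda>x. w x z $ c $ b *s \<beta> c x) \<in> L2 l" for c
  proof (rule L2_continuous_smult[OF _ \<beta>_L2])
    have "continuous_on {0..l} (\<lambda>x. (if c = b then 1 else 0) + (LINT t|Il x. F t $ c $ b))"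
      by (intro continuous_intros continuous_on_Il_integral Fab)
    then show "continuous_on {0..l} (\<lambda>x. w x z $ c $ b)"
      by (rule continuous_on_eq) (simp add: wab)
  qed
  then have uL: "u \<in> L2 l" unfolding u_def comb_def by (intro L2_sum) auto
  have "u x = \<beta> b x + z *s Q u x" if x: "0 < x" "x < l" for x
  proof -
    have ux: "u \<in> L2 x" using L2_restrict[OF uL] x by simp
    have "w x z $ a $ b = (if a = b then 1 else 0) + \<i> * z * L2_inner x u (\<beta> (swap_sum a))" for a
    proof -
      have "(LINT t|Il x. F t $ a $ b) = (LINT t|Il x. \<i> * z * hprod (u t) (\<beta> (swap_sum a) t))"
      proof (rule integral_cong_AE)
        show "AE t in Il x. F t $ a $ b = \<i> * z * hprod (u t) (\<beta> (swap_sum a) t)"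
          using H_Il[of x] by (rule eventually_mono) (unfold F_def u_def, rule system_nth)
        show "(\<lambda>t. F t $ a $ b) \<in> borel_measurable (Il x)"
          using x by (intro borel_measurable_integrable integrable_matrix_nth Fi) simp
        show "(\<lambda>t. \<i> * z * hprod (u t) (\<beta> (swap_sum a) t)) \<in> borel_measurable (Il x)"
          by (intro borel_measurable_integrable integrable_mult_right integrable_hprod ux \<beta>_L2)
      qed
      also have "\<dots> = \<i> * z * L2_inner x u (\<beta> (swap_sum a))"
        unfolding L2_inner_eq by (rule integral_mult_right_zero)
      finally show ?thesis using wab[of x a b] x by simp
    qed
    then show ?thesis unfolding u_def[THEN fun_cong] by (rule comb_eq_Q)
  qed
  then have "ae_eq l u (\<lambda>x. T (Pi_col b) x + z *s Q u x)"
    by (intro ae_eqI) (simp add: \<beta>_def)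
  then show ?thesis unfolding sol_def u_def[symmetric] by (rule T_volterra_unique[OF l Pi_col_L2 uL])
qed

lemma integrand_AE:
  assumes w: "fundamental_solution H w"
  shows "AE x in lebesgue. 0 < x \<longrightarrow>
    hblock (mat 1) (mat \<i> ** ctranspose F) ** ctranspose (w x z) ** H x ** w x z ** vblock (mat 1) (mat (- \<i>) ** F)
    = (\<chi> j j'. hprod (T (resolvent d z (\<lambda>x. \<Sum>b\<in>UNIV. Vmat F $ b $ j' *s Pi_col b x)) x)
        (T (resolvent d z (\<lambda>x. \<Sum>b\<in>UNIV. Vmat F $ b $ j *s Pi_col b x)) x))"
proof (rule AE_half_line)
  fix n :: nat
  have "AE x in Il (real n). \<forall>j\<in>UNIV. Ycol F (w x z) x j = T (resolvent d z (\<lambda>x. \<Sum>b\<in>UNIV. Vmat F $ b $ j *s Pi_col b x)) x"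
  proof (intro AE_finite_allI)
    fix j
    \<comment> \<open>The right end is n + 1 because n may be 0 and the lemmas require a positive
      length.\<close>
    have "ae_eq (real n + 1) (\<lambda>x. Ycol F (w x z) x j) (T (resolvent d z (\<lambda>x. \<Sum>b\<in>UNIV. Vmat F $ b $ j *s Pi_col b x)))"
      by (intro Ycol_eq fundamental_solution_comb[OF w]) auto
    then show "AE x in Il (real n). Ycol F (w x z) x j = T (resolvent d z (\<lambda>x. \<Sum>b\<in>UNIV. Vmat F $ b $ j *s Pi_col b x)) x"
      using ae_eq_mono[of "real n + 1" _ _ "real n"] by (simp add: ae_eq_def)
  qed simp
  then show "AE x in Il (real n).
      hblock (mat 1) (mat \<i> ** ctranspose F) ** ctranspose (w x z) ** H x ** w x z ** vblock (mat 1) (mat (- \<i>) ** F)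
      = (\<chi> j j'. hprod (T (resolvent d z (\<lambda>x. \<Sum>b\<in>UNIV. Vmat F $ b $ j' *s Pi_col b x)) x)
        (T (resolvent d z (\<lambda>x. \<Sum>b\<in>UNIV. Vmat F $ b $ j *s Pi_col b x)) x))"
    using H_Il[of "real n"]
  proof eventually_elim
    case (elim x)
    show ?case unfolding elim(2) vec_eq_iff Weyl_integrand using elim(1) by simp
  qed
qed

text \<open>The bound uniform in l makes the columns square integrable on the half-line. This
  settles the diagonal entries, and the others are dominated by them through the Cauchy-Schwarz
  inequality.\<close>

lemma Weyl_phi: "Weyl_function H phi"
  unfolding Weyl_function_def
proof (intro conjI allI)
  show "(\<lambda>z. phi z $ i $ j) holomorphic_on {z. 0 < Im z}" for i j by (rule phi_holomorphic)
  show "\<exists>w. fundamental_solution H w \<and> (\<forall>z. 0 < Im z \<longrightarrow> set_integrable lebesgue {0<..}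
      (\<lambda>x. hblock (mat 1) (mat \<i> ** ctranspose (phi z)) ** ctranspose (w x z) ** H x ** w x z ** vblock (mat 1) (mat (- \<i>) ** phi z)))"
  proof (intro exI[of _ wsol] conjI allI impI fundamental_solution_wsol)
    fix z assume z: "0 < Im z"
    define y where "y j = T (resolvent d z (\<lambda>x. \<Sum>b\<in>UNIV. Vmat (phi z) $ b $ j *s Pi_col b x))" for j
    have yL: "y j \<in> L2 l" if "0 < l" for j l unfolding y_def by (intro T_L2 that resolvent_L2 Vmat_Pi_L2)
    have yL': "y j \<in> L2 (real n)" for j n by (rule L2_restrict[OF yL[of "real n + 1"]]) auto
    have sq: "set_integrable lebesgue {0<..} (\<lambda>x. (norm (y j x))\<^sup>2)" for j
    proof -
      obtain C where C: "\<And>l. 0 < l \<Longrightarrow> L2_norm l (y j) \<le> C" using T_Vmat_phi_bounded[OF z, of j] unfolding y_def by blast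
      show ?thesis
      proof (rule integrable_half_line)
        fix n :: nat
        show "integrable (Il (real n)) (\<lambda>x. (norm (y j x))\<^sup>2)" by (rule L2_integrable_sq[OF yL'])
        have "L2_norm (real n) (y j) \<le> L2_norm (real n + 1) (y j)" by (rule L2_norm_mono[OF yL]) auto
        also have "\<dots> \<le> C" by (rule C) simp
        finally have "(L2_norm (real n) (y j))\<^sup>2 \<le> C\<^sup>2" by (intro power_mono) auto
        then show "(LINT x|Il (real n). (norm (y j x))\<^sup>2) \<le> C\<^sup>2" by (simp only: L2_norm_sq)
      qed simp
    qed
    have ent: "integrable lebesgue (\<lambda>x. indicator {0<..} x *\<^sub>R hprod (y j' x) (y j x))" for j j'
    proof (rule Bochner_Integration.integrable_bound)
      show "integrable lebesgue (\<lambda>x. indicator {0<..} x *\<^sub>R (norm (y j' x))\<^sup>2 + indicator {0<..} x *\<^sub>R (norm (y j x))\<^sup>2)"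
        using sq[of j] sq[of j'] unfolding set_integrable_def by (intro Bochner_Integration.integrable_add)
      show "(\<lambda>x. indicator {0<..} x *\<^sub>R hprod (y j' x) (y j x)) \<in> borel_measurable lebesgue"
        by (intro borel_measurable_half_line borel_measurable_hprod L2_measurable yL')
      have "norm (hprod u v) \<le> (norm u)\<^sup>2 + (norm v)\<^sup>2" for u v :: "complex^'p"
      proof -
        have "norm (hprod u v) \<le> norm u * norm v" by (rule norm_hprod_le)
        also have "\<dots> \<le> (norm u)\<^sup>2 + (norm v)\<^sup>2"
          using sum_squares_bound[of "norm u" "norm v"] mult_nonneg_nonneg[OF norm_ge_zero[of u] norm_ge_zero[of v]] by linarith
        finally show ?thesis .
      qed
      then show "AE x in lebesgue. norm (indicator {0<..} x *\<^sub>R hprod (y j' x) (y j x))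
          \<le> norm (indicator {0<..} x *\<^sub>R (norm (y j' x))\<^sup>2 + indicator {0<..} x *\<^sub>R (norm (y j x))\<^sup>2)"
        by (auto simp: indicator_def)
    qed
    have "set_integrable lebesgue {0<..} (\<lambda>x. \<chi> j j'. hprod (y j' x) (y j x))"
      unfolding set_integrable_def by (rule integrable_matrixI) (use ent in simp)
    moreover have "AE x in lebesgue. x \<in> {0<..} \<longrightarrow>
        hblock (mat 1) (mat \<i> ** ctranspose (phi z)) ** ctranspose (wsol x z) ** H x ** wsol x z ** vblock (mat 1) (mat (- \<i>) ** phi z)
        = (\<chi> j j'. hprod (y j' x) (y j x))"
      using integrand_AE[OF fundamental_solution_wsol, of "phi z" z] unfolding y_def greaterThan_iff .
    ultimately show "set_integrable lebesgue {0<..}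
        (\<lambda>x. hblock (mat 1) (mat \<i> ** ctranspose (phi z)) ** ctranspose (wsol x z) ** H x ** wsol x z ** vblock (mat 1) (mat (- \<i>) ** phi z))"
      by (rule set_integrable_spike_AE(1)[rotated])
  qed
qed

text \<open>The diagonal entries of the integrable matrix are the squared norms of the columns
  belonging to \<psi>. Their integrals bound these columns uniformly in l, and \<psi> can then be
  compared with phi entry by entry.\<close>

lemma Weyl_unique:
  assumes W: "Weyl_function H \<psi>" and z: "0 < Im z"
  shows "\<psi> z = phi z"
proof -
  obtain w where w: "fundamental_solution H w"
    and wi: "set_integrable lebesgue {0<..} (\<lambda>x. hblock (mat 1) (mat \<i> ** ctranspose (\<psi> z)) ** ctranspose (w x z) ** H x ** w x z ** vblock (mat 1) (mat (- \<i>) ** \<psi> z))"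
    using W z unfolding Weyl_function_def by blast
  define y where "y j = T (resolvent d z (\<lambda>x. \<Sum>b\<in>UNIV. Vmat (\<psi> z) $ b $ j *s Pi_col b x))" for j
  have "set_integrable lebesgue {0<..} (\<lambda>x. \<chi> j j'. hprod (y j' x) (y j x))"
  proof (rule set_integrable_spike_AE(1)[OF _ wi])
    show "AE x in lebesgue. x \<in> {0<..} \<longrightarrow> (\<chi> j j'. hprod (y j' x) (y j x))
        = hblock (mat 1) (mat \<i> ** ctranspose (\<psi> z)) ** ctranspose (w x z) ** H x ** w x z ** vblock (mat 1) (mat (- \<i>) ** \<psi> z)"
      using integrand_AE[OF w, of "\<psi> z" z] unfolding y_def greaterThan_iff
      by (rule eventually_mono) (rule impI, rule sym, erule mp)
  qed
  then have m: "integrable lebesgue (\<lambda>x. indicator {0<..} x *\<^sub>R (\<chi> j j'. hprod (y j' x) (y j x)))" by (simp only: set_integrable_def)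
  have mj: "integrable lebesgue (\<lambda>x. indicator {0<..} x * (norm (y j x))\<^sup>2)" for j
  proof -
    have "(indicator {0<..} x *\<^sub>R (\<chi> j j'. hprod (y j' x) (y j x))) $ j $ j = complex_of_real (indicator {0<..} x * (norm (y j x))\<^sup>2)" for x
      unfolding vector_scaleR_component vec_lambda_beta hprod_self by (simp add: scaleR_conv_of_real)
    then have "integrable lebesgue (\<lambda>x. complex_of_real (indicator {0<..} x * (norm (y j x))\<^sup>2))"
      using integrable_matrix_nth[OF m, of j j] by (simp only:)
    then show ?thesis by (simp only: complex_of_real_integrable_eq)
  qed
  define C where "C j = sqrt (LINT x|lebesgue. indicator {0<..} x * (norm (y j x))\<^sup>2)" for j
  have yb: "L2_norm l (y j) \<le> C j" if l: "0 < l" for l j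
  proof -
    have yL: "y j \<in> L2 l" unfolding y_def by (intro T_L2 l resolvent_L2 Vmat_Pi_L2)
    have "(L2_norm l (y j))\<^sup>2 = (LINT x|lebesgue. indicator {0<..<l} x *\<^sub>R (norm (y j x))\<^sup>2)"
      unfolding L2_norm_sq by (rule lebesgue_on_integral_eq) simp
    also have "\<dots> \<le> (LINT x|lebesgue. indicator {0<..} x * (norm (y j x))\<^sup>2)"
    proof (rule integral_mono[OF _ mj])
      show "integrable lebesgue (\<lambda>x. indicator {0<..<l} x *\<^sub>R (norm (y j x))\<^sup>2)"
        using L2_integrable_sq[OF yL] by (subst (asm) lebesgue_on_integrable_iff) auto
    qed (auto simp: indicator_def)
    finally show ?thesis unfolding C_def by (rule real_le_rsqrt)
  qed
  have "\<psi> z $ i $ j = phi z $ i $ j" for i j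
  proof -
    obtain D where D: "\<And>l. 0 < l \<Longrightarrow> L2_norm l (T (resolvent d z (\<lambda>x. \<Sum>b\<in>UNIV. Vmat (phi z) $ b $ j *s Pi_col b x))) \<le> D"
      using T_Vmat_phi_bounded[OF z, of j] by blast
    show ?thesis by (rule bounded_difference[OF z yb[unfolded y_def] D])
  qed
  then show ?thesis by (simp add: vec_eq_iff)
qed

end

end

theorem theorem4p3:
  fixes d :: "real^'p::finite"
    and H :: "real \<Rightarrow> complex^('p + 'p)^('p + 'p)"
    and k :: "real \<Rightarrow> complex^'p^'p"
  assumes "\<And>i. d $ i < 0"
    and "H \<in> Hamiltonian_class d"
    and "generates d k H"
  shows "\<exists>\<phi>. Weyl_function H \<phi> \<and>
           (\<forall>\<psi>. Weyl_function H \<psi> \<longrightarrow> (\<forall>z. 0 < Im z \<longrightarrow> \<psi> z = \<phi> z)) \<and>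
           (\<forall>z. 0 < Im z \<longrightarrow>
              set_integrable lebesgue {0..}
                (\<lambda>x. mat (exp (\<i> * z * complex_of_real x)) ** s_fun d k x) \<and>
              \<phi> z = mat (- z) ** diag_mat d **
                (LINT x:{0..}|lebesgue. mat (exp (\<i> * z * complex_of_real x)) ** s_fun d k x))"
proof -
  obtain E where E: "factorizing_kernel d k E"
    and H: "AE x in lebesgue_on {0<..}. H x = ctranspose (beta_fun d k E x) ** beta_fun d k E x"
    using assms(3) unfolding generates_def by blast
  interpret factorized_kernel d k E
    by unfold_locales (use assms(1,3) E in \<open>auto simp: generates_def admissible_kernel_def\<close>)
  show ?thesis
  proof (intro exI[of _ phi] conjI allI impI)
    show "Weyl_function H phi" by (rule Weyl_phi[OF H])
    show "\<psi> z = phi z" if "Weyl_function H \<psi>" "0 < Im z" for \<psi> z by (rule Weyl_unique[OF H that])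
    fix z :: complex assume z: "0 < Im z"
    show "set_integrable lebesgue {0..} (\<lambda>x. mat (exp (\<i> * z * complex_of_real x)) ** s_fun d k x)"
      by (rule s_Laplace(1)[OF z])
    show "phi z = mat (- z) ** diag_mat d ** (LINT x:{0..}|lebesgue. mat (exp (\<i> * z * complex_of_real x)) ** s_fun d k x)"
      by (rule phi_def)
  qed
qed

end
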